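(* Let $f$ be a Bernstein function satisfying the standing assumptions of the context, with associated Sonine pair $(\bar\mu,k)$, and assume $q=\lim_{x\to0}\bar\mu(x)\int_0^xk(s)\,ds<1$. Let $S^c$ be the censored decreasing subordinator constructed in the context. Then for any $T>0$, the process $S^c$ gives a Feller semigroup $P^c_t\phi(x)=\mathbb E^x[\phi(S^c_t)]$ (with $\phi(\partial)=0$) on $C_\infty(0,T]$, whose generator is $$\big(-D^{\mathrm{Ce}},\ I^{\mathrm{Ce}}C_\infty(0,T]\big),$$ i.e. the generator has domain $\{I^{\mathrm{Ce}}g:\ g\in C_\infty(0,T]\}$ and acts there as $-D^{\mathrm{Ce}}$.
   Context: Standing assumptions. $f$ is a complete Bernstein function with characteristics $(0,\mu)$: $f(\lambda)=\int_0^\infty(1-e^{-\lambda x})\,\mu(dx)$ for $\lambda>0$, where $\mu$ is a measure on $(0,\infty)$ with $\int_0^\infty\min\{1,x\}\,\mu(dx)<\infty$ which has a completely monotone density with respect to Lebesgue measure. Moreover $\lim_{\lambda\to0}\frac1{f(\lambda)}=\infty$, $\lim_{\lambda\to\infty}\frac1{f(\lambda)}=0$, $\lim_{\lambda\to0}\frac{\lambda}{f(\lambda)}=0$, $\lim_{\lambda\to\infty}\frac{\lambda}{f(\lambda)}=\infty$. Put $\bar\mu(s)=\mu(s,\infty)$, so that $\int_0^\infty e^{-\lambda x}\bar\mu(x)\,dx=f(\lambda)/\lambda$, and let $k:(0,\infty)\to[0,\infty)$ be the (completely monotone) potential density, determined by $\int_0^\infty e^{-\lambda x}k(x)\,dx=1/f(\lambda)$.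 The functions $(\bar\mu,k)$ form a Sonine pair: $\int_0^x\bar\mu(s)k(x-s)\,ds=1$ for all $x>0$. Function spaces: $C_{\bar\mu}(0,T]=\{\varphi\in C(0,T]\cap L^1(0,T]:\ \bar\mu*\varphi\in C^1(0,T]\}$, where $(\bar\mu*\varphi)(x)=\int_0^x\bar\mu(x-s)\varphi(s)\,ds$; $C_{\bar\mu}[0,T]=C[0,T]\cap C_{\bar\mu}(0,T]$; $C_\infty(0,T]=\{u\in C(0,T]:\ u(0+)=0\}$ with the sup norm. Operators: $D^{\mathrm R}\varphi(x)=\frac{d}{dx}\int_0^x\varphi(s)\bar\mu(x-s)\,ds$ for $\varphi\in C_{\bar\mu}(0,T]$; $I^{\mathrm R}\varphi(x)=\int_0^x\varphi(s)k(x-s)\,ds$; the censored Bernstein fractional derivative is $D^{\mathrm{Ce}}\varphi(x)=D^{\mathrm R}\varphi(x)-\varphi(x)\bar\mu(x)$, $x\in(0,T]$, for $\varphi\in C_{\bar\mu}(0,T]$. For $\varphi\in C[0,T]$ put $\mathcal K\varphi(x)=\int_0^x\bar\mu(r)k(x-r)\varphi(r)\,dr$ for $x>0$, $\mathcal K\varphi(0)=\varphi(0)$; $\mathcal K^0$ is the identity. When $q<1$, the censored integral of $g\in C[0,T]$ is $I^{\mathrm{Ce}}g=\sum_{j=0}^\infty\mathcal K^jI^{\mathrm R}g$ (with $I^{\mathrm R}g(0)=0$); this series converges and $I^{\mathrm{Ce}}$ maps $C[0,T]$ into $C_{\bar\mu}[0,T]$. Construction of $S^c$ (piecing together). Let $S^1,S^2,\dots$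 be i.i.d. subordinators with $\mathbb E[e^{-\lambda S^j_t}]=e^{-tf(\lambda)}$. Fix $x>0$. Put $\tau_0=0$, $Y_0=x$ and recursively for $j\ge1$ $$\sigma_j=\inf\{s>0:\ S^j_s>Y_{j-1}\},\qquad \tau_j=\sum_{i=1}^j\sigma_i,\qquad Y_j=Y_{j-1}-S^j_{\sigma_j-}.$$ Let $\tau_\infty=\lim_{j\to\infty}\tau_j$ and set $S^c_t=Y_{j-1}-S^j_{t-\tau_{j-1}}$ for $\tau_{j-1}\le t<\tau_j$, $j\ge1$, and $S^c_t=\partial$ (cemetery) for $t\ge\tau_\infty$. $\mathbb P^x,\mathbb E^x$ denote probability and expectation for the process started at $x$. A Feller semigroup on $C_\infty(0,T]$ is a strongly continuous, positivity preserving contraction semigroup mapping $C_\infty(0,T]$ into itself. *)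

theory Defs
  imports "HOL-Probability.Probability"
begin

section \<open>Complete Bernstein functions\<close>

text \<open>Only the values on $(0,\infty)$ matter: the iterated derivatives at a point of the open
  half-line do not see the values of the function elsewhere.\<close>

definition completely_monotone :: "(real \<Rightarrow> real) \<Rightarrow> bool" where
  "completely_monotone m \<longleftrightarrow>
     (\<forall>n. \<forall>x>0. (deriv ^^ n) m field_differentiable (at x) \<and> 0 \<le> (-1) ^ n * (deriv ^^ n) m x)"

text \<open>The Levy measure on $(0,\infty)$ is modelled as a Borel measure on the real line carried by
  the open half-line.\<close>

definition complete_bernstein :: "(real \<Rightarrow> real) \<Rightarrow> real measure \<Rightarrow> bool" where
  "complete_bernstein f \<mu> \<longleftrightarrow>
     (\<exists>m. completely_monotone m \<and> \<mu> = density lborel (\<lambda>x. ennreal (m x) * indicator {0<..} x)) \<and>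
     integrable \<mu> (\<lambda>x. min 1 x) \<and>
     (\<forall>l>0. f l = (\<integral>x. (1 - exp (- l * x)) \<partial>\<mu>))"

definition tail :: "real measure \<Rightarrow> real \<Rightarrow> real" where
  "tail \<mu> s = measure \<mu> {s<..}"

definition potential_density :: "(real \<Rightarrow> real) \<Rightarrow> (real \<Rightarrow> real) \<Rightarrow> bool" where
  "potential_density f k \<longleftrightarrow>
     completely_monotone k \<and>
     (\<forall>l>0. set_integrable lborel {0<..} (\<lambda>x. exp (- l * x) * k x) \<and>
            (LBINT x:{0<..}. exp (- l * x) * k x) = 1 / f l)"


section \<open>Function spaces\<close>

text \<open>A function on $(0,T]$ is represented by its extension by zero to the real line, so that
  equality of functions is equality on $(0,T]$; for elements of $C_\infty(0,T]$ this is also the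
  continuous extension to $[0,T]$.\<close>

definition zext :: "real \<Rightarrow> (real \<Rightarrow> real) \<Rightarrow> real \<Rightarrow> real" where
  "zext T u x = (if x \<in> {0<..T} then u x else 0)"

definition C_infty :: "real \<Rightarrow> (real \<Rightarrow> real) set" where
  "C_infty T = {u. continuous_on {0<..T} u \<and> (u \<longlongrightarrow> 0) (at_right 0) \<and> (\<forall>x. x \<notin> {0<..T} \<longrightarrow> u x = 0)}"

definition sup_norm :: "real \<Rightarrow> (real \<Rightarrow> real) \<Rightarrow> real" where
  "sup_norm T u = (SUP x\<in>{0<..T}. \<bar>u x\<bar>)"

definition conv :: "(real \<Rightarrow> real) \<Rightarrow> (real \<Rightarrow> real) \<Rightarrow> real \<Rightarrow> real" where
  "conv a \<phi> x = (LBINT s:{0<..<x}. a (x - s) * \<phi> s)"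

text \<open>Derivatives on $(0,T]$ are taken within that interval, hence one-sided at $T$.\<close>

definition C_tail :: "real measure \<Rightarrow> real \<Rightarrow> (real \<Rightarrow> real) set" where
  "C_tail \<mu> T = {\<phi>. continuous_on {0<..T} \<phi> \<and> set_integrable lborel {0<..T} \<phi> \<and>
     (\<exists>d. continuous_on {0<..T} d \<and>
          (\<forall>x\<in>{0<..T}. (conv (tail \<mu>) \<phi> has_real_derivative d x) (at x within {0<..T})))}"


section \<open>Operators\<close>

definition D_R :: "real measure \<Rightarrow> real \<Rightarrow> (real \<Rightarrow> real) \<Rightarrow> real \<Rightarrow> real" where
  "D_R \<mu> T \<phi> x = vector_derivative (conv (tail \<mu>) \<phi>) (at x within {0<..T})"

definition D_Ce :: "real measure \<Rightarrow> real \<Rightarrow> (real \<Rightarrow> real) \<Rightarrow> real \<Rightarrow> real" where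
  "D_Ce \<mu> T \<phi> x = D_R \<mu> T \<phi> x - \<phi> x * tail \<mu> x"

definition I_R :: "(real \<Rightarrow> real) \<Rightarrow> (real \<Rightarrow> real) \<Rightarrow> real \<Rightarrow> real" where
  "I_R k \<phi> x = conv k \<phi> x"

definition K_op :: "real measure \<Rightarrow> (real \<Rightarrow> real) \<Rightarrow> (real \<Rightarrow> real) \<Rightarrow> real \<Rightarrow> real" where
  "K_op \<mu> k \<phi> x = (if x = 0 then \<phi> 0 else (LBINT r:{0<..<x}. tail \<mu> r * k (x - r) * \<phi> r))"

definition I_Ce :: "real measure \<Rightarrow> (real \<Rightarrow> real) \<Rightarrow> (real \<Rightarrow> real) \<Rightarrow> real \<Rightarrow> real" where
  "I_Ce \<mu> k g x = (\<Sum>j. (K_op \<mu> k ^^ j) (I_R k g) x)"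


section \<open>Subordinators and the censored process\<close>

definition subordinator :: "'w measure \<Rightarrow> (real \<Rightarrow> 'w \<Rightarrow> real) \<Rightarrow> (real \<Rightarrow> real) \<Rightarrow> bool" where
  "subordinator M X f \<longleftrightarrow>
     (\<forall>t\<ge>0. X t \<in> borel_measurable M) \<and>
     (\<forall>w\<in>space M. X 0 w = 0 \<and> mono_on {0..} (\<lambda>t. X t w) \<and>
        (\<forall>t\<ge>0. continuous (at_right t) (\<lambda>s. X s w))) \<and>
     (\<forall>t::nat \<Rightarrow> real. 0 \<le> t 0 \<and> mono t \<longrightarrow>
        prob_space.indep_vars M (\<lambda>_. borel) (\<lambda>i w. X (t (Suc i)) w - X (t i) w) UNIV) \<and>
     (\<forall>s\<ge>0. \<forall>t\<ge>0. distr M borel (\<lambda>w. X (s + t) w - X s w) = distr M borel (X t)) \<and>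
     (\<forall>t\<ge>0. \<forall>l>0. (\<integral>w. exp (- l * X t w) \<partial>M) = exp (- t * f l))"

definition iid_processes :: "'w measure \<Rightarrow> 'i set \<Rightarrow> ('i \<Rightarrow> real \<Rightarrow> 'w \<Rightarrow> real) \<Rightarrow> bool" where
  "iid_processes M J S \<longleftrightarrow>
     prob_space.indep_vars M (\<lambda>_. PiM {0..} (\<lambda>_. borel)) (\<lambda>j w. \<lambda>t\<in>{0..}. S j t w) J \<and>
     (\<forall>i\<in>J. \<forall>j\<in>J. distr M (PiM {0..} (\<lambda>_. borel)) (\<lambda>w. \<lambda>t\<in>{0..}. S i t w)
                 = distr M (PiM {0..} (\<lambda>_. borel)) (\<lambda>w. \<lambda>t\<in>{0..}. S j t w))"

text \<open>The infimum is taken in the extended reals, so that the passage time is infinite when the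
  level is never exceeded.\<close>

definition passage_time :: "(real \<Rightarrow> real) \<Rightarrow> real \<Rightarrow> ereal" where
  "passage_time p y = Inf (ereal ` {s. 0 < s \<and> p s > y})"

text \<open>The value $p(s-)$. The cases $s = 0$, with the usual convention $p(0-) = p(0)$, and
  $s = \infty$ arise only on a null set.\<close>

definition left_value :: "(real \<Rightarrow> real) \<Rightarrow> ereal \<Rightarrow> real" where
  "left_value p s =
     (if s = 0 then p 0
      else if s = \<infinity> then Lim at_top p
      else Lim (at_left (real_of_ereal s)) p)"

text \<open>The argument \<open>S\<close> of the following functions is the realisation of the sequence of paths
  $S^1, S^2, \dots$; the index 0 is not used.\<close>

primrec Y_cens :: "(nat \<Rightarrow> real \<Rightarrow> real) \<Rightarrow> real \<Rightarrow> nat \<Rightarrow> real" where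
  "Y_cens S x 0 = x"
| "Y_cens S x (Suc j) =
     Y_cens S x j - left_value (S (Suc j)) (passage_time (S (Suc j)) (Y_cens S x j))"

definition sigma_cens :: "(nat \<Rightarrow> real \<Rightarrow> real) \<Rightarrow> real \<Rightarrow> nat \<Rightarrow> ereal" where
  "sigma_cens S x j = passage_time (S j) (Y_cens S x (j - 1))"

definition tau_cens :: "(nat \<Rightarrow> real \<Rightarrow> real) \<Rightarrow> real \<Rightarrow> nat \<Rightarrow> ereal" where
  "tau_cens S x j = (\<Sum>i=1..j. sigma_cens S x i)"

definition tau_infty :: "(nat \<Rightarrow> real \<Rightarrow> real) \<Rightarrow> real \<Rightarrow> ereal" where
  "tau_infty S x = lim (tau_cens S x)"

text \<open>\<open>None\<close> is the cemetery state; the index \<open>j\<close> below counts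
  the resurrections up to time \<open>t\<close>.\<close>

definition S_cens :: "(nat \<Rightarrow> real \<Rightarrow> real) \<Rightarrow> real \<Rightarrow> real \<Rightarrow> real option" where
  "S_cens S x t =
     (if ereal t < tau_infty S x
      then (let j = (THE j. tau_cens S x j \<le> ereal t \<and> ereal t < tau_cens S x (Suc j))
            in Some (Y_cens S x j - S (Suc j) (t - real_of_ereal (tau_cens S x j))))
      else None)"

definition P_cens ::
  "'w measure \<Rightarrow> (nat \<Rightarrow> real \<Rightarrow> 'w \<Rightarrow> real) \<Rightarrow> real \<Rightarrow> real \<Rightarrow> (real \<Rightarrow> real) \<Rightarrow> real \<Rightarrow> real" where
  "P_cens M S T t \<phi> = zext T (\<lambda>x.
     \<integral>w. (case S_cens (\<lambda>j s. S j s w) x t of None \<Rightarrow> 0 | Some y \<Rightarrow> \<phi> y) \<partial>M)"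


section \<open>Feller semigroups and generators\<close>

definition feller_semigroup :: "real \<Rightarrow> (real \<Rightarrow> (real \<Rightarrow> real) \<Rightarrow> real \<Rightarrow> real) \<Rightarrow> bool" where
  "feller_semigroup T P \<longleftrightarrow>
     (\<forall>t\<ge>0. \<forall>u\<in>C_infty T. P t u \<in> C_infty T) \<and>
     (\<forall>t\<ge>0. \<forall>u\<in>C_infty T. \<forall>v\<in>C_infty T. \<forall>a b.
        P t (\<lambda>x. a * u x + b * v x) = (\<lambda>x. a * P t u x + b * P t v x)) \<and>
     (\<forall>u\<in>C_infty T. P 0 u = u) \<and>
     (\<forall>s\<ge>0. \<forall>t\<ge>0. \<forall>u\<in>C_infty T. P (s + t) u = P s (P t u)) \<and>
     (\<forall>u\<in>C_infty T. ((\<lambda>t. sup_norm T (\<lambda>x. P t u x - u x)) \<longlongrightarrow> 0) (at_right 0)) \<and>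
     (\<forall>t\<ge>0. \<forall>u\<in>C_infty T. (\<forall>x. 0 \<le> u x) \<longrightarrow> (\<forall>x. 0 \<le> P t u x)) \<and>
     (\<forall>t\<ge>0. \<forall>u\<in>C_infty T. sup_norm T (P t u) \<le> sup_norm T u)"

text \<open>The generator, identified with its graph.\<close>

definition generator ::
  "real \<Rightarrow> (real \<Rightarrow> (real \<Rightarrow> real) \<Rightarrow> real \<Rightarrow> real) \<Rightarrow> ((real \<Rightarrow> real) \<times> (real \<Rightarrow> real)) set" where
  "generator T P = {(u, v). u \<in> C_infty T \<and> v \<in> C_infty T \<and>
     ((\<lambda>t. sup_norm T (\<lambda>x. (P t u x - u x) / t - v x)) \<longlongrightarrow> 0) (at_right 0)}"

end

theory Submission
  imports Defs
begin

text \<open>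
  Write $V = I^{\mathrm{Ce}}$. The whole proof rests on the resolvent identity
  $R_\lambda g = V(g - \lambda R_\lambda g)$ for $R_\lambda g(x) = \int_0^\infty e^{-\lambda t}
  \mathbb{E}^x[g(S^c_t)]\,dt$. It comes from summing over the resurrections: if $u_\lambda$ is the
  $\lambda$-resolvent density of the subordinator, the compensation formula says that one passage
  followed by a resurrection acts as $\psi \mapsto u_\lambda * (\bar\mu\psi)$, so that
  $R_\lambda g = u_\lambda * (g + \bar\mu R_\lambda g)$; and $u_\lambda + \lambda k * u_\lambda = k$
  turns this into $R_\lambda g = k * (g - \lambda R_\lambda g + \bar\mu R_\lambda g)$, whose only
  bounded solution is the Neumann series $V$, because the Sonine identity and $q < 1$ give
  $\sup_{(0,T]} \bar\mu \int_0^{\cdot} k < 1$.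

  The semigroup itself is then recovered from the resolvent: injectivity of the Laplace transform
  gives $P_t V h = V h - \int_0^t P_s h\,ds$ and the semigroup law, while a uniform inversion by
  finitely many values of the Laplace transform carries invariance of $C_\infty(0,T]$ from
  $R_\lambda$ to $P_t$. Hence every $V h$ is in the domain of the generator, and there is nothing else in it,
  since $u - A u = \phi$ has a unique solution by the maximum principle.
\<close>

text \<open>Resurrections occur at passage times, which suggests the strong Markov property.
  Instead, every life uses a fresh subordinator, so the state after \<open>j\<close> resurrections
  is a functional of the first \<open>j\<close> paths, and Fubini against path \<open>j + 1\<close>
  suffices. Nor is a jump measure used: passage is discretised with step h, and the Laplace exponent
  alone gives P(X_h > z)/h \<longlonglongrightarrow> \<open>tail \<mu> z\<close>. Paths reaching
  their level without jumping over it are never shown to be negligible; they would be resurrected at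
  0, where all test functions vanish.

  The analytic obstacle is that, by the Sonine identity, \<open>K_op\<close> maps the constant 1 to
  itself on (0,T] and is no strict contraction in the sup norm. It contracts by \<open>rho\<close>
  in the norm sup |\<phi>| / \<open>kap\<close>, where \<open>kap\<close> is the primitive of
  \<open>k\<close>. The functions \<open>I_R k g\<close> lie in that space, so every estimate
  carries the factor \<open>kap x\<close>. That \<open>tail \<mu> x * kap x\<close> stays below a
  constant less than 1 follows from q only near 0; elsewhere it takes the strict form of the Sonine
  bound, which rests on \<lambda>/f(\<lambda>) \<longlongrightarrow> 0 at 0.\<close>

abbreviation (input) eexp :: "real \<Rightarrow> real \<Rightarrow> ennreal" where
  "eexp l x \<equiv> ennreal (exp (-(l * x)))"

abbreviation (input) hexp :: "real \<Rightarrow> real \<Rightarrow> ennreal" where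
  "hexp l x \<equiv> indicator {0..} x * eexp l x"

section \<open>Laplace transforms\<close>

text \<open>Under u = exp(-x), polynomials in u become combinations of exponentials with integer
  rates, so Stone-Weierstrass on [0,1] yields an approximation that is uniform on the whole
  half-line.\<close>

lemma exp_poly_approx:
  fixes b :: "real \<Rightarrow> real"
  assumes "continuous_on {0..1} b" "0 < e"
  shows "\<exists>c n. \<forall>x\<ge>0. \<bar>b (exp (-x)) - (\<Sum>i\<le>(n::nat). c i * exp (-(real i * x)))\<bar> \<le> e"
proof -
  obtain p where p: "real_polynomial_function p" "\<And>x. x \<in> {0..1} \<Longrightarrow> \<bar>b x - p x\<bar> < e"
    using Stone_Weierstrass_real_polynomial_function[OF compact_Icc assms] by blast
  obtain c n where c: "p = (\<lambda>x. \<Sum>i\<le>(n::nat). c i * x ^ i)"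
    using p(1) real_polynomial_function_iff_sum by blast
  have "exp (-x) ^ i = exp (-(real i * x))" for x :: real and i
    by (simp flip: exp_of_nat_mult)
  hence "\<bar>b (exp (-x)) - (\<Sum>i\<le>n. c i * exp (-(real i * x)))\<bar> \<le> e" if "x \<ge> 0" for x
    using p(2)[of "exp (-x)"] that by (simp add: c)
  thus ?thesis by blast
qed

lemma bounded_01:
  fixes b :: "real \<Rightarrow> real"
  assumes "continuous_on {0..1} b"
  obtains B where "B > 0" "\<And>x. x \<ge> 0 \<Longrightarrow> \<bar>b (exp (-x))\<bar> \<le> B"
proof -
  have "compact (b ` {0..1})" using assms compact_continuous_image by blast
  then obtain B where B: "B > 0" "\<And>y. y \<in> b ` {0..1} \<Longrightarrow> norm y \<le> B"
    using compact_imp_bounded bounded_pos by metis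
  show ?thesis by (rule that[of B]) (use B in auto)
qed

text \<open>The factor \<open>exp (-x)\<close> damps measures of possibly infinite mass to finite
  ones, on which replacing \<open>b\<close> by its approximation costs at most the error times the
  mass. It also shifts the exponential of rate i to rate i + 1, whence the
  \<open>Suc\<close>.\<close>

lemma laplace_weak_limit:
  fixes b :: "real \<Rightarrow> real" and \<alpha> :: "nat \<Rightarrow> real measure"
  assumes sets: "\<And>n. sets (\<alpha> n) = sets borel" "sets \<beta> = sets borel"
    and ae: "\<And>n. AE x in \<alpha> n. 0 \<le> x" "AE x in \<beta>. 0 \<le> x"
    and int: "\<And>n. integrable (\<alpha> n) (\<lambda>x. exp (-x))" "integrable \<beta> (\<lambda>x. exp (-x))"
    and lim: "\<And>i. (\<lambda>n. \<integral>x. exp (-(real (Suc i) * x)) \<partial>\<alpha> n) \<longlonglongrightarrow> (\<integral>x. exp (-(real (Suc i) * x)) \<partial>\<beta>)"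
    and b: "continuous_on {0..1} b" and bm: "b \<in> borel_measurable borel"
  shows "(\<lambda>n. \<integral>x. exp (-x) * b (exp (-x)) \<partial>\<alpha> n) \<longlonglongrightarrow> (\<integral>x. exp (-x) * b (exp (-x)) \<partial>\<beta>)"
proof (rule LIMSEQ_I)
  fix r :: real assume "r > 0"
  define L where "L = (\<integral>x. exp (-x) \<partial>\<beta>)"
  have L0: "L \<ge> 0" unfolding L_def by simp
  \<comment> \<open>The damped masses are eventually below L + 1 for the sequence and equal to L for
    the limit, so both approximation errors together stay below e(2L + 1) = r/4.\<close>
  define e where "e = r / (4 * (2 * L + 1))"
  have e0: "e > 0" using \<open>r > 0\<close> L0 by (simp add: e_def)
  obtain c N where c: "\<And>x. x \<ge> 0 \<Longrightarrow> \<bar>b (exp (-x)) - (\<Sum>i\<le>(N::nat). c i * exp (-(real i * x)))\<bar> \<le> e"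
    using exp_poly_approx[OF b e0] by blast
  obtain B where B: "B > 0" "\<And>x. x \<ge> 0 \<Longrightarrow> \<bar>b (exp (-x))\<bar> \<le> B"
    using bounded_01[OF b] by blast
  have key: "\<bar>(\<integral>x. exp (-x) * b (exp (-x)) \<partial>\<gamma>) - (\<Sum>i\<le>N. c i * (\<integral>x. exp (-(real (Suc i) * x)) \<partial>\<gamma>))\<bar>
       \<le> e * (\<integral>x. exp (-x) \<partial>\<gamma>)"
    if s[measurable_cong]: "sets \<gamma> = sets borel" and a: "AE x in \<gamma>. 0 \<le> x" and i: "integrable \<gamma> (\<lambda>x. exp (-x))"
    for \<gamma> :: "real measure"
  proof -
    note [measurable] = bm
    have i1: "integrable \<gamma> (\<lambda>x. exp (-x) * b (exp (-x)))"
    proof (rule Bochner_Integration.integrable_bound[OF integrable_mult_right[OF i, of B]])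
      show "AE x in \<gamma>. norm (exp (-x) * b (exp (-x))) \<le> norm (B * exp (-x))"
        using a by eventually_elim (use B in \<open>auto simp: abs_mult mult.commute\<close>)
    qed measurable
    have i2: "integrable \<gamma> (\<lambda>x. exp (-(real (Suc j) * x)))" for j
    proof (rule Bochner_Integration.integrable_bound[OF i])
      show "AE x in \<gamma>. norm (exp (-(real (Suc j) * x))) \<le> norm (exp (-x))"
        using a by eventually_elim (auto simp: algebra_simps)
    qed measurable
    have "(\<integral>x. exp (-x) * b (exp (-x)) \<partial>\<gamma>) - (\<Sum>i\<le>N. c i * (\<integral>x. exp (-(real (Suc i) * x)) \<partial>\<gamma>))
       = (\<integral>x. exp (-x) * b (exp (-x)) - (\<Sum>i\<le>N. c i * exp (-(real (Suc i) * x))) \<partial>\<gamma>)"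
      using i1 i2 by (subst Bochner_Integration.integral_diff) (auto simp: integral_sum)
    also have "\<bar>\<dots>\<bar> \<le> (\<integral>x. e * exp (-x) \<partial>\<gamma>)"
    proof (rule integral_abs_bound[THEN order_trans], rule integral_mono_AE)
      show "AE x in \<gamma>. \<bar>exp (-x) * b (exp (-x)) - (\<Sum>i\<le>N. c i * exp (-(real (Suc i) * x)))\<bar> \<le> e * exp (-x)"
        using a
      proof eventually_elim
        case (elim x)
        have "exp (-x) * b (exp (-x)) - (\<Sum>i\<le>N. c i * exp (-(real (Suc i) * x))) =
          exp (-x) * (b (exp (-x)) - (\<Sum>i\<le>N. c i * exp (-(real i * x))))"
          by (simp add: right_diff_distrib sum_distrib_left algebra_simps exp_add[symmetric])
        thus ?case using c[OF elim] by (simp add: abs_mult)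
      qed
    qed (use i1 i2 i in auto)
    finally show ?thesis by simp
  qed
  have l1: "(\<lambda>n. \<integral>x. exp (-x) \<partial>\<alpha> n) \<longlonglongrightarrow> L" using lim[of 0] by (simp add: L_def)
  have l2: "(\<lambda>n. \<Sum>i\<le>N. c i * (\<integral>x. exp (-(real (Suc i) * x)) \<partial>\<alpha> n)) \<longlonglongrightarrow> (\<Sum>i\<le>N. c i * (\<integral>x. exp (-(real (Suc i) * x)) \<partial>\<beta>))"
    by (intro tendsto_intros lim)
  have "\<forall>\<^sub>F n in sequentially. (\<integral>x. exp (-x) \<partial>\<alpha> n) < L + 1"
    using l1 by (rule order_tendstoD) simp
  moreover have "\<forall>\<^sub>F n in sequentially. dist (\<Sum>i\<le>N. c i * (\<integral>x. exp (-(real (Suc i) * x)) \<partial>\<alpha> n)) (\<Sum>i\<le>N. c i * (\<integral>x. exp (-(real (Suc i) * x)) \<partial>\<beta>)) < r/2"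
    using l2 \<open>r > 0\<close> by (intro tendstoD) auto
  ultimately have "\<forall>\<^sub>F n in sequentially. norm ((\<integral>x. exp (-x) * b (exp (-x)) \<partial>\<alpha> n) - (\<integral>x. exp (-x) * b (exp (-x)) \<partial>\<beta>)) < r"
  proof eventually_elim
    case (elim n)
    have "e * (\<integral>x. exp (-x) \<partial>\<alpha> n) \<le> e * (L+1)" using elim e0 by (intro mult_left_mono) auto
    moreover have "e * (L + 1) + e * L = r / 4"
    proof -
      have "2 * L + 1 \<noteq> 0" using L0 by linarith
      hence "r / (4 * (2 * L + 1)) * (2 * L + 1) = r / 4"
        by (metis divide_divide_eq_left nonzero_eq_divide_eq)
      hence "e * (2 * L + 1) = r / 4" unfolding e_def .
      thus ?thesis by (simp add: algebra_simps)
    qed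
    ultimately show ?case using elim(2) key[OF sets(1) ae(1) int(1), of n] key[OF sets(2) ae(2) int(2)] \<open>r > 0\<close>
      unfolding L_def[symmetric] dist_real_def real_norm_def by linarith
  qed
  thus "\<exists>no. \<forall>n\<ge>no. norm ((\<integral>x. exp (-x) * b (exp (-x)) \<partial>\<alpha> n) - (\<integral>x. exp (-x) * b (exp (-x)) \<partial>\<beta>)) < r"
    by (simp add: eventually_sequentially)
qed

text \<open>The weak limit lemma for a constant sequence is an identity of integrals of
  \<open>exp (-x) * b (exp (-x))\<close>. Letting such \<open>b\<close> approach indicators of
  half-lines identifies the damped measures, and the density \<open>exp x\<close> removes the
  damping.\<close>

lemma laplace_unique_measure:
  fixes \<alpha> \<beta> :: "real measure"
  assumes sets[measurable_cong]: "sets \<alpha> = sets borel" "sets \<beta> = sets borel"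
    and ae: "AE x in \<alpha>. 0 \<le> x" "AE x in \<beta>. 0 \<le> x"
    and fin: "\<And>l. l > 0 \<Longrightarrow> (\<integral>\<^sup>+x. eexp l x \<partial>\<alpha>) < \<infinity>"
    and eq: "\<And>l. l > 0 \<Longrightarrow> (\<integral>\<^sup>+x. eexp l x \<partial>\<alpha>) = (\<integral>\<^sup>+x. eexp l x \<partial>\<beta>)"
  shows "\<alpha> = \<beta>"
proof -
  have inta: "integrable \<alpha> (\<lambda>x. exp (-(l * x)))" if "l > 0" for l
    using fin[OF that] by (intro integrableI_bounded) auto
  have intb: "integrable \<beta> (\<lambda>x. exp (-(l * x)))" if "l > 0" for l
    using fin[OF that] eq[OF that] by (intro integrableI_bounded) auto
  have eqi: "(\<integral>x. exp (-(l * x)) \<partial>\<alpha>) = (\<integral>x. exp (-(l * x)) \<partial>\<beta>)" if "l > 0" for l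
    using eq[OF that] by (simp add: integral_eq_nn_integral)
  have eqb: "(\<integral>x. exp (-x) * b (exp (-x)) \<partial>\<alpha>) = (\<integral>x. exp (-x) * b (exp (-x)) \<partial>\<beta>)"
    if "continuous_on {0..1} b" "b \<in> borel_measurable borel" for b :: "real \<Rightarrow> real"
  proof -
    have "(\<lambda>n::nat. \<integral>x. exp (-x) * b (exp (-x)) \<partial>\<alpha>) \<longlonglongrightarrow> (\<integral>x. exp (-x) * b (exp (-x)) \<partial>\<beta>)"
      by (rule laplace_weak_limit) (use inta[of 1] intb[of 1] ae that sets in \<open>auto simp: eqi simp del: of_nat_Suc\<close>)
    thus ?thesis by (simp add: LIMSEQ_const_iff)
  qed
  define A where "A = density \<alpha> (\<lambda>x. ennreal (exp (-x)))"
  define B where "B = density \<beta> (\<lambda>x. ennreal (exp (-x)))"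
  have meas: "emeasure (density \<gamma> (\<lambda>x. ennreal (exp (-x)))) {a<..} = ennreal (\<integral>x. exp (-x) * indicator {a<..} x \<partial>\<gamma>)"
    if [measurable_cong]: "sets \<gamma> = sets borel" and i: "integrable \<gamma> (\<lambda>x. exp (-x))" for \<gamma> a
  proof -
    have "emeasure (density \<gamma> (\<lambda>x. ennreal (exp (-x)))) {a<..} = (\<integral>\<^sup>+x. ennreal (exp (-x) * indicator {a<..} x) \<partial>\<gamma>)"
      by (subst emeasure_density) (auto intro!: nn_integral_cong simp: indicator_def)
    also have "\<dots> = ennreal (\<integral>x. exp (-x) * indicator {a<..} x \<partial>\<gamma>)"
    proof (rule nn_integral_eq_integral)
      show "integrable \<gamma> (\<lambda>x. exp (- x) * indicator {a<..} x)"
        by (rule Bochner_Integration.integrable_bound[OF i]) (auto simp: indicator_def)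
    qed (auto)
    finally show ?thesis .
  qed
  \<comment> \<open>In the variable u = exp(-x) these are ramps of slope n below exp(-a), continuous
    on [0,1] and increasing to the indicator of the half-line beyond a.\<close>
  have lim: "(\<lambda>n. \<integral>x. exp (-x) * min 1 (max 0 (real n * (exp (-a) - exp (-x)))) \<partial>\<gamma>) \<longlonglongrightarrow> (\<integral>x. exp (-x) * indicator {a<..} x \<partial>\<gamma>)"
    if [measurable_cong]: "sets \<gamma> = sets borel" and i: "integrable \<gamma> (\<lambda>x. exp (-x))" for \<gamma> a
  proof (rule integral_dominated_convergence[where w="\<lambda>x. exp (-x)"])
    show "AE x in \<gamma>. (\<lambda>n. exp (-x) * min 1 (max 0 (real n * (exp (-a) - exp (-x))))) \<longlonglongrightarrow> exp (-x) * indicator {a<..} x"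
    proof (rule AE_I2)
      fix x
      show "(\<lambda>n. exp (-x) * min 1 (max 0 (real n * (exp (-a) - exp (-x))))) \<longlonglongrightarrow> exp (-x) * indicator {a<..} x"
      proof (cases "x > a")
        case True
        hence d: "exp (-a) - exp (-x) > 0" by simp
        have "\<forall>\<^sub>F n in sequentially. 1 / (exp (-a) - exp (-x)) < real n"
          using filterlim_at_top_dense filterlim_real_sequentially by blast
        hence "\<forall>\<^sub>F n in sequentially. exp (-x) * min 1 (max 0 (real n * (exp (-a) - exp (-x)))) = exp (-x) * indicator {a<..} x"
          by eventually_elim (use d True in \<open>auto simp: field_simps min_def max_def\<close>)
        thus ?thesis by (rule tendsto_eventually)
      next
        case False
        hence "real n * (exp (-a) - exp (-x)) \<le> 0" for n by (simp add: mult_nonneg_nonpos)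
        hence "max 0 (real n * (exp (-a) - exp (-x))) = 0" for n by (simp add: max_def antisym)
        thus ?thesis using False by simp
      qed
    qed
  qed (use i in \<open>auto simp: abs_mult\<close>)
  have eqA: "(\<integral>x. exp (-x) * indicator {a<..} x \<partial>\<alpha>) = (\<integral>x. exp (-x) * indicator {a<..} x \<partial>\<beta>)" for a
  proof (rule LIMSEQ_unique[OF lim])
    show "(\<lambda>n. \<integral>x. exp (-x) * min 1 (max 0 (real n * (exp (-a) - exp (-x)))) \<partial>\<alpha>) \<longlonglongrightarrow> (\<integral>x. exp (-x) * indicator {a<..} x \<partial>\<beta>)"
      by (subst eqb) (use lim[of \<beta> a] intb[of 1] sets in \<open>auto intro!: continuous_intros\<close>)
  qed (use inta[of 1] sets in auto)
  have "A = B"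
  proof (rule measure_eqI_lessThan)
    show "emeasure A {x<..} = emeasure B {x<..}" for x
      unfolding A_def B_def using meas[of \<alpha> x] meas[of \<beta> x] inta[of 1] intb[of 1] eqA sets by simp
    show "emeasure A {x<..} < \<infinity>" for x
      unfolding A_def using meas[of \<alpha> x] inta[of 1] sets by simp
  qed (simp_all add: A_def B_def sets)
  hence "density A (\<lambda>x. ennreal (exp x)) = density B (\<lambda>x. ennreal (exp x))" by simp
  moreover have "density (density \<gamma> (\<lambda>x. ennreal (exp (-x)))) (\<lambda>x. ennreal (exp x)) = \<gamma>"
    if [measurable_cong]: "sets \<gamma> = sets borel" for \<gamma>
    by (subst density_density_eq) (auto simp: ennreal_mult[symmetric] exp_minus density_1)
  ultimately show ?thesis using sets by (simp add: A_def B_def)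
qed

lemma integrable_exp_half:
  "l > 0 \<Longrightarrow> set_integrable lborel {0..} (\<lambda>x::real. exp (-(l * x)))"
  "l > 0 \<Longrightarrow> (LBINT x:{0..}. exp (-(l * x))) = 1 / l"
proof -
  assume l: "l > 0"
  have "(\<integral>\<^sup>+x. eexp l x * indicator {0..} x \<partial>lborel) = ennreal (0 - (- exp (-(l * 0)) / l))"
  proof (rule nn_integral_FTC_atLeast)
    show "((\<lambda>x. - exp (- (l * x)) / l) \<longlongrightarrow> 0) at_top"
    proof -
      have "((\<lambda>x. exp (- (l * x))) \<longlongrightarrow> 0) at_top"
        by (rule filterlim_compose[OF exp_at_bot])
           (simp add: filterlim_uminus_at_bot filterlim_tendsto_pos_mult_at_top[OF tendsto_const l filterlim_ident])
      from tendsto_divide[OF tendsto_minus[OF this] tendsto_const, of l] show ?thesis using l by simp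
    qed
  qed (use l in \<open>auto intro!: derivative_eq_intros\<close>)
  hence n: "(\<integral>\<^sup>+x. ennreal (indicator {0..} x * exp (-(l * x))) \<partial>lborel) = ennreal (1 / l)"
    by (simp add: ennreal_mult' ennreal_indicator mult.commute)
  show "set_integrable lborel {0..} (\<lambda>x::real. exp (-(l * x)))"
    unfolding set_integrable_def using n by (intro integrableI_bounded) auto
  show "(LBINT x:{0..}. exp (-(l * x))) = 1 / l"
    unfolding set_lebesgue_integral_def using n l by (simp add: integral_eq_nn_integral)
qed

text \<open>A normalised tent over [exp(-(t+d)), exp(-t)], the image of the time interval under s
  \<mapsto> exp(-s). As a continuous function of exp(-s) it can be approximated by exponentials,
  which makes it a probability density located at t that Laplace transforms can see.\<close>

lemma exp_bump:
  fixes t d :: real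
  assumes t: "t \<ge> 0" "d > 0"
  obtains b :: "real \<Rightarrow> real" where "continuous_on {0..1} b" "b \<in> borel_measurable borel" "\<And>u. 0 \<le> b u"
    "\<And>s. s \<notin> {t..t+d} \<Longrightarrow> b (exp (-s)) = 0"
    "integrable lborel (\<lambda>s. indicator {0..} s * exp (-s) * b (exp (-s)))"
    "(\<integral>s. indicator {0..} s * exp (-s) * b (exp (-s)) \<partial>lborel) = 1"
proof -
  define b0 where "b0 u = max 0 (min (u - exp (-(t+d))) (exp (-t) - u))" for u :: real
  define w where "w s = indicator {0..} s * exp (-s)" for s :: real
  have wi: "integrable lborel w" and wI: "(\<integral>s. w s \<partial>lborel) = 1"
    using integrable_exp_half[of 1] unfolding w_def set_integrable_def set_lebesgue_integral_def by auto
  have w0: "w s \<ge> 0" for s by (simp add: w_def)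
  have b0m[measurable]: "b0 \<in> borel_measurable borel" unfolding b0_def by measurable
  have b0n: "b0 u \<ge> 0" for u by (simp add: b0_def)
  have b0s: "b0 (exp (-s)) = 0" if "s \<notin> {t..t+d}" for s
  proof -
    have "min (exp (-s) - exp (-(t+d))) (exp (-t) - exp (-s)) \<le> 0"
      using that by (cases "s < t") (auto simp: min_le_iff_disj)
    thus ?thesis unfolding b0_def by (rule max_absorb1)
  qed
  have b0b: "b0 u \<le> 1" for u
  proof -
    have "exp (-t) \<le> 1" using t by simp
    moreover have "exp (-(t+d)) > 0" by simp
    ultimately have "exp (-t) - u \<le> 1 \<or> u - exp (-(t+d)) \<le> 1" by linarith
    thus ?thesis unfolding b0_def by (auto simp: min_le_iff_disj)
  qed
  have wb: "integrable lborel (\<lambda>s. w s * b0 (exp (-s)))"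
  proof (rule Bochner_Integration.integrable_bound[OF wi])
    show "AE s in lborel. norm (w s * b0 (exp (-s))) \<le> norm (w s)"
    proof (rule AE_I2)
      fix s
      have "w s * b0 (exp (-s)) \<le> w s * 1" by (rule mult_left_mono[OF b0b w0])
      thus "norm (w s * b0 (exp (-s))) \<le> norm (w s)" using w0[of s] b0n by simp
    qed
  qed (simp add: w_def)
  define Z where "Z = (\<integral>s. w s * b0 (exp (-s)) \<partial>lborel)"
  have Zpos: "Z > 0"
  proof -
    have Z0: "Z \<ge> 0" unfolding Z_def using w0 b0n by (intro integral_nonneg_AE) auto
    have "Z \<noteq> 0"
    proof
      assume "Z = 0"
      hence ae0: "AE s in lborel. w s * b0 (exp (-s)) = 0"
        unfolding Z_def using integral_nonneg_eq_0_iff_AE[OF wb] w0 b0n by auto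
      have n0: "w s * b0 (exp (-s)) \<noteq> 0" if "s \<in> {t<..<t+d}" for s
      proof -
        have "min (exp (-s) - exp (-(t+d))) (exp (-t) - exp (-s)) > 0"
          using that by (simp add: min_less_iff_conj)
        hence "b0 (exp (-s)) > 0" unfolding b0_def by (simp add: max_absorb2)
        moreover have "w s > 0" using that t by (simp add: w_def)
        ultimately show ?thesis by simp
      qed
      have "AE s in lborel. \<not> (s \<in> {t<..<t+d})"
        using ae0 by (rule eventually_mono) (use n0 in blast)
      hence "emeasure lborel {s \<in> space lborel. s \<in> {t<..<t+d}} = 0"
        by (rule emeasure_eq_0_AE)
      moreover have "{s \<in> space lborel. s \<in> {t<..<t+d}} = {t<..<t+d}" by auto
      ultimately have "emeasure lborel {t<..<t+d} = 0" by simp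
      thus False using t by (simp add: emeasure_lborel_Ioo)
    qed
    thus ?thesis using Z0 by simp
  qed
  define b where "b u = b0 u / Z" for u
  have bm[measurable]: "b \<in> borel_measurable borel" unfolding b_def by measurable
  have bn: "b u \<ge> 0" for u using b0n Zpos by (simp add: b_def)
  have bint: "integrable lborel (\<lambda>s. w s * b (exp (-s)))" and bI: "(\<integral>s. w s * b (exp (-s)) \<partial>lborel) = 1"
    using wb Zpos unfolding b_def by (auto simp: Z_def[symmetric])
  have bcont: "continuous_on {0..1} b" unfolding b_def b0_def using Zpos by (intro continuous_intros) auto
  show ?thesis
    by (rule that[OF bcont bm bn _ bint[unfolded w_def] bI[unfolded w_def]]) (simp add: b_def b0s)
qed

text \<open>The coefficients depend on the modulus of continuity of $F$ at $t$ only, not on $F$: this is what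
  makes the inversion uniform in the starting point of the process.\<close>

lemma laplace_inversion:
  fixes t d \<epsilon> B :: real
  assumes t: "t \<ge> 0" "d > 0" "\<epsilon> > 0" "B \<ge> 0"
  shows "\<exists>c N. \<forall>F\<in>borel_measurable borel. (\<forall>s\<ge>0. \<bar>F s\<bar> \<le> B) \<longrightarrow> (\<forall>s\<in>{t..t+d}. \<bar>F s - F t\<bar> \<le> \<epsilon>) \<longrightarrow>
     \<bar>F t - (\<Sum>i\<le>(N::nat). c i * (LBINT s:{0..}. exp (-(real (Suc i) * s)) * F s))\<bar> \<le> 2 * \<epsilon>"
proof -
  define w where "w s = indicator {0..} s * exp (-s)" for s :: real
  have wi: "integrable lborel w" and wI: "(\<integral>s. w s \<partial>lborel) = 1"
    using integrable_exp_half[of 1] unfolding w_def set_integrable_def set_lebesgue_integral_def by auto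
  have w0: "w s \<ge> 0" for s by (simp add: w_def)
  obtain b :: "real \<Rightarrow> real" where bcont: "continuous_on {0..1} b" and bm[measurable]: "b \<in> borel_measurable borel" and bn: "\<And>u. 0 \<le> b u"
    and bs: "\<And>s. s \<notin> {t..t+d} \<Longrightarrow> b (exp (-s)) = 0"
    and bint: "integrable lborel (\<lambda>s. w s * b (exp (-s)))" and bI: "(\<integral>s. w s * b (exp (-s)) \<partial>lborel) = 1"
  proof (rule exp_bump[OF t(1,2)])
    fix b :: "real \<Rightarrow> real"
    assume "continuous_on {0..1} b" "b \<in> borel_measurable borel" "\<And>u. 0 \<le> b u"
      "\<And>s. s \<notin> {t..t+d} \<Longrightarrow> b (exp (-s)) = 0"
      "integrable lborel (\<lambda>s. indicator {0..} s * exp (-s) * b (exp (-s)))"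
      "(\<integral>s. indicator {0..} s * exp (-s) * b (exp (-s)) \<partial>lborel) = 1"
    thus thesis by (intro that[of b]) (auto simp: w_def)
  qed
  obtain Bb where Bb: "Bb > 0" "\<And>x. x \<ge> 0 \<Longrightarrow> \<bar>b (exp (-x))\<bar> \<le> Bb" using bounded_01[OF bcont] by blast
  \<comment> \<open>Against a function bounded by \<open>B\<close> this accuracy leaves an error of
    at most \<epsilon>; the other \<epsilon> of the bound comes from averaging \<open>F\<close> over
    the bump. The summand 1 covers \<open>B = 0\<close>.\<close>
  have "\<epsilon> / (B + 1) > 0" using t by simp
  then obtain c N where c: "\<And>x. x \<ge> 0 \<Longrightarrow> \<bar>b (exp (-x)) - (\<Sum>i\<le>(N::nat). c i * exp (-(real i * x)))\<bar> \<le> \<epsilon> / (B + 1)"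
    using exp_poly_approx[OF bcont] by metis
  show ?thesis
  proof (rule exI[of _ c], rule exI[of _ N], intro ballI impI)
    fix F :: "real \<Rightarrow> real" assume Fm[measurable]: "F \<in> borel_measurable borel"
      and FB: "\<forall>s\<ge>0. \<bar>F s\<bar> \<le> B" and Ft: "\<forall>s\<in>{t..t+d}. \<bar>F s - F t\<bar> \<le> \<epsilon>"
    have wF: "integrable lborel (\<lambda>s. w s * h s * F s)" if "\<And>s. s \<ge> 0 \<Longrightarrow> \<bar>h s\<bar> \<le> 1" "h \<in> borel_measurable borel" for h
    proof (rule Bochner_Integration.integrable_bound[OF integrable_mult_right[OF wi, of B]])
      note that(2)[measurable]
      show "AE s in lborel. norm (w s * h s * F s) \<le> norm (B * w s)"
      proof (rule AE_I2)
        fix s :: real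
        show "norm (w s * h s * F s) \<le> norm (B * w s)"
        proof (cases "s \<ge> 0")
          case True
          have "\<bar>h s\<bar> * \<bar>F s\<bar> \<le> 1 * B" using that(1)[OF True] FB True by (intro mult_mono) auto
          hence "w s * (\<bar>h s\<bar> * \<bar>F s\<bar>) \<le> w s * (1 * B)" by (rule mult_left_mono[OF _ w0])
          thus ?thesis using w0[of s] t by (simp add: abs_mult mult.assoc mult.commute[of B])
        qed (simp add: w_def)
      qed
      show "(\<lambda>s. w s * h s * F s) \<in> borel_measurable lborel" unfolding w_def by measurable
    qed
    have wFi: "integrable lborel (\<lambda>s. w s * exp (-(real i * s)) * F s)" for i
      by (rule wF) auto
    have conv: "(LBINT s:{0..}. exp (-(real (Suc i) * s)) * F s) = (\<integral>s. w s * exp (-(real i * s)) * F s \<partial>lborel)" for i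
      unfolding set_lebesgue_integral_def w_def
      by (rule Bochner_Integration.integral_cong) (auto simp: algebra_simps exp_add[symmetric])
    have wbF: "integrable lborel (\<lambda>s. w s * b (exp (-s)) * F s)"
    proof -
      have "integrable lborel (\<lambda>s. Bb * (w s * (b (exp (-s)) / Bb) * F s))"
        by (intro integrable_mult_right wF) (use Bb in \<open>auto simp: abs_divide\<close>)
      thus ?thesis using Bb by (simp add: mult_ac)
    qed
    have 1: "\<bar>F t - (\<integral>s. w s * b (exp (-s)) * F s \<partial>lborel)\<bar> \<le> \<epsilon>"
    proof -
      have "F t - (\<integral>s. w s * b (exp (-s)) * F s \<partial>lborel) = (\<integral>s. w s * b (exp (-s)) * (F t - F s) \<partial>lborel)"
        using bint bI wbF by (simp add: right_diff_distrib)
      also have "\<bar>\<dots>\<bar> \<le> (\<integral>s. w s * b (exp (-s)) * \<epsilon> \<partial>lborel)"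
      proof (rule integral_abs_bound[THEN order_trans], rule integral_mono)
        fix s
        show "\<bar>w s * b (exp (-s)) * (F t - F s)\<bar> \<le> w s * b (exp (-s)) * \<epsilon>"
        proof (cases "s \<in> {t..t+d}")
          case True
          hence "\<bar>F t - F s\<bar> \<le> \<epsilon>" using Ft by (simp add: abs_minus_commute)
          thus ?thesis using w0[of s] bn[of "exp (-s)"] by (simp add: abs_mult mult_left_mono)
        next
          case False
          thus ?thesis using bs by simp
        qed
      qed (use bint wbF in \<open>auto simp: right_diff_distrib\<close>)
      also have "\<dots> = \<epsilon>" using bI by simp
      finally show ?thesis .
    qed
    have "(\<integral>s. w s * b (exp (-s)) * F s \<partial>lborel) - (\<Sum>i\<le>N. c i * (\<integral>s. w s * exp (-(real i * s)) * F s \<partial>lborel))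
      = (\<integral>s. w s * b (exp (-s)) * F s - (\<Sum>i\<le>N. c i * (w s * exp (-(real i * s)) * F s)) \<partial>lborel)"
      using wbF wFi by (subst Bochner_Integration.integral_diff) (auto simp: integral_sum)
    also have "\<bar>\<dots>\<bar> \<le> (\<integral>s. w s * \<epsilon> \<partial>lborel)"
    proof (rule integral_abs_bound[THEN order_trans], rule integral_mono)
      fix s
      show "\<bar>w s * b (exp (-s)) * F s - (\<Sum>i\<le>N. c i * (w s * exp (-(real i * s)) * F s))\<bar> \<le> w s * \<epsilon>"
      proof (cases "s \<ge> 0")
        case True
        have "w s * b (exp (-s)) * F s - (\<Sum>i\<le>N. c i * (w s * exp (-(real i * s)) * F s)) =
          w s * ((b (exp (-s)) - (\<Sum>i\<le>N. c i * exp (-(real i * s)))) * F s)"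
          by (simp add: right_diff_distrib left_diff_distrib sum_distrib_left sum_distrib_right mult_ac)
        moreover have "\<bar>(b (exp (-s)) - (\<Sum>i\<le>N. c i * exp (-(real i * s)))) * F s\<bar> \<le> \<epsilon> / (B+1) * B"
          unfolding abs_mult using c[OF True] FB True t by (intro mult_mono) auto
        moreover have "\<epsilon> / (B+1) * B \<le> \<epsilon>" using t by (simp add: field_simps)
        ultimately show ?thesis using w0[of s] by (simp add: abs_mult[of "w s"] mult_left_mono)
      qed (simp add: w_def)
    qed (use wi wbF wFi in \<open>auto\<close>)
    also have "\<dots> = \<epsilon>" using wI by simp
    finally show "\<bar>F t - (\<Sum>i\<le>N. c i * (LBINT s:{0..}. exp (-(real (Suc i) * s)) * F s))\<bar> \<le> 2 * \<epsilon>"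
      using 1 unfolding conv by linarith
  qed
qed

text \<open>The inversion formula has the same coefficients for \<open>F\<close> and
  \<open>G\<close> once a common interval to the right of t serves both. Equality is thus obtained
  at the single point t, from right continuity there.\<close>

lemma laplace_unique_fun:
  fixes F G :: "real \<Rightarrow> real"
  assumes m: "F \<in> borel_measurable borel" "G \<in> borel_measurable borel"
    and b: "\<And>s. s \<ge> 0 \<Longrightarrow> \<bar>F s\<bar> \<le> B" "\<And>s. s \<ge> 0 \<Longrightarrow> \<bar>G s\<bar> \<le> B"
    and rc: "continuous (at_right t) F" "continuous (at_right t) G" and t: "t \<ge> 0"
    and eq: "\<And>l. l > 0 \<Longrightarrow> (LBINT s:{0..}. exp (-(l * s)) * F s) = (LBINT s:{0..}. exp (-(l * s)) * G s)"
  shows "F t = G t"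
proof (rule antisym)
  have B0: "B \<ge> 0" using b(1)[of 0] by simp
  have near: "\<exists>d>0. \<forall>s\<in>{t..t+d}. \<bar>H s - H t\<bar> \<le> e" if H: "continuous (at_right t) H" "e > 0" for H and e :: real
  proof -
    obtain c where c: "c > t" "\<forall>s>t. s < c \<longrightarrow> dist (H s) (H t) < e"
      using H unfolding continuous_within tendsto_iff eventually_at_right_field by blast
    define d where "d = c - t"
    have d: "d > 0" "\<And>s. s > t \<Longrightarrow> s < t + d \<Longrightarrow> dist (H s) (H t) < e"
      using c by (auto simp: d_def)
    have "\<bar>H s - H t\<bar> \<le> e" if "s \<in> {t..t+d/2}" for s
      using d(2)[of s] that d(1) \<open>e > 0\<close> by (cases "s = t") (auto simp: dist_real_def)
    thus ?thesis using d(1) by (intro exI[of _ "d/2"]) auto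
  qed
  have main: "\<bar>F t - G t\<bar> \<le> e" if "e > 0" for e
  proof -
    have e4: "e/4 > 0" using that by simp
    obtain d1 d2 where d1: "d1 > 0" "\<forall>s\<in>{t..t+d1}. \<bar>F s - F t\<bar> \<le> e/4"
       and d2: "d2 > 0" "\<forall>s\<in>{t..t+d2}. \<bar>G s - G t\<bar> \<le> e/4"
      using near[OF rc(1) e4] near[OF rc(2) e4] by blast
    have d: "min d1 d2 > 0" using d1 d2 by simp
    obtain c N where c: "\<And>F. F\<in>borel_measurable borel \<Longrightarrow> (\<forall>s\<ge>0. \<bar>F s\<bar> \<le> B) \<Longrightarrow> (\<forall>s\<in>{t..t+min d1 d2}. \<bar>F s - F t\<bar> \<le> e/4) \<Longrightarrow>
     \<bar>F t - (\<Sum>i\<le>(N::nat). c i * (LBINT s:{0..}. exp (-(real (Suc i) * s)) * F s))\<bar> \<le> 2 * (e/4)"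
      using laplace_inversion[OF t d e4 B0] by blast
    have e: "(LBINT s:{0..}. exp (-(real (Suc i) * s)) * F s) = (LBINT s:{0..}. exp (-(real (Suc i) * s)) * G s)" for i
      by (rule eq) simp
    have "\<bar>F t - (\<Sum>i\<le>(N::nat). c i * (LBINT s:{0..}. exp (-(real (Suc i) * s)) * F s))\<bar> \<le> 2 * (e/4)"
      by (rule c) (use m b d1 in auto)
    moreover have "\<bar>G t - (\<Sum>i\<le>(N::nat). c i * (LBINT s:{0..}. exp (-(real (Suc i) * s)) * F s))\<bar> \<le> 2 * (e/4)"
      unfolding e by (rule c) (use m b d2 in auto)
    ultimately show ?thesis by linarith
  qed
  show "F t \<le> G t"
  proof (rule field_le_epsilon)
    show "F t \<le> G t + e" if "e > 0" for e using main[OF that] by linarith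
  qed
  show "G t \<le> F t"
  proof (rule field_le_epsilon)
    show "G t \<le> F t + e" if "e > 0" for e using main[OF that] by linarith
  qed
qed

section \<open>The Sonine pair\<close>

lemma completely_monotoneD:
  assumes "completely_monotone m"
  shows cm_nonneg: "x > 0 \<Longrightarrow> 0 \<le> m x"
    and cm_continuous: "continuous_on {0<..} m"
    and cm_antimono: "0 < x \<Longrightarrow> x \<le> y \<Longrightarrow> m y \<le> m x"
proof -
  have d: "m field_differentiable (at x)" "0 \<le> m x" if "x > 0" for x
    using assms[unfolded completely_monotone_def, rule_format, of x 0] that by auto
  have d1: "deriv m x \<le> 0" if "x > 0" for x
    using assms[unfolded completely_monotone_def, rule_format, of x 1] that by auto
  show "x > 0 \<Longrightarrow> 0 \<le> m x" by (rule d)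
  show "continuous_on {0<..} m"
    by (auto intro!: continuous_at_imp_continuous_on field_differentiable_imp_continuous_at d)
  show "m y \<le> m x" if "0 < x" "x \<le> y"
  proof (rule DERIV_nonpos_imp_nonincreasing[OF that(2)])
    fix z assume "x \<le> z" "z \<le> y"
    hence "z > 0" using that by simp
    thus "\<exists>y. (m has_real_derivative y) (at z) \<and> y \<le> 0"
      using d(1)[of z] d1[of z] field_differentiable_derivI by blast
  qed
qed

lemma laplace_conv:
  fixes a b :: "real \<Rightarrow> ennreal"
  assumes [measurable]: "a \<in> borel_measurable borel" "b \<in> borel_measurable borel"
  shows "(\<integral>\<^sup>+x. eexp l x * (\<integral>\<^sup>+s. a (x - s) * b s \<partial>lborel) \<partial>lborel) =
     (\<integral>\<^sup>+x. eexp l x * a x \<partial>lborel) * (\<integral>\<^sup>+x. eexp l x * b x \<partial>lborel)"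
proof -
  have "(\<integral>\<^sup>+x. eexp l x * (\<integral>\<^sup>+s. a (x - s) * b s \<partial>lborel) \<partial>lborel)
    = (\<integral>\<^sup>+x. (\<integral>\<^sup>+s. eexp l x * (a (x - s) * b s) \<partial>lborel) \<partial>lborel)"
    by (intro nn_integral_cong) (simp add: nn_integral_cmult)
  also have "\<dots> = (\<integral>\<^sup>+s. (\<integral>\<^sup>+x. eexp l x * (a (x - s) * b s) \<partial>lborel) \<partial>lborel)"
    by (rule lborel_pair.Fubini') simp
  also have "\<dots> = (\<integral>\<^sup>+s. (\<integral>\<^sup>+x. eexp l x * a x \<partial>lborel) * (eexp l s * b s) \<partial>lborel)"
  proof (rule nn_integral_cong)
    fix s :: real
    have "(\<integral>\<^sup>+x. eexp l x * (a (x - s) * b s) \<partial>lborel) =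
      (\<integral>\<^sup>+x. ennreal (exp (-(l * (s + x)))) * (a x * b s) \<partial>lborel)"
      using nn_integral_real_affine[of "\<lambda>x. eexp l x * (a (x - s) * b s)" 1 s] by simp
    also have "\<dots> = (\<integral>\<^sup>+x. (eexp l x * a x) * (eexp l s * b s) \<partial>lborel)"
    proof (rule nn_integral_cong)
      fix x
      have "exp (-(l * (s + x))) = exp (-(l * x)) * exp (-(l * s))"
        by (simp add: exp_add[symmetric] algebra_simps)
      thus "ennreal (exp (-(l * (s + x)))) * (a x * b s) = (eexp l x * a x) * (eexp l s * b s)"
        by (simp only: ennreal_mult exp_ge_zero) (simp add: mult_ac)
    qed
    also have "\<dots> = (\<integral>\<^sup>+x. eexp l x * a x \<partial>lborel) * (eexp l s * b s)"
      by (rule nn_integral_multc) simp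
    finally show "(\<integral>\<^sup>+x. eexp l x * (a (x - s) * b s) \<partial>lborel) = \<dots>" .
  qed
  also have "\<dots> = (\<integral>\<^sup>+x. eexp l x * a x \<partial>lborel) * (\<integral>\<^sup>+x. eexp l x * b x \<partial>lborel)"
    by (rule nn_integral_cmult) simp
  finally show ?thesis .
qed

lemma nn_integral_exp_Ioi:
  assumes "l > (0::real)"
  shows "(\<integral>\<^sup>+x. eexp l x * indicator {0<..} x \<partial>lborel) = ennreal (1 / l)"
proof -
  have "(\<integral>\<^sup>+x. eexp l x * indicator {0<..} x \<partial>lborel) =
     (\<integral>\<^sup>+x. ennreal (indicator {0..} x * exp (-(l * x))) \<partial>lborel)"
    by (rule nn_integral_cong_AE, rule AE_mp[OF AE_lborel_singleton[of 0]]) (auto simp: indicator_def)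
  also have "\<dots> = ennreal (\<integral>x. indicator {0..} x * exp (-(l * x)) \<partial>lborel)"
    using integrable_exp_half(1)[OF assms] unfolding set_integrable_def by (intro nn_integral_eq_integral) auto
  finally show ?thesis using integrable_exp_half(2)[OF assms] by (simp add: set_lebesgue_integral_def)
qed

section \<open>The Levy measure, its tail and the potential density\<close>

locale bernstein_pair =
  fixes f k :: "real \<Rightarrow> real" and \<mu> :: "real measure"
  assumes cb: "complete_bernstein f \<mu>"
    and f_0: "filterlim (\<lambda>l. 1 / f l) at_top (at_right 0)"
    and f_inf: "((\<lambda>l. 1 / f l) \<longlongrightarrow> 0) at_top"
    and f_lin: "((\<lambda>l. l / f l) \<longlongrightarrow> 0) (at_right 0)"
    and pd: "potential_density f k"
begin

definition dens :: "real \<Rightarrow> real" where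
  "dens = (SOME m. completely_monotone m \<and> \<mu> = density lborel (\<lambda>x. ennreal (m x) * indicator {0<..} x))"

lemma dens: "completely_monotone dens" "\<mu> = density lborel (\<lambda>x. ennreal (dens x) * indicator {0<..} x)"
proof -
  have "\<exists>m. completely_monotone m \<and> \<mu> = density lborel (\<lambda>x. ennreal (m x) * indicator {0<..} x)"
    using cb unfolding complete_bernstein_def by (elim conjE)
  hence "completely_monotone dens \<and> \<mu> = density lborel (\<lambda>x. ennreal (dens x) * indicator {0<..} x)"
    unfolding dens_def by (rule someI_ex)
  thus "completely_monotone dens" "\<mu> = density lborel (\<lambda>x. ennreal (dens x) * indicator {0<..} x)" by auto
qed

lemma k_cm: "completely_monotone k"
  using pd by (simp add: potential_density_def)

lemmas k_nonneg = cm_nonneg[OF k_cm] and k_cont = cm_continuous[OF k_cm] and k_antimono = cm_antimono[OF k_cm]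

lemma dens_measurable[measurable]: "(\<lambda>x. ennreal (dens x) * indicator {0<..} x) \<in> borel_measurable borel"
proof -
  have "(\<lambda>x. indicator {0<..} x *\<^sub>R dens x) \<in> borel_measurable borel"
    by (rule borel_measurable_continuous_on_indicator) (use cm_continuous[OF dens(1)] in auto)
  hence "(\<lambda>x. ennreal (indicator {0<..} x *\<^sub>R dens x)) \<in> borel_measurable borel" by measurable
  also have "(\<lambda>x. ennreal (indicator {0<..} x *\<^sub>R dens x)) = (\<lambda>x. ennreal (dens x) * indicator {0<..} x)"
    by (auto simp: indicator_def)
  finally show ?thesis .
qed

lemma sets_mu[measurable_cong, simp]: "sets \<mu> = sets borel" and space_mu[simp]: "space \<mu> = UNIV"
  using dens(2) by (metis sets_density sets_lborel, metis space_density space_lborel space_borel)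

lemma dens_measurable_lborel: "(\<lambda>x. ennreal (dens x) * indicator {0<..} x) \<in> borel_measurable lborel"
  unfolding measurable_lborel2 by (rule dens_measurable)

lemma sf_mu: "sigma_finite_measure \<mu>"
proof -
  have "AE x in lborel. ennreal (dens x) * indicator {0<..} x \<noteq> \<infinity>"
    by (auto simp: indicator_def ennreal_mult_eq_top_iff)
  hence "sigma_finite_measure (density lborel (\<lambda>x. ennreal (dens x) * indicator {0<..} x))"
    using sigma_finite_measure.sigma_finite_iff_density_finite[OF sigma_finite_lborel dens_measurable_lborel] by blast
  thus ?thesis by (simp only: dens(2)[symmetric])
qed

lemma mu_pos: "AE x in \<mu>. x > 0"
proof -
  have "AE x in density lborel (\<lambda>x. ennreal (dens x) * indicator {0<..} x). x > 0"
    unfolding AE_density[OF dens_measurable_lborel] by (rule AE_I2) (auto simp: indicator_def)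
  thus ?thesis by (simp only: dens(2)[symmetric])
qed

lemma mu_min: "integrable \<mu> (\<lambda>x. min 1 x)"
  using cb by (simp add: complete_bernstein_def)

lemma f_eq: "l > 0 \<Longrightarrow> f l = (\<integral>x. (1 - exp (- l * x)) \<partial>\<mu>)"
  using cb by (simp add: complete_bernstein_def)

lemma mu_fin: "s > 0 \<Longrightarrow> emeasure \<mu> {s<..} < \<infinity>"
proof -
  assume s: "s > 0"
  have "ennreal (min 1 s) * emeasure \<mu> {s<..} = (\<integral>\<^sup>+x. ennreal (min 1 s) * indicator {s<..} x \<partial>\<mu>)"
    by (simp add: nn_integral_cmult)
  also have "\<dots> \<le> (\<integral>\<^sup>+x. ennreal (norm (min 1 x)) \<partial>\<mu>)"
    using s by (intro nn_integral_mono) (auto simp: indicator_def ennreal_leI)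
  also have "\<dots> < \<infinity>" using mu_min unfolding integrable_iff_bounded by simp
  finally show ?thesis using s by (auto simp: ennreal_mult_less_top)
qed

lemma tail_emeasure: "s > 0 \<Longrightarrow> emeasure \<mu> {s<..} = ennreal (tail \<mu> s)"
  unfolding tail_def using mu_fin[of s] by (simp add: emeasure_eq_ennreal_measure less_top)

lemma tail_nonneg: "tail \<mu> s \<ge> 0" by (simp add: tail_def)

lemma tail_antimono: "0 < x \<Longrightarrow> x \<le> y \<Longrightarrow> tail \<mu> y \<le> tail \<mu> x"
  unfolding tail_def using mu_fin[of x] by (intro measure_mono_fmeasurable) (auto simp: fmeasurable_def)

lemma tail_diff: "0 < x \<Longrightarrow> x \<le> y \<Longrightarrow> ennreal (tail \<mu> x - tail \<mu> y) = emeasure \<mu> {x<..y}"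
proof -
  assume xy: "0 < x" "x \<le> y"
  have "{x<..} = {x<..y} \<union> {y<..}" using xy by auto
  hence "emeasure \<mu> {x<..} = emeasure \<mu> ({x<..y} \<union> {y<..})" by (rule arg_cong)
  also have "\<dots> = emeasure \<mu> {x<..y} + emeasure \<mu> {y<..}" by (rule plus_emeasure[symmetric]) auto
  finally have "emeasure \<mu> {x<..} = emeasure \<mu> {x<..y} + emeasure \<mu> {y<..}" .
  hence *: "ennreal (tail \<mu> x) = emeasure \<mu> {x<..y} + ennreal (tail \<mu> y)"
    using xy tail_emeasure by simp
  have "ennreal (tail \<mu> x - tail \<mu> y) = ennreal (tail \<mu> x) - ennreal (tail \<mu> y)"
    by (simp add: ennreal_minus tail_nonneg)
  thus ?thesis unfolding * by simp
qed

text \<open>The density decreases, so its value at the left end bounds the integral. This is the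
  local Lipschitz estimate behind the continuity of the tail.\<close>

lemma tail_lipschitz: "0 < x \<Longrightarrow> x \<le> y \<Longrightarrow> tail \<mu> x - tail \<mu> y \<le> (y - x) * dens x"
proof -
  assume xy: "0 < x" "x \<le> y"
  have "ennreal (tail \<mu> x - tail \<mu> y) = (\<integral>\<^sup>+z. ennreal (dens z) * indicator {0<..} z * indicator {x<..y} z \<partial>lborel)"
    unfolding tail_diff[OF xy] by (subst dens(2), subst emeasure_density) auto
  also have "\<dots> \<le> (\<integral>\<^sup>+z. ennreal (dens x) * indicator {x<..y} z \<partial>lborel)"
    using xy cm_antimono[OF dens(1)] by (intro nn_integral_mono) (auto simp: indicator_def intro!: ennreal_leI)
  also have "\<dots> = ennreal ((y - x) * dens x)"
    using xy cm_nonneg[OF dens(1)] by (simp add: nn_integral_cmult ennreal_mult mult.commute)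
  finally show ?thesis using xy cm_nonneg[OF dens(1), of x] by (simp add: ennreal_le_iff)
qed

lemma tail_cont: "continuous_on {0<..} (tail \<mu>)"
proof (rule continuous_at_imp_continuous_on, rule ballI)
  fix x :: real assume "x \<in> {0<..}"
  hence x: "x > 0" by simp
  show "isCont (tail \<mu>) x"
    unfolding isCont_def
  proof -
    have "((\<lambda>y. tail \<mu> y - tail \<mu> x) \<longlongrightarrow> 0) (at x)"
    proof (rule Lim_null_comparison)
      have "\<forall>\<^sub>F y in at x. y > x / 2"
        using x by (intro order_tendstoD(1)[OF tendsto_ident_at]) auto
      thus "\<forall>\<^sub>F y in at x. norm (tail \<mu> y - tail \<mu> x) \<le> \<bar>y - x\<bar> * dens (x/2)"
      proof eventually_elim
        case (elim y)
        show ?case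
        proof (cases "y \<le> x")
          case True
          have "tail \<mu> y - tail \<mu> x \<le> (x - y) * dens y" using tail_lipschitz[of y x] elim True x by simp
          also have "\<dots> \<le> (x - y) * dens (x/2)" using True elim x cm_antimono[OF dens(1), of "x/2" y]
            by (intro mult_left_mono) auto
          finally show ?thesis using tail_antimono[of y x] True elim x by simp
        next
          case False
          have "tail \<mu> x - tail \<mu> y \<le> (y - x) * dens x" using tail_lipschitz[of x y] elim False x by simp
          also have "\<dots> \<le> (y - x) * dens (x/2)" using False elim x cm_antimono[OF dens(1), of "x/2" x]
            by (intro mult_left_mono) auto
          finally show ?thesis using tail_antimono[of x y] False elim x by simp
        qed
      qed
      have "((\<lambda>y. \<bar>y - x\<bar> * dens (x/2)) \<longlongrightarrow> \<bar>x - x\<bar> * dens (x/2)) (at x)" by (intro tendsto_intros)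
      thus "((\<lambda>y. \<bar>y - x\<bar> * dens (x/2)) \<longlongrightarrow> 0) (at x)" by simp
    qed
    thus "tail \<mu> \<midarrow>x\<rightarrow> tail \<mu> x" by (simp add: LIM_zero_iff)
  qed
qed

definition tail_nn :: "real \<Rightarrow> ennreal" where "tail_nn x = ennreal (tail \<mu> x) * indicator {0<..} x"
definition k_nn :: "real \<Rightarrow> ennreal" where "k_nn x = ennreal (k x) * indicator {0<..} x"

lemma cont_ind_measurable:
  fixes g :: "real \<Rightarrow> real"
  assumes "continuous_on {0<..} g"
  shows "(\<lambda>x. ennreal (g x) * indicator {0<..} x) \<in> borel_measurable borel"
proof -
  have "(\<lambda>x. indicator {0<..} x *\<^sub>R g x) \<in> borel_measurable borel"
    by (rule borel_measurable_continuous_on_indicator) (use assms in auto)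
  hence "(\<lambda>x. ennreal (indicator {0<..} x *\<^sub>R g x)) \<in> borel_measurable borel" by measurable
  also have "(\<lambda>x. ennreal (indicator {0<..} x *\<^sub>R g x)) = (\<lambda>x. ennreal (g x) * indicator {0<..} x)"
    by (auto simp: indicator_def)
  finally show ?thesis .
qed

lemma tail_nn_measurable[measurable]: "tail_nn \<in> borel_measurable borel"
  unfolding tail_nn_def by (rule cont_ind_measurable[OF tail_cont])

lemma k_nn_measurable[measurable]: "k_nn \<in> borel_measurable borel"
  unfolding k_nn_def by (rule cont_ind_measurable[OF k_cont])

lemma f_nn: "l > 0 \<Longrightarrow> (\<integral>\<^sup>+x. ennreal (1 - exp (-(l * x))) \<partial>\<mu>) = ennreal (f l)" and f_nonneg: "l > 0 \<Longrightarrow> f l \<ge> 0"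
  and f_integrable: "l > 0 \<Longrightarrow> integrable \<mu> (\<lambda>x. 1 - exp (-(l * x)))"
proof -
  assume l: "l > 0"
  \<comment> \<open>Compares the integrand of \<open>f\<close> with the function min(1,x) whose
    integrability is the standing assumption on \<mu>: the bound 1 serves large x, the bound l x
    small x.\<close>
  have bound: "1 - exp (-(l * x)) \<le> max 1 l * min 1 x" if "x > 0" for x
  proof (cases "x \<ge> 1")
    case True
    have "1 - exp (-(l * x)) \<le> 1 * 1" by simp
    also have "1 * 1 \<le> max 1 l * min 1 x" using True by (intro mult_mono) auto
    finally show ?thesis .
  next
    case False
    have "1 - exp (-(l * x)) \<le> l * x" using exp_ge_add_one_self[of "-(l*x)"] by linarith
    also have "\<dots> \<le> max 1 l * min 1 x" using False that by (intro mult_mono) auto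
    finally show ?thesis .
  qed
  show i: "integrable \<mu> (\<lambda>x. 1 - exp (-(l * x)))"
  proof (rule Bochner_Integration.integrable_bound[OF integrable_mult_right[OF mu_min, of "max 1 l"]])
    show "AE x in \<mu>. norm (1 - exp (-(l * x))) \<le> norm (max 1 l * min 1 x)"
      using mu_pos
    proof eventually_elim
      case (elim x)
      have "1 - exp (-(l * x)) \<ge> 0" using l elim by simp
      thus ?case using bound[OF elim] by simp
    qed
  qed measurable
  have pos: "AE x in \<mu>. 0 \<le> 1 - exp (-(l * x))" using mu_pos by eventually_elim (use l in simp)
  show "f l \<ge> 0" unfolding f_eq[OF l] using pos by (intro integral_nonneg_AE) simp
  show "(\<integral>\<^sup>+x. ennreal (1 - exp (-(l * x))) \<partial>\<mu>) = ennreal (f l)"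
    unfolding f_eq[OF l] using nn_integral_eq_integral[OF i pos] by simp
qed

text \<open>A single zero of \<open>f\<close> forces \<open>1 - exp (-(l * x))\<close> to vanish
  \<mu>-almost everywhere, hence \<mu> to be null and \<open>f\<close> to vanish identically. Then
  \<open>1 / f l\<close> is 0 by the convention for division by zero and cannot tend to
  infinity.\<close>

lemma f_pos: "l > 0 \<Longrightarrow> f l > 0"
proof (rule ccontr)
  assume l: "l > 0" and "\<not> f l > 0"
  hence "f l = 0" using f_nonneg[OF l] by simp
  hence "(\<integral>\<^sup>+x. ennreal (1 - exp (-(l * x))) \<partial>\<mu>) = 0" using f_nn[OF l] by simp
  hence "AE x in \<mu>. ennreal (1 - exp (-(l * x))) = 0" by (simp add: nn_integral_0_iff_AE)
  hence "AE x in \<mu>. False" using mu_pos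
  proof eventually_elim
    case (elim x)
    have "exp (-(l * x)) < 1" using l elim by simp
    thus ?case using elim(1) by (simp add: ennreal_eq_0_iff)
  qed
  hence z: "AE x in \<mu>. 1 - exp (-(l' * x)) = 0" for l' by eventually_elim simp
  have f0: "f l' = 0" if "l' > 0" for l'
    unfolding f_eq[OF that] using integral_cong_AE[OF _ _ z[of l']] by simp
  have "\<forall>\<^sub>F l in at_right 0. 1 \<le> 1 / f l" using f_0 unfolding filterlim_at_top by blast
  moreover have "\<forall>\<^sub>F l in at_right (0::real). l > 0" by (rule eventually_at_right_less)
  ultimately have "\<forall>\<^sub>F l in at_right (0::real). False"
    by eventually_elim (simp add: f0)
  thus False by simp
qed

lemma tail_laplace: "l > 0 \<Longrightarrow> (\<integral>\<^sup>+x. eexp l x * tail_nn x \<partial>lborel) = ennreal (f l / l)"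
proof -
  assume l: "l > 0"
  interpret mu: sigma_finite_measure \<mu> by (rule sf_mu)
  interpret pair_sigma_finite \<mu> lborel ..
  have "(\<integral>\<^sup>+x. eexp l x * tail_nn x \<partial>lborel) =
    (\<integral>\<^sup>+x. (\<integral>\<^sup>+y. eexp l x * indicator {0<..} x * (if x < y then 1 else 0) \<partial>\<mu>) \<partial>lborel)"
  proof (rule nn_integral_cong)
    fix x :: real
    have "tail_nn x = (\<integral>\<^sup>+y. (if x < y then 1 else 0) \<partial>\<mu>)" if "x > 0"
    proof -
      have "(\<integral>\<^sup>+y. (if x < y then 1 else 0) \<partial>\<mu>) = (\<integral>\<^sup>+y. indicator {x<..} y \<partial>\<mu>)"
        by (intro nn_integral_cong) (auto simp: indicator_def)
      thus ?thesis using that by (simp add: tail_nn_def tail_emeasure)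
    qed
    thus "eexp l x * tail_nn x = (\<integral>\<^sup>+y. eexp l x * indicator {0<..} x * (if x < y then 1 else 0) \<partial>\<mu>)"
      by (cases "x > 0") (simp_all add: nn_integral_cmult tail_nn_def)
  qed
  also have "\<dots> = (\<integral>\<^sup>+y. (\<integral>\<^sup>+x. eexp l x * indicator {0<..} x * (if x < y then 1 else 0) \<partial>lborel) \<partial>\<mu>)"
    by (rule Fubini') measurable
  also have "\<dots> = (\<integral>\<^sup>+y. ennreal (1 - exp (-(l * y))) * ennreal (1/l) \<partial>\<mu>)"
  proof (rule nn_integral_cong_AE)
    show "AE y in \<mu>. (\<integral>\<^sup>+x. eexp l x * indicator {0<..} x * (if x < y then 1 else 0) \<partial>lborel) = ennreal (1 - exp (-(l * y))) * ennreal (1/l)"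
      using mu_pos
    proof eventually_elim
      case (elim y)
      have "(\<integral>\<^sup>+x. eexp l x * indicator {0<..} x * (if x < y then 1 else 0) \<partial>lborel) =
        (\<integral>\<^sup>+x. eexp l x * indicator {0..y} x \<partial>lborel)"
        by (rule nn_integral_cong_AE, rule AE_mp[OF AE_lborel_singleton[of 0]], rule AE_mp[OF AE_lborel_singleton[of y]])
           (auto simp: indicator_def)
      also have "\<dots> = ennreal (- exp (-(l * y)) / l - (- exp (-(l * 0)) / l))"
        using l elim by (intro nn_integral_FTC_Icc[where F="\<lambda>x. - exp (-(l * x)) / l"]) (auto intro!: derivative_eq_intros)
      also have "- exp (-(l * y)) / l - (- exp (-(l * 0)) / l) = (1 - exp (-(l * y))) * (1/l)"
        by (simp add: diff_divide_distrib)
      also have "ennreal \<dots> = ennreal (1 - exp (-(l * y))) * ennreal (1/l)"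
        using l elim by (intro ennreal_mult) auto
      finally show ?case .
    qed
  qed
  also have "\<dots> = ennreal (f l) * ennreal (1/l)"
    using l by (simp add: nn_integral_multc f_nn)
  also have "\<dots> = ennreal (f l / l)" using l f_nonneg[OF l] by (simp add: ennreal_mult[symmetric])
  finally show ?thesis .
qed

lemma k_laplace: "l > 0 \<Longrightarrow> (\<integral>\<^sup>+x. eexp l x * k_nn x \<partial>lborel) = ennreal (1 / f l)"
proof -
  assume l: "l > 0"
  have i: "set_integrable lborel {0<..} (\<lambda>x. exp (- l * x) * k x)" and e: "(LBINT x:{0<..}. exp (- l * x) * k x) = 1 / f l"
    using pd l unfolding potential_density_def by auto
  have "(\<integral>\<^sup>+x. eexp l x * k_nn x \<partial>lborel) = (\<integral>\<^sup>+x. ennreal (indicator {0<..} x *\<^sub>R (exp (- l * x) * k x)) \<partial>lborel)"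
    by (intro nn_integral_cong) (auto simp: k_nn_def indicator_def ennreal_mult k_nonneg)
  also have "\<dots> = ennreal (1 / f l)"
    unfolding e[symmetric] set_lebesgue_integral_def using i unfolding set_integrable_def
    by (intro nn_integral_eq_integral) (auto simp: indicator_def k_nonneg)
  finally show ?thesis .
qed

text \<open>The transforms f(l)/l and 1/f(l) multiply to 1/l, the transform of the indicator of the
  half-line. Uniqueness of densities gives the identity almost everywhere; its uses are under an
  integral or followed by a continuity argument.\<close>

lemma sonine_AE: "AE x in lborel. (\<integral>\<^sup>+s. tail_nn (x - s) * k_nn s \<partial>lborel) = indicator {0<..} x"
proof -
  have [measurable]: "(\<lambda>x. \<integral>\<^sup>+s. tail_nn (x - s) * k_nn s \<partial>lborel) \<in> borel_measurable borel" by measurable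
  have eq: "density lborel (\<lambda>x. \<integral>\<^sup>+s. tail_nn (x - s) * k_nn s \<partial>lborel) = density lborel (indicator {0<..})"
  proof (rule laplace_unique_measure)
    have z: "(\<integral>\<^sup>+s. tail_nn (x - s) * k_nn s \<partial>lborel) = 0" if "x \<le> 0" for x
    proof -
      have "(\<lambda>s. tail_nn (x - s) * k_nn s) = (\<lambda>_. 0)" using that by (auto simp: tail_nn_def k_nn_def indicator_def)
      thus ?thesis by simp
    qed
    show "AE x in density lborel (\<lambda>x. \<integral>\<^sup>+s. tail_nn (x - s) * k_nn s \<partial>lborel). 0 \<le> x"
    proof (subst AE_density)
      show "AE x in lborel. 0 < (\<integral>\<^sup>+s. tail_nn (x - s) * k_nn s \<partial>lborel) \<longrightarrow> 0 \<le> x"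
        by (rule AE_I2) (metis z less_irrefl linorder_le_cases)
    qed measurable
    show "AE x in density lborel (indicator {0<..} :: real \<Rightarrow> ennreal). 0 \<le> x"
      by (subst AE_density) (auto simp: indicator_def)
    have R: "(\<integral>\<^sup>+x. eexp l x \<partial>density lborel (indicator {0<..})) = ennreal (1/l)" if "l > 0" for l
      using nn_integral_exp_Ioi[OF that] by (subst nn_integral_density) (auto simp: mult.commute)
    have L: "(\<integral>\<^sup>+x. eexp l x \<partial>density lborel (\<lambda>x. \<integral>\<^sup>+s. tail_nn (x - s) * k_nn s \<partial>lborel)) = ennreal (1/l)" if "l > 0" for l
    proof -
      have "(\<integral>\<^sup>+x. eexp l x \<partial>density lborel (\<lambda>x. \<integral>\<^sup>+s. tail_nn (x - s) * k_nn s \<partial>lborel)) =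
         (\<integral>\<^sup>+x. eexp l x * (\<integral>\<^sup>+s. tail_nn (x - s) * k_nn s \<partial>lborel) \<partial>lborel)"
        by (subst nn_integral_density) (auto simp: mult.commute)
      also have "\<dots> = ennreal (f l / l) * ennreal (1 / f l)"
        using that by (simp add: laplace_conv tail_laplace k_laplace)
      also have "\<dots> = ennreal (1 / l)" using f_pos[OF that] that by (simp add: ennreal_mult[symmetric])
      finally show ?thesis .
    qed
    show "(\<integral>\<^sup>+x. eexp l x \<partial>density lborel (\<lambda>x. \<integral>\<^sup>+s. tail_nn (x - s) * k_nn s \<partial>lborel)) < \<infinity>" if "l > 0" for l
      using L[OF that] by simp
    show "(\<integral>\<^sup>+x. eexp l x \<partial>density lborel (\<lambda>x. \<integral>\<^sup>+s. tail_nn (x - s) * k_nn s \<partial>lborel))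
      = (\<integral>\<^sup>+x. eexp l x \<partial>density lborel (indicator {0<..}))" if "l > 0" for l
      using L[OF that] R[OF that] by simp
  qed auto
  show ?thesis
    using eq sigma_finite_measure.density_unique_iff[OF sigma_finite_lborel,
      of "\<lambda>x. \<integral>\<^sup>+s. tail_nn (x - s) * k_nn s \<partial>lborel" "indicator {0<..}"] by simp
qed

end

section \<open>Convolution with the potential density\<close>

lemma conv_cong: "(\<And>s. 0 < s \<Longrightarrow> s < x \<Longrightarrow> \<phi> s = \<psi> s) \<Longrightarrow> conv a \<phi> x = conv a \<psi> x"
  unfolding conv_def by (intro set_lebesgue_integral_cong) auto

context bernstein_pair
begin

text \<open>This primitive measures everything about k * h for bounded h: up to constants it bounds
  the modulus of continuity and the decay at 0. It is also the weight in which the censored integral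
  is a geometric series.\<close>

definition kap :: "real \<Rightarrow> real" where "kap x = (LBINT s:{0<..<x}. k s)"

definition kz :: "real \<Rightarrow> real" where "kz x = indicator {0<..} x * k x"

lemma kz_measurable[measurable]: "kz \<in> borel_measurable borel"
proof -
  have "(\<lambda>x. indicator {0<..} x *\<^sub>R k x) \<in> borel_measurable borel"
    by (rule borel_measurable_continuous_on_indicator) (use k_cont in auto)
  thus ?thesis by (simp add: kz_def[abs_def])
qed

lemma kz_nonneg: "kz x \<ge> 0" by (auto simp: kz_def indicator_def k_nonneg)

lemma k_nn_kz: "k_nn x = ennreal (kz x)" by (auto simp: k_nn_def kz_def indicator_def)

lemma kz_eq: "x > 0 \<Longrightarrow> kz x = k x" and kz_0: "x \<le> 0 \<Longrightarrow> kz x = 0" by (auto simp: kz_def)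

text \<open>Local integrability at 0 is read off from the finite Laplace transform at rate 1, since
  exp(|x| - s) is at least 1 for s < x.\<close>

lemma kz_int: "integrable lborel (\<lambda>s. indicator {..<x} s * kz s)"
proof (rule integrableI_bounded)
  have "(\<integral>\<^sup>+s. ennreal (norm (indicator {..<x} s * kz s)) \<partial>lborel) \<le> (\<integral>\<^sup>+s. ennreal (exp \<bar>x\<bar>) * (eexp 1 s * k_nn s) \<partial>lborel)"
  proof (rule nn_integral_mono)
    fix s
    show "ennreal (norm (indicator {..<x} s * kz s)) \<le> ennreal (exp \<bar>x\<bar>) * (eexp 1 s * k_nn s)"
    proof (cases "s < x")
      case True
      have "1 \<le> exp (\<bar>x\<bar> - s)" using True by simp
      hence "1 * kz s \<le> exp (\<bar>x\<bar> - s) * kz s" by (intro mult_right_mono kz_nonneg)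
      also have "exp (\<bar>x\<bar> - s) * kz s = exp \<bar>x\<bar> * (exp (-(1 * s)) * kz s)"
        by (simp add: exp_diff exp_minus field_simps)
      finally have "ennreal (kz s) \<le> ennreal (exp \<bar>x\<bar> * (exp (-(1 * s)) * kz s))" by (intro ennreal_leI) simp
      thus ?thesis using True kz_nonneg[of s] by (simp add: k_nn_kz ennreal_mult abs_of_nonneg)
    qed simp
  qed
  also have "\<dots> = ennreal (exp \<bar>x\<bar>) * ennreal (1 / f 1)"
    using k_laplace[of 1] by (subst nn_integral_cmult) auto
  also have "\<dots> < \<infinity>" by (simp add: ennreal_mult_less_top)
  finally show "(\<integral>\<^sup>+s. ennreal (norm (indicator {..<x} s * kz s)) \<partial>lborel) < \<infinity>" .
qed measurable

lemma kap_eq: "kap x = (\<integral>s. indicator {..<x} s * kz s \<partial>lborel)"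
  unfolding kap_def set_lebesgue_integral_def
  by (intro Bochner_Integration.integral_cong) (auto simp: kz_def indicator_def)

lemma kap_nn: "(\<integral>\<^sup>+s. indicator {..<x} s * k_nn s \<partial>lborel) = ennreal (kap x)"
proof -
  have "(\<integral>\<^sup>+s. indicator {..<x} s * k_nn s \<partial>lborel) = (\<integral>\<^sup>+s. ennreal (indicator {..<x} s * kz s) \<partial>lborel)"
    by (intro nn_integral_cong) (auto simp: k_nn_kz indicator_def)
  also have "\<dots> = ennreal (kap x)" unfolding kap_eq
    by (intro nn_integral_eq_integral kz_int) (auto simp: kz_nonneg)
  finally show ?thesis .
qed

lemma kap_nonneg: "kap x \<ge> 0"
  unfolding kap_eq by (intro integral_nonneg_AE) (auto simp: kz_nonneg)

lemma kap_mono: "x \<le> y \<Longrightarrow> kap x \<le> kap y"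
  unfolding kap_eq by (intro integral_mono kz_int) (auto simp: kz_nonneg indicator_def)

lemma kap_0: "x \<le> 0 \<Longrightarrow> kap x = 0"
proof -
  assume "x \<le> 0"
  hence "(\<lambda>s. indicator {..<x} s * kz s) = (\<lambda>_. 0)" by (auto simp: kz_def indicator_def)
  thus ?thesis unfolding kap_eq by (simp only: lebesgue_integral_const) simp
qed

lemma kap_sub: "(\<integral>s. indicator {0<..<x} s * kz (d + x - s) \<partial>lborel) = kap (d + x) - kap d"
  and kap_sub_int: "integrable lborel (\<lambda>s. indicator {0<..<x} s * kz (d + x - s))" if d: "d \<ge> 0" "x > 0"
proof -
  \<comment> \<open>The reflection s \<mapsto> d + x - s maps the open interval (0,x) to (d,d+x), so
    the point d has to be taken off separately from the difference of the two half-lines.\<close>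
  have *: "(\<lambda>s. indicator {0<..<x} (d + x + (-1) * s) * kz (d + x - (d + x + (-1) * s))) = (\<lambda>s. indicator {..<d+x} s * kz s - indicator {..<d} s * kz s - (indicator {d} s * kz s))"
    using d by (auto simp: indicator_def kz_def fun_eq_iff)
  have z: "integrable lborel (\<lambda>s. indicator {d} s * kz s)" "(\<integral>s. indicator {d} s * kz s \<partial>lborel) = 0"
  proof -
    have ae: "AE s in lborel. indicator {d} s * kz s = 0"
      using AE_lborel_singleton[of d] by eventually_elim auto
    show "integrable lborel (\<lambda>s. indicator {d} s * kz s)"
      by (subst integrable_cong_AE[OF _ _ ae]) auto
    show "(\<integral>s. indicator {d} s * kz s \<partial>lborel) = 0"
      using integral_cong_AE[OF _ _ ae] by simp
  qed
  have "integrable lborel (\<lambda>s. indicator {..<d+x} s * kz s - indicator {..<d} s * kz s - indicator {d} s * kz s)"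
    by (intro Bochner_Integration.integrable_diff kz_int z)
  thus "integrable lborel (\<lambda>s. indicator {0<..<x} s * kz (d + x - s))"
    using lborel_integrable_real_affine_iff[of "-1" "\<lambda>s. indicator {0<..<x} s * kz (d + x - s)" "d + x"] unfolding * by simp
  have "(\<integral>s. indicator {0<..<x} s * kz (d + x - s) \<partial>lborel) = (\<integral>s. indicator {..<d+x} s * kz s - indicator {..<d} s * kz s - indicator {d} s * kz s \<partial>lborel)"
    using lborel_integral_real_affine[of "-1" "\<lambda>s. indicator {0<..<x} s * kz (d + x - s)" "d + x"] unfolding * by simp
  also have "\<dots> = kap (d + x) - kap d"
    using kz_int z by (simp add: kap_eq)
  finally show "(\<integral>s. indicator {0<..<x} s * kz (d + x - s) \<partial>lborel) = kap (d + x) - kap d" .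
qed

text \<open>Since \<open>k\<close> decreases, its integral over (d,d+x) is at most that over (0,x).
  This makes \<open>kap\<close> its own modulus of continuity.\<close>

lemma kap_subadd: "d \<ge> 0 \<Longrightarrow> x \<ge> 0 \<Longrightarrow> kap (d + x) - kap d \<le> kap x"
proof -
  assume "d \<ge> 0" "x \<ge> 0"
  show ?thesis
  proof (cases "x = 0")
    case False
  hence d: "d \<ge> 0" "x > 0" using \<open>d \<ge> 0\<close> \<open>x \<ge> 0\<close> by auto
  have "kap (d + x) - kap d = (\<integral>s. indicator {0<..<x} s * kz (d + x - s) \<partial>lborel)" using kap_sub[OF d] by simp
  also have "\<dots> \<le> (\<integral>s. indicator {0<..<x} s * kz (0 + x - s) \<partial>lborel)"
    by (intro integral_mono kap_sub_int d) (use d in \<open>auto simp: indicator_def kz_eq intro!: k_antimono\<close>)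
  also have "\<dots> = kap x" using kap_sub[of 0 x] d by (simp add: kap_0)
  finally show ?thesis .
  qed (simp add: kap_0)
qed

lemma kap_tendsto_0: "(kap \<longlongrightarrow> 0) (at_right 0)"
proof (rule tendstoI)
  fix e :: real assume e: "e > 0"
  have "(\<lambda>n. kap (1 / real (Suc n))) \<longlonglongrightarrow> (\<integral>s. 0 \<partial>(lborel :: real measure))"
    unfolding kap_eq
  proof (rule integral_dominated_convergence[where w="\<lambda>s. indicator {..<2} s * kz s"])
    show "AE s in lborel. (\<lambda>n. indicator {..<1 / real (Suc n)} s * kz s) \<longlonglongrightarrow> 0"
    proof (rule AE_I2)
      fix s :: real
      show "(\<lambda>n. indicator {..<1 / real (Suc n)} s * kz s) \<longlonglongrightarrow> 0"
      proof (cases "s > 0")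
        case True
        have "(\<lambda>n. 1 / real (Suc n)) \<longlonglongrightarrow> 0" by (rule LIMSEQ_Suc[OF lim_1_over_n])
        hence "\<forall>\<^sub>F n in sequentially. 1 / real (Suc n) < s" using True by (rule order_tendstoD)
        hence "\<forall>\<^sub>F n in sequentially. indicator {..<1 / real (Suc n)} s * kz s = 0"
          by eventually_elim auto
        thus ?thesis by (rule tendsto_eventually)
      next
        case False
        thus ?thesis by (simp add: kz_0)
      qed
    qed
    show "AE s in lborel. norm (indicator {..<1 / real (Suc n)} s * kz s) \<le> indicator {..<2} s * kz s" for n
    proof (rule AE_I2)
      fix s :: real
      have "1 / real (Suc n) \<le> 1" by simp
      hence "s < 1 / real (Suc n) \<Longrightarrow> s < 2" by linarith
      thus "norm (indicator {..<1 / real (Suc n)} s * kz s) \<le> indicator {..<2} s * kz s"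
        using kz_nonneg[of s] by (auto simp: indicator_def simp del: of_nat_Suc)
    qed
  qed (auto intro: kz_int)
  hence "(\<lambda>n. kap (1 / real (Suc n))) \<longlonglongrightarrow> 0" by simp
  hence "\<forall>\<^sub>F n in sequentially. kap (1 / real (Suc n)) < e" using e by (rule order_tendstoD)
  then obtain n where n: "kap (1 / real (Suc n)) < e" by (auto simp: eventually_sequentially)
  have "\<forall>\<^sub>F x in at_right 0. x < 1 / real (Suc n)"
    by (rule eventually_at_right_real[THEN eventually_mono]) auto
  thus "\<forall>\<^sub>F x in at_right 0. dist (kap x) 0 < e"
  proof eventually_elim
    case (elim x)
    have "kap x \<le> kap (1 / real (Suc n))" by (rule kap_mono) (use elim in simp)
    thus ?case using n kap_nonneg[of x] by (simp add: dist_real_def)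
  qed
qed

lemma kap_near: assumes "e > 0" obtains d where "d > 0" "\<And>x. x \<le> d \<Longrightarrow> kap x < e"
proof -
  have "\<forall>\<^sub>F x in at_right 0. kap x < e" using kap_tendsto_0 assms by (rule order_tendstoD)
  then obtain b where b: "b > 0" "\<forall>y>0. y < b \<longrightarrow> kap y < e" unfolding eventually_at_right_field by blast
  show ?thesis
  proof (rule that[of "b/2"])
    show "kap x < e" if "x \<le> b/2" for x using b that assms by (cases "x > 0") (auto simp: kap_0)
  qed (use b in auto)
qed

lemma kap_diff: "\<bar>kap y - kap x\<bar> \<le> kap \<bar>y - x\<bar>" if "x \<ge> 0" "y \<ge> 0"
proof (cases "x \<le> y")
  case True thus ?thesis using kap_subadd[of x "y - x"] kap_mono[of x y] that by simp
next
  case False thus ?thesis using kap_subadd[of y "x - y"] kap_mono[of y x] that by simp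
qed

lemma modulus_cont:
  fixes g :: "real \<Rightarrow> real"
  assumes "\<And>x y. x \<in> A \<Longrightarrow> y \<in> A \<Longrightarrow> \<bar>g y - g x\<bar> \<le> C * kap \<bar>y - x\<bar>"
  shows "continuous_on A g"
  unfolding continuous_on_iff
proof (intro ballI allI impI)
  fix x e assume x: "x \<in> A" and e: "(e::real) > 0"
  have "e / (\<bar>C\<bar> + 1) > 0" using e by simp
  then obtain d where d: "d > 0" "\<And>x. x \<le> d \<Longrightarrow> kap x < e / (\<bar>C\<bar> + 1)" using kap_near by blast
  have "dist (g y) (g x) < e" if "y \<in> A" "dist y x < d" for y
  proof -
    have "\<bar>g y - g x\<bar> \<le> C * kap \<bar>y - x\<bar>" using assms x that by blast
    also have "\<dots> \<le> (\<bar>C\<bar> + 1) * kap \<bar>y - x\<bar>" by (intro mult_right_mono kap_nonneg) simp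
    also have "\<dots> < (\<bar>C\<bar> + 1) * (e / (\<bar>C\<bar> + 1))"
      by (intro mult_strict_left_mono d) (use that in \<open>auto simp: dist_real_def\<close>)
    also have "\<dots> = e" by simp
    finally show ?thesis by (simp add: dist_real_def)
  qed
  thus "\<exists>d>0. \<forall>x'\<in>A. dist x' x < d \<longrightarrow> dist (g x') (g x) < e" using d(1) by blast
qed

lemma kap_cont: "continuous_on {0..} kap"
  by (rule modulus_cont[where C=1]) (use kap_diff in auto)

lemma conv_eq: "conv k h x = (\<integral>s. kz (x - s) * (indicator {0<..} s * h s) \<partial>lborel)"
  unfolding conv_def set_lebesgue_integral_def
  by (intro Bochner_Integration.integral_cong) (auto simp: kz_def indicator_def)

lemma conv_integrable:
  assumes [measurable]: "h \<in> borel_measurable borel" and b: "\<And>s. 0 < s \<Longrightarrow> s < x \<Longrightarrow> \<bar>h s\<bar> \<le> C"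
  shows "integrable lborel (\<lambda>s. kz (x - s) * (indicator {0<..} s * h s))"
proof (cases "x > 0")
  case True
  have "C \<ge> 0" using b[of "x/2"] True by simp
  have i: "integrable lborel (\<lambda>s. C * (indicator {0<..<x} s * kz (0 + x - s)))"
    using True by (intro integrable_mult_right kap_sub_int) auto
  show ?thesis
  proof (rule Bochner_Integration.integrable_bound[OF i])
    show "AE s in lborel. norm (kz (x - s) * (indicator {0<..} s * h s)) \<le> norm (C * (indicator {0<..<x} s * kz (0 + x - s)))"
    proof (rule AE_I2)
      fix s
      show "norm (kz (x - s) * (indicator {0<..} s * h s)) \<le> norm (C * (indicator {0<..<x} s * kz (0 + x - s)))"
      proof (cases "0 < s \<and> s < x")
        case True
        have "kz (x - s) * \<bar>h s\<bar> \<le> kz (x - s) * C" using True b by (intro mult_left_mono kz_nonneg) auto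
        thus ?thesis using True kz_nonneg[of "x - s"] \<open>C \<ge> 0\<close> by (simp add: abs_mult mult.commute)
      qed (auto simp: indicator_def kz_0)
    qed
  qed measurable
next
  case False
  have "(\<lambda>s. kz (x - s) * (indicator {0<..} s * h s)) = (\<lambda>_. 0)" using False by (auto simp: kz_0 indicator_def)
  thus ?thesis by simp
qed

lemma conv_const: "x \<ge> 0 \<Longrightarrow> conv k (\<lambda>_. c) x = c * kap x"
proof -
  assume "x \<ge> 0"
  show ?thesis
  proof (cases "x = 0")
    case True
    thus ?thesis by (simp add: conv_def set_lebesgue_integral_def kap_0)
  next
    case False
  hence x: "x > 0" using \<open>x \<ge> 0\<close> by simp
  have "conv k (\<lambda>_. c) x = (\<integral>s. c * (indicator {0<..<x} s * kz (0 + x - s)) \<partial>lborel)"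
    unfolding conv_eq by (intro Bochner_Integration.integral_cong) (auto simp: kz_def indicator_def)
  also have "\<dots> = c * kap x" using kap_sub[of 0 x] x by (simp add: kap_0)
  finally show ?thesis .
  qed
qed

lemma conv_mono:
  assumes "h \<in> borel_measurable borel" "g \<in> borel_measurable borel"
   and "\<And>s. 0 < s \<Longrightarrow> s < x \<Longrightarrow> \<bar>h s\<bar> \<le> g s" "\<And>s. 0 < s \<Longrightarrow> s < x \<Longrightarrow> g s \<le> C"
  shows "\<bar>conv k h x\<bar> \<le> conv k g x"
  unfolding conv_eq
proof (rule integral_abs_bound[THEN order_trans], rule integral_mono)
  show "integrable lborel (\<lambda>s. \<bar>kz (x - s) * (indicator {0<..} s * h s)\<bar>)"
    by (intro integrable_abs conv_integrable[where C=C] assms order_trans[OF assms(3) assms(4)])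
  show "integrable lborel (\<lambda>s. kz (x - s) * (indicator {0<..} s * g s))"
    by (rule conv_integrable[where C=C]) (use assms(2) in simp, metis abs_ge_zero abs_of_nonneg assms(3,4) order_trans)
  show "\<bar>kz (x - s) * (indicator {0<..} s * h s)\<bar> \<le> kz (x - s) * (indicator {0<..} s * g s)" for s
  proof (cases "0 < s \<and> s < x")
    case True
    thus ?thesis using assms(3)[of s] kz_nonneg[of "x-s"] by (simp add: abs_mult mult_left_mono)
  qed (auto simp: indicator_def kz_0)
qed

lemma conv_bound:
  assumes "h \<in> borel_measurable borel" "\<And>s. 0 < s \<Longrightarrow> s < x \<Longrightarrow> \<bar>h s\<bar> \<le> C" "x \<ge> 0"
  shows "\<bar>conv k h x\<bar> \<le> C * kap x"
  using conv_mono[OF assms(1), of "\<lambda>_. C" x C] assms(2,3) by (simp add: conv_const)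

lemma conv_lin:
  assumes "h \<in> borel_measurable borel" "g \<in> borel_measurable borel"
   and "\<And>s. 0 < s \<Longrightarrow> s < x \<Longrightarrow> \<bar>h s\<bar> \<le> C" "\<And>s. 0 < s \<Longrightarrow> s < x \<Longrightarrow> \<bar>g s\<bar> \<le> D"
  shows "conv k (\<lambda>s. a * h s + b * g s) x = a * conv k h x + b * conv k g x"
proof -
  have "conv k (\<lambda>s. a * h s + b * g s) x = (\<integral>s. a * (kz (x - s) * (indicator {0<..} s * h s)) + b * (kz (x - s) * (indicator {0<..} s * g s)) \<partial>lborel)"
    unfolding conv_eq by (intro Bochner_Integration.integral_cong) (auto simp: algebra_simps)
  also have "\<dots> = a * conv k h x + b * conv k g x"
    using conv_integrable[OF assms(1,3)] conv_integrable[OF assms(2,4)] by (simp add: conv_eq)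
  finally show ?thesis .
qed

lemma conv_nn:
  assumes "h \<in> borel_measurable borel" "\<And>s. 0 < s \<Longrightarrow> s < x \<Longrightarrow> 0 \<le> h s" "\<And>s. 0 < s \<Longrightarrow> s < x \<Longrightarrow> h s \<le> C"
  shows "(\<integral>\<^sup>+s. k_nn (x - s) * (indicator {0<..} s * ennreal (h s)) \<partial>lborel) = ennreal (conv k h x)"
    and "conv k h x \<ge> 0"
proof -
  have nn: "kz (x - s) * (indicator {0<..} s * h s) \<ge> 0" for s
    using assms(2)[of s] kz_nonneg[of "x - s"] by (cases "0 < s \<and> s < x") (auto simp: indicator_def kz_0)
  have "k_nn (x - s) * (indicator {0<..} s * ennreal (h s)) = ennreal (kz (x - s) * (indicator {0<..} s * h s))" for s
    by (cases "0 < s \<and> s < x") (auto simp: k_nn_kz kz_0 indicator_def ennreal_mult kz_nonneg assms(2))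
  hence "(\<integral>\<^sup>+s. k_nn (x - s) * (indicator {0<..} s * ennreal (h s)) \<partial>lborel) = (\<integral>\<^sup>+s. ennreal (kz (x - s) * (indicator {0<..} s * h s)) \<partial>lborel)" by simp
  also have "\<dots> = ennreal (conv k h x)" unfolding conv_eq
    by (intro nn_integral_eq_integral conv_integrable[where C=C] assms(1)) (use assms nn in auto)
  finally show "(\<integral>\<^sup>+s. k_nn (x - s) * (indicator {0<..} s * ennreal (h s)) \<partial>lborel) = ennreal (conv k h x)" .
  show "conv k h x \<ge> 0" unfolding conv_eq by (intro integral_nonneg_AE) (use nn in auto)
qed

text \<open>On (0,x) monotonicity of \<open>k\<close> fixes the sign of k(x-s) - k(y-s), so this
  part telescopes to kap x - kap y + kap(y-x); the rest of the mass, on [x,y), is kap(y-x). As kap x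
  \<le> kap y, the total is at most twice kap(y-x).\<close>

lemma conv_modulus:
  assumes [measurable]: "h \<in> borel_measurable borel" and b: "\<And>s. 0 < s \<Longrightarrow> s < y \<Longrightarrow> \<bar>h s\<bar> \<le> C"
    and xy: "0 < x" "x \<le> y"
  shows "\<bar>conv k h y - conv k h x\<bar> \<le> 2 * C * kap (y - x)"
proof -
  define d where "d = y - x"
  have d: "d \<ge> 0" "y = d + x" using xy by (auto simp: d_def)
  have "C \<ge> 0" using b[of "x/2"] xy by auto
  have i: "integrable lborel (\<lambda>s. kz (y - s) * (indicator {0<..} s * h s))" "integrable lborel (\<lambda>s. kz (x - s) * (indicator {0<..} s * h s))"
    using b xy by (auto intro!: conv_integrable[where C=C])
  have i2: "integrable lborel (\<lambda>s. indicator {0<..<x} s * kz (0 + x - s))" "integrable lborel (\<lambda>s. indicator {0<..<x} s * kz (d + x - s))"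
    "integrable lborel (\<lambda>s. indicator {0<..<y} s * kz (0 + y - s))"
    using kap_sub_int[of 0 x] kap_sub_int[of d x] kap_sub_int[of 0 y] d xy by auto
  define I where "I = conv k h y - conv k h x"
  have I: "I = (\<integral>s. kz (y - s) * (indicator {0<..} s * h s) - kz (x - s) * (indicator {0<..} s * h s) \<partial>lborel)"
    unfolding I_def conv_eq using i by simp
  \<comment> \<open>One formula for both ranges: on (0,x) the three terms add up to k(x-s) - k(y-s),
    and on [x,y) only the last one, k(y-s), survives.\<close>
  have "\<bar>I\<bar> \<le> (\<integral>s. C * (indicator {0<..<x} s * kz (0 + x - s) - 2 * (indicator {0<..<x} s * kz (d + x - s)) + indicator {0<..<y} s * kz (0 + y - s)) \<partial>lborel)"
    unfolding I
  proof (rule integral_abs_bound[THEN order_trans], rule integral_mono)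
    fix s :: real
    have split: "kz (y - s) * (indicator {0<..} s * h s) - kz (x - s) * (indicator {0<..} s * h s) = indicator {0<..} s * h s * (kz (y - s) - kz (x - s))"
      by (simp add: algebra_simps)
    consider "s \<le> 0" | "0 < s" "s < x" | "0 < s" "x \<le> s" "s < y" | "s \<ge> y" "s > 0" by linarith
    thus "\<bar>kz (y - s) * (indicator {0<..} s * h s) - kz (x - s) * (indicator {0<..} s * h s)\<bar> \<le>
      C * (indicator {0<..<x} s * kz (0 + x - s) - 2 * (indicator {0<..<x} s * kz (d + x - s)) + indicator {0<..<y} s * kz (0 + y - s))"
    proof cases
      case 2
      have "kz (y - s) \<le> kz (x - s)" using 2 xy by (auto simp: kz_eq intro!: k_antimono)
      hence "\<bar>h s\<bar> * (kz (x - s) - kz (y - s)) \<le> C * (kz (x - s) - kz (y - s))"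
        using b[of s] 2 xy by (intro mult_right_mono) auto
      moreover have "\<bar>h s * (kz (y - s) - kz (x - s))\<bar> = \<bar>h s\<bar> * (kz (x - s) - kz (y - s))"
        using \<open>kz (y - s) \<le> kz (x - s)\<close> by (simp add: abs_mult)
      moreover have "d + x - s = y - s" using d by simp
      ultimately show ?thesis unfolding split using 2 xy by (simp add: algebra_simps)
    next
      case 3
      have "\<bar>h s\<bar> * kz (y - s) \<le> C * kz (y - s)"
        using b[of s] 3 kz_nonneg by (intro mult_right_mono) auto
      thus ?thesis unfolding split using 3 kz_nonneg[of "y - s"] by (simp add: kz_0 abs_mult)
    qed (use xy in \<open>auto simp: indicator_def kz_0\<close>)
  qed (intro integrable_abs integrable_mult_right Bochner_Integration.integrable_add Bochner_Integration.integrable_diff i i2)+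
  also have "\<dots> = C * (kap x - 2 * (kap y - kap d) + kap y)"
  proof -
    have e1: "(\<integral>s. indicator {0<..<x} s * kz (0 + x - s) \<partial>lborel) = kap x"
      and e3: "(\<integral>s. indicator {0<..<y} s * kz (0 + y - s) \<partial>lborel) = kap y"
    proof -
      have "y > 0" using xy by simp
      show "(\<integral>s. indicator {0<..<x} s * kz (0 + x - s) \<partial>lborel) = kap x"
        using kap_sub[OF order_refl xy(1)] by (simp only: add_0_left kap_0[OF order_refl] diff_zero)
      show "(\<integral>s. indicator {0<..<y} s * kz (0 + y - s) \<partial>lborel) = kap y"
        using kap_sub[OF order_refl \<open>y > 0\<close>] by (simp only: add_0_left kap_0[OF order_refl] diff_zero)
    qed
    have e2: "(\<integral>s. indicator {0<..<x} s * kz (d + x - s) \<partial>lborel) = kap y - kap d"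
      unfolding d(2) by (rule kap_sub) (use d xy in auto)
    have "(\<integral>s. C * (indicator {0<..<x} s * kz (0 + x - s) - 2 * (indicator {0<..<x} s * kz (d + x - s)) + indicator {0<..<y} s * kz (0 + y - s)) \<partial>lborel)
      = C * ((\<integral>s. indicator {0<..<x} s * kz (0 + x - s) \<partial>lborel) - 2 * (\<integral>s. indicator {0<..<x} s * kz (d + x - s) \<partial>lborel)
         + (\<integral>s. indicator {0<..<y} s * kz (0 + y - s) \<partial>lborel))"
      using i2 by (simp only: integral_mult_right_zero Bochner_Integration.integral_add Bochner_Integration.integral_diff
          Bochner_Integration.integrable_diff integrable_mult_right)
    thus ?thesis by (simp only: e1 e2 e3)
  qed
  also have "\<dots> \<le> C * (2 * kap d)"
    using \<open>C \<ge> 0\<close> kap_mono[of x y] xy by (intro mult_left_mono) auto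
  finally show ?thesis by (simp add: d_def I_def)
qed

lemma conv_cont:
  assumes "h \<in> borel_measurable borel" and b: "\<And>s. 0 < s \<Longrightarrow> s \<le> T \<Longrightarrow> \<bar>h s\<bar> \<le> C"
  shows "continuous_on {0<..T} (conv k h)"
proof (rule modulus_cont[where C="2*C"])
  fix x y assume xy: "x \<in> {0<..T}" "y \<in> {0<..T}"
  show "\<bar>conv k h y - conv k h x\<bar> \<le> 2 * C * kap \<bar>y - x\<bar>"
  proof (cases "x \<le> y")
    case True thus ?thesis using conv_modulus[OF assms(1), of y C x] b xy by auto
  next
    case False thus ?thesis using conv_modulus[OF assms(1), of x C y] b xy by (auto simp: abs_minus_commute)
  qed
qed

text \<open>In the sup norm weighted by exp(-c x), convolution with \<open>k\<close> has norm at
  most its Laplace transform 1/f(c). Since this tends to 0 as c grows, the weight makes the censored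
  integral as small as desired.\<close>

lemma conv_exp_bound:
  assumes c: "c > 0" and x: "x > 0"
  shows "conv k (\<lambda>s. exp (c * s)) x \<le> exp (c * x) / f c"
proof -
  have b: "exp (c * s) \<le> exp (c * x)" if "s < x" for s using that c by simp
  have "ennreal (conv k (\<lambda>s. exp (c * s)) x) = (\<integral>\<^sup>+s. k_nn (x - s) * (indicator {0<..} s * ennreal (exp (c * s))) \<partial>lborel)"
    by (rule conv_nn(1)[symmetric, where C="exp (c * x)"]) (use b in auto)
  also have "\<dots> \<le> (\<integral>\<^sup>+s. k_nn (x - s) * ennreal (exp (c * s)) \<partial>lborel)"
    by (intro nn_integral_mono) (auto simp: indicator_def)
  also have "\<dots> = (\<integral>\<^sup>+s. k_nn s * ennreal (exp (c * (x - s))) \<partial>lborel)"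
    using nn_integral_real_affine[of "\<lambda>s. k_nn (x - s) * ennreal (exp (c * s))" "-1" x] by simp
  also have "\<dots> = (\<integral>\<^sup>+s. ennreal (exp (c * x)) * (eexp c s * k_nn s) \<partial>lborel)"
  proof (rule nn_integral_cong)
    fix s
    have "exp (c * (x - s)) = exp (c * x) * exp (-(c * s))" by (simp add: exp_add[symmetric] algebra_simps)
    hence "ennreal (exp (c * (x - s))) = ennreal (exp (c * x)) * eexp c s" by (simp only: ennreal_mult exp_ge_zero)
    thus "k_nn s * ennreal (exp (c * (x - s))) = ennreal (exp (c * x)) * (eexp c s * k_nn s)" by (simp add: mult_ac)
  qed
  also have "\<dots> = ennreal (exp (c * x)) * ennreal (1 / f c)"
    using k_laplace[OF c] by (simp add: nn_integral_cmult)
  also have "\<dots> = ennreal (exp (c * x) / f c)" using f_pos[OF c] by (simp add: ennreal_mult[symmetric])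
  finally show ?thesis using f_pos[OF c] by (simp add: ennreal_le_iff)
qed

text \<open>If the tail were flat on (x,y], the decreasing density would vanish at some z there and
  hence beyond z. Then \<mu> has bounded support and finite first moment, so f(l) \<le> C l,
  contradicting l/f(l) \<longlongrightarrow> 0 at 0.\<close>

lemma tail_strict: assumes "0 < x" "x < y" shows "tail \<mu> y < tail \<mu> x"
proof (rule ccontr)
  assume "\<not> ?thesis"
  hence "ennreal (tail \<mu> x - tail \<mu> y) = 0" by (simp add: ennreal_neg)
  hence "emeasure \<mu> {x<..y} = 0" using tail_diff[of x y] assms by (simp add: ennreal_eq_0_iff)
  hence "(\<integral>\<^sup>+z. ennreal (dens z) * indicator {0<..} z * indicator {x<..y} z \<partial>lborel) = 0"
    using emeasure_density[OF dens_measurable_lborel, of "{x<..y}"] by (simp only: dens(2)[symmetric]) simp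
  hence ae: "AE z in lborel. ennreal (dens z) * indicator {0<..} z * indicator {x<..y} z = 0"
    by (subst (asm) nn_integral_0_iff_AE) (use dens_measurable in measurable)
  have "\<exists>z\<in>{x<..y}. dens z = 0"
  proof (rule ccontr)
    assume "\<not> ?thesis"
    hence p: "dens z > 0" if "z \<in> {x<..y}" for z using that cm_nonneg[OF dens(1), of z] assms by force
    have "AE z in lborel. \<not> (z \<in> {x<..y})"
      using ae
    proof eventually_elim
      case (elim z)
      show ?case
      proof
        assume z: "z \<in> {x<..y}"
        hence "z > 0" using assms by simp
        thus False using elim p[OF z] z by simp
      qed
    qed
    hence "emeasure lborel {z \<in> space lborel. z \<in> {x<..y}} = 0" by (rule emeasure_eq_0_AE)
    moreover have "{z \<in> space lborel. z \<in> {x<..y}} = {x<..y}" by auto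
    ultimately show False using assms by simp
  qed
  then obtain z where z: "z > x" "dens z = 0" by auto
  have d0: "dens w = 0" if "w \<ge> z" for w
    using cm_nonneg[OF dens(1), of w] cm_antimono[OF dens(1), of z w] z assms that by auto
  have "AE w in density lborel (\<lambda>x. ennreal (dens x) * indicator {0<..} x). w < z"
    unfolding AE_density[OF dens_measurable_lborel] 
  proof (rule AE_I2, rule impI, rule ccontr)
    fix w assume "0 < ennreal (dens w) * indicator {0<..} w" "\<not> w < z"
    thus False using d0[of w] by simp
  qed
  hence aez: "AE w in \<mu>. w < z" by (simp only: dens(2)[symmetric])
  \<comment> \<open>On the support, where w < z, one has w \<le> max(1,z) min(1,w), so
    \<open>C\<close> bounds the first moment of \<mu>.\<close>
  define C where "C = max 1 z * (\<integral>w. min 1 w \<partial>\<mu>)"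
  have fl: "f l \<le> l * C" if l: "l > 0" for l
  proof -
    have "f l \<le> (\<integral>w. l * max 1 z * min 1 w \<partial>\<mu>)"
      unfolding f_eq[OF l]
    proof (rule integral_mono_AE)
      show "AE w in \<mu>. 1 - exp (- l * w) \<le> l * max 1 z * min 1 w"
        using aez mu_pos
      proof eventually_elim
        case (elim w)
        have "1 - exp (- l * w) \<le> l * w" using exp_ge_add_one_self[of "-l*w"] by simp
        also have "w \<le> max 1 z * min 1 w" using elim by (cases "w \<ge> 1") (auto simp: mult_le_cancel_right1 max_def min_def)
        finally show ?case using l by (simp add: mult.assoc)
      qed
    qed (use f_integrable[OF l] mu_min in auto)
    thus ?thesis by (simp add: C_def)
  qed
  have "f 1 \<le> C" using fl[of 1] by simp
  hence C: "C > 0" using f_pos[of 1] by linarith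
  have "\<forall>\<^sub>F l in at_right 0. l / f l < 1 / C" using f_lin C by (intro order_tendstoD) auto
  moreover have "\<forall>\<^sub>F l in at_right (0::real). l > 0" by (rule eventually_at_right_less)
  ultimately have "\<forall>\<^sub>F l in at_right (0::real). False"
  proof eventually_elim
    case (elim l)
    have "1 / C \<le> l / f l" using fl[of l] f_pos[of l] elim C by (simp add: field_simps)
    thus False using elim by simp
  qed
  thus False by simp
qed

lemma k_pos_near: obtains a0 c0 where "a0 > 0" "c0 > 0" "\<And>s. 0 < s \<Longrightarrow> s \<le> a0 \<Longrightarrow> k s \<ge> c0"
proof -
  have "\<exists>s>0. k s \<noteq> 0"
  proof (rule ccontr)
    assume "\<not> ?thesis"
    hence "k_nn = (\<lambda>_. 0)" by (auto simp: k_nn_def fun_eq_iff indicator_def)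
    hence "ennreal (1 / f 1) = 0" using k_laplace[of 1] by simp
    thus False using f_pos[of 1] by (simp add: ennreal_eq_0_iff)
  qed
  then obtain a where a: "a > 0" "k a \<noteq> 0" by blast
  show ?thesis
    by (rule that[of a "k a"]) (use a k_nonneg[of a] k_antimono in auto)
qed

text \<open>By monotonicity the Sonine integral dominates the product $\bar\mu(r)\int_0^r k$; the gain near
  $s = 0$, where $k$ is bounded below and $\bar\mu(r - s)$ strictly larger than $\bar\mu(r)$,
  makes the inequality strict.\<close>

lemma tail_kap_lt_1: assumes r: "r > 0" shows "tail \<mu> r * kap r < 1"
proof -
  obtain a0 c0 where a0: "a0 > 0" "c0 > 0" "\<And>s. 0 < s \<Longrightarrow> s \<le> a0 \<Longrightarrow> k s \<ge> c0" by (rule k_pos_near) blast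
  define a where "a = min a0 (r/2)"
  have a: "a > 0" "a < r" "\<And>s. 0 < s \<Longrightarrow> s \<le> a \<Longrightarrow> k s \<ge> c0" using a0 r by (auto simp: a_def)
  \<comment> \<open>The second summand is the gain over s in [a/2,a]: there k(s) \<ge> c0, the tail
    at x - s is at least the tail at x - a/2, and the interval has length a/2.\<close>
  define F where "F x = tail \<mu> x * kap x + (tail \<mu> (x - a/2) - tail \<mu> x) * (c0 * (a/2))" for x
  have ae: "AE x in lborel. x > a \<longrightarrow> F x \<le> 1"
    using sonine_AE
  proof eventually_elim
    case (elim x)
    show ?case
    proof
      assume x: "x > a"
      define g where "g = tail \<mu> (x - a/2) - tail \<mu> x"
      have g: "g \<ge> 0" using tail_antimono[of "x - a/2" x] x a by (simp add: g_def)
      have "ennreal (tail \<mu> x * kap x + g * (c0 * (a/2))) = ennreal (tail \<mu> x) * ennreal (kap x) + ennreal (g * c0) * ennreal (a/2)"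
        using tail_nonneg kap_nonneg g a0 a by (simp add: ennreal_mult[symmetric] ennreal_plus[symmetric] mult.assoc del: ennreal_plus)
      also have "\<dots> = (\<integral>\<^sup>+s. ennreal (tail \<mu> x) * (indicator {..<x} s * k_nn s) + ennreal (g * c0) * indicator {a/2..a} s \<partial>lborel)"
        using a by (subst nn_integral_add) (auto simp: nn_integral_cmult kap_nn)
      also have "\<dots> \<le> (\<integral>\<^sup>+s. tail_nn (x - s) * k_nn s \<partial>lborel)"
      proof (rule nn_integral_mono)
        fix s
        consider "s \<le> 0" | "s \<ge> x" | "0 < s" "s < x" "s \<notin> {a/2..a}" | "s \<in> {a/2..a}" "0 < s" "s < x" by linarith
        thus "ennreal (tail \<mu> x) * (indicator {..<x} s * k_nn s) + ennreal (g * c0) * indicator {a/2..a} s \<le> tail_nn (x - s) * k_nn s"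
        proof cases
          case 3
          thus ?thesis using tail_antimono[of "x - s" x] by (simp add: tail_nn_def mult_right_mono ennreal_leI)
        next
          case 4
          have "tail \<mu> x * k s + g * c0 \<le> tail \<mu> x * k s + g * k s"
            using a(3)[of s] 4 g by (intro add_left_mono mult_left_mono) auto
          also have "\<dots> = tail \<mu> (x - a/2) * k s" by (simp add: g_def algebra_simps)
          also have "\<dots> \<le> tail \<mu> (x - s) * k s"
            using 4 x a by (intro mult_right_mono tail_antimono k_nonneg) auto
          finally have "ennreal (tail \<mu> x * k s + g * c0) \<le> ennreal (tail \<mu> (x - s) * k s)" by (rule ennreal_leI)
          thus ?thesis using 4 tail_nonneg k_nonneg[of s] g a0 by (simp add: tail_nn_def k_nn_def ennreal_mult)
        qed (use x a in \<open>auto simp: k_nn_def tail_nn_def indicator_def\<close>)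
      qed
      also have "\<dots> = 1" using elim x a by simp
      finally show "F x \<le> 1" unfolding F_def g_def[symmetric] by simp
    qed
  qed
  \<comment> \<open>The bound is known almost everywhere only. As \<open>F\<close> is continuous
    beyond a, a violation at r would fill an open ball, which is not a null set.\<close>
  have "F r \<le> 1"
  proof (rule ccontr)
    assume "\<not> F r \<le> 1"
    hence F1: "F r > 1" by simp
    have "continuous_on {a<..} F" unfolding F_def
      by (intro continuous_intros continuous_on_subset[OF tail_cont] continuous_on_subset[OF kap_cont] continuous_on_compose2[OF tail_cont]) (use a in auto)
    hence "open ({a<..} \<inter> F -` {1<..})" by (intro continuous_open_preimage) auto
    moreover have "r \<in> {a<..} \<inter> F -` {1<..}" using F1 a by simp
    ultimately obtain e where e: "e > 0" "ball r e \<subseteq> {a<..} \<inter> F -` {1<..}" by (rule openE)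
    have "AE x in lborel. \<not> (x \<in> ball r e)"
      using ae
    proof eventually_elim
      case (elim x)
      show ?case
      proof
        assume "x \<in> ball r e"
        hence "x \<in> {a<..} \<inter> F -` {1<..}" using e(2) by blast
        thus False using elim by simp
      qed
    qed
    hence "emeasure lborel {x \<in> space lborel. x \<in> ball r e} = 0" by (rule emeasure_eq_0_AE)
    moreover have "{x \<in> space lborel. x \<in> ball r e} = {r - e<..<r + e}" by (auto simp: dist_real_def)
    ultimately show False using e by simp
  qed
  moreover have "(tail \<mu> (r - a/2) - tail \<mu> r) * (c0 * (a/2)) > 0"
    using tail_strict[of "r - a/2" r] a a0 by simp
  ultimately show ?thesis unfolding F_def by linarith
qed

end

section \<open>The censored integral\<close>

locale censored_pair = bernstein_pair +
  fixes q T :: real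
  assumes q_lim: "((\<lambda>x. tail \<mu> x * (LBINT s:{0<..<x}. k s)) \<longlongrightarrow> q) (at_right 0)"
    and q_less: "q < 1" and T: "T > 0"
begin

definition rho :: real where
  "rho = (SOME \<rho>. 0 \<le> \<rho> \<and> \<rho> < 1 \<and> (\<forall>x\<in>{0<..T}. tail \<mu> x * kap x \<le> \<rho>))"

text \<open>The limit q settles a neighbourhood of 0, with (q + 1)/2 as bound; on the remaining
  compact interval the continuous product attains its maximum, and that is below 1 by
  \<open>tail_kap_lt_1\<close>.\<close>

lemma rho: "0 \<le> rho" "rho < 1" "\<And>x. 0 < x \<Longrightarrow> x \<le> T \<Longrightarrow> tail \<mu> x * kap x \<le> rho"
proof -
  have "\<forall>\<^sub>F x in at_right 0. tail \<mu> x * kap x < (q + 1) / 2"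
    using q_lim q_less unfolding kap_def by (intro order_tendstoD) auto
  then obtain b where b: "b > 0" "\<forall>y>0. y < b \<longrightarrow> tail \<mu> y * kap y < (q + 1) / 2"
    unfolding eventually_at_right_field by blast
  define a where "a = min (b/2) T"
  have a: "a > 0" "a \<le> T" "a < b" using b T by (auto simp: a_def)
  have "continuous_on {a..T} (\<lambda>x. tail \<mu> x * kap x)"
    by (intro continuous_intros continuous_on_subset[OF tail_cont] continuous_on_subset[OF kap_cont]) (use a in auto)
  then obtain m where m: "m \<in> {a..T}" "\<And>x. x \<in> {a..T} \<Longrightarrow> tail \<mu> x * kap x \<le> tail \<mu> m * kap m"
    using continuous_attains_sup[of "{a..T}" "\<lambda>x. tail \<mu> x * kap x"] a by auto
  have m1: "tail \<mu> m * kap m < 1" using tail_kap_lt_1[of m] m a by auto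
  define R where "R = max ((q + 1) / 2) (tail \<mu> m * kap m)"
  have "0 \<le> R" unfolding R_def using mult_nonneg_nonneg[OF tail_nonneg[of m] kap_nonneg[of m]] by linarith
  moreover have "R < 1" using m1 q_less by (simp add: R_def)
  moreover have "tail \<mu> x * kap x \<le> R" if "x \<in> {0<..T}" for x
  proof (cases "x < a")
    case True
    thus ?thesis using b a that unfolding R_def by (meson greaterThanAtMost_iff le_max_iff_disj less_imp_le less_trans)
  next
    case False
    hence "tail \<mu> x * kap x \<le> tail \<mu> m * kap m" using m(2)[of x] that by simp
    thus ?thesis unfolding R_def by simp
  qed
  ultimately have ex: "\<exists>\<rho>. 0 \<le> \<rho> \<and> \<rho> < 1 \<and> (\<forall>x\<in>{0<..T}. tail \<mu> x * kap x \<le> \<rho>)" by blast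
  have "0 \<le> rho \<and> rho < 1 \<and> (\<forall>x\<in>{0<..T}. tail \<mu> x * kap x \<le> rho)"
    unfolding rho_def by (rule someI_ex[OF ex])
  thus "0 \<le> rho" "rho < 1" "\<And>x. 0 < x \<Longrightarrow> x \<le> T \<Longrightarrow> tail \<mu> x * kap x \<le> rho" by auto
qed

text \<open>Functions matter on (0,T] only, and the values of terms such as \<open>I_Ce\<close>
  elsewhere are uncontrolled. Measurability is therefore required of the extension by zero.\<close>

definition bmeas :: "(real \<Rightarrow> real) \<Rightarrow> bool" where "bmeas h \<longleftrightarrow> zext T h \<in> borel_measurable borel"
definition bmeas_le :: "(real \<Rightarrow> real) \<Rightarrow> real \<Rightarrow> bool" where "bmeas_le h C \<longleftrightarrow> bmeas h \<and> (\<forall>x. 0 < x \<longrightarrow> x \<le> T \<longrightarrow> \<bar>h x\<bar> \<le> C)"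
definition k_exp :: "real \<Rightarrow> real \<Rightarrow> real" where "k_exp c x = conv k (\<lambda>s. exp (c * s)) x"
definition V_term :: "(real \<Rightarrow> real) \<Rightarrow> nat \<Rightarrow> real \<Rightarrow> real" where "V_term \<psi> j = (K_op \<mu> k ^^ j) (I_R k \<psi>)"
definition V :: "(real \<Rightarrow> real) \<Rightarrow> real \<Rightarrow> real" where "V \<psi> x = I_Ce \<mu> k \<psi> x"

lemma V_V_term: "V \<psi> x = (\<Sum>j. V_term \<psi> j x)" by (simp add: V_def I_Ce_def V_term_def)

lemma zext_in: "0 < x \<Longrightarrow> x \<le> T \<Longrightarrow> zext T h x = h x" by (simp add: zext_def)

lemma bmeas_cont: "continuous_on {0<..T} h \<Longrightarrow> bmeas h"
proof -
  assume c: "continuous_on {0<..T} h"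
  have "(\<lambda>x. indicator {0<..T} x *\<^sub>R h x) \<in> borel_measurable borel"
    by (rule borel_measurable_continuous_on_indicator) (use c in auto)
  also have "(\<lambda>x. indicator {0<..T} x *\<^sub>R h x) = zext T h" by (auto simp: zext_def indicator_def)
  finally show ?thesis by (simp add: bmeas_def)
qed

lemma bmeas_comb: "bmeas h \<Longrightarrow> bmeas g \<Longrightarrow> bmeas (\<lambda>s. a * h s + b * g s)"
proof -
  assume "bmeas h" "bmeas g"
  hence [measurable]: "zext T h \<in> borel_measurable borel" "zext T g \<in> borel_measurable borel" by (auto simp: bmeas_def)
  have "zext T (\<lambda>s. a * h s + b * g s) = (\<lambda>x. a * zext T h x + b * zext T g x)" by (auto simp: zext_def)
  thus ?thesis by (simp add: bmeas_def)
qed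

lemma bmeas_add: "bmeas h \<Longrightarrow> bmeas g \<Longrightarrow> bmeas (\<lambda>s. h s + g s)" using bmeas_comb[of h g 1 1] by simp

lemma bmeas_mult: "bmeas h \<Longrightarrow> bmeas g \<Longrightarrow> bmeas (\<lambda>s. h s * g s)"
proof -
  assume "bmeas h" "bmeas g"
  hence [measurable]: "zext T h \<in> borel_measurable borel" "zext T g \<in> borel_measurable borel" by (auto simp: bmeas_def)
  have "zext T (\<lambda>s. h s * g s) = (\<lambda>x. zext T h x * zext T g x)" by (auto simp: zext_def)
  thus ?thesis by (simp add: bmeas_def)
qed

lemma bmeas_tail: "bmeas (tail \<mu>)"
  by (intro bmeas_cont continuous_on_subset[OF tail_cont]) auto

lemma bmeas_cong: "bmeas h \<Longrightarrow> (\<And>x. 0 < x \<Longrightarrow> x \<le> T \<Longrightarrow> g x = h x) \<Longrightarrow> bmeas g"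
proof -
  assume "bmeas h" and e: "\<And>x. 0 < x \<Longrightarrow> x \<le> T \<Longrightarrow> g x = h x"
  have "zext T g = zext T h" using e by (auto simp: zext_def)
  thus ?thesis using \<open>bmeas h\<close> by (simp add: bmeas_def)
qed

lemma conv_zext: "x \<le> T \<Longrightarrow> conv a h x = conv a (zext T h) x"
  by (intro conv_cong) (auto simp: zext_def)

lemma conv_linT:
  assumes "bmeas_le h C" "bmeas_le g D" "x \<le> T"
  shows "conv k (\<lambda>s. a * h s + b * g s) x = a * conv k h x + b * conv k g x"
proof -
  have "conv k (\<lambda>s. a * h s + b * g s) x = conv k (\<lambda>s. a * zext T h s + b * zext T g s) x"
    by (intro conv_cong) (use assms(3) in \<open>auto simp: zext_def\<close>)
  also have "\<dots> = a * conv k (zext T h) x + b * conv k (zext T g) x"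
    by (rule conv_lin[where C=C and D=D]) (use assms in \<open>auto simp: bmeas_le_def bmeas_def zext_in\<close>)
  finally show ?thesis by (simp only: conv_zext[OF assms(3), symmetric])
qed

lemma k_exp_le_kap: "c \<ge> 0 \<Longrightarrow> x \<ge> 0 \<Longrightarrow> k_exp c x \<le> exp (c * x) * kap x"
  unfolding k_exp_def by (rule abs_le_D1, rule conv_bound) (auto intro: mult_left_mono)

lemma k_exp_0: "x \<ge> 0 \<Longrightarrow> k_exp 0 x = kap x" unfolding k_exp_def using conv_const[of x 1] by simp

text \<open>The weight exp(c x) serves two purposes at once: c = 0 gives the bounds by
  \<open>kap\<close>, and large c gives the quasinilpotency of \<open>V\<close>.\<close>

lemma conv_step:
  assumes "bmeas h" "c \<ge> 0" and b: "\<And>x. 0 < x \<Longrightarrow> x \<le> T \<Longrightarrow> \<bar>h x\<bar> \<le> N * exp (c * x)"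
  shows "continuous_on {0<..T} (conv k h)" "\<And>x. 0 < x \<Longrightarrow> x \<le> T \<Longrightarrow> \<bar>conv k h x\<bar> \<le> N * k_exp c x"
proof -
  have [measurable]: "zext T h \<in> borel_measurable borel" using assms by (simp add: bmeas_def)
  have N: "N \<ge> 0" using b[of T] T by (metis abs_ge_zero exp_gt_zero order_refl order_trans zero_le_mult_iff not_le)
  have bb: "\<bar>zext T h s\<bar> \<le> N * exp (c * T)" if "0 < s" "s \<le> T" for s
  proof -
    have "\<bar>h s\<bar> \<le> N * exp (c * s)" using b that by blast
    also have "\<dots> \<le> N * exp (c * T)" using N that assms(2) by (intro mult_left_mono) (auto intro: mult_left_mono)
    finally show ?thesis using that by (simp add: zext_in)
  qed
  have "continuous_on {0<..T} (conv k (zext T h))" by (rule conv_cont[OF _ bb]) auto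
  thus "continuous_on {0<..T} (conv k h)"
    by (rule continuous_on_eq) (simp add: conv_zext[symmetric])
  fix x assume x: "0 < x" "x \<le> T"
  have "\<bar>conv k h x\<bar> = \<bar>conv k (zext T h) x\<bar>" by (simp only: conv_zext[OF x(2), symmetric])
  also have "\<dots> \<le> conv k (\<lambda>s. N * exp (c * s)) x"
  proof (rule conv_mono[where C="N * exp (c * T)"])
    show "\<bar>zext T h s\<bar> \<le> N * exp (c * s)" if "0 < s" "s < x" for s using b[of s] that x by (simp add: zext_in)
    show "N * exp (c * s) \<le> N * exp (c * T)" if "0 < s" "s < x" for s
      using N that assms(2) x by (intro mult_left_mono) (auto intro: mult_left_mono)
  qed auto
  also have "\<dots> = N * k_exp c x"
    unfolding k_exp_def using conv_lin[of "\<lambda>s. exp (c * s)" "\<lambda>_. 0" x "exp (c * x)" 0 N 0] assms(2)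
    by (simp add: mult_left_mono)
  finally show "\<bar>conv k h x\<bar> \<le> N * k_exp c x" .
qed

lemma tail_k_exp: assumes "c \<ge> 0" "0 < x" "x \<le> T" shows "tail \<mu> x * k_exp c x \<le> rho * exp (c * x)"
proof -
  have "tail \<mu> x * k_exp c x \<le> tail \<mu> x * (exp (c * x) * kap x)"
    using assms k_exp_le_kap[of c x] by (intro mult_left_mono tail_nonneg) auto
  also have "\<dots> = tail \<mu> x * kap x * exp (c * x)" by simp
  also have "\<dots> \<le> rho * exp (c * x)" using rho(3)[of x] assms by (intro mult_right_mono) auto
  finally show ?thesis .
qed

lemma K_op_conv: "x > 0 \<Longrightarrow> K_op \<mu> k \<phi> x = conv k (\<lambda>r. tail \<mu> r * \<phi> r) x"
  unfolding K_op_def conv_def by (simp add: mult_ac)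

lemma V_term_Suc: "x > 0 \<Longrightarrow> V_term \<psi> (Suc j) x = conv k (\<lambda>r. tail \<mu> r * V_term \<psi> j r) x"
  unfolding V_term_def by (simp add: K_op_conv)

lemma V_term_0: "V_term \<psi> 0 x = conv k \<psi> x" by (simp add: V_term_def I_R_def)

text \<open>A bound by a constant would not survive the next multiplication by the tail, which is
  unbounded at 0. The factor \<open>k_exp c x\<close> does: \<open>tail_k_exp\<close> turns tail
  times \<open>k_exp\<close> into \<open>rho\<close> times the original weight.\<close>

lemma V_term_bound:
  assumes "bmeas \<psi>" "c \<ge> 0" and b: "\<And>x. 0 < x \<Longrightarrow> x \<le> T \<Longrightarrow> \<bar>\<psi> x\<bar> \<le> N * exp (c * x)"
  shows "continuous_on {0<..T} (V_term \<psi> j)" "0 < x \<Longrightarrow> x \<le> T \<Longrightarrow> \<bar>V_term \<psi> j x\<bar> \<le> N * rho ^ j * k_exp c x"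
proof -
  have "continuous_on {0<..T} (V_term \<psi> j) \<and> (\<forall>x. 0 < x \<longrightarrow> x \<le> T \<longrightarrow> \<bar>V_term \<psi> j x\<bar> \<le> N * rho ^ j * k_exp c x)"
  proof (induction j)
    case 0
    have "V_term \<psi> 0 = conv k \<psi>" by (simp add: V_term_0 fun_eq_iff)
    thus ?case using conv_step[OF assms] by simp
  next
    case (Suc j)
    have bm: "bmeas (\<lambda>r. tail \<mu> r * V_term \<psi> j r)" using Suc by (intro bmeas_mult bmeas_tail bmeas_cont) auto
    have bd: "\<bar>tail \<mu> x * V_term \<psi> j x\<bar> \<le> (N * rho ^ Suc j) * exp (c * x)" if x: "0 < x" "x \<le> T" for x
    proof -
      have N: "N \<ge> 0" using b[of T] T by (metis abs_ge_zero exp_gt_zero order_refl order_trans zero_le_mult_iff not_le)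
      have "\<bar>tail \<mu> x * V_term \<psi> j x\<bar> = tail \<mu> x * \<bar>V_term \<psi> j x\<bar>" by (simp add: abs_mult tail_nonneg)
      also have "\<dots> \<le> tail \<mu> x * (N * rho ^ j * k_exp c x)" using Suc x by (intro mult_left_mono tail_nonneg) auto
      also have "\<dots> = (N * rho ^ j) * (tail \<mu> x * k_exp c x)" by simp
      also have "\<dots> \<le> (N * rho ^ j) * (rho * exp (c * x))"
        using N rho(1) tail_k_exp[OF assms(2) x] by (intro mult_left_mono) auto
      finally show ?thesis by (simp add: mult_ac)
    qed
    note step = conv_step[OF bm assms(2) bd]
    have "continuous_on {0<..T} (V_term \<psi> (Suc j))"
      by (rule continuous_on_eq[OF step(1)]) (auto simp: V_term_Suc)
    thus ?case using step(2) by (auto simp: V_term_Suc)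
  qed
  thus "continuous_on {0<..T} (V_term \<psi> j)" "0 < x \<Longrightarrow> x \<le> T \<Longrightarrow> \<bar>V_term \<psi> j x\<bar> \<le> N * rho ^ j * k_exp c x" by auto
qed

lemma V_term_summable:
  assumes "bmeas \<psi>" "c \<ge> 0" and b: "\<And>x. 0 < x \<Longrightarrow> x \<le> T \<Longrightarrow> \<bar>\<psi> x\<bar> \<le> N * exp (c * x)" and x: "0 < x" "x \<le> T"
  shows "summable (\<lambda>j. V_term \<psi> j x)"
    and "\<bar>V \<psi> x - (\<Sum>j<n. V_term \<psi> j x)\<bar> \<le> N * rho ^ n / (1 - rho) * k_exp c x"
proof -
  have s: "summable (\<lambda>j. N * rho ^ j * k_exp c x)"
    using rho by (intro summable_mult2 summable_mult summable_geometric) simp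
  have bd: "norm (V_term \<psi> j x) \<le> N * rho ^ j * k_exp c x" for j using V_term_bound(2)[OF assms(1-3) x] by simp
  show sm: "summable (\<lambda>j. V_term \<psi> j x)" by (rule summable_comparison_test'[OF s bd])
  have "V \<psi> x - (\<Sum>j<n. V_term \<psi> j x) = (\<Sum>j. V_term \<psi> (j + n) x)"
    unfolding V_V_term using suminf_minus_initial_segment[OF sm, of n] by simp
  also have "norm \<dots> \<le> (\<Sum>j. N * rho ^ (j + n) * k_exp c x)"
  proof (rule norm_suminf_le)
    show "summable (\<lambda>j. N * rho ^ (j + n) * k_exp c x)" using summable_ignore_initial_segment[OF s, of n] by simp
  qed (rule bd)
  also have "(\<Sum>j. N * rho ^ (j + n) * k_exp c x) = (\<Sum>j. rho ^ j * (N * rho ^ n * k_exp c x))"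
    by (intro suminf_cong) (simp add: power_add)
  also have "\<dots> = (\<Sum>j. rho ^ j) * (N * rho ^ n * k_exp c x)"
    using rho by (intro suminf_mult2[symmetric] summable_geometric) simp
  also have "\<dots> = N * rho ^ n / (1 - rho) * k_exp c x" using rho by (simp add: suminf_geometric)
  finally show "\<bar>V \<psi> x - (\<Sum>j<n. V_term \<psi> j x)\<bar> \<le> N * rho ^ n / (1 - rho) * k_exp c x" by simp
qed

lemma V_bound_exp:
  assumes "bmeas \<psi>" "c \<ge> 0" "\<And>x. 0 < x \<Longrightarrow> x \<le> T \<Longrightarrow> \<bar>\<psi> x\<bar> \<le> N * exp (c * x)" "0 < x" "x \<le> T"
  shows "\<bar>V \<psi> x\<bar> \<le> N / (1 - rho) * k_exp c x"
  using V_term_summable(2)[OF assms, of 0] by simp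

lemma bmeas_le_nonneg: "bmeas_le \<psi> C \<Longrightarrow> C \<ge> 0" unfolding bmeas_le_def using T by force

lemma V_summable: "bmeas_le \<psi> C \<Longrightarrow> 0 < x \<Longrightarrow> x \<le> T \<Longrightarrow> summable (\<lambda>j. V_term \<psi> j x)"
  by (rule V_term_summable(1)[of \<psi> 0 C]) (auto simp: bmeas_le_def)

lemma V_bound: "bmeas_le \<psi> C \<Longrightarrow> 0 < x \<Longrightarrow> x \<le> T \<Longrightarrow> \<bar>V \<psi> x\<bar> \<le> C / (1 - rho) * kap x"
  using V_bound_exp[of \<psi> 0 C x] by (auto simp: bmeas_le_def k_exp_0)

lemma V_rest: "bmeas_le \<psi> C \<Longrightarrow> 0 < x \<Longrightarrow> x \<le> T \<Longrightarrow> \<bar>V \<psi> x - (\<Sum>j<n. V_term \<psi> j x)\<bar> \<le> C * rho ^ n / (1 - rho) * kap x"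
  using V_term_summable(2)[of \<psi> 0 C x n] by (auto simp: bmeas_le_def k_exp_0)

lemma V_term_cont: "bmeas_le \<psi> C \<Longrightarrow> continuous_on {0<..T} (V_term \<psi> j)"
  by (rule V_term_bound(1)[of \<psi> 0 C]) (auto simp: bmeas_le_def)

lemma V_bmeas: "bmeas_le \<psi> C \<Longrightarrow> bmeas (V \<psi>)"
proof -
  assume b: "bmeas_le \<psi> C"
  have [measurable]: "zext T (V_term \<psi> j) \<in> borel_measurable borel" for j
    using bmeas_cont[OF V_term_cont[OF b]] by (simp add: bmeas_def)
  have "zext T (V \<psi>) = (\<lambda>x. \<Sum>j. zext T (V_term \<psi> j) x)"
  proof
    fix x
    show "zext T (V \<psi>) x = (\<Sum>j. zext T (V_term \<psi> j) x)"
      by (cases "x \<in> {0<..T}") (simp_all only: zext_def V_V_term if_True if_False suminf_zero)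
  qed
  thus ?thesis unfolding bmeas_def by simp
qed

lemma tail_mult_bound:
  assumes "0 < x" "x \<le> T" "\<bar>r\<bar> \<le> C * kap x" "C \<ge> 0" shows "\<bar>tail \<mu> x * r\<bar> \<le> C * rho"
proof -
  have "\<bar>tail \<mu> x * r\<bar> \<le> tail \<mu> x * (C * kap x)" using assms by (simp add: abs_mult tail_nonneg mult_left_mono)
  also have "\<dots> = C * (tail \<mu> x * kap x)" by simp
  also have "\<dots> \<le> C * rho" using rho(3)[of x] assms by (intro mult_left_mono) auto
  finally show ?thesis .
qed

lemma V_source_bmeas_le: "bmeas_le \<psi> C \<Longrightarrow> bmeas_le (\<lambda>r. \<psi> r + tail \<mu> r * V \<psi> r) (C + C / (1 - rho) * rho)"
  unfolding bmeas_le_def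
proof (intro conjI allI impI, goal_cases)
  case 1 thus ?case using V_bmeas[of \<psi> C] by (intro bmeas_add bmeas_mult bmeas_tail) (auto simp: bmeas_le_def)
next
  case (2 x)
  have "bmeas_le \<psi> C" using 2 by (simp add: bmeas_le_def)
  hence "\<bar>tail \<mu> x * V \<psi> x\<bar> \<le> C / (1 - rho) * rho"
    using 2 V_bound bmeas_le_nonneg rho by (intro tail_mult_bound) auto
  thus ?case using 2 by fastforce
qed

lemma conv_kap_bound: "bmeas_le h C \<Longrightarrow> 0 < x \<Longrightarrow> x \<le> T \<Longrightarrow> \<bar>conv k h x\<bar> \<le> C * kap x"
  using conv_step(2)[of h 0 C x] by (auto simp: bmeas_le_def k_exp_0)

text \<open>The partial sums satisfy the equation with a shift of index, and the limit may be taken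
  inside the convolution because the remainder carries the factor \<open>kap\<close>, so that it
  stays small even after multiplication by the tail.\<close>

lemma V_eq:
  assumes b: "bmeas_le \<psi> C" and x: "0 < x" "x \<le> T"
  shows "V \<psi> x = conv k (\<lambda>r. \<psi> r + tail \<mu> r * V \<psi> r) x"
proof -
  define S where "S n y = (\<Sum>j<n. V_term \<psi> j y)" for n y
  define C' where "C' = C / (1 - rho)"
  have C': "C' \<ge> 0" using bmeas_le_nonneg[OF b] rho by (simp add: C'_def)
  have SBM: "bmeas (S n)" for n
    unfolding S_def by (intro bmeas_cont continuous_intros V_term_cont[OF b])
  have rest: "\<bar>V \<psi> y - S n y\<bar> \<le> C' * rho ^ n * kap y" if "0 < y" "y \<le> T" for y n
    using V_rest[OF b that, of n] by (simp add: S_def C'_def mult_ac)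
  \<comment> \<open>The remainder is at most a multiple of \<open>rho ^ n * kap\<close>; the product
    of tail and \<open>kap\<close> contributes one more factor \<open>rho\<close> and leaves a
    bounded function.\<close>
  have tS: "bmeas_le (\<lambda>r. tail \<mu> r * (V \<psi> r - S n r)) (C' * rho ^ n * rho)" for n
    unfolding bmeas_le_def
  proof (intro conjI allI impI)
    have "bmeas (\<lambda>r. 1 * V \<psi> r + (-1) * S n r)" by (rule bmeas_comb[OF V_bmeas[OF b] SBM])
    thus "bmeas (\<lambda>r. tail \<mu> r * (V \<psi> r - S n r))" by (intro bmeas_mult bmeas_tail) simp
    show "\<bar>tail \<mu> y * (V \<psi> y - S n y)\<bar> \<le> C' * rho ^ n * rho" if "0 < y" "y \<le> T" for y
      using rest[OF that] C' rho that by (intro tail_mult_bound) auto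
  qed
  have phiBd: "bmeas_le (\<lambda>r. tail \<mu> r * V_term \<psi> j r) (C * rho ^ j * rho)" for j
    unfolding bmeas_le_def
  proof (intro conjI allI impI)
    show "bmeas (\<lambda>r. tail \<mu> r * V_term \<psi> j r)" by (intro bmeas_mult bmeas_tail bmeas_cont V_term_cont[OF b])
    show "\<bar>tail \<mu> y * V_term \<psi> j y\<bar> \<le> C * rho ^ j * rho" if "0 < y" "y \<le> T" for y
      using V_term_bound(2)[of \<psi> 0 C y j] b that rho bmeas_le_nonneg[OF b]
      by (intro tail_mult_bound) (auto simp: bmeas_le_def k_exp_0)
  qed
  \<comment> \<open>The bound accompanies the identity in the induction because additivity of the
    convolution is available for bounded functions only.\<close>
  have main: "bmeas_le (\<lambda>r. \<psi> r + tail \<mu> r * S n r) (C + (\<Sum>j<n. C * rho ^ j * rho)) \<and> conv k (\<lambda>r. \<psi> r + tail \<mu> r * S n r) x = S (Suc n) x" for n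
  proof (induction n)
    case 0 thus ?case using b by (simp add: S_def V_term_0)
  next
    case (Suc n)
    have e: "(\<lambda>r. \<psi> r + tail \<mu> r * S (Suc n) r) = (\<lambda>r. 1 * (\<psi> r + tail \<mu> r * S n r) + 1 * (tail \<mu> r * V_term \<psi> n r))"
      by (auto simp: S_def algebra_simps)
    have "conv k (\<lambda>r. \<psi> r + tail \<mu> r * S (Suc n) r) x = S (Suc n) x + V_term \<psi> (Suc n) x"
      unfolding e using Suc phiBd x by (subst conv_linT) (auto simp: V_term_Suc)
    moreover have "bmeas_le (\<lambda>r. \<psi> r + tail \<mu> r * S (Suc n) r) (C + (\<Sum>j<Suc n. C * rho ^ j * rho))"
      unfolding bmeas_le_def
    proof (intro conjI allI impI)
      show "bmeas (\<lambda>r. \<psi> r + tail \<mu> r * S (Suc n) r)" unfolding e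
        using Suc phiBd[of n] by (intro bmeas_comb) (auto simp: bmeas_le_def)
      fix y assume y: "0 < y" "y \<le> T"
      have "\<bar>\<psi> y + tail \<mu> y * S n y\<bar> \<le> C + (\<Sum>j<n. C * rho ^ j * rho)" "\<bar>tail \<mu> y * V_term \<psi> n y\<bar> \<le> C * rho ^ n * rho"
        using Suc phiBd[of n] y by (auto simp: bmeas_le_def)
      moreover have "\<psi> y + tail \<mu> y * S (Suc n) y = (\<psi> y + tail \<mu> y * S n y) + tail \<mu> y * V_term \<psi> n y"
        using fun_cong[OF e, of y] by simp
      ultimately show "\<bar>\<psi> y + tail \<mu> y * S (Suc n) y\<bar> \<le> C + (\<Sum>j<Suc n. C * rho ^ j * rho)" by simp
    qed
    ultimately show ?case by (simp add: S_def)
  qed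
  have diff: "\<bar>conv k (\<lambda>r. \<psi> r + tail \<mu> r * V \<psi> r) x - S (Suc n) x\<bar> \<le> C' * rho ^ n * rho * kap x" for n
  proof -
    have e: "(\<lambda>r. tail \<mu> r * (V \<psi> r - S n r)) = (\<lambda>r. 1 * (\<psi> r + tail \<mu> r * V \<psi> r) + (-1) * (\<psi> r + tail \<mu> r * S n r))"
      by (auto simp: algebra_simps)
    have "conv k (\<lambda>r. tail \<mu> r * (V \<psi> r - S n r)) x = conv k (\<lambda>r. \<psi> r + tail \<mu> r * V \<psi> r) x - S (Suc n) x"
      unfolding e using main[of n] V_source_bmeas_le[OF b] x by (subst conv_linT) auto
    thus ?thesis using conv_kap_bound[OF tS[of n] x] by simp
  qed
  have "(\<lambda>n. C' * rho ^ n * rho * kap x) \<longlonglongrightarrow> C' * 0 * rho * kap x"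
    using rho by (intro tendsto_intros LIMSEQ_realpow_zero) auto
  hence z: "(\<lambda>n. C' * rho ^ n * rho * kap x) \<longlonglongrightarrow> 0" by simp
  have "(\<lambda>n. conv k (\<lambda>r. \<psi> r + tail \<mu> r * V \<psi> r) x - S (Suc n) x) \<longlonglongrightarrow> 0"
    by (rule Lim_null_comparison[OF _ z]) (use diff in auto)
  hence "(\<lambda>n. S (Suc n) x) \<longlonglongrightarrow> conv k (\<lambda>r. \<psi> r + tail \<mu> r * V \<psi> r) x"
    using tendsto_diff[OF tendsto_const[of "conv k (\<lambda>r. \<psi> r + tail \<mu> r * V \<psi> r) x"]] by fastforce
  moreover have "(\<lambda>n. S (Suc n) x) \<longlonglongrightarrow> V \<psi> x"
    unfolding V_V_term S_def by (intro LIMSEQ_Suc summable_LIMSEQ V_summable[OF b x])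
  ultimately show ?thesis by (rule LIMSEQ_unique[symmetric])
qed

text \<open>The bound on \<open>R\<close> by a multiple of \<open>kap\<close> places
  \<open>R\<close> in the space where the equation contracts: each application gains a factor
  \<open>rho\<close> for the difference of two solutions. A bound by a constant would give no
  contraction, since \<open>K_op\<close> maps the constant 1 to itself.\<close>

lemma V_unique:
  assumes z: "bmeas_le z C" and R: "bmeas R" "\<And>x. 0 < x \<Longrightarrow> x \<le> T \<Longrightarrow> \<bar>R x\<bar> \<le> D * kap x"
    and eq: "\<And>x. 0 < x \<Longrightarrow> x \<le> T \<Longrightarrow> R x = conv k (\<lambda>r. z r + tail \<mu> r * R r) x"
    and x: "0 < x" "x \<le> T"
  shows "R x = V z x"
proof -
  define E where "E = \<bar>D\<bar> + C / (1 - rho)"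
  have C0: "C \<ge> 0" by (rule bmeas_le_nonneg[OF z])
  have E: "E \<ge> 0" using C0 rho by (simp add: E_def)
  have DB: "bmeas (\<lambda>r. R r - V z r)" using bmeas_comb[OF R(1) V_bmeas[OF z], of 1 "-1"] by simp
  have RB: "bmeas_le (\<lambda>r. z r + tail \<mu> r * R r) (C + \<bar>D\<bar> * rho)"
    unfolding bmeas_le_def
  proof (intro conjI allI impI)
    show "bmeas (\<lambda>r. z r + tail \<mu> r * R r)" using z R by (intro bmeas_add bmeas_mult bmeas_tail) (auto simp: bmeas_le_def)
    fix y assume y: "0 < y" "y \<le> T"
    have "\<bar>R y\<bar> \<le> \<bar>D\<bar> * kap y" using R(2)[OF y] kap_nonneg[of y] by (meson abs_ge_self mult_right_mono order_trans)
    hence "\<bar>tail \<mu> y * R y\<bar> \<le> \<bar>D\<bar> * rho" using y by (intro tail_mult_bound) auto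
    moreover have "\<bar>z y\<bar> \<le> C" using z y by (simp add: bmeas_le_def)
    ultimately show "\<bar>z y + tail \<mu> y * R y\<bar> \<le> C + \<bar>D\<bar> * rho" by linarith
  qed
  have bd: "\<bar>R y - V z y\<bar> \<le> E * rho ^ n * kap y" if "0 < y" "y \<le> T" for n y
    using that
  proof (induction n arbitrary: y)
    case 0
    have "\<bar>R y\<bar> \<le> \<bar>D\<bar> * kap y" using R(2)[OF 0] kap_nonneg[of y] by (meson abs_ge_self mult_right_mono order_trans)
    thus ?case using V_bound[OF z 0] by (simp add: E_def algebra_simps)
  next
    case (Suc n)
    have "bmeas_le (\<lambda>r. tail \<mu> r * (R r - V z r)) (E * rho ^ n * rho)"
      unfolding bmeas_le_def
    proof (intro conjI allI impI)
      show "bmeas (\<lambda>r. tail \<mu> r * (R r - V z r))" by (intro bmeas_mult bmeas_tail DB)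
      show "\<bar>tail \<mu> w * (R w - V z w)\<bar> \<le> E * rho ^ n * rho" if "0 < w" "w \<le> T" for w
        using Suc.IH[OF that] that E rho by (intro tail_mult_bound) auto
    qed
    hence "\<bar>conv k (\<lambda>r. tail \<mu> r * (R r - V z r)) y\<bar> \<le> E * rho ^ n * rho * kap y"
      by (rule conv_kap_bound[OF _ Suc.prems])
    moreover have "(\<lambda>r. tail \<mu> r * (R r - V z r)) = (\<lambda>r. 1 * (z r + tail \<mu> r * R r) + (-1) * (z r + tail \<mu> r * V z r))"
      by (auto simp: algebra_simps)
    hence "conv k (\<lambda>r. tail \<mu> r * (R r - V z r)) y = R y - V z y"
      using conv_linT[OF RB V_source_bmeas_le[OF z] Suc.prems(2), of 1 "-1"] eq[OF Suc.prems] V_eq[OF z Suc.prems] by simp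
    ultimately show ?case by (simp add: mult_ac)
  qed
  have "(\<lambda>n. E * rho ^ n * kap x) \<longlonglongrightarrow> E * 0 * kap x"
    using rho by (intro tendsto_intros LIMSEQ_realpow_zero) auto
  hence zr: "(\<lambda>n. E * rho ^ n * kap x) \<longlonglongrightarrow> 0" by simp
  have "(\<lambda>n::nat. R x - V z x) \<longlonglongrightarrow> 0"
    by (rule Lim_null_comparison[OF _ zr]) (use bd[OF x] in auto)
  thus ?thesis by (simp add: LIMSEQ_const_iff)
qed

lemma bmeas_le_comb: "bmeas_le h C \<Longrightarrow> bmeas_le g D \<Longrightarrow> bmeas_le (\<lambda>s. a * h s + b * g s) (\<bar>a\<bar> * C + \<bar>b\<bar> * D)"
  unfolding bmeas_le_def
proof (intro conjI allI impI, goal_cases)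
  case 1 thus ?case by (intro bmeas_comb) auto
next
  case (2 x)
  have "\<bar>a * h x + b * g x\<bar> \<le> \<bar>a\<bar> * \<bar>h x\<bar> + \<bar>b\<bar> * \<bar>g x\<bar>" by (metis abs_mult abs_triangle_ineq)
  also have "\<dots> \<le> \<bar>a\<bar> * C + \<bar>b\<bar> * D" using 2 by (intro add_mono mult_left_mono) auto
  finally show ?case .
qed

text \<open>Both sides solve the same equation in the class bounded by \<open>kap\<close>, which
  avoids manipulating the series term by term.\<close>

lemma V_lin:
  assumes h: "bmeas_le h C" and g: "bmeas_le g D" and x: "0 < x" "x \<le> T"
  shows "V (\<lambda>s. a * h s + b * g s) x = a * V h x + b * V g x"
proof (rule V_unique[symmetric, OF bmeas_le_comb[OF h g]])
  show "bmeas (\<lambda>x. a * V h x + b * V g x)" by (intro bmeas_comb V_bmeas[OF h] V_bmeas[OF g])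
  show "\<bar>a * V h y + b * V g y\<bar> \<le> (\<bar>a\<bar> * (C / (1 - rho)) + \<bar>b\<bar> * (D / (1 - rho))) * kap y" if y: "0 < y" "y \<le> T" for y
  proof -
    have "\<bar>a * V h y + b * V g y\<bar> \<le> \<bar>a\<bar> * \<bar>V h y\<bar> + \<bar>b\<bar> * \<bar>V g y\<bar>" by (metis abs_mult abs_triangle_ineq)
    also have "\<dots> \<le> \<bar>a\<bar> * (C / (1 - rho) * kap y) + \<bar>b\<bar> * (D / (1 - rho) * kap y)"
      by (intro add_mono mult_left_mono V_bound[OF h y] V_bound[OF g y]) auto
    finally show ?thesis by (simp add: algebra_simps)
  qed
  show "a * V h y + b * V g y = conv k (\<lambda>r. a * h r + b * g r + tail \<mu> r * (a * V h r + b * V g r)) y" if y: "0 < y" "y \<le> T" for y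
  proof -
    have "(\<lambda>r. a * h r + b * g r + tail \<mu> r * (a * V h r + b * V g r)) = (\<lambda>r. a * (h r + tail \<mu> r * V h r) + b * (g r + tail \<mu> r * V g r))"
      by (auto simp: algebra_simps)
    thus ?thesis using conv_linT[OF V_source_bmeas_le[OF h] V_source_bmeas_le[OF g] y(2)] V_eq[OF h y] V_eq[OF g y] by simp
  qed
qed (use x in auto)

lemma f_tendsto_inv: assumes "e > 0" obtains c where "c > 0" "1 / f c < e"
proof -
  have "\<forall>\<^sub>F c in at_top. 1 / f c < e" using f_inf assms by (rule order_tendstoD)
  moreover have "\<forall>\<^sub>F c in at_top. (c::real) > 0" by (rule eventually_gt_at_top)
  ultimately have "\<forall>\<^sub>F c in at_top. c > 0 \<and> 1 / f c < e" by eventually_elim simp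
  then obtain c where "c > 0 \<and> 1 / f c < e" unfolding eventually_at_top_linorder by blast
  thus ?thesis using that by blast
qed

text \<open>In the norm weighted by $e^{-cx}$ the operator $V$ has norm at most
  $(f(c)(1 - \rho))^{-1}$, which is below $1/(2|\lambda|)$ for large $c$.\<close>

lemma V_quasinilpotent:
  assumes w: "bmeas_le w C" and eq: "\<And>x. 0 < x \<Longrightarrow> x \<le> T \<Longrightarrow> w x = l * V w x" and x: "0 < x" "x \<le> T"
  shows "w x = 0"
proof -
  have "(1 - rho) / (2 * (\<bar>l\<bar> + 1)) > 0" using rho by simp
  then obtain c where c: "c > 0" "1 / f c < (1 - rho) / (2 * (\<bar>l\<bar> + 1))" by (rule f_tendsto_inv)
  have C: "C \<ge> 0" by (rule bmeas_le_nonneg[OF w])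
  have bd: "\<bar>w y\<bar> \<le> C * (1/2) ^ n * exp (c * y)" if "0 < y" "y \<le> T" for y n
    using that
  proof (induction n arbitrary: y)
    case 0
    have "\<bar>w y\<bar> \<le> C * 1" using w 0 by (simp add: bmeas_le_def)
    also have "\<dots> \<le> C * exp (c * y)" using C c 0 by (intro mult_left_mono) auto
    finally show ?case by simp
  next
    case (Suc n)
    define N where "N = C * (1/2) ^ n"
    have N: "N \<ge> 0" using C by (simp add: N_def)
    have "\<bar>V w y\<bar> \<le> N / (1 - rho) * k_exp c y"
      using Suc c w unfolding N_def by (intro V_bound_exp) (auto simp: bmeas_le_def)
    also have "\<dots> \<le> N / (1 - rho) * (exp (c * y) / f c)"
      unfolding k_exp_def using N rho c Suc.prems by (intro mult_left_mono conv_exp_bound) auto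
    also have "\<dots> = N / (1 - rho) * exp (c * y) * (1 / f c)" by simp
    also have "\<dots> \<le> N / (1 - rho) * exp (c * y) * ((1 - rho) / (2 * (\<bar>l\<bar> + 1)))"
      using N rho c by (intro mult_left_mono) auto
    also have "\<dots> = N * exp (c * y) / (2 * (\<bar>l\<bar> + 1))" using rho by simp
    finally have "\<bar>l\<bar> * \<bar>V w y\<bar> \<le> \<bar>l\<bar> * (N * exp (c * y) / (2 * (\<bar>l\<bar> + 1)))" by (intro mult_left_mono) auto
    also have "\<dots> = (\<bar>l\<bar> / (\<bar>l\<bar> + 1)) * (N * exp (c * y) / 2)" by simp
    also have "\<dots> \<le> 1 * (N * exp (c * y) / 2)" using N by (intro mult_right_mono) auto
    finally show ?case using eq[OF Suc.prems] by (simp add: abs_mult N_def)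
  qed
  have "(\<lambda>n. C * (1/2) ^ n * exp (c * x)) \<longlonglongrightarrow> C * 0 * exp (c * x)"
    by (intro tendsto_intros LIMSEQ_realpow_zero) auto
  hence zr: "(\<lambda>n. C * (1/2) ^ n * exp (c * x)) \<longlonglongrightarrow> 0" by simp
  have "(\<lambda>n::nat. w x) \<longlonglongrightarrow> 0"
    by (rule Lim_null_comparison[OF _ zr]) (use bd[OF x] in auto)
  thus ?thesis by (simp add: LIMSEQ_const_iff)
qed

end

text \<open>The limit 0 at 0+ is what makes the extension by zero continuous to the left of T. At T
  itself the extension may jump, hence the closed half-line up to T.\<close>

lemma C_infty_iff:
  assumes T: "T > 0"
  shows "g \<in> C_infty T \<longleftrightarrow> continuous_on {..T} g \<and> (\<forall>x. x \<notin> {0<..T} \<longrightarrow> g x = 0)"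
proof
  assume g: "g \<in> C_infty T"
  hence c: "continuous_on {0<..T} g" and l: "(g \<longlongrightarrow> 0) (at_right 0)" and z: "\<And>x. x \<notin> {0<..T} \<Longrightarrow> g x = 0"
    by (auto simp: C_infty_def)
  have "continuous_on {0..T} g"
  proof (rule continuous_on_IccI[OF _ _ _ T])
    show "(g \<longlongrightarrow> g 0) (at_right 0)" using l z[of 0] by simp
    have "(g \<longlongrightarrow> g T) (at T within {0<..T})" using c T by (auto simp: continuous_on_def)
    moreover have "at T within {0<..T} = at_left T"
      by (rule at_within_nhd[of _ "{0<..}"]) (use T in auto)
    ultimately show "(g \<longlongrightarrow> g T) (at_left T)" by simp
    show "g \<midarrow>x\<rightarrow> g x" if "0 < x" "x < T" for x
    proof -
      have "continuous_on {0<..<T} g" by (rule continuous_on_subset[OF c]) auto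
      thus ?thesis using that continuous_on_eq_continuous_at[of "{0<..<T}" g] by (simp add: isCont_def)
    qed
  qed
  moreover have "continuous_on {..0} g"
    by (rule continuous_on_eq[OF continuous_on_const[of _ 0]]) (use z in auto)
  moreover have "{..T} = {..0} \<union> {0..T}" using T by auto
  ultimately have "continuous_on {..T} g" by (auto intro!: continuous_on_closed_Un)
  thus "continuous_on {..T} g \<and> (\<forall>x. x \<notin> {0<..T} \<longrightarrow> g x = 0)" using z by blast
next
  assume g: "continuous_on {..T} g \<and> (\<forall>x. x \<notin> {0<..T} \<longrightarrow> g x = 0)"
  have "\<forall>x\<in>{..T}. (g \<longlongrightarrow> g x) (at x within {..T})" using g unfolding continuous_on_def by (rule conjunct1)
  hence "(g \<longlongrightarrow> g 0) (at 0 within {..T})" by (rule bspec) (use T in simp)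
  hence "(g \<longlongrightarrow> g 0) (at 0 within {0<..T})" by (rule tendsto_within_subset) auto
  moreover have "at 0 within {0<..T} = at_right 0" by (rule at_within_nhd[of _ "{..<T}"]) (use T in auto)
  ultimately have "(g \<longlongrightarrow> 0) (at_right 0)" using g by simp
  moreover have "continuous_on {0<..T} g" by (rule continuous_on_subset[OF conjunct1[OF g]]) auto
  ultimately show "g \<in> C_infty T" using g by (simp add: C_infty_def)
qed

lemma C_infty_bounded: assumes "T > 0" "g \<in> C_infty T" obtains C where "\<And>x. \<bar>g x\<bar> \<le> C" "C \<ge> 0"
proof -
  have "continuous_on {0..T} g" using assms C_infty_iff[OF assms(1)] continuous_on_subset[of "{..T}" g "{0..T}"] by auto
  hence "bounded (g ` {0..T})" by (intro compact_imp_bounded compact_continuous_image) auto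
  then obtain C where C: "C > 0" "\<forall>y\<in>g ` {0..T}. norm y \<le> C" using bounded_pos by blast
  have "\<bar>g x\<bar> \<le> C" for x
  proof (cases "x \<in> {0<..T}")
    case True thus ?thesis using C(2) by auto
  next
    case False thus ?thesis using C(1) assms(2) by (auto simp: C_infty_def)
  qed
  thus ?thesis using that[of C] C(1) by simp
qed

lemma C_infty_measurable: "T > 0 \<Longrightarrow> g \<in> C_infty T \<Longrightarrow> g \<in> borel_measurable borel"
proof -
  assume "T > 0" "g \<in> C_infty T"
  hence c: "continuous_on {0<..T} g" and z: "\<And>x. x \<notin> {0<..T} \<Longrightarrow> g x = 0" by (auto simp: C_infty_def)
  have "(\<lambda>x. indicator {0<..T} x *\<^sub>R g x) \<in> borel_measurable borel"
    by (rule borel_measurable_continuous_on_indicator) (use c in auto)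
  also have "(\<lambda>x. indicator {0<..T} x *\<^sub>R g x) = g" using z by (auto simp: indicator_def fun_eq_iff)
  finally show ?thesis .
qed

lemma zext_id: "g \<in> C_infty T \<Longrightarrow> zext T g = g"
  by (auto simp: zext_def C_infty_def fun_eq_iff)

section \<open>The censored derivative inverts the censored integral\<close>

context censored_pair
begin

lemma C_infty_bmeas_le: "g \<in> C_infty T \<Longrightarrow> (\<And>x. \<bar>g x\<bar> \<le> C) \<Longrightarrow> bmeas_le g C"
  unfolding bmeas_le_def bmeas_def using C_infty_measurable[OF T] by (simp add: zext_id)

lemma C_infty_ex_bmeas_le: assumes "g \<in> C_infty T" obtains C where "bmeas_le g C"
  using C_infty_bounded[OF T assms] C_infty_bmeas_le[OF assms] by metis

lemma V_cont: "bmeas_le g C \<Longrightarrow> continuous_on {0<..T} (V g)"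
proof -
  assume g: "bmeas_le g C"
  have "continuous_on {0<..T} (conv k (\<lambda>r. g r + tail \<mu> r * V g r))"
    using V_source_bmeas_le[OF g] by (intro conv_step(1)[where c=0 and N="C + C / (1 - rho) * rho"]) (auto simp: bmeas_le_def)
  thus ?thesis by (rule continuous_on_eq) (use V_eq[OF g] in auto)
qed

lemma V_C_infty: "bmeas_le g C \<Longrightarrow> zext T (V g) \<in> C_infty T"
proof -
  assume g: "bmeas_le g C"
  have "continuous_on {0<..T} (zext T (V g))"
    by (rule continuous_on_eq[OF V_cont[OF g]]) (simp add: zext_def)
  moreover have "(zext T (V g) \<longlongrightarrow> 0) (at_right 0)"
  proof (rule Lim_null_comparison)
    have "\<forall>\<^sub>F x in at_right (0::real). x \<in> {0<..<T}" by (rule eventually_at_right_real[OF T])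
    thus "\<forall>\<^sub>F x in at_right 0. norm (zext T (V g) x) \<le> C / (1 - rho) * kap x"
      by eventually_elim (use V_bound[OF g] in \<open>auto simp: zext_def\<close>)
    show "((\<lambda>x. C / (1 - rho) * kap x) \<longlongrightarrow> 0) (at_right 0)"
      by (rule tendsto_mult_right_zero[OF kap_tendsto_0])
  qed
  ultimately show ?thesis by (simp add: C_infty_def zext_def)
qed

definition tailz :: "real \<Rightarrow> real" where "tailz x = indicator {0<..} x * tail \<mu> x"

lemma tailz_measurable[measurable]: "tailz \<in> borel_measurable borel"
proof -
  have "(\<lambda>x. indicator {0<..} x *\<^sub>R tail \<mu> x) \<in> borel_measurable borel"
    by (rule borel_measurable_continuous_on_indicator) (use tail_cont in auto)
  thus ?thesis by (simp add: tailz_def[abs_def])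
qed

lemma tailz_nonneg: "tailz x \<ge> 0" by (simp add: tailz_def tail_nonneg)
lemma tail_nn_tailz: "tail_nn x = ennreal (tailz x)" by (auto simp: tail_nn_def tailz_def indicator_def)

text \<open>Associativity: convolving the tail with \<open>k\<close> gives the constant 1 by the
  Sonine identity. That identity is needed for almost every r only, since r is integrated out
  against \<open>h\<close>.\<close>

lemma conv_tail_conv_k:
  assumes h: "bmeas_le h C" and x: "0 < x" "x \<le> T"
  shows "conv (tail \<mu>) (\<lambda>s. conv k h s) x = (LBINT r:{0<..<x}. h r)"
proof -
  define hh where "hh = zext T h"
  have [measurable]: "hh \<in> borel_measurable borel" using h by (simp add: bmeas_le_def bmeas_def hh_def)
  have C: "C \<ge> 0" by (rule bmeas_le_nonneg[OF h])
  have itail: "\<bar>hh r\<bar> \<le> C * indicator {0<..T} r" for r using h C by (auto simp: hh_def zext_def bmeas_le_def indicator_def)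
  have hz: "hh r = 0" if "r \<le> 0" for r using that by (simp add: hh_def zext_def)
  have inner_nn: "AE r in lborel. (\<integral>\<^sup>+s. ennreal (tailz (x - s) * kz (s - r)) \<partial>lborel) = indicator {..<x} r"
  proof -
    \<comment> \<open>The Sonine identity at the point x - r; the reflection r \<mapsto> x - r
      preserves Lebesgue measure and hence null sets.\<close>
    have "AE r in lborel. (\<integral>\<^sup>+s. tail_nn (x - r - s) * k_nn s \<partial>lborel) = indicator {0<..} (x - r)"
    proof -
      have eq: "distr lborel borel (\<lambda>r::real. x + (-1) * r) = lborel"
        using lborel_real_affine[of "-1" x] by (simp add: density_1)
      have "AE r in distr lborel borel (\<lambda>r::real. x + (-1) * r). (\<integral>\<^sup>+s. tail_nn (r - s) * k_nn s \<partial>lborel) = indicator {0<..} r"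
        unfolding eq by (rule sonine_AE)
      hence "AE r in lborel. (\<integral>\<^sup>+s. tail_nn (x + (-1) * r - s) * k_nn s \<partial>lborel) = indicator {0<..} (x + (-1) * r)"
        by (subst (asm) AE_distr_iff) auto
      thus ?thesis by (simp add: algebra_simps)
    qed
    thus ?thesis
    proof eventually_elim
      case (elim r)
      have "(\<integral>\<^sup>+s. ennreal (tailz (x - s) * kz (s - r)) \<partial>lborel) = (\<integral>\<^sup>+s. tail_nn (x - r - s) * k_nn s \<partial>lborel)"
        using nn_integral_real_affine[of "\<lambda>s. ennreal (tailz (x - s) * kz (s - r))" 1 r]
        by (simp add: tail_nn_tailz k_nn_kz ennreal_mult tailz_nonneg kz_nonneg diff_diff_eq)
      thus ?case using elim by (simp add: indicator_def)
    qed
  qed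
  have inner: "AE r in lborel. (\<integral>s. tailz (x - s) * kz (s - r) \<partial>lborel) = indicator {..<x} r"
    using inner_nn
  proof eventually_elim
    case (elim r)
    have "(\<integral>s. tailz (x - s) * kz (s - r) \<partial>lborel) = enn2real (\<integral>\<^sup>+s. ennreal (tailz (x - s) * kz (s - r)) \<partial>lborel)"
      by (intro integral_eq_nn_integral) (auto simp: tailz_nonneg kz_nonneg)
    thus ?case using elim by (simp add: indicator_def)
  qed
  have int: "integrable (lborel \<Otimes>\<^sub>M lborel) (\<lambda>(r, s). tailz (x - s) * kz (s - r) * hh r)"
  proof (rule integrableI_bounded)
    have "(\<integral>\<^sup>+z. ennreal (norm (case z of (r, s) \<Rightarrow> tailz (x - s) * kz (s - r) * hh r)) \<partial>(lborel \<Otimes>\<^sub>M lborel))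
       = (\<integral>\<^sup>+r. (\<integral>\<^sup>+s. ennreal (norm (tailz (x - s) * kz (s - r) * hh r)) \<partial>lborel) \<partial>lborel)"
      by (subst lborel.nn_integral_fst[symmetric]) auto
    also have "\<dots> \<le> (\<integral>\<^sup>+r. ennreal C * indicator {0<..T} r \<partial>lborel)"
    proof (rule nn_integral_mono_AE)
      show "AE r in lborel. (\<integral>\<^sup>+s. ennreal (norm (tailz (x - s) * kz (s - r) * hh r)) \<partial>lborel) \<le> ennreal C * indicator {0<..T} r"
        using inner_nn
      proof eventually_elim
        case (elim r)
        have "(\<integral>\<^sup>+s. ennreal (norm (tailz (x - s) * kz (s - r) * hh r)) \<partial>lborel) = (\<integral>\<^sup>+s. ennreal (tailz (x - s) * kz (s - r)) * ennreal \<bar>hh r\<bar> \<partial>lborel)"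
          by (intro nn_integral_cong) (simp add: abs_mult tailz_nonneg kz_nonneg ennreal_mult)
        also have "\<dots> = indicator {..<x} r * ennreal \<bar>hh r\<bar>" using elim by (simp add: nn_integral_multc)
        also have "\<dots> \<le> 1 * ennreal (C * indicator {0<..T} r)"
          by (intro mult_mono ennreal_leI itail) (auto simp: indicator_def)
        also have "\<dots> = ennreal C * indicator {0<..T} r" by (simp add: indicator_def)
        finally show ?case .
      qed
    qed
    also have "\<dots> < \<infinity>" using T by (simp add: nn_integral_cmult ennreal_mult_less_top)
    finally show "(\<integral>\<^sup>+z. ennreal (norm (case z of (r, s) \<Rightarrow> tailz (x - s) * kz (s - r) * hh r)) \<partial>(lborel \<Otimes>\<^sub>M lborel)) < \<infinity>" .
  qed measurable
  have "conv (tail \<mu>) (\<lambda>s. conv k h s) x = (\<integral>s. (\<integral>r. tailz (x - s) * kz (s - r) * hh r \<partial>lborel) \<partial>lborel)"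
    unfolding conv_def[of "tail \<mu>"] set_lebesgue_integral_def
  proof (rule Bochner_Integration.integral_cong)
    fix s :: real
    show "indicator {0<..<x} s *\<^sub>R (tail \<mu> (x - s) * conv k h s) = (\<integral>r. tailz (x - s) * kz (s - r) * hh r \<partial>lborel)"
    proof (cases "0 < s \<and> s < x")
      case True
      hence "conv k h s = (\<integral>r. kz (s - r) * (indicator {0<..} r * hh r) \<partial>lborel)"
        using conv_zext[of s k h] x conv_eq[of hh s] by (simp add: hh_def)
      also have "\<dots> = (\<integral>r. kz (s - r) * hh r \<partial>lborel)"
        by (intro Bochner_Integration.integral_cong) (auto simp: indicator_def hz)
      finally show ?thesis using True by (simp add: tailz_def mult.assoc)
    next
      case False
      have "tailz (x - s) * kz (s - r) * hh r = 0" for r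
      proof (cases "s \<le> 0")
        case True thus ?thesis by (cases "r \<le> 0") (auto simp: hz kz_0)
      next
        case s: False thus ?thesis using False by (simp add: tailz_def)
      qed
      hence "(\<lambda>r. tailz (x - s) * kz (s - r) * hh r) = (\<lambda>_. 0)" by auto
      thus ?thesis using False by (simp add: indicator_def)
    qed
  qed simp
  also have "\<dots> = (\<integral>r. (\<integral>s. tailz (x - s) * kz (s - r) * hh r \<partial>lborel) \<partial>lborel)"
    using lborel_pair.Fubini_integral[of "\<lambda>r s. tailz (x - s) * kz (s - r) * hh r"] int by simp
  also have "\<dots> = (\<integral>r. indicator {..<x} r * hh r \<partial>lborel)"
  proof (rule integral_cong_AE)
    show "AE r in lborel. (\<integral>s. tailz (x - s) * kz (s - r) * hh r \<partial>lborel) = indicator {..<x} r * hh r"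
      using inner by eventually_elim simp
  qed measurable
  also have "\<dots> = (LBINT r:{0<..<x}. h r)"
    unfolding set_lebesgue_integral_def using x
    by (intro Bochner_Integration.integral_cong) (auto simp: indicator_def hh_def zext_def)
  finally show ?thesis .
qed

text \<open>\<open>h\<close> need not be continuous at 0, so the integral is split at a = x/2. The
  part over (0,a) is constant in y, and the fundamental theorem applies on [a,T].\<close>

lemma indefinite_integral_deriv:
  assumes h: "bmeas_le h C" and c: "continuous_on {0<..T} h" and x: "0 < x" "x \<le> T"
  shows "((\<lambda>y. LBINT r:{0<..<y}. h r) has_real_derivative h x) (at x within {0<..T})"
proof -
  define a where "a = x / 2"
  have a: "0 < a" "a < x" using x by (auto simp: a_def)
  have [measurable]: "zext T h \<in> borel_measurable borel" using h by (simp add: bmeas_le_def bmeas_def)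
  have si: "set_integrable lborel A h" if "A \<subseteq> {0<..T}" and [measurable]: "A \<in> sets borel" for A
  proof -
    have "integrable lborel (\<lambda>r. indicator A r * zext T h r)"
    proof (rule Bochner_Integration.integrable_bound)
      show "integrable lborel (\<lambda>r. C * indicator {0<..T} r :: real)"
        using T by (intro integrable_mult_right) (simp add: integrable_indicator_iff)
      show "AE r in lborel. norm (indicator A r * zext T h r) \<le> norm (C * indicator {0<..T} r)"
        using h bmeas_le_nonneg[OF h] that by (auto simp: indicator_def bmeas_le_def zext_def intro!: AE_I2)
    qed measurable
    also have "(\<lambda>r. indicator A r * zext T h r) = (\<lambda>r. indicator A r *\<^sub>R h r)"
      using that(1) by (auto simp: indicator_def zext_def fun_eq_iff)
    finally show ?thesis by (simp add: set_integrable_def)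
  qed
  have split: "(LBINT r:{0<..<y}. h r) = (LBINT r:{0<..<a}. h r) + integral {a..y} h" if y: "y \<in> {a..T}" for y
  proof -
    have "(LBINT r:{0<..<y}. h r) = (LBINT r:{0<..<a} \<union> {a..y}. h r)"
      unfolding set_lebesgue_integral_def
    proof (rule integral_cong_AE)
      show "AE r in lborel. indicator {0<..<y} r *\<^sub>R h r = indicator ({0<..<a} \<union> {a..y}) r *\<^sub>R h r"
        using AE_lborel_singleton[of y] by eventually_elim (use a y in \<open>auto simp: indicator_def\<close>)
      show "(\<lambda>r. indicator {0<..<y} r *\<^sub>R h r) \<in> borel_measurable lborel"
        by (rule borel_measurable_integrable, rule si[unfolded set_integrable_def]) (use y in auto)
      show "(\<lambda>r. indicator ({0<..<a} \<union> {a..y}) r *\<^sub>R h r) \<in> borel_measurable lborel"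
        by (rule borel_measurable_integrable, rule si[unfolded set_integrable_def]) (use a y in auto)
    qed
    also have "\<dots> = (LBINT r:{0<..<a}. h r) + (LBINT r:{a..y}. h r)"
      using a y by (intro set_integral_Un si) auto
    also have "(LBINT r:{a..y}. h r) = integral {a..y} h"
      using a y by (intro set_borel_integral_eq_integral(2) si) auto
    finally show ?thesis .
  qed
  have "((\<lambda>y. integral {a..y} h) has_vector_derivative h x) (at x within {a..T})"
    by (rule integral_has_vector_derivative) (use a x c in \<open>auto intro: continuous_on_subset\<close>)
  hence "((\<lambda>y. integral {a..y} h) has_real_derivative h x) (at x within {a..T})"
    by (simp add: has_real_derivative_iff_has_vector_derivative)
  hence "((\<lambda>y. (LBINT r:{0<..<a}. h r) + integral {a..y} h) has_real_derivative h x) (at x within {a..T})"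
    by (auto intro!: derivative_eq_intros)
  hence "((\<lambda>y. LBINT r:{0<..<y}. h r) has_real_derivative h x) (at x within {a..T})"
  proof (rule has_field_derivative_transform_within[where d=1])
    show "(LBINT r:{0<..<a}. h r) + integral {a..y} h = (LBINT r:{0<..<y}. h r)" if "y \<in> {a..T}" for y
      using split[OF that] by (rule sym)
  qed (use a x in auto)
  moreover have "at x within {a..T} = at x within {0<..T}"
    by (rule at_within_nhd[of _ "{a<..}"]) (use a in auto)
  ultimately show ?thesis by simp
qed

text \<open>By the fixed point equation \<open>V g\<close> is k * (g + tail \<open>V g\<close>).
  Convolution with the tail turns this into the primitive of g + tail \<open>V g\<close>, so
  subtracting the potential term of \<open>D_Ce\<close> leaves exactly g.\<close>

lemma V_tail_deriv:
  assumes g: "g \<in> C_infty T" and x: "0 < x" "x \<le> T"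
  shows "(conv (tail \<mu>) (zext T (V g)) has_real_derivative (g x + tail \<mu> x * V g x)) (at x within {0<..T})"
    and "continuous_on {0<..T} (\<lambda>x. g x + tail \<mu> x * V g x)"
proof -
  obtain C where C: "bmeas_le g C" using C_infty_ex_bmeas_le[OF g] by blast
  let ?h = "\<lambda>r. g r + tail \<mu> r * V g r"
  show c: "continuous_on {0<..T} ?h"
    by (intro continuous_intros V_cont[OF C] continuous_on_subset[OF tail_cont]) (use g in \<open>auto simp: C_infty_def\<close>)
  have e: "conv (tail \<mu>) (zext T (V g)) y = (LBINT r:{0<..<y}. ?h r)" if y: "0 < y" "y \<le> T" for y
  proof -
    have "conv (tail \<mu>) (zext T (V g)) y = conv (tail \<mu>) (\<lambda>s. conv k ?h s) y"
      by (rule conv_cong) (use y V_eq[OF C] in \<open>auto simp: zext_def\<close>)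
    thus ?thesis using conv_tail_conv_k[OF V_source_bmeas_le[OF C] y] by simp
  qed
  show "(conv (tail \<mu>) (zext T (V g)) has_real_derivative ?h x) (at x within {0<..T})"
    by (rule has_field_derivative_transform_within[OF indefinite_integral_deriv[OF V_source_bmeas_le[OF C] c x], where d=1])
       (use x e in auto)
qed

lemma V_C_tail:
  assumes g: "g \<in> C_infty T" shows "zext T (V g) \<in> C_tail \<mu> T"
proof -
  obtain C where C: "bmeas_le g C" using C_infty_ex_bmeas_le[OF g] by blast
  have z: "zext T (V g) \<in> C_infty T" by (rule V_C_infty[OF C])
  obtain B where B: "\<And>x. \<bar>zext T (V g) x\<bar> \<le> B" using C_infty_bounded[OF T z] by blast
  have "set_integrable lborel {0<..T} (zext T (V g))"
    unfolding set_integrable_def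
  proof (rule Bochner_Integration.integrable_bound)
    show "integrable lborel (\<lambda>r. B * indicator {0<..T} r :: real)"
      using T by (intro integrable_mult_right) (simp add: integrable_indicator_iff)
    show "AE x in lborel. norm (indicator {0<..T} x *\<^sub>R zext T (V g) x) \<le> norm (B * indicator {0<..T} x)"
      using B by (auto simp: indicator_def intro!: AE_I2 order_trans[OF B])
    have [measurable]: "zext T (V g) \<in> borel_measurable borel" by (rule C_infty_measurable[OF T z])
    show "(\<lambda>x. indicator {0<..T} x *\<^sub>R zext T (V g) x) \<in> borel_measurable lborel" by measurable
  qed
  moreover have "continuous_on {0<..T} (zext T (V g))" using z by (simp add: C_infty_def)
  ultimately show ?thesis unfolding C_tail_def
    using V_tail_deriv[OF g] T by (auto intro!: exI[of _ "\<lambda>x. g x + tail \<mu> x * V g x"])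
qed

lemma D_Ce_V:
  assumes g: "g \<in> C_infty T" and x: "0 < x" "x \<le> T"
  shows "D_Ce \<mu> T (zext T (V g)) x = g x"
proof -
  \<comment> \<open>Derivatives within the interval are unique only at limit points; this covers the
    right end T, where the derivative is one-sided.\<close>
  have nt: "at x within {0<..T} \<noteq> bot"
  proof -
    have "x islimpt {0<..T}"
      by (rule islimpt_subset[of x "{0<..<x}"]) (use x in \<open>auto intro: islimpt_greaterThanLessThan2\<close>)
    thus ?thesis by (simp add: trivial_limit_within)
  qed
  have "D_R \<mu> T (zext T (V g)) x = g x + tail \<mu> x * V g x"
    unfolding D_R_def
    by (rule vector_derivative_within[OF nt])
       (use V_tail_deriv(1)[OF g x] in \<open>simp add: has_real_derivative_iff_has_vector_derivative\<close>)
  thus ?thesis unfolding D_Ce_def using x by (simp add: zext_def)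
qed

end

section \<open>First passage of an increasing path\<close>

definition nice_path :: "(real \<Rightarrow> real) \<Rightarrow> bool" where
  "nice_path p \<longleftrightarrow> p 0 = 0 \<and> mono_on {0..} p \<and> (\<forall>t\<ge>0. continuous (at_right t) p)"

text \<open>Passage time and left limit, rewritten through rational times so that they are measurable
  functions of the path.\<close>

definition passQ :: "(real \<Rightarrow> real) \<Rightarrow> real \<Rightarrow> ereal" where
  "passQ p y = (INF q\<in>{q. q \<in> \<rat> \<and> 0 < q}. if p q > y then ereal q else \<infinity>)"

definition leftQ :: "(real \<Rightarrow> real) \<Rightarrow> ereal \<Rightarrow> real" where
  "leftQ p s = real_of_ereal (SUP q\<in>{q. q \<in> \<rat> \<and> 0 \<le> q}. if ereal q < s then ereal (p q) else 0)"

definition discount :: "real \<Rightarrow> ereal \<Rightarrow> real" where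
  "discount l s = (if s = \<infinity> then 0 else exp (-(l * real_of_ereal s)))"

lemma nice_mono: "nice_path p \<Longrightarrow> 0 \<le> s \<Longrightarrow> s \<le> t \<Longrightarrow> p s \<le> p t"
  by (auto simp: nice_path_def mono_on_def)

lemma nice_nonneg: "nice_path p \<Longrightarrow> 0 \<le> t \<Longrightarrow> 0 \<le> p t"
  using nice_mono[of p 0 t] by (simp add: nice_path_def)

lemma nice_near:
  assumes "nice_path p" "t \<ge> 0" "e > 0"
  obtains d where "d > 0" "\<And>s. t \<le> s \<Longrightarrow> s < t + d \<Longrightarrow> \<bar>p s - p t\<bar> < e"
proof -
  have "(p \<longlongrightarrow> p t) (at_right t)" using assms by (simp add: nice_path_def continuous_within)
  hence "\<forall>\<^sub>F s in at_right t. dist (p s) (p t) < e" using assms(3) by (rule tendstoD)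
  then obtain b where b: "b > t" "\<forall>y>t. y < b \<longrightarrow> dist (p y) (p t) < e"
    unfolding eventually_at_right_field by blast
  show ?thesis
  proof (rule that[of "b - t"])
    show "\<bar>p s - p t\<bar> < e" if "t \<le> s" "s < t + (b - t)" for s
      using b that assms(3) by (cases "s = t") (auto simp: dist_real_def)
  qed (use b in simp)
qed

lemma passage_nonneg: "0 \<le> passage_time p y"
  unfolding passage_time_def by (intro INF_greatest) auto

lemma passage_before:
  assumes "nice_path p" "y \<ge> 0" "t \<ge> 0" "ereal t < passage_time p y" shows "p t \<le> y"
proof (rule ccontr)
  assume "\<not> p t \<le> y"
  \<comment> \<open>The passage time is an infimum over positive times, so time 0 is handled through
    p(0) = 0 \<le> y.\<close>
  hence "t \<noteq> 0" "p t > y" using assms by (auto simp: nice_path_def)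
  hence "passage_time p y \<le> ereal t" unfolding passage_time_def using assms by (intro INF_lower) auto
  thus False using assms by simp
qed

lemma passage_after:
  assumes "nice_path p" "passage_time p y < ereal t" shows "p t > y"
proof -
  obtain s where "0 < s" "p s > y" "ereal s < ereal t"
    using assms(2) unfolding passage_time_def INF_less_iff by auto
  thus ?thesis using nice_mono[OF assms(1), of s t] by auto
qed

text \<open>Right continuity: a path below y at t would stay below y for a while after t. At the
  passage time itself the remaining distance to the level is therefore nonpositive, so test
  functions vanishing there see nothing of the old piece.\<close>

lemma passage_at:
  assumes "nice_path p" "passage_time p y = ereal t" "t \<ge> 0" shows "p t \<ge> y"
proof (rule ccontr)
  assume "\<not> p t \<ge> y"
  hence "y - p t > 0" by simp
  then obtain d where d: "d > 0" "\<And>s. t \<le> s \<Longrightarrow> s < t + d \<Longrightarrow> \<bar>p s - p t\<bar> < y - p t"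
    using nice_near[OF assms(1,3)] by blast
  have "p (t + d/2) > y" by (rule passage_after[OF assms(1)]) (use assms d in simp)
  moreover have "\<bar>p (t + d/2) - p t\<bar> < y - p t" by (rule d(2)) (use d in auto)
  ultimately show False by simp
qed

lemma passage_pos:
  assumes "nice_path p" "t \<ge> 0" "p t < y" shows "ereal t < passage_time p y"
proof -
  have "y - p t > 0" using assms by simp
  then obtain d where d: "d > 0" "\<And>s. t \<le> s \<Longrightarrow> s < t + d \<Longrightarrow> \<bar>p s - p t\<bar> < y - p t"
    using nice_near[OF assms(1,2)] by blast
  have "ereal (t + d) \<le> passage_time p y"
    unfolding passage_time_def
  proof (rule INF_greatest)
    fix s assume s: "s \<in> {s. 0 < s \<and> y < p s}"
    have "\<not> s < t + d"
    proof
      assume sd: "s < t + d"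
      show False
      proof (cases "s \<ge> t")
        case True thus False using d(2)[OF True sd] s by auto
      next
        case False thus False using nice_mono[OF assms(1), of s t] s assms(3) by auto
      qed
    qed
    thus "ereal (t + d) \<le> ereal s" by simp
  qed
  thus ?thesis using d(1) by (metis ereal_less(2) less_add_same_cancel1 less_ereal.simps(1) order_less_le_trans)
qed

lemma passage_passQ:
  assumes "nice_path p" shows "passage_time p y = passQ p y"
proof (rule antisym)
  show "passage_time p y \<le> passQ p y"
    unfolding passQ_def passage_time_def by (intro INF_greatest) (auto intro: INF_lower)
  show "passQ p y \<le> passage_time p y"
    unfolding passage_time_def
  proof (rule INF_greatest)
    fix s assume "s \<in> {s. 0 < s \<and> y < p s}"
    hence s: "0 < s" "y < p s" by auto
    show "passQ p y \<le> ereal s"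
    proof (rule ereal_le_epsilon2)
      fix e :: real assume "0 < e"
      then obtain q where q: "q \<in> \<rat>" "s < q" "q < s + e" using Rats_dense_in_real[of s "s + e"] by auto
      have "p q > y" using nice_mono[OF assms, of s q] s q by auto
      hence "passQ p y \<le> ereal q" unfolding passQ_def using q s by (intro INF_lower2[of q]) auto
      also have "\<dots> \<le> ereal s + ereal e" using q by simp
      finally show "passQ p y \<le> ereal s + ereal e" .
    qed
  qed
qed

text \<open>For a positive passage time the left limit of the increasing path is the supremum L of
  its earlier values, also when that time is infinite. The bound by y holds because the path has not
  exceeded y before. Passage at time 0 is covered by the convention for
  \<open>left_value\<close>.\<close>

lemma left_value_props:
  assumes p: "nice_path p" and y: "y \<ge> 0" and \<sigma>: "\<sigma> = passage_time p y"
  shows "left_value p \<sigma> = leftQ p \<sigma>" "0 \<le> left_value p \<sigma>" "left_value p \<sigma> \<le> y"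
    "\<And>r. \<sigma> = ereal r \<Longrightarrow> r > 0 \<Longrightarrow> (p \<longlongrightarrow> left_value p \<sigma>) (at_left r)"
proof -
  have "left_value p \<sigma> = leftQ p \<sigma> \<and> 0 \<le> left_value p \<sigma> \<and> left_value p \<sigma> \<le> y \<and>
    (\<forall>r. \<sigma> = ereal r \<longrightarrow> r > 0 \<longrightarrow> (p \<longlongrightarrow> left_value p \<sigma>) (at_left r))"
  proof (cases "\<sigma> = 0")
    case True
    have "(SUP q\<in>{q. q \<in> \<rat> \<and> 0 \<le> q}. if ereal q < \<sigma> then ereal (p q) else 0) = (SUP q\<in>{q::real. q \<in> \<rat> \<and> 0 \<le> q}. 0 :: ereal)"
      using True by (intro SUP_cong) auto
    also have "\<dots> = 0" by (rule SUP_const) (auto intro: Rats_0 exI[of _ 0])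
    finally show ?thesis using True p y by (simp add: left_value_def leftQ_def nice_path_def zero_ereal_def)
  next
    case False
    hence s0: "\<sigma> > 0" using passage_nonneg[of p y] \<sigma> by (simp add: order_less_le)
    define S where "S = {t. 0 \<le> t \<and> ereal t < \<sigma>}"
    define L where "L = Sup (p ` S)"
    have S0: "0 \<in> S" using s0 by (simp add: S_def zero_ereal_def)
    have up: "p t \<le> y" if "t \<in> S" for t using that passage_before[OF p y] \<sigma> by (auto simp: S_def)
    have bdd: "bdd_above (p ` S)" using up by (auto intro!: bdd_aboveI)
    have pL: "p t \<le> L" if "t \<in> S" for t unfolding L_def using that bdd by (intro cSup_upper) auto
    have L0: "0 \<le> L" using pL[OF S0] p by (simp add: nice_path_def)
    have Ly: "L \<le> y" unfolding L_def using S0 up by (intro cSup_least) auto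
    have ex: "\<exists>t\<in>S. a < p t" if "a < L" for a
      using that less_cSup_iff[OF _ bdd, of a] S0 unfolding L_def by auto
    have pre_exit: "left_value p \<sigma> = L \<and> (\<forall>r. \<sigma> = ereal r \<longrightarrow> r > 0 \<longrightarrow> (p \<longlongrightarrow> left_value p \<sigma>) (at_left r))"
    proof (cases \<sigma>)
      case PInf
      have "(p \<longlongrightarrow> L) at_top"
      proof (rule increasing_tendsto)
        show "\<forall>\<^sub>F t in at_top. p t \<le> L"
          using eventually_ge_at_top[of 0] by eventually_elim (use pL PInf in \<open>auto simp: S_def\<close>)
        fix a assume "a < L"
        then obtain t where t: "t \<in> S" "a < p t" using ex by blast
        show "\<forall>\<^sub>F t in at_top. a < p t"
          using eventually_ge_at_top[of t]
        proof eventually_elim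
          case (elim s)
          have "p t \<le> p s" using t elim by (intro nice_mono[OF p]) (auto simp: S_def)
          thus ?case using t by simp
        qed
      qed
      hence "Lim at_top p = L" by (intro tendsto_Lim) auto
      thus ?thesis using PInf by (simp add: left_value_def)
    next
      case (real r)
      hence r: "r > 0" using s0 by simp
      have t: "(p \<longlongrightarrow> L) (at_left r)"
      proof (rule increasing_tendsto)
        have ev: "\<forall>\<^sub>F t in at_left r. 0 < t \<and> t < r"
          using eventually_at_left_real[OF r] by eventually_elim auto
        show "\<forall>\<^sub>F t in at_left r. p t \<le> L"
          using ev by eventually_elim (use pL real in \<open>auto simp: S_def\<close>)
        fix a assume "a < L"
        then obtain t where t: "t \<in> S" "a < p t" using ex by blast
        hence "t < r" using real by (simp add: S_def)
        show "\<forall>\<^sub>F t in at_left r. a < p t"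
          using eventually_at_left_real[OF \<open>t < r\<close>]
        proof eventually_elim
          case (elim s)
          have "p t \<le> p s" using t elim by (intro nice_mono[OF p]) (auto simp: S_def)
          thus ?case using t by simp
        qed
      qed
      hence "Lim (at_left r) p = L" by (intro tendsto_Lim) (auto simp: trivial_limit_at_left_real)
      thus ?thesis using real r t by (simp add: left_value_def zero_ereal_def)
    next
      case MInf thus ?thesis using s0 by simp
    qed
    \<comment> \<open>The default value 0 for rational times from \<sigma> on does not disturb the
      supremum, as L is nonnegative and q = 0 already contributes p(0) = 0.\<close>
    have "(SUP q\<in>{q. q \<in> \<rat> \<and> 0 \<le> q}. if ereal q < \<sigma> then ereal (p q) else 0) = ereal L"
    proof (rule SUP_eqI)
      fix q :: real assume "q \<in> {q. q \<in> \<rat> \<and> 0 \<le> q}"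
      thus "(if ereal q < \<sigma> then ereal (p q) else 0) \<le> ereal L" using pL[of q] L0 by (auto simp: S_def)
    next
      fix B :: ereal assume B: "\<And>q. q \<in> {q. q \<in> \<rat> \<and> 0 \<le> q} \<Longrightarrow> (if ereal q < \<sigma> then ereal (p q) else 0) \<le> B"
      show "ereal L \<le> B"
      proof (rule ccontr)
        assume "\<not> ereal L \<le> B"
        hence BL: "B < ereal L" by simp
        have "0 \<le> B" using B[of 0] s0 p by (auto simp: nice_path_def zero_ereal_def)
        then obtain b where b: "B = ereal b" using BL by (cases B) auto
        obtain t where t: "t \<in> S" "b < p t" using ex[of b] BL b by auto
        obtain z where z: "ereal t < ereal z" "ereal z < \<sigma>" using ereal_dense2[of "ereal t" \<sigma>] t by (auto simp: S_def)
        then obtain q where q: "q \<in> \<rat>" "t < q" "q < z" using Rats_dense_in_real[of t z] by auto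
        have q\<sigma>: "ereal q < \<sigma>" using q z by (meson less_ereal.simps(1) order_less_trans)
        have "p t \<le> p q" using t q by (intro nice_mono[OF p]) (auto simp: S_def)
        moreover have "ereal (p q) \<le> B" using B[of q] q q\<sigma> t by (auto simp: S_def)
        ultimately show False using t b by simp
      qed
    qed
    hence "leftQ p \<sigma> = L" by (simp add: leftQ_def)
    thus ?thesis using pre_exit L0 Ly by simp
  qed
  thus "left_value p \<sigma> = leftQ p \<sigma>" "0 \<le> left_value p \<sigma>" "left_value p \<sigma> \<le> y"
    "\<And>r. \<sigma> = ereal r \<Longrightarrow> r > 0 \<Longrightarrow> (p \<longlongrightarrow> left_value p \<sigma>) (at_left r)" by auto
qed

text \<open>Discretisation of the passage: as $h \to 0$, the times $t$ with $p(t) \le x < p(t+h)$ fill the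
  interval of length about $h$ that ends at the passage time.\<close>

lemma passage_average:
  fixes \<psi> :: "real \<Rightarrow> real"
  assumes p: "nice_path p" and x: "x > 0" and \<psi>: "continuous_on UNIV \<psi>" "\<And>z. 0 \<le> \<psi> z" "\<And>z. \<psi> z \<le> 1"
    and l: "l \<ge> 0"
  defines "A \<equiv> \<lambda>h. \<integral>\<^sup>+t. indicator {0..} t * (eexp l t * (ennreal (\<psi> (x - p t)) * (if p t \<le> x \<and> x < p (t + h) then ennreal (1 / h) else 0))) \<partial>lborel"
  shows "h > 0 \<Longrightarrow> A h \<le> 1"
    and "((A \<circ> (\<lambda>n. 1 / real (Suc n))) \<longlongrightarrow> ennreal (discount l (passage_time p x) * \<psi> (x - left_value p (passage_time p x)))) sequentially"
proof -
  define \<sigma> where "\<sigma> = passage_time p x"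
  define G where "G t = exp (-(l * t)) * \<psi> (x - p t)" for t
  have G1: "G t \<le> 1" if "t \<ge> 0" for t
  proof -
    have "exp (-(l * t)) * \<psi> (x - p t) \<le> 1 * 1" using \<psi> l that by (intro mult_mono) auto
    thus ?thesis by (simp add: G_def)
  qed
  have s0: "\<sigma> > 0" unfolding \<sigma>_def using passage_pos[OF p, of 0 x] p x by (simp add: nice_path_def zero_ereal_def)
  \<comment> \<open>For an increasing path the condition p(t) \<le> x < p(t + h) means r - h < t <
    r, up to endpoints that form a null set.\<close>
  have fin: "A h = (\<integral>\<^sup>+t. indicator {max 0 (r - h)<..<r} t * ennreal (G t / h) \<partial>lborel)" if r: "\<sigma> = ereal r" and h: "h > 0" for r h
    unfolding A_def
  proof (rule nn_integral_cong_AE)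
    show "AE t in lborel. indicator {0..} t * (eexp l t * (ennreal (\<psi> (x - p t)) * (if p t \<le> x \<and> x < p (t + h) then ennreal (1 / h) else 0)))
       = indicator {max 0 (r - h)<..<r} t * ennreal (G t / h)"
      using AE_lborel_singleton[of r] AE_lborel_singleton[of "r - h"] AE_lborel_singleton[of "0::real"]
    proof eventually_elim
      case (elim t)
      show ?case
      proof (cases "t > 0")
        case True
        have "p t \<le> x \<longleftrightarrow> t < r"
          using passage_before[OF p, of x t] passage_after[OF p, of x t] r elim True x
          by (cases "t < r") (auto simp: \<sigma>_def)
        moreover have "x < p (t + h) \<longleftrightarrow> r - h < t"
          using passage_before[OF p, of x "t + h"] passage_after[OF p, of x "t + h"] r elim True x h
          by (cases "r - h < t") (auto simp: \<sigma>_def)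
        ultimately show ?thesis using True h \<psi>
          by (auto simp: G_def indicator_def ennreal_mult[symmetric] divide_inverse mult.assoc)
      next
        case False
        thus ?thesis using elim by (auto simp: indicator_def)
      qed
    qed
  qed
  have inf: "A h = 0" if "\<sigma> = \<infinity>" and h: "h > 0" for h
  proof -
    have "(\<lambda>t. indicator {0..} t * (eexp l t * (ennreal (\<psi> (x - p t)) * (if p t \<le> x \<and> x < p (t + h) then ennreal (1 / h) else 0)))) = (\<lambda>_. 0)"
    proof
      fix t
      have "p (t + h) \<le> x" if "t \<ge> 0" using passage_before[OF p, of x "t + h"] x h that \<open>\<sigma> = \<infinity>\<close> by (simp add: \<sigma>_def)
      thus "indicator {0..} t * (eexp l t * (ennreal (\<psi> (x - p t)) * (if p t \<le> x \<and> x < p (t + h) then ennreal (1 / h) else 0))) = 0"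
        by (auto simp: indicator_def)
    qed
    thus ?thesis by (simp add: A_def)
  qed
  show "A h \<le> 1" if h: "h > 0" for h
  proof (cases \<sigma>)
    case (real r)
    have "A h \<le> (\<integral>\<^sup>+t. ennreal (1 / h) * indicator {r - h..r} t \<partial>lborel)"
      unfolding fin[OF real h]
    proof (rule nn_integral_mono)
      fix t
      show "indicator {max 0 (r - h)<..<r} t * ennreal (G t / h) \<le> ennreal (1 / h) * indicator {r - h..r} t"
        using G1[of t] h by (auto simp: indicator_def intro!: ennreal_leI divide_right_mono)
    qed
    also have "\<dots> = 1" using h by (simp add: nn_integral_cmult ennreal_mult[symmetric])
    finally show ?thesis .
  qed (use inf h s0 in auto)
  show "((A \<circ> (\<lambda>n. 1 / real (Suc n))) \<longlongrightarrow> ennreal (discount l (passage_time p x) * \<psi> (x - left_value p (passage_time p x)))) sequentially"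
  proof (cases \<sigma>)
    case PInf
    hence "(A \<circ> (\<lambda>n. 1 / real (Suc n))) = (\<lambda>_. 0)" by (auto simp: fun_eq_iff inf)
    thus ?thesis using PInf by (simp add: discount_def \<sigma>_def)
  next
    case MInf thus ?thesis using s0 by simp
  next
    case (real r)
    hence r: "r > 0" using s0 by simp
    define g where "g = exp (-(l * r)) * \<psi> (x - left_value p \<sigma>)"
    have g0: "g \<ge> 0" using \<psi> by (simp add: g_def)
    have lim: "(G \<longlongrightarrow> g) (at_left r)"
    proof -
      have "(p \<longlongrightarrow> left_value p \<sigma>) (at_left r)"
        by (rule left_value_props(4)[OF p _ _ real r]) (use x in \<open>auto simp: \<sigma>_def\<close>)
      moreover have "isCont \<psi> (x - left_value p \<sigma>)" using \<psi>(1) continuous_on_eq_continuous_at[of UNIV] by auto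
      ultimately have "((\<lambda>t. \<psi> (x - p t)) \<longlongrightarrow> \<psi> (x - left_value p \<sigma>)) (at_left r)"
        by (intro isCont_tendsto_compose[of "x - left_value p \<sigma>" \<psi>] tendsto_intros)
      thus ?thesis unfolding G_def g_def by (intro tendsto_intros)
    qed
    \<comment> \<open>For small h the integral is the average of \<open>G\<close> over (r - h, r),
      and \<open>G\<close> has the limit g at r from the left. The requirement h < r keeps this
      interval inside the positive times.\<close>
    have sand: "\<forall>\<^sub>F n in sequentially. ennreal (g - e) \<le> A (1 / real (Suc n)) \<and> A (1 / real (Suc n)) \<le> ennreal (g + e)" if e: "e > 0" for e
    proof -
      have "\<forall>\<^sub>F t in at_left r. dist (G t) g < e" using lim e by (rule tendstoD)
      then obtain b where b: "b < r" "\<forall>y>b. y < r \<longrightarrow> dist (G y) g < e" unfolding eventually_at_left_field by blast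
      have "(\<lambda>n. 1 / real (Suc n)) \<longlonglongrightarrow> 0" by (rule LIMSEQ_Suc[OF lim_1_over_n])
      hence "\<forall>\<^sub>F n in sequentially. 1 / real (Suc n) < min (r - b) r" using b r by (intro order_tendstoD) auto
      thus ?thesis
      proof eventually_elim
        case (elim n)
        define h where "h = 1 / real (Suc n)"
        have h: "h > 0" "h < r - b" "h < r" using elim by (auto simp: h_def)
        have mx: "max 0 (r - h) = r - h" using h by simp
        have near: "\<bar>G t - g\<bar> < e" if "r - h < t" "t < r" for t
          using b(2) that h by (auto simp: dist_real_def)
        have cst: "(\<integral>\<^sup>+t. indicator {r - h<..<r} t * ennreal (c / h) \<partial>lborel) = ennreal c" for c
        proof -
          have "(\<integral>\<^sup>+t. indicator {r - h<..<r} t * ennreal (c / h) \<partial>lborel) = (\<integral>\<^sup>+t. ennreal (c / h) * indicator {r - h<..<r} t \<partial>lborel)"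
            by (intro nn_integral_cong) (simp add: mult.commute)
          also have "\<dots> = ennreal (c / h) * ennreal h"
            using h by (subst nn_integral_cmult) auto
          also have "\<dots> = ennreal c"
          proof (cases "c \<ge> 0")
            case True thus ?thesis using h by (simp add: ennreal_mult[symmetric])
          next
            case False thus ?thesis using h by (simp add: ennreal_neg divide_nonpos_pos)
          qed
          finally show ?thesis .
        qed
        have "ennreal (g - e) \<le> A h" unfolding fin[OF real h(1)] mx cst[of "g - e", symmetric]
          by (intro nn_integral_mono) (use near h in \<open>force simp: indicator_def intro!: ennreal_leI divide_right_mono\<close>)
        moreover have "A h \<le> ennreal (g + e)" unfolding fin[OF real h(1)] mx cst[of "g + e", symmetric]
          by (intro nn_integral_mono) (use near h in \<open>force simp: indicator_def intro!: ennreal_leI divide_right_mono\<close>)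
        ultimately show ?case by (simp add: h_def)
      qed
    qed
    have "(\<lambda>n. A (1 / real (Suc n))) \<longlonglongrightarrow> ennreal g"
    proof (rule order_tendstoI)
      fix a assume a: "a < ennreal g"
      then obtain a' where a': "a = ennreal a'" "a' \<ge> 0" by (cases a) auto
      hence "a' < g" using a g0 by (simp add: ennreal_less_iff)
      hence "(g - a') / 2 > 0" by simp
      from sand[OF this] show "\<forall>\<^sub>F n in sequentially. a < A (1 / real (Suc n))"
      proof eventually_elim
        case (elim n)
        have "a < ennreal (g - (g - a') / 2)" using a' \<open>a' < g\<close> by (simp add: ennreal_less_iff field_simps)
        thus ?case using elim by (meson order_less_le_trans)
      qed
    next
      fix a assume a: "ennreal g < a"
      obtain e where e: "e > 0" "ennreal (g + e) < a"
      proof (cases a)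
        case (real a')
        hence "g < a'" using a g0 by (simp add: ennreal_less_iff)
        thus ?thesis using that[of "(a' - g) / 2"] real g0 by (simp add: ennreal_less_iff field_simps)
      next
        case top thus ?thesis using that[of 1] by (simp add: less_top[symmetric])
      qed
      from sand[OF e(1)] show "\<forall>\<^sub>F n in sequentially. A (1 / real (Suc n)) < a"
        by eventually_elim (use e in \<open>meson order_le_less_trans\<close>)
    qed
    moreover have "discount l (passage_time p x) * \<psi> (x - left_value p (passage_time p x)) = g"
      using real by (simp add: discount_def g_def \<sigma>_def)
    ultimately show ?thesis by (simp add: comp_def)
  qed
qed

section \<open>Subordinators\<close>

abbreviation path_space :: "(real \<Rightarrow> real) measure" where "path_space \<equiv> PiM {0..} (\<lambda>_. borel)"

lemma countable_rats: "countable {q::real. q \<in> \<rat> \<and> 0 < q}" "countable {q::real. q \<in> \<rat> \<and> 0 \<le> q}"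
  by (rule countable_subset[OF _ countable_rat], auto)+

lemma passQ_measurable[measurable]: "(\<lambda>(y, p). passQ p y) \<in> borel_measurable (borel \<Otimes>\<^sub>M path_space)"
  unfolding passQ_def split_beta'
proof (rule borel_measurable_INF[OF countable_rats(1)])
  fix q :: real assume "q \<in> {q. q \<in> \<rat> \<and> 0 < q}"
  hence [measurable]: "(\<lambda>z. snd z q) \<in> borel_measurable (borel \<Otimes>\<^sub>M path_space)"
    by (intro measurable_compose[OF measurable_snd] measurable_component_singleton) auto
  show "(\<lambda>z. if fst z < snd z q then ereal q else \<infinity>) \<in> borel_measurable (borel \<Otimes>\<^sub>M path_space)"
    by measurable
qed

lemma leftQ_measurable[measurable]: "(\<lambda>(s, p). leftQ p s) \<in> borel_measurable (borel \<Otimes>\<^sub>M path_space)"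
  unfolding leftQ_def split_beta'
proof (rule borel_measurable_real_of_ereal, rule borel_measurable_SUP[OF countable_rats(2)])
  fix q :: real assume "q \<in> {q. q \<in> \<rat> \<and> 0 \<le> q}"
  hence [measurable]: "(\<lambda>z. snd z q) \<in> borel_measurable ((borel :: ereal measure) \<Otimes>\<^sub>M path_space)"
    by (intro measurable_compose[OF measurable_snd] measurable_component_singleton) auto
  show "(\<lambda>z. if ereal q < fst z then ereal (snd z q) else 0) \<in> borel_measurable ((borel :: ereal measure) \<Otimes>\<^sub>M path_space)"
    by measurable
qed

lemma discount_measurable[measurable]: "discount l \<in> borel_measurable borel"
  unfolding discount_def by measurable

lemma passQ_restrict: "passQ (restrict p {0..}) y = passQ p y" 
  unfolding passQ_def by (intro INF_cong) auto

lemma leftQ_restrict: "leftQ (restrict p {0..}) s = leftQ p s" 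
  unfolding leftQ_def by (intro arg_cong[of _ _ real_of_ereal] SUP_cong) auto

text \<open>The random time is approximated by grid points strictly above it, which take countably
  many values. Strictness matters, because right continuity speaks about limits from above.\<close>

lemma right_cont_measurable:
  fixes X :: "real \<Rightarrow> 'a \<Rightarrow> real"
  assumes X: "\<And>t. t \<ge> 0 \<Longrightarrow> X t \<in> borel_measurable M"
    and rc: "\<And>w t. w \<in> space M \<Longrightarrow> t \<ge> 0 \<Longrightarrow> continuous (at_right t) (\<lambda>s. X s w)"
    and [measurable]: "r \<in> borel_measurable N" "p \<in> measurable N M"
    and r0: "\<And>z. z \<in> space N \<Longrightarrow> r z \<ge> 0"
  shows "(\<lambda>z. X (r z) (p z)) \<in> borel_measurable N"
proof (rule borel_measurable_LIMSEQ_real)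
  define u where "u n z = (real (nat \<lfloor>real (Suc n) * r z\<rfloor>) + 1) / real (Suc n)" for n z
  show "(\<lambda>z. X (u n z) (p z)) \<in> borel_measurable N" for n
  proof -
    have m: "(\<lambda>z. X ((real i + 1) / real (Suc n)) (p z)) \<in> borel_measurable N" for i :: nat
      by (intro measurable_compose[OF assms(4)] X) simp
    have "(\<lambda>z. (\<lambda>i z. X ((real i + 1) / real (Suc n)) (p z)) (nat \<lfloor>real (Suc n) * r z\<rfloor>) z) \<in> borel_measurable N"
      by (rule measurable_compose_countable[OF m]) measurable
    thus ?thesis by (simp add: u_def)
  qed
  fix z assume z: "z \<in> space N"
  have u1: "r z < u n z" for n
  proof -
    have "real (Suc n) * r z < real (nat \<lfloor>real (Suc n) * r z\<rfloor>) + 1"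
      using r0[OF z] by linarith
    thus ?thesis unfolding u_def by (simp add: field_simps)
  qed
  have u2: "u n z \<le> r z + 1 / real (Suc n)" for n
  proof -
    have "0 \<le> real (Suc n) * r z" using r0[OF z] by simp
    hence "real (nat \<lfloor>real (Suc n) * r z\<rfloor>) \<le> real (Suc n) * r z" by linarith
    hence "real (nat \<lfloor>real (Suc n) * r z\<rfloor>) / real (Suc n) \<le> r z"
      by (simp add: divide_le_eq mult.commute del: of_nat_Suc)
    thus ?thesis unfolding u_def add_divide_distrib by simp
  qed
  have "(\<lambda>n. u n z) \<longlonglongrightarrow> r z"
  proof (rule real_tendsto_sandwich[OF _ _ tendsto_const])
    show "(\<lambda>n. r z + 1 / real (Suc n)) \<longlonglongrightarrow> r z"
      using tendsto_add[OF tendsto_const LIMSEQ_Suc[OF lim_1_over_n], of "r z"] by simp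
    show "\<forall>\<^sub>F n in sequentially. r z \<le> u n z" by (intro always_eventually allI less_imp_le u1)
    show "\<forall>\<^sub>F n in sequentially. u n z \<le> r z + 1 / real (Suc n)" by (intro always_eventually allI u2)
  qed
  hence "filterlim (\<lambda>n. u n z) (at_right (r z)) sequentially"
    unfolding filterlim_at using u1 by (auto intro!: always_eventually) (metis less_irrefl)
  moreover have "((\<lambda>s. X s (p z)) \<longlongrightarrow> X (r z) (p z)) (at_right (r z))"
    using rc[of "p z" "r z"] r0[OF z] measurable_space[OF assms(4) z] by (simp add: continuous_within)
  ultimately show "(\<lambda>n. X (u n z) (p z)) \<longlonglongrightarrow> X (r z) (p z)"
    by (rule filterlim_compose[rotated])
qed

lemma (in prob_space) indep_nn_integral:
  assumes ind: "indep_var S A T B" and [measurable]: "g \<in> borel_measurable (S \<Otimes>\<^sub>M T)"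
  shows "(\<integral>\<^sup>+w. g (A w, B w) \<partial>M) = (\<integral>\<^sup>+w. (\<integral>\<^sup>+w'. g (A w, B w') \<partial>M) \<partial>M)"
proof -
  have [measurable]: "A \<in> measurable M S" "B \<in> measurable M T"
    and e: "distr M S A \<Otimes>\<^sub>M distr M T B = distr M (S \<Otimes>\<^sub>M T) (\<lambda>w. (A w, B w))"
    using ind unfolding indep_var_distribution_eq by auto
  interpret B: prob_space "distr M T B" by (rule prob_space_distr) simp
  have "(\<integral>\<^sup>+w. g (A w, B w) \<partial>M) = (\<integral>\<^sup>+z. g z \<partial>distr M (S \<Otimes>\<^sub>M T) (\<lambda>w. (A w, B w)))"
    by (subst nn_integral_distr) auto
  also have "\<dots> = (\<integral>\<^sup>+z. g z \<partial>(distr M S A \<Otimes>\<^sub>M distr M T B))" by (simp only: e)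
  also have "\<dots> = (\<integral>\<^sup>+a. (\<integral>\<^sup>+b. g (a, b) \<partial>distr M T B) \<partial>distr M S A)"
    by (rule B.nn_integral_fst[symmetric]) simp
  also have "\<dots> = (\<integral>\<^sup>+w. (\<integral>\<^sup>+b. g (A w, b) \<partial>distr M T B) \<partial>M)"
    by (subst nn_integral_distr) auto
  also have "\<dots> = (\<integral>\<^sup>+w. (\<integral>\<^sup>+w'. g (A w, B w') \<partial>M) \<partial>M)"
  proof (rule nn_integral_cong)
    fix w assume "w \<in> space M"
    hence "A w \<in> space S" using measurable_space[of A M S w] by simp
    hence [measurable]: "(\<lambda>b. g (A w, b)) \<in> borel_measurable T" by measurable
    show "(\<integral>\<^sup>+b. g (A w, b) \<partial>distr M T B) = (\<integral>\<^sup>+w'. g (A w, B w') \<partial>M)"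
      by (subst nn_integral_distr) auto
  qed
  finally show ?thesis .
qed

section \<open>Potential measures and the resolvent equation of a subordinator\<close>

locale subordinated = prob_space M + bernstein_pair f k \<mu> for M :: "'w measure" and f k \<mu> +
  fixes X :: "real \<Rightarrow> 'w \<Rightarrow> real"
  assumes sub: "subordinator M X f"
begin

lemma X_meas: "t \<ge> 0 \<Longrightarrow> X t \<in> borel_measurable M"
  using sub by (simp add: subordinator_def)

lemma X_nice: "w \<in> space M \<Longrightarrow> nice_path (\<lambda>t. X t w)"
  using sub by (simp add: subordinator_def nice_path_def)

lemma X_rc: "w \<in> space M \<Longrightarrow> t \<ge> 0 \<Longrightarrow> continuous (at_right t) (\<lambda>s. X s w)"
  using X_nice by (simp add: nice_path_def)

lemma X_nonneg: "w \<in> space M \<Longrightarrow> t \<ge> 0 \<Longrightarrow> 0 \<le> X t w"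
  using nice_nonneg[OF X_nice] by simp

lemma X_incr_law: "s \<ge> 0 \<Longrightarrow> t \<ge> 0 \<Longrightarrow> distr M borel (\<lambda>w. X (s + t) w - X s w) = distr M borel (X t)"
  using sub by (simp add: subordinator_def)

lemma X_indep:
  assumes "s \<ge> 0" "h \<ge> 0"
  shows "indep_var borel (X s) borel (\<lambda>w. X (s + h) w - X s w)"
proof -
  \<comment> \<open>The time sequence 0, s, s + h, s + h, ... has X(s) - X(0) and X(s+h) - X(s) as
    its first two increments, and X(0) = 0.\<close>
  define t where "t i = (if i = 0 then 0 else if i = 1 then s else s + h)" for i :: nat
  have "0 \<le> t 0 \<and> mono t" using assms by (auto simp: t_def mono_def)
  hence iv: "indep_vars (\<lambda>_. borel) (\<lambda>i w. X (t (Suc i)) w - X (t i) w) UNIV"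
    using sub unfolding subordinator_def by blast
  have "indep_var borel ((\<lambda>r. r 0) \<circ> (\<lambda>w. restrict (\<lambda>i. X (t (Suc i)) w - X (t i) w) {0})) borel
     ((\<lambda>r. r 1) \<circ> (\<lambda>w. restrict (\<lambda>i. X (t (Suc i)) w - X (t i) w) {1}))"
    by (rule indep_var_compose[OF indep_var_restrict[OF iv]]) auto
  hence "indep_var borel (\<lambda>w. X s w - X 0 w) borel (\<lambda>w. X (s + h) w - X s w)"
    by (simp add: comp_def t_def)
  moreover have e: "X s w - X 0 w = X s w" if "w \<in> space M" for w
    using X_nice[OF that] by (simp add: nice_path_def)
  hence "distr M borel (\<lambda>w. X s w - X 0 w) = distr M borel (X s)"
    "distr M (borel \<Otimes>\<^sub>M borel) (\<lambda>w. (X s w - X 0 w, X (s + h) w - X s w)) = distr M (borel \<Otimes>\<^sub>M borel) (\<lambda>w. (X s w, X (s + h) w - X s w))"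
    by (auto intro!: distr_cong)
  ultimately show ?thesis using X_meas assms by (simp add: indep_var_distribution_eq)
qed

lemma X_laplace: "l > 0 \<Longrightarrow> t \<ge> 0 \<Longrightarrow> (\<integral>\<^sup>+w. ennreal (exp (-(l * X t w))) \<partial>M) = ennreal (exp (-(t * f l)))"
proof -
  assume l: "l > 0" and t: "t \<ge> 0"
  have [measurable]: "X t \<in> borel_measurable M" by (rule X_meas[OF t])
  have "integrable M (\<lambda>w. exp (- l * X t w))"
  proof (rule Bochner_Integration.integrable_bound[of M "\<lambda>_. 1::real"])
    show "AE w in M. norm (exp (- l * X t w)) \<le> norm (1::real)"
      using X_nonneg[OF _ t] l by (intro AE_I2) auto
  qed auto
  hence "(\<integral>\<^sup>+w. ennreal (exp (- l * X t w)) \<partial>M) = ennreal (\<integral>w. exp (- l * X t w) \<partial>M)"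
    by (intro nn_integral_eq_integral) auto
  also have "(\<integral>w. exp (- l * X t w) \<partial>M) = exp (- t * f l)" using sub l t by (simp add: subordinator_def)
  finally show ?thesis by simp
qed

lemma X_joint: "(\<lambda>z. X (max 0 (fst z)) (snd z)) \<in> borel_measurable (lborel \<Otimes>\<^sub>M M)"
  by (rule right_cont_measurable[OF X_meas X_rc]) auto

lemma X_joint': "(\<lambda>z. X (max 0 (snd z)) (fst z)) \<in> borel_measurable (M \<Otimes>\<^sub>M lborel)"
  by (rule right_cont_measurable[OF X_meas X_rc]) auto

text \<open>The \<lambda>-potential measure: expected discounted occupation of the subordinator. The
  \<open>max 0\<close> keeps the time argument in the range where \<open>X\<close> is known to be
  measurable and right continuous.\<close>

definition umeas :: "real \<Rightarrow> real measure" where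
  "umeas l = distr (density (lborel \<Otimes>\<^sub>M M) (\<lambda>z. indicator {0..} (fst z) * ennreal (exp (-(l * fst z))))) borel
     (\<lambda>z. X (max 0 (fst z)) (snd z))"

lemma sets_umeas[measurable_cong, simp]: "sets (umeas l) = sets borel" and space_umeas[simp]: "space (umeas l) = UNIV"
  by (simp_all add: umeas_def)

lemma nn_umeas:
  assumes [measurable]: "\<psi> \<in> borel_measurable borel"
  shows "(\<integral>\<^sup>+z. \<psi> z \<partial>umeas l) = (\<integral>\<^sup>+t. hexp l t * (\<integral>\<^sup>+w. \<psi> (X t w) \<partial>M) \<partial>lborel)"
proof -
  note [measurable] = X_joint
  have "(\<integral>\<^sup>+z. \<psi> z \<partial>umeas l) = (\<integral>\<^sup>+z. indicator {0..} (fst z) * ennreal (exp (-(l * fst z))) * \<psi> (X (max 0 (fst z)) (snd z)) \<partial>(lborel \<Otimes>\<^sub>M M))"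
    unfolding umeas_def by (subst nn_integral_distr, measurable, subst nn_integral_density) auto
  also have "\<dots> = (\<integral>\<^sup>+t. (\<integral>\<^sup>+w. hexp l t * \<psi> (X (max 0 t) w) \<partial>M) \<partial>lborel)"
    by (subst nn_integral_fst[symmetric]) auto
  also have "\<dots> = (\<integral>\<^sup>+t. hexp l t * (\<integral>\<^sup>+w. \<psi> (X t w) \<partial>M) \<partial>lborel)"
  proof (rule nn_integral_cong)
    fix t :: real
    show "(\<integral>\<^sup>+w. hexp l t * \<psi> (X (max 0 t) w) \<partial>M) = hexp l t * (\<integral>\<^sup>+w. \<psi> (X t w) \<partial>M)"
    proof (cases "t \<ge> 0")
      case True
      note [measurable] = X_meas[OF True]
      show ?thesis using True by (simp add: nn_integral_cmult)
    qed simp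
  qed
  finally show ?thesis .
qed

lemma umeas_laplace:
  assumes a: "a > 0" and l: "l \<ge> 0"
  shows "(\<integral>\<^sup>+z. eexp a z \<partial>umeas l) = ennreal (1 / (l + f a))"
proof -
  have "(\<integral>\<^sup>+z. eexp a z \<partial>umeas l) = (\<integral>\<^sup>+t. hexp l t * (\<integral>\<^sup>+w. ennreal (exp (-(a * X t w))) \<partial>M) \<partial>lborel)"
    by (rule nn_umeas) simp
  also have "\<dots> = (\<integral>\<^sup>+t. ennreal (exp (-((l + f a) * t))) * indicator {0<..} t \<partial>lborel)"
  proof (rule nn_integral_cong_AE)
    show "AE t in lborel. hexp l t * (\<integral>\<^sup>+w. ennreal (exp (-(a * X t w))) \<partial>M) = ennreal (exp (-((l + f a) * t))) * indicator {0<..} t"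
      using AE_lborel_singleton[of 0]
    proof eventually_elim
      case (elim t)
      show ?case
      proof (cases "t > 0")
        case True
        have "eexp l t * ennreal (exp (-(t * f a))) = ennreal (exp (-((l + f a) * t)))"
          by (simp add: ennreal_mult[symmetric] exp_add[symmetric] algebra_simps)
        thus ?thesis using True a X_laplace[of a t] by simp
      next
        case False thus ?thesis using elim by (auto simp: indicator_def)
      qed
    qed
  qed
  also have "\<dots> = ennreal (1 / (l + f a))"
    by (rule nn_integral_exp_Ioi) (use l f_pos[OF a] in simp)
  finally show ?thesis .
qed

lemma umeas_mono:
  assumes [measurable]: "\<psi> \<in> borel_measurable borel" and l: "l \<ge> 0"
  shows "(\<integral>\<^sup>+z. \<psi> z \<partial>umeas l) \<le> (\<integral>\<^sup>+z. \<psi> z \<partial>umeas 0)"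
  unfolding nn_umeas[OF assms(1)]
proof (rule nn_integral_mono)
  fix t :: real
  have "eexp l t \<le> 1" if "t \<ge> 0" using that l by (simp add: ennreal_le_1)
  thus "hexp l t * (\<integral>\<^sup>+w. \<psi> (X t w) \<partial>M) \<le> hexp 0 t * (\<integral>\<^sup>+w. \<psi> (X t w) \<partial>M)"
    using mult_right_mono[of "eexp l t" 1 "\<integral>\<^sup>+w. \<psi> (X t w) \<partial>M"]
    by (cases "t \<ge> 0") auto
qed

lemma umeas_AE_nonneg: "AE z in umeas l. 0 \<le> z"
proof -
  have "(\<integral>\<^sup>+z. indicator {..<0} z \<partial>umeas l) = (\<integral>\<^sup>+t. hexp l t * (\<integral>\<^sup>+w. indicator {..<0} (X t w) \<partial>M) \<partial>lborel)"
    by (rule nn_umeas) simp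
  also have "\<dots> = (\<integral>\<^sup>+t. 0 \<partial>(lborel :: real measure))"
  proof (rule nn_integral_cong)
    fix t :: real
    have "(\<integral>\<^sup>+w. indicator {..<0} (X t w) \<partial>M) = (\<integral>\<^sup>+w. 0 \<partial>M)" if "t \<ge> 0"
      by (intro nn_integral_cong) (use X_nonneg[OF _ that] in \<open>auto simp: indicator_def not_less\<close>)
    thus "hexp l t * (\<integral>\<^sup>+w. indicator {..<0} (X t w) \<partial>M) = 0"
      by (cases "t \<ge> 0") auto
  qed
  finally have "emeasure (umeas l) {z \<in> space (umeas l). \<not> 0 \<le> z} = 0"
    by (simp add: nn_integral_indicator lessThan_def not_le)
  thus ?thesis by (subst AE_iff_measurable[OF _ refl]) auto
qed

text \<open>Both measures have Laplace transform 1/f. This is the point where the analytically given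
  \<open>k\<close> becomes the potential density of the process.\<close>

lemma umeas_0: "umeas 0 = density lborel k_nn"
proof (rule laplace_unique_measure)
  show "AE x in density lborel k_nn. 0 \<le> x"
    by (subst AE_density) (auto simp: k_nn_def indicator_def)
  show "(\<integral>\<^sup>+x. eexp l x \<partial>umeas 0) < \<infinity>" if "l > 0" for l
    using umeas_laplace[OF that, of 0] by simp
  show "(\<integral>\<^sup>+x. eexp l x \<partial>umeas 0) = (\<integral>\<^sup>+x. eexp l x \<partial>density lborel k_nn)" if "l > 0" for l
    using umeas_laplace[OF that, of 0] k_laplace[OF that] by (subst nn_integral_density) (auto simp: mult.commute)
qed (auto simp: umeas_AE_nonneg)

text \<open>The Radon-Nikodym derivative is determined almost everywhere only; the indicator makes
  the support in the half-line hold at every point.\<close>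

definition udens :: "real \<Rightarrow> real \<Rightarrow> ennreal" where
  "udens l x = RN_deriv lborel (umeas l) x * indicator {0..} x"

lemma udens_measurable[measurable]: "udens l \<in> borel_measurable borel"
  unfolding udens_def by measurable

text \<open>Discounting decreases the potential measure, so it is dominated by the undiscounted one,
  which has density \<open>k\<close> and thus ignores Lebesgue null sets.\<close>

lemma umeas_density: assumes l: "l \<ge> 0" shows "umeas l = density lborel (udens l)"
proof -
  have ac: "absolutely_continuous lborel (umeas l)"
    unfolding absolutely_continuous_def
  proof
    fix A assume A: "A \<in> null_sets (lborel :: real measure)"
    hence [measurable]: "A \<in> sets borel" by auto
    have "emeasure (umeas l) A \<le> emeasure (umeas 0) A"
      using umeas_mono[OF _ l, of "indicator A"] by simp
    also have "\<dots> = (\<integral>\<^sup>+x. k_nn x * indicator A x \<partial>lborel)" unfolding umeas_0 by (subst emeasure_density) auto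
    also have "\<dots> = 0" by (rule nn_integral_null_set[OF A])
    finally show "A \<in> null_sets (umeas l)" by (auto simp: null_sets_def)
  qed
  have e: "density lborel (RN_deriv lborel (umeas l)) = umeas l"
    by (rule sigma_finite_measure.density_RN_deriv[OF sigma_finite_lborel ac]) simp
  have "density lborel (udens l) = density (density lborel (RN_deriv lborel (umeas l))) (indicator {0..})"
    unfolding udens_def by (subst density_density_eq) auto
  also have "\<dots> = density (umeas l) (indicator {0..})" by (simp only: e)
  also have "\<dots> = density (umeas l) (\<lambda>_. 1)"
    by (rule density_cong) (use umeas_AE_nonneg[of l] in \<open>auto simp: indicator_def\<close>)
  finally show ?thesis by (simp add: density_1)
qed

text \<open>The resolvent of the decreasing motion x - X without killing. Killing at passage is
  expressed by applying it to functions that vanish on the nonpositive half-line.\<close>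

definition U_op :: "real \<Rightarrow> (real \<Rightarrow> ennreal) \<Rightarrow> real \<Rightarrow> ennreal" where
  "U_op l \<psi> x = (\<integral>\<^sup>+z. \<psi> (x - z) \<partial>umeas l)"

lemma U_op_density: "\<psi> \<in> borel_measurable borel \<Longrightarrow> l \<ge> 0 \<Longrightarrow> U_op l \<psi> x = (\<integral>\<^sup>+z. udens l z * \<psi> (x - z) \<partial>lborel)"
  unfolding U_op_def by (subst umeas_density) (auto intro!: nn_integral_density)

lemma U_op_0: "\<psi> \<in> borel_measurable borel \<Longrightarrow> U_op 0 \<psi> x = (\<integral>\<^sup>+z. k_nn z * \<psi> (x - z) \<partial>lborel)"
  unfolding U_op_def umeas_0 by (auto intro!: nn_integral_density)

lemma U_op_measurable[measurable]:
  assumes [measurable]: "\<psi> \<in> borel_measurable borel" and l: "l \<ge> 0"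
  shows "U_op l \<psi> \<in> borel_measurable borel"
proof -
  have "U_op l \<psi> = (\<lambda>x. \<integral>\<^sup>+z. udens l z * \<psi> (x - z) \<partial>lborel)" using U_op_density[OF assms] by auto
  thus ?thesis by simp
qed

lemma U_op_mono: "\<psi> \<in> borel_measurable borel \<Longrightarrow> l \<ge> 0 \<Longrightarrow> U_op l \<psi> x \<le> U_op 0 \<psi> x"
  unfolding U_op_def by (rule umeas_mono) auto

lemma U_op_zero: assumes "\<And>y. y \<le> 0 \<Longrightarrow> \<psi> y = 0" "x \<le> 0" shows "U_op l \<psi> x = 0"
proof -
  have "U_op l \<psi> x = (\<integral>\<^sup>+z. 0 \<partial>umeas l)" unfolding U_op_def
    by (rule nn_integral_cong_AE) (use umeas_AE_nonneg[of l] in \<open>eventually_elim, use assms in simp\<close>)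
  thus ?thesis by simp
qed

text \<open>In Laplace transforms this is 1/f = 1/(l + f) + l (1/f)(1/(l + f)). The sum on the right
  avoids a difference of extended reals.\<close>

lemma resolvent_density:
  assumes l: "l > 0"
  shows "AE x in lborel. k_nn x = udens l x + ennreal l * (\<integral>\<^sup>+s. k_nn (x - s) * udens l s \<partial>lborel)"
proof -
  have L: "(\<integral>\<^sup>+x. eexp a x * udens l x \<partial>lborel) = ennreal (1 / (l + f a))" if "a > 0" for a
    using umeas_laplace[OF that, of l] l by (simp add: umeas_density nn_integral_density mult.commute)
  have R: "(\<integral>\<^sup>+x. eexp a x \<partial>density lborel (\<lambda>x. udens l x + ennreal l * (\<integral>\<^sup>+s. k_nn (x - s) * udens l s \<partial>lborel))) = ennreal (1 / f a)"
    if a: "a > 0" for a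
  proof -
    have "(\<integral>\<^sup>+x. eexp a x \<partial>density lborel (\<lambda>x. udens l x + ennreal l * (\<integral>\<^sup>+s. k_nn (x - s) * udens l s \<partial>lborel)))
      = (\<integral>\<^sup>+x. eexp a x * udens l x + ennreal l * (eexp a x * (\<integral>\<^sup>+s. k_nn (x - s) * udens l s \<partial>lborel)) \<partial>lborel)"
      by (subst nn_integral_density) (auto intro!: nn_integral_cong simp: algebra_simps)
    also have "\<dots> = ennreal (1 / (l + f a)) + ennreal l * (ennreal (1 / f a) * ennreal (1 / (l + f a)))"
      by (subst nn_integral_add) (auto simp: nn_integral_cmult laplace_conv L[OF a] k_laplace[OF a])
    also have "\<dots> = ennreal (1 / (l + f a) + l * (1 / f a * (1 / (l + f a))))"
      using l f_pos[OF a] by (simp add: ennreal_mult[symmetric] ennreal_plus[symmetric] del: ennreal_plus)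
    also have "1 / (l + f a) + l * (1 / f a * (1 / (l + f a))) = 1 / f a"
    proof -
      have "f a \<noteq> 0" "l + f a \<noteq> 0" using l f_pos[OF a] by auto
      thus ?thesis by (simp add: divide_simps)
    qed
    finally show ?thesis .
  qed
  have "density lborel k_nn = density lborel (\<lambda>x. udens l x + ennreal l * (\<integral>\<^sup>+s. k_nn (x - s) * udens l s \<partial>lborel))"
  proof (rule laplace_unique_measure)
    have K: "(\<integral>\<^sup>+x. eexp a x \<partial>density lborel k_nn) = ennreal (1 / f a)" if "a > 0" for a
      using k_laplace[OF that] by (subst nn_integral_density) (auto simp: mult.commute)
    show "AE x in density lborel k_nn. 0 \<le> x"
      by (subst AE_density) (auto simp: k_nn_def indicator_def)
    have z: "(\<integral>\<^sup>+s. k_nn (x - s) * udens l s \<partial>lborel) = 0" if "x < 0" for x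
    proof -
      have "(\<lambda>s. k_nn (x - s) * udens l s) = (\<lambda>_. 0)" using that by (auto simp: udens_def k_nn_def indicator_def)
      thus ?thesis by simp
    qed
    show "AE x in density lborel (\<lambda>x. udens l x + ennreal l * (\<integral>\<^sup>+s. k_nn (x - s) * udens l s \<partial>lborel)). 0 \<le> x"
    proof (subst AE_density)
      show "AE x in lborel. 0 < udens l x + ennreal l * (\<integral>\<^sup>+s. k_nn (x - s) * udens l s \<partial>lborel) \<longrightarrow> 0 \<le> x"
      proof (rule AE_I2, rule impI, rule ccontr)
        fix x assume "0 < udens l x + ennreal l * (\<integral>\<^sup>+s. k_nn (x - s) * udens l s \<partial>lborel)" "\<not> 0 \<le> x"
        thus False using z[of x] by (simp add: udens_def)
      qed
    qed measurable
    show "(\<integral>\<^sup>+x. eexp a x \<partial>density lborel k_nn) < \<infinity>" if "a > 0" for a using K[OF that] by simp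
    show "(\<integral>\<^sup>+x. eexp a x \<partial>density lborel k_nn) = (\<integral>\<^sup>+x. eexp a x \<partial>density lborel (\<lambda>x. udens l x + ennreal l * (\<integral>\<^sup>+s. k_nn (x - s) * udens l s \<partial>lborel)))" if "a > 0" for a
      using K[OF that] R[OF that] by simp
  qed auto
  thus ?thesis
    using sigma_finite_measure.density_unique_iff[OF sigma_finite_lborel,
      of k_nn "\<lambda>x. udens l x + ennreal l * (\<integral>\<^sup>+s. k_nn (x - s) * udens l s \<partial>lborel)"] by simp
qed

lemma U_op_resolvent:
  assumes l: "l > 0" and [measurable]: "\<psi> \<in> borel_measurable borel"
  shows "U_op 0 \<psi> x = U_op l \<psi> x + ennreal l * U_op 0 (U_op l \<psi>) x"
proof -
  have [measurable]: "U_op l \<psi> \<in> borel_measurable borel" using l by (intro U_op_measurable) auto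
  have "U_op 0 \<psi> x = (\<integral>\<^sup>+z. k_nn z * \<psi> (x - z) \<partial>lborel)" by (rule U_op_0) simp
  also have "\<dots> = (\<integral>\<^sup>+z. udens l z * \<psi> (x - z) + ennreal l * ((\<integral>\<^sup>+s. k_nn (z - s) * udens l s \<partial>lborel) * \<psi> (x - z)) \<partial>lborel)"
    by (rule nn_integral_cong_AE) (use resolvent_density[OF l] in \<open>eventually_elim, simp add: algebra_simps\<close>)
  also have "\<dots> = U_op l \<psi> x + ennreal l * (\<integral>\<^sup>+z. (\<integral>\<^sup>+s. k_nn (z - s) * udens l s \<partial>lborel) * \<psi> (x - z) \<partial>lborel)"
    using l by (subst nn_integral_add) (auto simp: nn_integral_cmult U_op_density)
  also have "(\<integral>\<^sup>+z. (\<integral>\<^sup>+s. k_nn (z - s) * udens l s \<partial>lborel) * \<psi> (x - z) \<partial>lborel) =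
     (\<integral>\<^sup>+z. (\<integral>\<^sup>+s. k_nn (z - s) * udens l s * \<psi> (x - z) \<partial>lborel) \<partial>lborel)"
    by (intro nn_integral_cong) (simp add: nn_integral_multc)
  also have "\<dots> = (\<integral>\<^sup>+s. (\<integral>\<^sup>+z. k_nn (z - s) * udens l s * \<psi> (x - z) \<partial>lborel) \<partial>lborel)"
    by (rule lborel_pair.Fubini') simp
  also have "\<dots> = (\<integral>\<^sup>+s. (\<integral>\<^sup>+z. k_nn z * udens l s * \<psi> (x - z - s) \<partial>lborel) \<partial>lborel)"
  proof (rule nn_integral_cong)
    fix s :: real
    show "(\<integral>\<^sup>+z. k_nn (z - s) * udens l s * \<psi> (x - z) \<partial>lborel) = (\<integral>\<^sup>+z. k_nn z * udens l s * \<psi> (x - z - s) \<partial>lborel)"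
      using nn_integral_real_affine[of "\<lambda>z. k_nn (z - s) * udens l s * \<psi> (x - z)" 1 s] by (simp add: algebra_simps)
  qed
  also have "\<dots> = (\<integral>\<^sup>+z. (\<integral>\<^sup>+s. k_nn z * udens l s * \<psi> (x - z - s) \<partial>lborel) \<partial>lborel)"
    by (rule lborel_pair.Fubini') simp
  also have "\<dots> = (\<integral>\<^sup>+z. k_nn z * U_op l \<psi> (x - z) \<partial>lborel)"
    using l by (intro nn_integral_cong) (simp add: U_op_density nn_integral_cmult mult.assoc)
  also have "\<dots> = U_op 0 (U_op l \<psi>) x" by (rule U_op_0[symmetric]) simp
  finally show ?thesis .
qed

end

section \<open>Small-time tails and the compensation formula at first passage\<close>

context subordinated
begin

text \<open>Converges to $\bar\mu$ as $h \to 0$.\<close>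

definition itail :: "real \<Rightarrow> real \<Rightarrow> real" where "itail h z = measure M {w \<in> space M. z < X h w} / h"

lemma itail_em: "h > 0 \<Longrightarrow> emeasure M {w \<in> space M. z < X h w} * ennreal (1 / h) = ennreal (itail h z)"
  by (simp add: emeasure_eq_measure itail_def ennreal_mult[symmetric])

lemma itail_nonneg: "h > 0 \<Longrightarrow> 0 \<le> itail h z" by (simp add: itail_def)

lemma itail_antimono: "h > 0 \<Longrightarrow> y \<le> z \<Longrightarrow> itail h z \<le> itail h y"
proof -
  assume h: "h > 0" and yz: "y \<le> z"
  have [measurable]: "X h \<in> borel_measurable M" using X_meas h by simp
  have "measure M {w \<in> space M. z < X h w} \<le> measure M {w \<in> space M. y < X h w}"
    by (rule finite_measure_mono) (use yz in auto)
  thus ?thesis using h by (simp add: itail_def divide_right_mono)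
qed

lemma itail_measurable[measurable]: assumes "h > 0" shows "itail h \<in> borel_measurable borel"
proof -
  have "(\<lambda>z. - itail h z) \<in> borel_measurable borel"
    by (rule borel_measurable_mono) (auto simp: mono_def intro: itail_antimono[OF assms])
  hence "(\<lambda>z. - (- itail h z)) \<in> borel_measurable borel" by (rule borel_measurable_uminus)
  thus ?thesis by simp
qed

text \<open>Markov's inequality for 1 - exp(-X/z), whose mean 1 - exp(-h f(1/z)) is at most h
  f(1/z). The bound is uniform in h, as dominated convergence and the continuity of the semigroup at
  time 0 require.\<close>

lemma itail_bound:
  assumes h: "h > 0" and z: "z > 0"
  shows "itail h z \<le> f (1 / z) / (1 - exp (-1))"
proof -
  have h0: "h \<ge> 0" using h by simp
  note [measurable] = X_meas[OF h0]
  let ?l = "1 / z"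
  have e1: "(1::real) - exp (-1) > 0" by simp
  have i: "integrable M (\<lambda>w. exp (- ?l * X h w))"
  proof (rule Bochner_Integration.integrable_bound[of M "\<lambda>_. 1::real"])
    show "AE w in M. norm (exp (- ?l * X h w)) \<le> norm (1::real)"
      using X_nonneg[OF _ h0] z by (intro AE_I2) auto
  qed auto
  have "(1 - exp (-1)) * measure M {w \<in> space M. z < X h w} = (\<integral>w. (1 - exp (-1)) * indicator {w \<in> space M. z < X h w} w \<partial>M)"
    by simp
  also have "\<dots> \<le> (\<integral>w. 1 - exp (- ?l * X h w) \<partial>M)"
  proof (rule integral_mono)
    show "integrable M (\<lambda>w. 1 - exp (- ?l * X h w))" using i by simp
    fix w assume w: "w \<in> space M"
    show "(1 - exp (-1)) * indicator {w \<in> space M. z < X h w} w \<le> 1 - exp (- ?l * X h w)"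
    proof (cases "z < X h w")
      case True
      hence "- ?l * X h w \<le> -1" using z by (simp add: field_simps)
      hence "exp (- ?l * X h w) \<le> exp (-1)" by (simp only: exp_le_cancel_iff)
      thus ?thesis using True w by simp
    next
      case False
      thus ?thesis using X_nonneg[OF w h0] z by simp
    qed
  next
    show "integrable M (\<lambda>w. (1 - exp (-1) :: real) * indicator {w \<in> space M. z < X h w} w)"
    proof -
      have "{w \<in> space M. z < X h w} \<in> sets M" by measurable
      hence "integrable M (indicator {w \<in> space M. z < X h w} :: _ \<Rightarrow> real)"
        by (rule integrable_real_indicator) (simp add: emeasure_eq_measure)
      thus ?thesis by (rule integrable_mult_right)
    qed
  qed
  also have "\<dots> = 1 - exp (- h * f ?l)"
  proof -
    have "?l > 0" using z by simp
    hence "(\<integral>w. exp (- ?l * X h w) \<partial>M) = exp (- h * f ?l)"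
      using sub h0 unfolding subordinator_def by blast
    thus ?thesis using Bochner_Integration.integral_diff[OF integrable_const[of 1] i] by (simp only: lebesgue_integral_const prob_space) simp
  qed
  also have "\<dots> \<le> h * f ?l" using exp_ge_add_one_self[of "- h * f ?l"] by simp
  finally have "(1 - exp (-1)) * itail h z \<le> f ?l" using h by (simp add: itail_def field_simps)
  thus ?thesis using e1 by (simp add: pos_le_divide_eq mult.commute)
qed

lemma itail_laplace:
  assumes h: "h > 0" and a: "a > 0"
  shows "(\<integral>\<^sup>+z. eexp a z * (ennreal (itail h z) * indicator {0<..} z) \<partial>lborel) = ennreal ((1 - exp (-(h * f a))) / (a * h))"
proof -
  have h0: "h \<ge> 0" using h by simp
  note [measurable] = X_meas[OF h0]
  interpret P: pair_sigma_finite M "lborel :: real measure" ..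
  have "(\<integral>\<^sup>+z. eexp a z * (ennreal (itail h z) * indicator {0<..} z) \<partial>lborel) =
    (\<integral>\<^sup>+z. (\<integral>\<^sup>+w. eexp a z * ennreal (1 / h) * indicator {0<..} z * (if z < X h w then 1 else 0) \<partial>M) \<partial>lborel)"
  proof (rule nn_integral_cong)
    fix z :: real
    have "(\<integral>\<^sup>+w. (if z < X h w then 1 else 0) \<partial>M) = (\<integral>\<^sup>+w. indicator {w \<in> space M. z < X h w} w \<partial>M)"
      by (intro nn_integral_cong) (auto simp: indicator_def)
    also have "\<dots> = emeasure M {w \<in> space M. z < X h w}" by simp
    finally show "eexp a z * (ennreal (itail h z) * indicator {0<..} z) =
      (\<integral>\<^sup>+w. eexp a z * ennreal (1 / h) * indicator {0<..} z * (if z < X h w then 1 else 0) \<partial>M)"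
      by (simp add: nn_integral_cmult itail_em[OF h, symmetric] mult_ac)
  qed
  also have "\<dots> = (\<integral>\<^sup>+w. (\<integral>\<^sup>+z. eexp a z * ennreal (1 / h) * indicator {0<..} z * (if z < X h w then 1 else 0) \<partial>lborel) \<partial>M)"
    by (rule P.Fubini') measurable
  also have "\<dots> = (\<integral>\<^sup>+w. ennreal (1 - exp (- a * X h w)) * ennreal (1 / (a * h)) \<partial>M)"
  proof (rule nn_integral_cong)
    fix w assume w: "w \<in> space M"
    have x0: "X h w \<ge> 0" by (rule X_nonneg[OF w h0])
    have "(\<integral>\<^sup>+z. eexp a z * ennreal (1 / h) * indicator {0<..} z * (if z < X h w then 1 else 0) \<partial>lborel) =
      (\<integral>\<^sup>+z. (eexp a z * indicator {0..X h w} z) * ennreal (1 / h) \<partial>lborel)"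
      by (rule nn_integral_cong_AE, rule AE_mp[OF AE_lborel_singleton[of 0]], rule AE_mp[OF AE_lborel_singleton[of "X h w"]])
         (auto simp: indicator_def)
    also have "\<dots> = (\<integral>\<^sup>+z. eexp a z * indicator {0..X h w} z \<partial>lborel) * ennreal (1 / h)"
      by (rule nn_integral_multc) simp
    also have "(\<integral>\<^sup>+z. eexp a z * indicator {0..X h w} z \<partial>lborel) = ennreal (- exp (-(a * X h w)) / a - (- exp (-(a * 0)) / a))"
      using a x0 by (intro nn_integral_FTC_Icc[where F="\<lambda>x. - exp (-(a * x)) / a"]) (auto intro!: derivative_eq_intros)
    also have "- exp (-(a * X h w)) / a - (- exp (-(a * 0)) / a) = (1 - exp (- a * X h w)) * (1 / a)"
      by (simp add: diff_divide_distrib)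
    also have "ennreal \<dots> * ennreal (1 / h) = ennreal (1 - exp (- a * X h w)) * ennreal (1 / (a * h))"
      using a h x0 by (simp add: ennreal_mult[symmetric] divide_simps)
    finally show "(\<integral>\<^sup>+z. eexp a z * ennreal (1 / h) * indicator {0<..} z * (if z < X h w then 1 else 0) \<partial>lborel) = ennreal (1 - exp (- a * X h w)) * ennreal (1 / (a * h))" .
  qed
  also have "\<dots> = (\<integral>\<^sup>+w. ennreal (1 - exp (- a * X h w)) \<partial>M) * ennreal (1 / (a * h))"
    by (rule nn_integral_multc) simp
  also have "(\<integral>\<^sup>+w. ennreal (1 - exp (- a * X h w)) \<partial>M) = ennreal (1 - exp (-(h * f a)))"
  proof -
    have i: "integrable M (\<lambda>w. exp (- a * X h w))"
    proof (rule Bochner_Integration.integrable_bound[of M "\<lambda>_. 1::real"])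
      show "AE w in M. norm (exp (- a * X h w)) \<le> norm (1::real)"
        using X_nonneg[OF _ h0] a by (intro AE_I2) auto
    qed auto
    have "(\<integral>\<^sup>+w. ennreal (1 - exp (- a * X h w)) \<partial>M) = ennreal (\<integral>w. 1 - exp (- a * X h w) \<partial>M)"
      using i X_nonneg[OF _ h0] a by (intro nn_integral_eq_integral) (auto intro!: AE_I2)
    also have "(\<integral>w. 1 - exp (- a * X h w) \<partial>M) = 1 - exp (-(h * f a))"
      using i sub h0 a by (simp add: subordinator_def prob_space)
    finally show ?thesis .
  qed
  also have "ennreal (1 - exp (-(h * f a))) * ennreal (1 / (a * h)) = ennreal ((1 - exp (-(h * f a))) / (a * h))"
    using a h f_pos[OF a] by (simp add: ennreal_mult[symmetric])
  finally show ?thesis .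
qed

text \<open>At rate a the transform (1 - exp(-h f(a)))/(a h) of \<open>itail\<close> is a difference
  quotient of the exponential and converges to f(a)/a, the transform of the tail.\<close>

lemma itail_weak:
  fixes b :: "real \<Rightarrow> real"
  assumes b: "continuous_on {0..1} b" and [measurable]: "b \<in> borel_measurable borel"
  shows "(\<lambda>n. \<integral>s. indicator {0<..} s * itail (1 / real (Suc n)) s * (exp (-s) * b (exp (-s))) \<partial>lborel)
    \<longlonglongrightarrow> (\<integral>s. indicator {0<..} s * tail \<mu> s * (exp (-s) * b (exp (-s))) \<partial>lborel)"
proof -
  define h where "h n = 1 / real (Suc n)" for n
  have h: "h n > 0" for n by (simp add: h_def)
  note [measurable] = itail_measurable[OF h]
  have [measurable]: "(\<lambda>s. indicator {0<..} s * tail \<mu> s) \<in> borel_measurable borel"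
    using borel_measurable_continuous_on_indicator[OF _ tail_cont] by simp
  have ma: "(\<lambda>s. ennreal (indicator {0<..} s * itail (h n) s)) \<in> borel_measurable lborel" for n by measurable
  have mb: "(\<lambda>s. ennreal (indicator {0<..} s * tail \<mu> s)) \<in> borel_measurable lborel" by measurable
  define \<alpha> where "\<alpha> n = density lborel (\<lambda>s. ennreal (indicator {0<..} s * itail (h n) s))" for n
  define \<beta> where "\<beta> = density lborel (\<lambda>s. ennreal (indicator {0<..} s * tail \<mu> s))"
  have ia: "(\<integral>s. g s \<partial>\<alpha> n) = (\<integral>s. indicator {0<..} s * itail (h n) s * g s \<partial>lborel)" if "g \<in> borel_measurable borel" for g :: "real \<Rightarrow> real" and n
    unfolding \<alpha>_def using that itail_nonneg[OF h] by (subst integral_density) (auto simp: mult.assoc)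
  have ib: "(\<integral>s. g s \<partial>\<beta>) = (\<integral>s. indicator {0<..} s * tail \<mu> s * g s \<partial>lborel)" if "g \<in> borel_measurable borel" for g :: "real \<Rightarrow> real"
    unfolding \<beta>_def using that tail_nonneg by (subst integral_density) (auto simp: mult.assoc)
  have na: "(\<integral>\<^sup>+s. eexp a s \<partial>\<alpha> n) = ennreal ((1 - exp (-(h n * f a))) / (a * h n))" if "a > 0" for a n
  proof -
    have "(\<integral>\<^sup>+s. eexp a s \<partial>\<alpha> n) = (\<integral>\<^sup>+s. eexp a s * (ennreal (itail (h n) s) * indicator {0<..} s) \<partial>lborel)"
      unfolding \<alpha>_def by (subst nn_integral_density) (auto intro!: nn_integral_cong simp: indicator_def mult.commute)
    thus ?thesis using itail_laplace[OF h that] by simp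
  qed
  have nb: "(\<integral>\<^sup>+s. eexp a s \<partial>\<beta>) = ennreal (f a / a)" if "a > 0" for a
  proof -
    have "(\<integral>\<^sup>+s. eexp a s \<partial>\<beta>) = (\<integral>\<^sup>+s. eexp a s * tail_nn s \<partial>lborel)"
      unfolding \<beta>_def by (subst nn_integral_density[OF mb]) (auto intro!: nn_integral_cong simp: indicator_def tail_nn_def mult.commute)
    thus ?thesis using tail_laplace[OF that] by simp
  qed
  have sets: "sets (\<alpha> n) = sets borel" "sets \<beta> = sets borel" for n by (auto simp: \<alpha>_def \<beta>_def)
  have inta: "integrable (\<alpha> n) (\<lambda>s. exp (-(a * s)))" if "a > 0" for a n
    using na[OF that, of n] sets by (intro integrableI_bounded) (auto simp: measurable_cong_sets[OF sets(1) refl])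
  have intb: "integrable \<beta> (\<lambda>s. exp (-(a * s)))" if "a > 0" for a
    using nb[OF that] sets by (intro integrableI_bounded) (auto simp: measurable_cong_sets[OF sets(2) refl])
  have la: "(\<integral>s. exp (-(a * s)) \<partial>\<alpha> n) = (1 - exp (-(h n * f a))) / (a * h n)" if "a > 0" for a n
  proof -
    have "ennreal (\<integral>s. exp (-(a * s)) \<partial>\<alpha> n) = ennreal ((1 - exp (-(h n * f a))) / (a * h n))"
      using nn_integral_eq_integral[OF inta[OF that, of n]] na[OF that, of n] by simp
    thus ?thesis using h[of n] that f_pos[OF that] by (subst (asm) ennreal_inj) (auto intro!: integral_nonneg_AE)
  qed
  have lb: "(\<integral>s. exp (-(a * s)) \<partial>\<beta>) = f a / a" if "a > 0" for a
  proof -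
    have "ennreal (\<integral>s. exp (-(a * s)) \<partial>\<beta>) = ennreal (f a / a)"
      using nn_integral_eq_integral[OF intb[OF that]] nb[OF that] by simp
    thus ?thesis using that f_pos[OF that] by (subst (asm) ennreal_inj) (auto intro!: integral_nonneg_AE)
  qed
  have "(\<lambda>n. \<integral>x. exp (-x) * b (exp (-x)) \<partial>\<alpha> n) \<longlonglongrightarrow> (\<integral>x. exp (-x) * b (exp (-x)) \<partial>\<beta>)"
  proof (rule laplace_weak_limit[OF sets])
    show "AE x in \<alpha> n. 0 \<le> x" for n unfolding \<alpha>_def AE_density[OF ma] by (auto simp: indicator_def)
    show "AE x in \<beta>. 0 \<le> x" unfolding \<beta>_def AE_density[OF mb] by (auto simp: indicator_def)
    show "(\<lambda>n. \<integral>x. exp (-(real (Suc i) * x)) \<partial>\<alpha> n) \<longlonglongrightarrow> (\<integral>x. exp (-(real (Suc i) * x)) \<partial>\<beta>)" for i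
    proof -
      define a where "a = real (Suc i)"
      have a: "a > 0" by (simp add: a_def)
      have h0: "h \<longlonglongrightarrow> 0" unfolding h_def by (rule LIMSEQ_Suc[OF lim_1_over_n])
      have "((\<lambda>x. 1 - exp (-(x * f a))) has_real_derivative f a) (at 0)"
        by (auto intro!: derivative_eq_intros)
      hence d: "((\<lambda>x. (1 - exp (-(x * f a))) / x) \<longlongrightarrow> f a) (at 0)"
        unfolding has_field_derivative_iff by simp
      have "filterlim h (at 0) sequentially"
        unfolding filterlim_at using h0 h by (auto intro!: always_eventually) (metis less_irrefl h)
      hence "(\<lambda>n. (1 - exp (-(h n * f a))) / h n) \<longlonglongrightarrow> f a" by (rule filterlim_compose[OF d])
      hence "(\<lambda>n. (1 - exp (-(h n * f a))) / h n / a) \<longlonglongrightarrow> f a / a" using a by (intro tendsto_intros) auto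
      thus ?thesis unfolding a_def[symmetric] la[OF a] lb[OF a] by (simp add: mult.commute)
    qed
  qed (use inta[of 1] intb[of 1] b in auto)
  thus ?thesis by (simp add: ia ib h_def)
qed

lemma bump_integrals:
  fixes b D :: "real \<Rightarrow> real"
  assumes [measurable]: "b \<in> borel_measurable borel" and b0: "\<And>u. 0 \<le> b u"
    and bs: "\<And>s. s \<notin> {t..t+d} \<Longrightarrow> b (exp (-s)) = 0"
    and bi: "integrable lborel (\<lambda>s. indicator {0..} s * exp (-s) * b (exp (-s)))"
    and b1: "(\<integral>s. indicator {0..} s * exp (-s) * b (exp (-s)) \<partial>lborel) = 1"
    and t: "t > 0" "d > 0"
    and [measurable]: "(\<lambda>s. indicator {0<..} s * D s) \<in> borel_measurable borel"
    and D: "\<And>s. s \<in> {t..t+d} \<Longrightarrow> cl \<le> D s" "\<And>s. s \<in> {t..t+d} \<Longrightarrow> D s \<le> cu" "0 \<le> cl"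
  shows "cl \<le> (\<integral>s. indicator {0<..} s * D s * (exp (-s) * b (exp (-s))) \<partial>lborel)"
    "(\<integral>s. indicator {0<..} s * D s * (exp (-s) * b (exp (-s))) \<partial>lborel) \<le> cu"
proof -
  let ?w = "\<lambda>s. indicator {0..} s * exp (-s) * b (exp (-s))"
  have le: "cl * ?w s \<le> indicator {0<..} s * D s * (exp (-s) * b (exp (-s)))"
    "indicator {0<..} s * D s * (exp (-s) * b (exp (-s))) \<le> cu * ?w s" for s
  proof -
    consider "s \<in> {t..t+d}" | "s \<notin> {t..t+d}" by blast
    hence "cl * ?w s \<le> indicator {0<..} s * D s * (exp (-s) * b (exp (-s))) \<and> indicator {0<..} s * D s * (exp (-s) * b (exp (-s))) \<le> cu * ?w s"
    proof cases
      case 1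
      hence "s > 0" using t by simp
      thus ?thesis using D(1,2)[OF 1] b0[of "exp (-s)"] by (auto intro!: mult_right_mono)
    next
      case 2 thus ?thesis using bs by simp
    qed
    thus "cl * ?w s \<le> indicator {0<..} s * D s * (exp (-s) * b (exp (-s)))"
      "indicator {0<..} s * D s * (exp (-s) * b (exp (-s))) \<le> cu * ?w s" by auto
  qed
  have w0: "0 \<le> ?w s" for s using b0 by simp
  have i: "integrable lborel (\<lambda>s. indicator {0<..} s * D s * (exp (-s) * b (exp (-s))))"
  proof (rule Bochner_Integration.integrable_bound[OF integrable_mult_right[OF bi, of cu]])
    show "AE s in lborel. norm (indicator {0<..} s * D s * (exp (-s) * b (exp (-s)))) \<le> norm (cu * ?w s)"
    proof (rule AE_I2)
      fix s
      have "0 \<le> cl * ?w s" by (rule mult_nonneg_nonneg[OF D(3) w0])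
      thus "norm (indicator {0<..} s * D s * (exp (-s) * b (exp (-s)))) \<le> norm (cu * ?w s)"
        using le[of s] unfolding real_norm_def by linarith
    qed
  qed measurable
  have "(\<integral>s. cl * ?w s \<partial>lborel) \<le> (\<integral>s. indicator {0<..} s * D s * (exp (-s) * b (exp (-s))) \<partial>lborel)"
    by (intro integral_mono i integrable_mult_right bi le)
  thus "cl \<le> (\<integral>s. indicator {0<..} s * D s * (exp (-s) * b (exp (-s))) \<partial>lborel)"
    by (simp only: integral_mult_right_zero b1 mult_1_right)
  have "(\<integral>s. indicator {0<..} s * D s * (exp (-s) * b (exp (-s))) \<partial>lborel) \<le> (\<integral>s. cu * ?w s \<partial>lborel)"
    by (intro integral_mono i integrable_mult_right bi le)
  thus "(\<integral>s. indicator {0<..} s * D s * (exp (-s) * b (exp (-s))) \<partial>lborel) \<le> cu"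
    by (simp only: integral_mult_right_zero b1 mult_1_right)
qed

text \<open>Weak convergence of monotone densities to a continuous one is pointwise: averages over a
  bump to the right of z bound \<open>itail\<close> at z from below, averages over a bump to the
  left bound it from above.\<close>

lemma itail_tendsto:
  assumes z: "z > 0"
  shows "(\<lambda>n. itail (1 / real (Suc n)) z) \<longlonglongrightarrow> tail \<mu> z"
proof (rule order_tendstoI)
  have h: "1 / real (Suc n) > 0" for n by simp
  have m1[measurable]: "(\<lambda>s. indicator {0<..} s * tail \<mu> s) \<in> borel_measurable borel"
    using borel_measurable_continuous_on_indicator[OF _ tail_cont] by simp
  have m2: "(\<lambda>s. indicator {0<..} s * itail (1 / real (Suc n)) s) \<in> borel_measurable borel" for n
    using itail_measurable[OF h, of n] by measurable
  have "isCont (tail \<mu>) z" using tail_cont continuous_on_eq_continuous_at[of "{0<..}" "tail \<mu>"] z by auto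
  hence lim: "(tail \<mu> \<longlongrightarrow> tail \<mu> z) (at z)" by (simp add: isCont_def)
  {
    fix a assume a: "a < tail \<mu> z"
    have "\<forall>\<^sub>F y in at_right z. a < tail \<mu> y"
      by (rule order_tendstoD(1)[OF _ a]) (use lim in \<open>auto intro: tendsto_within_subset\<close>)
    then obtain y where y: "y > z" "\<forall>w>z. w < y \<longrightarrow> a < tail \<mu> w" unfolding eventually_at_right_field by blast
    define d where "d = (y - z) / 2"
    have d: "d > 0" "a < tail \<mu> (z + d)" using y by (auto simp: d_def field_simps)
    have z0: "z \<ge> 0" using z by simp
    obtain b :: "real \<Rightarrow> real" where b: "continuous_on {0..1} b" "b \<in> borel_measurable borel" "\<And>u. 0 \<le> b u"
    "\<And>s. s \<notin> {z..z+d} \<Longrightarrow> b (exp (-s)) = 0"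
    "integrable lborel (\<lambda>s. indicator {0..} s * exp (-s) * b (exp (-s)))"
    "(\<integral>s. indicator {0..} s * exp (-s) * b (exp (-s)) \<partial>lborel) = 1" by (rule exp_bump[OF z0 d(1)], rule that)
    have "tail \<mu> (z + d) \<le> (\<integral>s. indicator {0<..} s * tail \<mu> s * (exp (-s) * b (exp (-s))) \<partial>lborel)"
      by (rule bump_integrals(1)[OF b(2-6) z d(1) m1, where cu="tail \<mu> z"]) (use z tail_antimono tail_nonneg in auto)
    hence "a < (\<integral>s. indicator {0<..} s * tail \<mu> s * (exp (-s) * b (exp (-s))) \<partial>lborel)" using d by simp
    from order_tendstoD(1)[OF itail_weak[OF b(1,2)] this]
    show "\<forall>\<^sub>F n in sequentially. a < itail (1 / real (Suc n)) z"
    proof eventually_elim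
      case (elim n)
      have "(\<integral>s. indicator {0<..} s * itail (1 / real (Suc n)) s * (exp (-s) * b (exp (-s))) \<partial>lborel) \<le> itail (1 / real (Suc n)) z"
        by (rule bump_integrals(2)[OF b(2-6) z d(1) m2, where cl=0]) (use itail_antimono[OF h] itail_nonneg[OF h] in auto)
      thus ?case using elim by simp
    qed
  }
  {
    fix a assume a: "tail \<mu> z < a"
    have "\<forall>\<^sub>F y in at_left z. tail \<mu> y < a"
      by (rule order_tendstoD(2)[OF _ a]) (use lim in \<open>auto intro: tendsto_within_subset\<close>)
    then obtain y where y: "y < z" "\<forall>w>y. w < z \<longrightarrow> tail \<mu> w < a" unfolding eventually_at_left_field by blast
    define t where "t = (max y 0 + z) / 2"
    have t: "t > 0" "t < z" "tail \<mu> t < a" using y z by (auto simp: t_def)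
    define d where "d = z - t"
    have d: "d > 0" "t + d = z" "t \<ge> 0" using t by (auto simp: d_def)
    obtain b :: "real \<Rightarrow> real" where b: "continuous_on {0..1} b" "b \<in> borel_measurable borel" "\<And>u. 0 \<le> b u"
    "\<And>s. s \<notin> {t..t+d} \<Longrightarrow> b (exp (-s)) = 0"
    "integrable lborel (\<lambda>s. indicator {0..} s * exp (-s) * b (exp (-s)))"
    "(\<integral>s. indicator {0..} s * exp (-s) * b (exp (-s)) \<partial>lborel) = 1" by (rule exp_bump[OF d(3) d(1)], rule that)
    have "(\<integral>s. indicator {0<..} s * tail \<mu> s * (exp (-s) * b (exp (-s))) \<partial>lborel) \<le> tail \<mu> t"
      by (rule bump_integrals(2)[OF b(2-6) t(1) d(1) m1, where cl=0]) (use t tail_antimono tail_nonneg in auto)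
    hence "(\<integral>s. indicator {0<..} s * tail \<mu> s * (exp (-s) * b (exp (-s))) \<partial>lborel) < a" using t by simp
    from order_tendstoD(2)[OF itail_weak[OF b(1,2)] this]
    show "\<forall>\<^sub>F n in sequentially. itail (1 / real (Suc n)) z < a"
    proof eventually_elim
      case (elim n)
      have "itail (1 / real (Suc n)) z \<le> (\<integral>s. indicator {0<..} s * itail (1 / real (Suc n)) s * (exp (-s) * b (exp (-s))) \<partial>lborel)"
        by (rule bump_integrals(1)[OF b(2-6) t(1) d(1) m2, where cu="itail (1 / real (Suc n)) t"])
           (use itail_antimono[OF h] itail_nonneg[OF h] d in auto)
      thus ?case using elim by simp
    qed
  }
qed

definition path_of :: "'w \<Rightarrow> real \<Rightarrow> real" where "path_of w = restrict (\<lambda>t. X t w) {0..}"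

lemma path_of_measurable[measurable]: "path_of \<in> measurable M path_space"
  unfolding path_of_def by (rule measurable_restrict) (use X_meas in auto)

definition exit_t :: "real \<Rightarrow> 'w \<Rightarrow> ereal" where "exit_t x w = passage_time (\<lambda>t. X t w) x"
definition pre_exit :: "real \<Rightarrow> 'w \<Rightarrow> real" where "pre_exit x w = left_value (\<lambda>t. X t w) (exit_t x w)"

lemma exit_t_eq: "w \<in> space M \<Longrightarrow> exit_t x w = passQ (path_of w) x"
  unfolding exit_t_def path_of_def passQ_restrict by (rule passage_passQ[OF X_nice])

lemma pre_exit_eq: "w \<in> space M \<Longrightarrow> x \<ge> 0 \<Longrightarrow> pre_exit x w = leftQ (path_of w) (passQ (path_of w) x)"
  unfolding pre_exit_def path_of_def leftQ_restrict passQ_restrict exit_t_def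
  using left_value_props(1)[OF X_nice _ refl, of w x] passage_passQ[OF X_nice, of w x] by simp

lemma exit_t_measurable[measurable]: "exit_t x \<in> borel_measurable M"
proof -
  have "(\<lambda>w. (\<lambda>(y, p). passQ p y) (x, path_of w)) \<in> borel_measurable M" by measurable
  thus ?thesis by (subst measurable_cong[OF exit_t_eq]) auto
qed

lemma pre_exit_measurable: "x \<ge> 0 \<Longrightarrow> pre_exit x \<in> borel_measurable M"
proof -
  assume x: "x \<ge> 0"
  have "(\<lambda>w. (\<lambda>(y, p). passQ p y) (x, path_of w)) \<in> borel_measurable M" by measurable
  hence "(\<lambda>w. (\<lambda>(s, p). leftQ p s) ((\<lambda>(y, p). passQ p y) (x, path_of w), path_of w)) \<in> borel_measurable M" by measurable
  thus ?thesis by (subst measurable_cong[OF pre_exit_eq[OF _ x]]) auto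
qed

text \<open>The expectation of the discretised passage is computed in two ways. Pathwise it
  converges to the value at passage; by independent stationary increments the chance of crossing x
  within h, given X(t), is h times \<open>itail h\<close> at x - X(t). Since \<psi> vanishes up to
  e, only levels where \<open>itail\<close> is uniformly bounded enter.\<close>

lemma compensation_cont:
  fixes \<psi> :: "real \<Rightarrow> real"
  assumes x: "x > 0" and l: "l > 0" and \<psi>: "continuous_on UNIV \<psi>" "\<And>z. 0 \<le> \<psi> z" "\<And>z. \<psi> z \<le> 1"
    and e: "e > 0" "\<And>z. z \<le> e \<Longrightarrow> \<psi> z = 0"
  shows "(\<integral>\<^sup>+w. ennreal (discount l (exit_t x w) * \<psi> (x - pre_exit x w)) \<partial>M) = (\<integral>\<^sup>+z. ennreal (\<psi> (x - z)) * tail_nn (x - z) \<partial>umeas l)"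
proof -
  note [measurable] = X_joint' pre_exit_measurable[OF less_imp_le[OF x]]
  have [measurable]: "\<psi> \<in> borel_measurable borel" using \<psi>(1) by (rule borel_measurable_continuous_onI)
  define h where "h n = 1 / real (Suc n)" for n
  have h: "h n > 0" and h0: "h n \<ge> 0" for n by (auto simp: h_def)
  note [measurable] = itail_measurable[OF h]
  define A where "A n w = (\<integral>\<^sup>+t. indicator {0..} t * (eexp l t * (ennreal (\<psi> (x - X t w)) * (if X t w \<le> x \<and> x < X (t + h n) w then ennreal (1 / h n) else 0))) \<partial>lborel)" for n w
  \<comment> \<open>Agrees with the integrand of \<open>A\<close> for t \<ge> 0; the maxima make the
    time arguments nonnegative everywhere, so that joint measurability holds on the whole
    line.\<close>
  define J where "J n w t = indicator {0..} t * (eexp l t * (ennreal (\<psi> (x - X (max 0 t) w)) * (if X (max 0 t) w \<le> x \<and> x < X (max 0 (max 0 t + h n)) w then ennreal (1 / h n) else 0)))" for n w t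
  have AJ: "A n w = (\<integral>\<^sup>+t. J n w t \<partial>lborel)" for n w
    unfolding A_def J_def
  proof (rule nn_integral_cong)
    fix t :: real
    show "indicator {0..} t * (eexp l t * (ennreal (\<psi> (x - X t w)) * (if X t w \<le> x \<and> x < X (t + h n) w then ennreal (1 / h n) else 0))) =
      indicator {0..} t * (eexp l t * (ennreal (\<psi> (x - X (max 0 t) w)) * (if X (max 0 t) w \<le> x \<and> x < X (max 0 (max 0 t + h n)) w then ennreal (1 / h n) else 0)))"
      using h0[of n] by (cases "t \<ge> 0") (auto simp: max_absorb2)
  qed
  have [measurable]: "(\<lambda>z. X (max 0 (max 0 (snd z) + h n)) (fst z)) \<in> borel_measurable (M \<Otimes>\<^sub>M lborel)" for n
    by (rule right_cont_measurable[OF X_meas X_rc]) auto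
  have "(\<lambda>z. J n (fst z) (snd z)) \<in> borel_measurable (M \<Otimes>\<^sub>M lborel)" for n
    unfolding J_def by measurable
  hence Jm'[measurable]: "case_prod (J n) \<in> borel_measurable (M \<Otimes>\<^sub>M lborel)" for n by (simp add: split_beta')
  have Am[measurable]: "A n \<in> borel_measurable M" for n
  proof -
    have "A n = (\<lambda>w. \<integral>\<^sup>+t. J n w t \<partial>lborel)" using AJ by auto
    thus ?thesis by simp
  qed
  have av: "A n w \<le> 1" "(\<lambda>n. A n w) \<longlonglongrightarrow> ennreal (discount l (exit_t x w) * \<psi> (x - pre_exit x w))" if "w \<in> space M" for n w
    using passage_average(1)[OF X_nice[OF that] x \<psi> less_imp_le[OF l] h[of n]]
      passage_average(2)[OF X_nice[OF that] x \<psi> less_imp_le[OF l]]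
    unfolding A_def exit_t_def pre_exit_def h_def by (simp_all only: comp_def)
  have L1: "(\<lambda>n. \<integral>\<^sup>+w. A n w \<partial>M) \<longlonglongrightarrow> (\<integral>\<^sup>+w. ennreal (discount l (exit_t x w) * \<psi> (x - pre_exit x w)) \<partial>M)"
  proof (rule nn_integral_dominated_convergence[where w="\<lambda>_. 1"])
    show "AE w in M. A n w \<le> 1" for n using av(1) by (intro AE_I2) auto
    show "AE w in M. (\<lambda>n. A n w) \<longlonglongrightarrow> ennreal (discount l (exit_t x w) * \<psi> (x - pre_exit x w))" using av(2) by (intro AE_I2) auto
    show "(\<integral>\<^sup>+w. 1 \<partial>M) < \<infinity>" by (simp add: emeasure_space_1)
  qed auto
  interpret P: pair_sigma_finite M "lborel :: real measure" ..
  have E: "(\<integral>\<^sup>+w. A n w \<partial>M) = (\<integral>\<^sup>+z. ennreal (\<psi> (x - z)) * ennreal (itail (h n) (x - z)) \<partial>umeas l)" for n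
  proof -
    have "(\<integral>\<^sup>+w. A n w \<partial>M) = (\<integral>\<^sup>+t. (\<integral>\<^sup>+w. J n w t \<partial>M) \<partial>lborel)"
      unfolding AJ by (rule P.Fubini'[symmetric]) measurable
    also have "\<dots> = (\<integral>\<^sup>+t. hexp l t * (\<integral>\<^sup>+w. ennreal (\<psi> (x - X t w)) * ennreal (itail (h n) (x - X t w)) \<partial>M) \<partial>lborel)"
    proof (rule nn_integral_cong)
      fix t :: real
      show "(\<integral>\<^sup>+w. J n w t \<partial>M) = hexp l t * (\<integral>\<^sup>+w. ennreal (\<psi> (x - X t w)) * ennreal (itail (h n) (x - X t w)) \<partial>M)"
      proof (cases "t \<ge> 0")
        case True
        have th: "t + h n \<ge> 0" using True h0[of n] by simp
        note [measurable] = X_meas[OF True] X_meas[OF th] X_meas[OF h0[of n]]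
        have "(\<integral>\<^sup>+w. J n w t \<partial>M) = (\<integral>\<^sup>+w. eexp l t * (ennreal (\<psi> (x - X t w)) * (if x < X (t + h n) w then ennreal (1 / h n) else 0)) \<partial>M)"
        proof (rule nn_integral_cong)
          fix w
          have "\<psi> (x - X t w) = 0" if "\<not> X t w \<le> x" using e that by simp
          thus "J n w t = eexp l t * (ennreal (\<psi> (x - X t w)) * (if x < X (t + h n) w then ennreal (1 / h n) else 0))"
            using True h0[of n] by (auto simp: J_def max_absorb2)
        qed
        also have "\<dots> = eexp l t * (\<integral>\<^sup>+w. ennreal (\<psi> (x - X t w)) * (if x < X (t + h n) w then ennreal (1 / h n) else 0) \<partial>M)"
          by (rule nn_integral_cmult) measurable
        also have "(\<integral>\<^sup>+w. ennreal (\<psi> (x - X t w)) * (if x < X (t + h n) w then ennreal (1 / h n) else 0) \<partial>M) =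
          (\<integral>\<^sup>+w. (\<lambda>(a, b). ennreal (\<psi> (x - a)) * (if x - a < b then ennreal (1 / h n) else 0)) (X t w, X (t + h n) w - X t w) \<partial>M)"
          by (intro nn_integral_cong) (auto simp: algebra_simps)
        also have "\<dots> = (\<integral>\<^sup>+w. (\<integral>\<^sup>+w'. (\<lambda>(a, b). ennreal (\<psi> (x - a)) * (if x - a < b then ennreal (1 / h n) else 0)) (X t w, X (t + h n) w' - X t w') \<partial>M) \<partial>M)"
          by (rule indep_nn_integral[OF X_indep[OF True h0[of n]]]) measurable
        also have "\<dots> = (\<integral>\<^sup>+w. ennreal (\<psi> (x - X t w)) * ennreal (itail (h n) (x - X t w)) \<partial>M)"
        proof (rule nn_integral_cong)
          fix w
          let ?g = "\<lambda>b. ennreal (\<psi> (x - X t w)) * (if x - X t w < b then ennreal (1 / h n) else 0)"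
          have "(\<integral>\<^sup>+w'. ?g (X (t + h n) w' - X t w') \<partial>M) = (\<integral>\<^sup>+b. ?g b \<partial>distr M borel (\<lambda>w. X (t + h n) w - X t w))"
            by (subst nn_integral_distr) auto
          also have "\<dots> = (\<integral>\<^sup>+b. ?g b \<partial>distr M borel (X (h n)))" by (simp only: X_incr_law[OF True h0[of n]])
          also have "\<dots> = (\<integral>\<^sup>+w'. ?g (X (h n) w') \<partial>M)" by (subst nn_integral_distr) auto
          also have "\<dots> = (\<integral>\<^sup>+w'. ennreal (\<psi> (x - X t w)) * (ennreal (1 / h n) * indicator {w' \<in> space M. x - X t w < X (h n) w'} w') \<partial>M)"
            by (intro nn_integral_cong) (auto simp: indicator_def)
          also have "\<dots> = ennreal (\<psi> (x - X t w)) * (ennreal (1 / h n) * emeasure M {w' \<in> space M. x - X t w < X (h n) w'})"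
            by (simp add: nn_integral_cmult)
          also have "\<dots> = ennreal (\<psi> (x - X t w)) * ennreal (itail (h n) (x - X t w))"
            by (simp add: itail_em[OF h, symmetric] mult.commute)
          finally show "(\<integral>\<^sup>+w'. (\<lambda>(a, b). ennreal (\<psi> (x - a)) * (if x - a < b then ennreal (1 / h n) else 0)) (X t w, X (t + h n) w' - X t w') \<partial>M) =
             ennreal (\<psi> (x - X t w)) * ennreal (itail (h n) (x - X t w))" by simp
        qed
        finally show ?thesis using True by simp
      qed (simp add: J_def)
    qed
    also have "\<dots> = (\<integral>\<^sup>+z. ennreal (\<psi> (x - z)) * ennreal (itail (h n) (x - z)) \<partial>umeas l)"
      by (rule nn_umeas[symmetric]) measurable
    finally show ?thesis .
  qed
  \<comment> \<open>The bound of \<open>itail\<close> at level e, uniform in h; it is integrable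
    because the total mass of \<open>umeas l\<close> is finite for l > 0.\<close>
  define C where "C = f (1 / e) / (1 - exp (-1))"
  have L2: "(\<lambda>n. \<integral>\<^sup>+w. A n w \<partial>M) \<longlonglongrightarrow> (\<integral>\<^sup>+z. ennreal (\<psi> (x - z)) * tail_nn (x - z) \<partial>umeas l)"
    unfolding E
  proof (rule nn_integral_dominated_convergence[where w="\<lambda>_. ennreal C"])
    show "AE z in umeas l. ennreal (\<psi> (x - z)) * ennreal (itail (h n) (x - z)) \<le> ennreal C" for n
    proof (rule AE_I2)
      fix z
      show "ennreal (\<psi> (x - z)) * ennreal (itail (h n) (x - z)) \<le> ennreal C"
      proof (cases "x - z \<le> e")
        case True thus ?thesis using e by simp
      next
        case False
        have "itail (h n) (x - z) \<le> itail (h n) e" using False h by (intro itail_antimono) auto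
        also have "\<dots> \<le> C" unfolding C_def by (rule itail_bound[OF h e(1)])
        finally have "ennreal (\<psi> (x - z)) * ennreal (itail (h n) (x - z)) \<le> 1 * ennreal C"
          using \<psi>(3)[of "x - z"] by (intro mult_mono ennreal_leI) (auto simp: ennreal_le_1)
        thus ?thesis by simp
      qed
    qed
    have "(\<integral>\<^sup>+z. 1 \<partial>umeas l) = (\<integral>\<^sup>+t. hexp l t * (\<integral>\<^sup>+w. 1 \<partial>M) \<partial>lborel)" by (rule nn_umeas) simp
    also have "\<dots> = (\<integral>\<^sup>+t. ennreal (indicator {0..} t * exp (-(l * t))) \<partial>lborel)"
      by (intro nn_integral_cong) (auto simp: emeasure_space_1 indicator_def)
    also have "\<dots> < \<infinity>" using integrable_exp_half(1)[OF l] unfolding set_integrable_def integrable_iff_bounded by simp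
    finally have "emeasure (umeas l) UNIV < \<infinity>" by simp
    thus "(\<integral>\<^sup>+z. ennreal C \<partial>umeas l) < \<infinity>" by (simp add: ennreal_mult_less_top)
    show "AE z in umeas l. (\<lambda>n. ennreal (\<psi> (x - z)) * ennreal (itail (h n) (x - z))) \<longlonglongrightarrow> ennreal (\<psi> (x - z)) * tail_nn (x - z)"
    proof (rule AE_I2)
      fix z
      show "(\<lambda>n. ennreal (\<psi> (x - z)) * ennreal (itail (h n) (x - z))) \<longlonglongrightarrow> ennreal (\<psi> (x - z)) * tail_nn (x - z)"
      proof (cases "x - z \<le> e")
        case True thus ?thesis using e by simp
      next
        case False
        hence p: "x - z > 0" using e by simp
        have "(\<lambda>n. ennreal (\<psi> (x - z) * itail (h n) (x - z))) \<longlonglongrightarrow> ennreal (\<psi> (x - z) * tail \<mu> (x - z))"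
          unfolding h_def by (intro tendsto_ennrealI tendsto_intros itail_tendsto[OF p])
        thus ?thesis using p \<psi>(2) itail_nonneg[OF h] tail_nonneg by (simp add: ennreal_mult tail_nn_def)
      qed
    qed
  qed measurable
  show ?thesis by (rule LIMSEQ_unique[OF L1 L2])
qed

text \<open>Both sides are integrals of \<psi> over measures of the new level x -
  \<open>pre_exit\<close>, which are identified on half-lines by continuous \<psi>. The indicator
  discards the new level 0, about which the formula says nothing.\<close>

lemma compensation:
  assumes x: "x \<ge> 0" and l: "l > 0" and [measurable]: "\<psi> \<in> borel_measurable borel"
  shows "(\<integral>\<^sup>+w. ennreal (discount l (exit_t x w)) * (\<psi> (x - pre_exit x w) * indicator {0<..} (x - pre_exit x w)) \<partial>M) =
    U_op l (\<lambda>y. tail_nn y * \<psi> y) x"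
proof (cases "x = 0")
  case True
  have "(\<integral>\<^sup>+w. ennreal (discount l (exit_t x w)) * (\<psi> (x - pre_exit x w) * indicator {0<..} (x - pre_exit x w)) \<partial>M) = (\<integral>\<^sup>+w. 0 \<partial>M)"
  proof (rule nn_integral_cong)
    fix w assume w: "w \<in> space M"
    have "0 \<le> pre_exit x w" unfolding pre_exit_def exit_t_def by (rule left_value_props(2)[OF X_nice[OF w] x refl])
    thus "ennreal (discount l (exit_t x w)) * (\<psi> (x - pre_exit x w) * indicator {0<..} (x - pre_exit x w)) = 0" using True by simp
  qed
  moreover have "U_op l (\<lambda>y. tail_nn y * \<psi> y) x = 0"
    by (rule U_op_zero) (use True in \<open>auto simp: tail_nn_def\<close>)
  ultimately show ?thesis by simp
next
  case False
  hence x0: "x > 0" using x by simp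
  note [measurable] = pre_exit_measurable[OF x]
  have d01: "0 \<le> discount l s \<and> discount l s \<le> 1" if "s \<ge> 0" for s
    using that l by (cases s) (auto simp: discount_def)
  define N1 where "N1 = distr (density M (\<lambda>w. ennreal (discount l (exit_t x w)) * indicator {0<..} (x - pre_exit x w))) borel (\<lambda>w. x - pre_exit x w)"
  define N2 where "N2 = distr (density (umeas l) (\<lambda>z. tail_nn (x - z))) borel (\<lambda>z. x - z)"
  have n1: "(\<integral>\<^sup>+y. \<phi> y \<partial>N1) = (\<integral>\<^sup>+w. ennreal (discount l (exit_t x w)) * (\<phi> (x - pre_exit x w) * indicator {0<..} (x - pre_exit x w)) \<partial>M)"
    if [measurable]: "\<phi> \<in> borel_measurable borel" for \<phi>
    unfolding N1_def by (subst nn_integral_distr, measurable, subst nn_integral_density) (auto simp: mult_ac)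
  have n2: "(\<integral>\<^sup>+y. \<phi> y \<partial>N2) = U_op l (\<lambda>y. tail_nn y * \<phi> y) x"
    if [measurable]: "\<phi> \<in> borel_measurable borel" for \<phi>
    unfolding N2_def U_op_def by (subst nn_integral_distr, measurable, subst nn_integral_density) auto
  have "N1 = N2"
  proof (rule measure_eqI_lessThan)
    show "sets N1 = sets borel" "sets N2 = sets borel" by (auto simp: N1_def N2_def)
    fix a :: real
    define a0 where "a0 = max 0 a"
    \<comment> \<open>Ramps that vanish up to a0 + 1/(n+1), reach 1 at a0 + 2/(n+1) and increase to
      the indicator of (a0,\<infinity>). Vanishing near 0 is the form that
      \<open>compensation_cont\<close> accepts.\<close>
    define P where "P n z = min 1 (max 0 (real (Suc n) * (z - a0) - 1))" for n z
    have Pc: "continuous_on UNIV (P n)" for n unfolding P_def by (intro continuous_intros)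
    hence [measurable]: "P n \<in> borel_measurable borel" for n by (rule borel_measurable_continuous_onI)
    have P01: "0 \<le> P n z" "P n z \<le> 1" for n z by (auto simp: P_def)
    have Pz: "P n z = 0" if "z \<le> a0 + 1 / real (Suc n)" for n z
    proof -
      have "real (Suc n) * (z - a0) \<le> real (Suc n) * (1 / real (Suc n))" using that by (intro mult_left_mono) auto
      hence "real (Suc n) * (z - a0) \<le> 1" by simp
      thus ?thesis unfolding P_def by simp
    qed
    have Pm: "P m z \<le> P n z" if "m \<le> n" for m n z
    proof (cases "z \<le> a0")
      case True
      have "z \<le> a0 + 1 / real (Suc m)" using True by (simp add: add_increasing2)
      thus ?thesis using Pz P01 by simp
    next
      case False
      have "real (Suc m) * (z - a0) \<le> real (Suc n) * (z - a0)" using that False by (intro mult_right_mono) auto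
      thus ?thesis unfolding P_def by (intro min.mono max.mono) auto
    qed
    have Pl: "(\<lambda>n. ennreal (P n z)) \<longlonglongrightarrow> indicator {a<..} z * indicator {0<..} z" for z
    proof (cases "z > a0")
      case True
      have "\<forall>\<^sub>F n in sequentially. real n > 2 / (z - a0)"
        using filterlim_at_top_dense filterlim_real_sequentially by blast
      hence "\<forall>\<^sub>F n in sequentially. ennreal (P n z) = indicator {a<..} z * indicator {0<..} z"
      proof eventually_elim
        case (elim n)
        have "2 < real n * (z - a0)" using elim True by (simp add: field_simps)
        also have "\<dots> \<le> real (Suc n) * (z - a0)" using True by (intro mult_right_mono) auto
        finally have "P n z = 1" unfolding P_def by simp
        thus ?case using True by (simp add: a0_def)
      qed
      thus ?thesis by (rule tendsto_eventually)
    next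
      case False
      hence "P n z = 0" for n by (intro Pz) (simp add: add_increasing2)
      moreover have e: "indicator {a<..} z * indicator {0<..} z = (0::ennreal)" using False by (auto simp: a0_def indicator_def)
      ultimately show ?thesis unfolding e by simp
    qed
    have eqn: "(\<integral>\<^sup>+y. ennreal (P n y) \<partial>N1) = (\<integral>\<^sup>+y. ennreal (P n y) \<partial>N2)" for n
    proof -
      have e: "a0 + 1 / real (Suc n) > 0" by (simp add: a0_def add_nonneg_pos)
      have "(\<integral>\<^sup>+y. ennreal (P n y) \<partial>N1) = (\<integral>\<^sup>+w. ennreal (discount l (exit_t x w) * P n (x - pre_exit x w)) \<partial>M)"
      proof (subst n1, simp, rule nn_integral_cong)
        fix w assume "w \<in> space M"
        have "discount l (exit_t x w) \<ge> 0" using d01[OF passage_nonneg] unfolding exit_t_def by blast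
        moreover have "P n (x - pre_exit x w) = 0" if "\<not> x - pre_exit x w > 0"
          by (rule Pz) (use that e in linarith)
        ultimately show "ennreal (discount l (exit_t x w)) * (ennreal (P n (x - pre_exit x w)) * indicator {0<..} (x - pre_exit x w)) = ennreal (discount l (exit_t x w) * P n (x - pre_exit x w))"
          using P01 by (cases "x - pre_exit x w > 0") (auto simp: ennreal_mult)
      qed
      also have "\<dots> = (\<integral>\<^sup>+z. ennreal (P n (x - z)) * tail_nn (x - z) \<partial>umeas l)"
        by (rule compensation_cont[OF x0 l Pc P01 e Pz])
      also have "\<dots> = (\<integral>\<^sup>+y. ennreal (P n y) \<partial>N2)" by (subst n2) (auto simp: U_op_def mult.commute)
      finally show ?thesis .
    qed
    have lim: "(\<lambda>n. \<integral>\<^sup>+y. ennreal (P n y) \<partial>N) \<longlonglongrightarrow> (\<integral>\<^sup>+y. indicator {a<..} y * indicator {0<..} y \<partial>N)" if [measurable_cong]: "sets N = sets borel" for N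
      by (rule nn_integral_LIMSEQ) (use Pm Pl in \<open>auto simp: incseq_def le_fun_def intro!: ennreal_leI\<close>)
    have "(\<integral>\<^sup>+y. indicator {a<..} y * indicator {0<..} y \<partial>N1) = (\<integral>\<^sup>+y. indicator {a<..} y * indicator {0<..} y \<partial>N2)"
      by (rule LIMSEQ_unique[OF lim]) (use lim[of N2] eqn in \<open>auto simp: N1_def N2_def\<close>)
    moreover have "(\<integral>\<^sup>+y. indicator {a<..} y * indicator {0<..} y \<partial>N1) = (\<integral>\<^sup>+y. indicator {a<..} y \<partial>N1)"
      by (subst (1 2) n1) (auto intro!: nn_integral_cong simp: indicator_def)
    moreover have "(\<integral>\<^sup>+y. indicator {a<..} y * indicator {0<..} y \<partial>N2) = (\<integral>\<^sup>+y. indicator {a<..} y \<partial>N2)"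
      by (subst (1 2) n2) (auto simp: U_op_def intro!: nn_integral_cong simp: indicator_def tail_nn_def)
    ultimately show "emeasure N1 {a<..} = emeasure N2 {a<..}" by (simp add: N1_def N2_def)
    have "emeasure N1 {a<..} \<le> emeasure N1 (space N1)" by (rule emeasure_space)
    also have "\<dots> = (\<integral>\<^sup>+y. 1 \<partial>N1)" by simp
    also have "\<dots> \<le> (\<integral>\<^sup>+w. 1 \<partial>M)"
    proof (subst n1, simp, rule nn_integral_mono)
      fix w
      have "ennreal (discount l (exit_t x w)) \<le> 1" using d01[OF passage_nonneg] unfolding exit_t_def by (simp add: ennreal_le_1)
      thus "ennreal (discount l (exit_t x w)) * (1 * indicator {0<..} (x - pre_exit x w)) \<le> 1" by (simp add: indicator_def)
    qed
    also have "\<dots> < \<infinity>" by (simp add: emeasure_space_1)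
    finally show "emeasure N1 {a<..} < \<infinity>" .
  qed
  thus ?thesis using n1[of \<psi>] n2[of \<psi>] by simp
qed

end

lemma discount_add: "0 \<le> s \<Longrightarrow> 0 \<le> t \<Longrightarrow> discount l (s + t) = discount l s * discount l t"
  by (cases s; cases t) (auto simp: discount_def exp_add[symmetric] algebra_simps)

lemma nice_path_measurable:
  assumes "nice_path p" shows "(\<lambda>s. p (max 0 s)) \<in> borel_measurable borel"
  by (rule borel_measurable_mono) (auto simp: mono_def intro!: nice_mono[OF assms])

section \<open>The censored process\<close>

text \<open>The cemetery is identified with the point 0, where all functions of
  \<open>C_infty\<close> vanish. This yields a real-valued process with the same
  expectations.\<close>

definition Z_cens :: "(nat \<Rightarrow> real \<Rightarrow> real) \<Rightarrow> real \<Rightarrow> real \<Rightarrow> real" where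
  "Z_cens p x t = (case S_cens p x t of None \<Rightarrow> 0 | Some y \<Rightarrow> y)"

section \<open>Pathwise structure of one realisation\<close>

context
  fixes p :: "nat \<Rightarrow> real \<Rightarrow> real" and x :: real
  assumes p: "\<And>j. j \<ge> 1 \<Longrightarrow> nice_path (p j)" and x: "x \<ge> 0"
begin

abbreviation (input) "YY \<equiv> Y_cens p x"
abbreviation (input) "tt \<equiv> tau_cens p x"
abbreviation (input) "ss j \<equiv> passage_time (p (Suc j)) (Y_cens p x j)"

lemma Y_nonneg: "0 \<le> YY j" and Y_decr: "YY (Suc j) \<le> YY j"
proof -
  have "0 \<le> YY j \<and> YY (Suc j) \<le> YY j \<and> 0 \<le> YY (Suc j)" for j
  proof (induction j)
    case 0
    show ?case using left_value_props(2,3)[OF p[of 1] x refl] x by simp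
  next
    case (Suc j)
    hence y: "0 \<le> YY (Suc j)" by simp
    have "0 \<le> left_value (p (Suc (Suc j))) (ss (Suc j))" "left_value (p (Suc (Suc j))) (ss (Suc j)) \<le> YY (Suc j)"
      using left_value_props(2,3)[OF p[of "Suc (Suc j)"] y refl] by auto
    thus ?case using y by (simp del: Y_cens.simps(2) add: Y_cens.simps(2)[of p x "Suc j"])
  qed
  thus "0 \<le> YY j" "YY (Suc j) \<le> YY j" by auto
qed

lemma Y_le: "YY j \<le> x"
  by (induction j) (use Y_decr order_trans in \<open>auto simp del: Y_cens.simps(2)\<close>)

lemma tau_0: "tt 0 = 0" by (simp add: tau_cens_def)

lemma tau_Suc: "tt (Suc j) = tt j + ss j"
  by (simp add: tau_cens_def sigma_cens_def)

lemma tau_nonneg: "0 \<le> tt j"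
  by (induction j) (auto simp: tau_0 tau_Suc passage_nonneg)

lemma tau_incseq: "incseq tt"
  by (rule incseq_SucI) (simp add: tau_Suc passage_nonneg add_increasing2)

lemma tau_infty_SUP: "tau_infty p x = (SUP j. tt j)"
  unfolding tau_infty_def by (rule limI, rule LIMSEQ_SUP, rule tau_incseq)

text \<open>The contribution of the j-th life at time t. No condition that t precedes the end of
  that life is imposed: afterwards the path has reached its level, the argument is nonpositive, and
  g vanishes there. This frees each term from its own passage time.\<close>

definition cterm :: "(real \<Rightarrow> 'b::zero) \<Rightarrow> real \<Rightarrow> nat \<Rightarrow> 'b" where
  "cterm g t j = (if tt j \<le> ereal t then g (YY j - p (Suc j) (t - real_of_ereal (tt j))) else 0)"

lemma tau_real: "tt j \<le> ereal t \<Longrightarrow> tt j = ereal (real_of_ereal (tt j)) \<and> 0 \<le> real_of_ereal (tt j) \<and> real_of_ereal (tt j) \<le> t"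
  using tau_nonneg[of j] by (cases "tt j") auto

lemma cterm_zero:
  assumes g: "\<And>z. z \<le> 0 \<Longrightarrow> g z = 0" and t: "tt (Suc j) \<le> ereal t"
  shows "cterm g t j = 0"
proof (cases "tt j \<le> ereal t")
  case True
  note r = tau_real[OF True]
  define a where "a = real_of_ereal (tt j)"
  have a: "tt j = ereal a" "0 \<le> a" "a \<le> t" using r by (auto simp: a_def)
  have "ss j \<le> ereal (t - a)" using t a passage_nonneg[of "p (Suc j)" "YY j"] by (cases "ss j") (auto simp: tau_Suc)
  \<comment> \<open>The case of equality is the passage instant itself, where right continuity gives
    that the level is reached, though perhaps not exceeded.\<close>
  hence "ss j < ereal (t - a) \<or> ss j = ereal (t - a)" by (simp only: le_less)
  hence "p (Suc j) (t - a) \<ge> YY j"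
    using passage_after[OF p[of "Suc j"], of "YY j" "t - a"] passage_at[OF p[of "Suc j"], of "YY j" "t - a"] a
    by auto
  thus ?thesis using True g by (simp add: cterm_def a_def)
qed (simp add: cterm_def)

lemma cens_alive:
  assumes "tt j \<le> ereal t" "ereal t < tt (Suc j)"
  shows "S_cens p x t = Some (YY j - p (Suc j) (t - real_of_ereal (tt j)))"
    "0 \<le> YY j - p (Suc j) (t - real_of_ereal (tt j))" "YY j - p (Suc j) (t - real_of_ereal (tt j)) \<le> x"
proof -
  have uniq: "(THE j. tt j \<le> ereal t \<and> ereal t < tt (Suc j)) = j"
  proof (rule the_equality)
    fix i assume i: "tt i \<le> ereal t \<and> ereal t < tt (Suc i)"
    show "i = j"
    proof (rule ccontr)
      assume "i \<noteq> j"
      hence "Suc i \<le> j \<or> Suc j \<le> i" by auto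
      hence "tt (Suc i) \<le> tt j \<or> tt (Suc j) \<le> tt i" using tau_incseq by (auto simp: incseq_def)
      thus False using i assms by (meson leD order_trans)
    qed
  qed (use assms in simp)
  have "ereal t < tau_infty p x" unfolding tau_infty_SUP
    using assms(2) by (meson SUP_upper UNIV_I order_less_le_trans)
  thus "S_cens p x t = Some (YY j - p (Suc j) (t - real_of_ereal (tt j)))"
    by (simp add: S_cens_def uniq Let_def)
  define a where "a = real_of_ereal (tt j)"
  have a: "tt j = ereal a" "0 \<le> a" "a \<le> t" using tau_real[OF assms(1)] by (auto simp: a_def)
  have "ereal (t - a) < ss j" using assms(2) a by (cases "ss j") (auto simp: tau_Suc)
  hence "p (Suc j) (t - a) \<le> YY j" using a by (intro passage_before[OF p Y_nonneg]) auto
  thus "0 \<le> YY j - p (Suc j) (t - real_of_ereal (tt j))" by (simp add: a_def)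
  have "0 \<le> p (Suc j) (t - a)" using a by (intro nice_nonneg[OF p]) auto
  thus "YY j - p (Suc j) (t - real_of_ereal (tt j)) \<le> x" using Y_le[of j] by (simp add: a_def)
qed

lemma cens_cases:
  assumes t: "t \<ge> 0"
  obtains j where "tt j \<le> ereal t" "ereal t < tt (Suc j)" | "tau_infty p x \<le> ereal t" "S_cens p x t = None" "\<And>j. tt j \<le> ereal t"
proof (cases "ereal t < tau_infty p x")
  case True
  then obtain n where n: "ereal t < tt n" unfolding tau_infty_SUP less_SUP_iff by auto
  define m where "m = (LEAST n. ereal t < tt n)"
  have m: "ereal t < tt m" unfolding m_def by (rule LeastI[of "\<lambda>n. ereal t < tt n" n, OF n])
  have "m \<noteq> 0"
  proof
    assume "m = 0"
    hence "ereal t < 0" using m tau_0 by simp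
    thus False using t by (simp add: zero_ereal_def)
  qed
  then obtain j where j: "m = Suc j" using not0_implies_Suc by blast
  have "\<not> ereal t < tt j" using not_less_Least[of j "\<lambda>n. ereal t < tt n"] j by (simp add: m_def)
  thus ?thesis using that(1)[of j] m j by simp
next
  case False
  have "tt j \<le> ereal t" for j using False unfolding tau_infty_SUP by (meson SUP_upper UNIV_I not_less order_trans)
  thus ?thesis using that(2) False by (simp add: S_cens_def)
qed

lemma cens_cterm:
  assumes g: "\<And>z. z \<le> 0 \<Longrightarrow> g z = (0 :: ennreal)" and t: "t \<ge> 0"
  shows "g (Z_cens p x t) = (\<Sum>j. cterm g t j)"
  using t
proof (cases rule: cens_cases)
  case (1 j)
  have z: "cterm g t i = 0" if "i \<noteq> j" for i
  proof (cases "i < j")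
    case True
    hence "tt (Suc i) \<le> tt j" using tau_incseq by (simp add: incseq_def)
    hence "tt (Suc i) \<le> ereal t" using 1(1) by (rule order_trans)
    from cterm_zero[of g, OF g this] show ?thesis by simp
  next
    case False
    hence "tt (Suc j) \<le> tt i" using that tau_incseq by (simp add: incseq_def)
    hence "\<not> tt i \<le> ereal t" using 1(2) by (meson leD order_trans)
    thus ?thesis by (simp add: cterm_def)
  qed
  have "(\<Sum>i. cterm g t i) = sum (cterm g t) {j}" by (rule suminf_finite) (use z in auto)
  also have "\<dots> = g (Z_cens p x t)" using cens_alive(1)[OF 1] 1 by (simp add: Z_cens_def cterm_def)
  finally show ?thesis by simp
next
  case 2
  have "cterm g t i = 0" for i by (rule cterm_zero[OF g 2(3)])
  hence "(\<lambda>i. cterm g t i) = (\<lambda>_. 0)" by auto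
  thus ?thesis using 2 g by (simp add: Z_cens_def)
qed

lemma Z_cens_bounds:
  assumes t: "t \<ge> 0" shows "0 \<le> Z_cens p x t" "Z_cens p x t \<le> x"
proof -
  have "0 \<le> Z_cens p x t \<and> Z_cens p x t \<le> x"
    using t
  proof (cases rule: cens_cases)
    case (1 j)
    thus ?thesis using cens_alive[OF 1] by (simp add: Z_cens_def)
  next
    case 2
    thus ?thesis using x by (simp add: Z_cens_def)
  qed
  thus "0 \<le> Z_cens p x t" "Z_cens p x t \<le> x" by auto
qed

lemma Z_cens_start: "t \<ge> 0 \<Longrightarrow> p 1 t < x \<Longrightarrow> Z_cens p x t = x - p 1 t"
proof -
  assume t: "t \<ge> 0" "p 1 t < x"
  have a: "ereal t < tt (Suc 0)" using passage_pos[OF p[of 1] t] by (simp add: tau_Suc tau_0)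
  have b: "tt 0 \<le> ereal t" using t by (simp add: tau_0)
  show ?thesis using cens_alive(1)[OF b a] by (simp add: Z_cens_def tau_0)
qed

lemma Z_cens_right_cont: assumes t: "t \<ge> 0" shows "continuous (at_right t) (Z_cens p x)"
  using t
proof (cases rule: cens_cases)
  case (1 j)
  define a where "a = real_of_ereal (tt j)"
  have a: "tt j = ereal a" "0 \<le> a" "a \<le> t" using tau_real[OF 1(1)] by (auto simp: a_def)
  obtain b where b: "t < b" "ereal b < tt (Suc j)" using ereal_dense2[OF 1(2)] by auto
  have e: "Z_cens p x s = YY j - p (Suc j) (s - a)" if "t \<le> s" "s < b" for s
  proof -
    have "tt j \<le> ereal s" using a that by simp
    moreover have "ereal s < tt (Suc j)" using b that by (meson less_ereal.simps(1) order_less_trans)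
    ultimately show ?thesis using cens_alive(1)[of j s] by (simp add: Z_cens_def a_def)
  qed
  have "((p (Suc j)) \<longlongrightarrow> p (Suc j) (t - a)) (at_right (t - a))"
    using p[of "Suc j"] a by (simp add: nice_path_def continuous_within)
  hence "((\<lambda>s. p (Suc j) (s + (- a))) \<longlongrightarrow> p (Suc j) (t - a)) (at_right t)"
    using filterlim_at_right_to_0[of "p (Suc j)" "nhds (p (Suc j) (t - a))" "t - a"]
      filterlim_at_right_to_0[of "\<lambda>s. p (Suc j) (s + (- a))" "nhds (p (Suc j) (t - a))" t] by (simp add: algebra_simps)
  hence "((\<lambda>s. YY j - p (Suc j) (s - a)) \<longlongrightarrow> YY j - p (Suc j) (t - a)) (at_right t)"
    by (intro tendsto_intros) simp
  moreover have "\<forall>\<^sub>F s in at_right t. YY j - p (Suc j) (s - a) = Z_cens p x s"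
    using eventually_at_right_real[OF b(1)] by eventually_elim (use e in auto)
  ultimately have "(Z_cens p x \<longlongrightarrow> YY j - p (Suc j) (t - a)) (at_right t)"
    by (rule Lim_transform_eventually)
  thus ?thesis using e[of t] b by (simp add: continuous_within)
next
  case 2
  have e: "Z_cens p x s = 0" if "t \<le> s" for s
  proof -
    have "tau_infty p x \<le> ereal s" using 2(1) that by (meson ereal_less_eq(3) order_trans)
    hence "\<not> ereal s < tau_infty p x" by (simp add: not_less)
    hence "S_cens p x s = None" by (simp only: S_cens_def if_False)
    thus ?thesis by (simp add: Z_cens_def)
  qed
  have "\<forall>\<^sub>F s in at_right t. Z_cens p x t = Z_cens p x s"
    using eventually_at_right_less[of t] by eventually_elim (use e in auto)
  hence "(Z_cens p x \<longlongrightarrow> Z_cens p x t) (at_right t)"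
    by (rule Lim_transform_eventually[OF tendsto_const])
  thus ?thesis by (simp add: continuous_within)
qed

text \<open>The sum over the resurrections of the path from which the renewal series arises.\<close>

lemma cens_laplace:
  assumes g: "\<And>z. z \<le> 0 \<Longrightarrow> g z = (0 :: ennreal)" and [measurable]: "g \<in> borel_measurable borel"
  shows "(\<integral>\<^sup>+t. hexp l t * g (Z_cens p x t) \<partial>lborel) =
    (\<Sum>j. ennreal (discount l (tt j)) * (\<integral>\<^sup>+s. hexp l s * g (YY j - p (Suc j) s) \<partial>lborel))"
proof -
  note [measurable] = nice_path_measurable[OF p]
  define c where "c j t = (if tt j \<le> ereal t then hexp l t * g (YY j - p (Suc j) (max 0 (t - real_of_ereal (tt j)))) else 0)" for j t
  have cm[measurable]: "c j \<in> borel_measurable borel" for j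
  proof -
    have [measurable]: "(\<lambda>s. p (Suc j) (max 0 s)) \<in> borel_measurable borel" by (rule nice_path_measurable[OF p]) simp
    have "(\<lambda>t. (\<lambda>s. p (Suc j) (max 0 s)) (t - real_of_ereal (tt j))) \<in> borel_measurable borel" by measurable
    thus ?thesis unfolding c_def by measurable
  qed
  have "(\<integral>\<^sup>+t. hexp l t * g (Z_cens p x t) \<partial>lborel) = (\<integral>\<^sup>+t. (\<Sum>j. c j t) \<partial>lborel)"
  proof (rule nn_integral_cong)
    fix t :: real
    show "hexp l t * g (Z_cens p x t) = (\<Sum>j. c j t)"
    proof (cases "t \<ge> 0")
      case True
      have "hexp l t * g (Z_cens p x t) = (\<Sum>j. hexp l t * cterm g t j)"
        using cens_cterm[of g t, OF g True] by simp
      also have "\<dots> = (\<Sum>j. c j t)"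
      proof (rule suminf_cong)
        fix j
        show "hexp l t * cterm g t j = c j t"
          using tau_real[of j t] by (auto simp: c_def cterm_def max_absorb2)
      qed
      finally show ?thesis .
    next
      case False
      have "(\<lambda>j. c j t) = (\<lambda>_. 0)" using False by (auto simp: c_def)
      thus ?thesis using False by simp
    qed
  qed
  also have "\<dots> = (\<Sum>j. \<integral>\<^sup>+t. c j t \<partial>lborel)" by (rule nn_integral_suminf) simp
  also have "\<dots> = (\<Sum>j. ennreal (discount l (tt j)) * (\<integral>\<^sup>+s. hexp l s * g (YY j - p (Suc j) s) \<partial>lborel))"
  proof (rule suminf_cong)
    fix j
    have [measurable]: "(\<lambda>s. p (Suc j) (max 0 s)) \<in> borel_measurable borel" by (rule nice_path_measurable[OF p]) simp
    show "(\<integral>\<^sup>+t. c j t \<partial>lborel) = ennreal (discount l (tt j)) * (\<integral>\<^sup>+s. hexp l s * g (YY j - p (Suc j) s) \<partial>lborel)"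
    proof (cases "tt j")
      case (real a)
      hence a: "0 \<le> a" using tau_nonneg[of j] by simp
      have "(\<integral>\<^sup>+t. c j t \<partial>lborel) = (\<integral>\<^sup>+s. c j (a + 1 * s) \<partial>lborel)"
        using nn_integral_real_affine[of "c j" 1 a] by simp
      also have "\<dots> = (\<integral>\<^sup>+s. ennreal (discount l (tt j)) * (hexp l s * g (YY j - p (Suc j) (max 0 s))) \<partial>lborel)"
      proof (rule nn_integral_cong)
        fix s :: real
        have "exp (-(l * (a + s))) = exp (-(l * a)) * exp (-(l * s))" by (simp add: exp_add[symmetric] algebra_simps)
        hence "ennreal (exp (-(l * (a + s)))) = ennreal (discount l (tt j)) * eexp l s"
          using real by (simp add: discount_def ennreal_mult)
        thus "c j (a + 1 * s) = ennreal (discount l (tt j)) * (hexp l s * g (YY j - p (Suc j) (max 0 s)))"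
          using real a by (cases "s \<ge> 0") (auto simp: c_def mult_ac)
      qed
      also have "\<dots> = ennreal (discount l (tt j)) * (\<integral>\<^sup>+s. hexp l s * g (YY j - p (Suc j) (max 0 s)) \<partial>lborel)"
        by (rule nn_integral_cmult) measurable
      also have "(\<integral>\<^sup>+s. hexp l s * g (YY j - p (Suc j) (max 0 s)) \<partial>lborel) =
         (\<integral>\<^sup>+s. hexp l s * g (YY j - p (Suc j) s) \<partial>lborel)"
        by (intro nn_integral_cong) (auto simp: indicator_def max_absorb2)
      finally show ?thesis .
    next
      case PInf
      have "c j = (\<lambda>_. 0)" using PInf by (auto simp: c_def)
      thus ?thesis using PInf by (simp add: discount_def)
    next
      case MInf thus ?thesis using tau_nonneg[of j] by simp
    qed
  qed
  finally show ?thesis .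
qed

end

text \<open>The potential measure is determined by its transform 1/(l + f), so all the subordinators
  share the operators of the first one, and the passages compose as powers of one operator.\<close>

lemma umeas_unique:
  assumes "subordinated M f k \<mu> X" "subordinated M' f k \<mu> X'" "l \<ge> 0"
  shows "subordinated.umeas M X l = subordinated.umeas M' X' l"
proof -
  interpret A: subordinated M f k \<mu> X by fact
  interpret B: subordinated M' f k \<mu> X' by fact
  show ?thesis
    by (rule laplace_unique_measure) (use A.umeas_AE_nonneg B.umeas_AE_nonneg A.umeas_laplace B.umeas_laplace assms(3) in auto)
qed

section \<open>The process built from independent subordinators\<close>

locale censored_process = prob_space M + censored_pair f k \<mu> q T
  for M :: "'w measure" and f k \<mu> q T +
  fixes S :: "nat \<Rightarrow> real \<Rightarrow> 'w \<Rightarrow> real"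
  assumes subS: "\<And>j. j \<ge> 1 \<Longrightarrow> subordinator M (S j) f"
    and iid: "iid_processes M {1..} S"
begin

lemma sub_loc: "j \<ge> 1 \<Longrightarrow> subordinated M f k \<mu> (S j)"
  by (intro subordinated.intro subordinated_axioms.intro subS prob_space_axioms bernstein_pair_axioms)

end

sublocale censored_process \<subseteq> X1: subordinated M f k \<mu> "S (Suc 0)"
  by (rule sub_loc) simp

context censored_process
begin

definition path_seq :: "'w \<Rightarrow> nat \<Rightarrow> real \<Rightarrow> real" where "path_seq w j s = S j s w"
definition rpath :: "nat \<Rightarrow> 'w \<Rightarrow> real \<Rightarrow> real" where "rpath j w = restrict (\<lambda>t. S j t w) {0..}"
definition Y_rv :: "real \<Rightarrow> nat \<Rightarrow> 'w \<Rightarrow> real" where "Y_rv x j w = Y_cens (path_seq w) x j"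
definition tau_rv :: "real \<Rightarrow> nat \<Rightarrow> 'w \<Rightarrow> ereal" where "tau_rv x j w = tau_cens (path_seq w) x j"
definition disc_rv :: "real \<Rightarrow> real \<Rightarrow> nat \<Rightarrow> 'w \<Rightarrow> real" where "disc_rv l x j w = discount l (tau_rv x j w)"
definition Z_rv :: "real \<Rightarrow> real \<Rightarrow> 'w \<Rightarrow> real" where "Z_rv x t w = Z_cens (path_seq w) x t"

lemma nice_S: "w \<in> space M \<Longrightarrow> j \<ge> 1 \<Longrightarrow> nice_path (path_seq w j)"
proof -
  assume w: "w \<in> space M" and j: "j \<ge> 1"
  interpret J: subordinated M f k \<mu> "S j" by (rule sub_loc[OF j])
  show ?thesis using J.X_nice[OF w] unfolding path_seq_def by simp
qed

lemma rpath_measurable[measurable]: "j \<ge> 1 \<Longrightarrow> rpath j \<in> measurable M path_space"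
proof -
  assume j: "j \<ge> 1"
  interpret J: subordinated M f k \<mu> "S j" by (rule sub_loc[OF j])
  show ?thesis using J.path_of_measurable unfolding J.path_of_def rpath_def by simp
qed

lemma Y_rv_nonneg: "w \<in> space M \<Longrightarrow> x \<ge> 0 \<Longrightarrow> 0 \<le> Y_rv x j w"
  unfolding Y_rv_def by (rule Y_nonneg) (use nice_S in auto)

lemma Y_rv_0: "Y_rv x 0 w = x" by (simp add: Y_rv_def)
lemma tau_rv_0: "tau_rv x 0 w = 0" by (simp add: tau_rv_def tau_cens_def)
lemma disc_rv_0: "disc_rv l x 0 w = 1" by (simp add: disc_rv_def tau_rv_0 discount_def)

lemma passage_rpath: "w \<in> space M \<Longrightarrow> passage_time (path_seq w (Suc j)) y = passQ (rpath (Suc j) w) y"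
proof -
  assume w: "w \<in> space M"
  have "rpath (Suc j) w = restrict (path_seq w (Suc j)) {0..}" by (auto simp: rpath_def path_seq_def)
  thus ?thesis using passage_passQ[OF nice_S[OF w, of "Suc j"]] by (simp add: passQ_restrict)
qed

lemma left_rpath: "w \<in> space M \<Longrightarrow> y \<ge> 0 \<Longrightarrow> left_value (path_seq w (Suc j)) (passQ (rpath (Suc j) w) y) = leftQ (rpath (Suc j) w) (passQ (rpath (Suc j) w) y)"
proof -
  assume w: "w \<in> space M" and y: "y \<ge> 0"
  have e: "rpath (Suc j) w = restrict (path_seq w (Suc j)) {0..}" by (auto simp: rpath_def path_seq_def)
  show ?thesis
    using left_value_props(1)[OF nice_S[OF w, of "Suc j"] y passage_rpath[OF w, symmetric]] by (simp add: e leftQ_restrict)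
qed

lemma Y_rv_Suc: "w \<in> space M \<Longrightarrow> x \<ge> 0 \<Longrightarrow>
   Y_rv x (Suc j) w = Y_rv x j w - leftQ (rpath (Suc j) w) (passQ (rpath (Suc j) w) (Y_rv x j w))"
proof -
  assume w: "w \<in> space M" and x: "x \<ge> 0"
  show ?thesis
    using left_rpath[OF w Y_rv_nonneg[OF w x, of j], of j] passage_rpath[OF w, of j "Y_rv x j w"] by (simp add: Y_rv_def)
qed

lemma tau_rv_Suc: "w \<in> space M \<Longrightarrow> tau_rv x (Suc j) w = tau_rv x j w + passQ (rpath (Suc j) w) (Y_rv x j w)"
  using passage_rpath[of w j "Y_rv x j w"] by (simp add: tau_rv_def tau_cens_def sigma_cens_def Y_rv_def)

lemma tau_rv_nonneg: "w \<in> space M \<Longrightarrow> x \<ge> 0 \<Longrightarrow> 0 \<le> tau_rv x j w"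
  unfolding tau_rv_def by (rule tau_nonneg) (use nice_S in auto)

lemma disc_rv_Suc: "w \<in> space M \<Longrightarrow> x \<ge> 0 \<Longrightarrow> disc_rv l x (Suc j) w = disc_rv l x j w * discount l (passQ (rpath (Suc j) w) (Y_rv x j w))"
  unfolding disc_rv_def tau_rv_Suc
  by (rule discount_add[OF tau_rv_nonneg]) (use passage_rpath[of w j "Y_rv x j w"] passage_nonneg in \<open>auto, metis\<close>)

lemma disc_rv_nonneg: "0 \<le> disc_rv l x j w" by (simp add: disc_rv_def discount_def)

lemma discount_nonneg: "0 \<le> discount l s" by (simp add: discount_def)

text \<open>The state is assembled from finitely many paths by measurable maps on path space.
  Writing it as a functional of the paths 1 to j exposes its independence of path j + 1.\<close>

lemma state_functional:
  assumes x: "x \<ge> 0"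
  shows "\<exists>F\<in>measurable (PiM {1..j} (\<lambda>_. path_space)) (borel \<Otimes>\<^sub>M borel). \<forall>w\<in>space M.
    (disc_rv l x j w, Y_rv x j w) = F (restrict (\<lambda>i. rpath i w) {1..j})"
proof (induction j)
  case 0
  show ?case by (rule bexI[of _ "\<lambda>_. (1, x)"]) (auto simp: disc_rv_0 Y_rv_0)
next
  case (Suc j)
  then obtain F where F[measurable]: "F \<in> measurable (PiM {1..j} (\<lambda>_. path_space)) (borel \<Otimes>\<^sub>M borel)"
    and Fe: "\<And>w. w \<in> space M \<Longrightarrow> (disc_rv l x j w, Y_rv x j w) = F (restrict (\<lambda>i. rpath i w) {1..j})" by blast
  define N where "N = PiM {1..Suc j} (\<lambda>_. path_space)"
  define G where "G \<omega> = F (restrict \<omega> {1..j})" for \<omega>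
  have Gm[measurable]: "G \<in> measurable N (borel \<Otimes>\<^sub>M borel)"
    unfolding G_def N_def by (rule measurable_compose[OF measurable_restrict_subset F]) auto
  have cm[measurable]: "(\<lambda>\<omega>. \<omega> (Suc j)) \<in> measurable N path_space"
    unfolding N_def by (rule measurable_component_singleton) simp
  have [measurable]: "(\<lambda>\<omega>. passQ (\<omega> (Suc j)) (snd (G \<omega>))) \<in> borel_measurable N"
  proof -
    have "(\<lambda>\<omega>. (\<lambda>(y, p). passQ p y) (snd (G \<omega>), \<omega> (Suc j))) \<in> borel_measurable N" by measurable
    thus ?thesis by simp
  qed
  have [measurable]: "(\<lambda>\<omega>. leftQ (\<omega> (Suc j)) (passQ (\<omega> (Suc j)) (snd (G \<omega>)))) \<in> borel_measurable N"
  proof -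
    have "(\<lambda>\<omega>. (\<lambda>(s, p). leftQ p s) (passQ (\<omega> (Suc j)) (snd (G \<omega>)), \<omega> (Suc j))) \<in> borel_measurable N" by measurable
    thus ?thesis by simp
  qed
  define H where "H \<omega> = (fst (G \<omega>) * discount l (passQ (\<omega> (Suc j)) (snd (G \<omega>))), snd (G \<omega>) - leftQ (\<omega> (Suc j)) (passQ (\<omega> (Suc j)) (snd (G \<omega>))))" for \<omega>
  have "H \<in> measurable N (borel \<Otimes>\<^sub>M borel)" unfolding H_def by measurable
  moreover have "(disc_rv l x (Suc j) w, Y_rv x (Suc j) w) = H (restrict (\<lambda>i. rpath i w) {1..Suc j})" if w: "w \<in> space M" for w
  proof -
    have "restrict (restrict (\<lambda>i. rpath i w) {1..Suc j}) {1..j} = restrict (\<lambda>i. rpath i w) {1..j}" by (auto simp: restrict_def fun_eq_iff)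
    hence "G (restrict (\<lambda>i. rpath i w) {1..Suc j}) = (disc_rv l x j w, Y_rv x j w)" by (simp add: G_def Fe[OF w])
    thus ?thesis by (simp add: H_def disc_rv_Suc[OF w x] Y_rv_Suc[OF w x])
  qed
  ultimately show ?case unfolding N_def by blast
qed

text \<open>Plays the role of the strong Markov property at the j-th resurrection: the state up to
  then is frozen and the next path is averaged out.\<close>

lemma state_indep:
  assumes x: "x \<ge> 0" and [measurable]: "g \<in> borel_measurable ((borel \<Otimes>\<^sub>M borel) \<Otimes>\<^sub>M path_space)"
  shows "(\<integral>\<^sup>+w. g ((disc_rv l x j w, Y_rv x j w), rpath (Suc j) w) \<partial>M) =
    (\<integral>\<^sup>+w. (\<integral>\<^sup>+w'. g ((disc_rv l x j w, Y_rv x j w), rpath (Suc j) w') \<partial>M) \<partial>M)"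
proof -
  obtain F where F[measurable]: "F \<in> measurable (PiM {1..j} (\<lambda>_. path_space)) (borel \<Otimes>\<^sub>M borel)"
    and Fe: "\<And>w. w \<in> space M \<Longrightarrow> (disc_rv l x j w, Y_rv x j w) = F (restrict (\<lambda>i. rpath i w) {1..j})"
    using state_functional[OF x, of j l] by blast
  have iv: "indep_vars (\<lambda>_. path_space) rpath {1..}"
    using iid unfolding iid_processes_def rpath_def[abs_def] by blast
  have ind: "indep_var (PiM {1..j} (\<lambda>_. path_space)) (\<lambda>w. restrict (\<lambda>i. rpath i w) {1..j})
     (PiM {Suc j} (\<lambda>_. path_space)) (\<lambda>w. restrict (\<lambda>i. rpath i w) {Suc j})"
    by (rule indep_var_restrict[OF iv]) auto
  have cm[measurable]: "(\<lambda>r. r (Suc j)) \<in> measurable (PiM {Suc j} (\<lambda>_. path_space)) path_space"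
    by (rule measurable_component_singleton) simp
  define G where "G z = g (F (fst z), snd z (Suc j))" for z
  have Gm: "G \<in> borel_measurable (PiM {1..j} (\<lambda>_. path_space) \<Otimes>\<^sub>M PiM {Suc j} (\<lambda>_. path_space))"
    unfolding G_def by measurable
  have "(\<integral>\<^sup>+w. g ((disc_rv l x j w, Y_rv x j w), rpath (Suc j) w) \<partial>M) =
    (\<integral>\<^sup>+w. G (restrict (\<lambda>i. rpath i w) {1..j}, restrict (\<lambda>i. rpath i w) {Suc j}) \<partial>M)"
    by (intro nn_integral_cong) (simp add: Fe G_def)
  also have "\<dots> = (\<integral>\<^sup>+w. (\<integral>\<^sup>+w'. G (restrict (\<lambda>i. rpath i w) {1..j}, restrict (\<lambda>i. rpath i w') {Suc j}) \<partial>M) \<partial>M)"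
    by (rule indep_nn_integral[OF ind Gm])
  also have "\<dots> = (\<integral>\<^sup>+w. (\<integral>\<^sup>+w'. g ((disc_rv l x j w, Y_rv x j w), rpath (Suc j) w') \<partial>M) \<partial>M)"
    by (intro nn_integral_cong) (simp add: Fe G_def)
  finally show ?thesis .
qed

lemma state_measurable: "x \<ge> 0 \<Longrightarrow> (\<lambda>w. (disc_rv l x j w, Y_rv x j w)) \<in> measurable M (borel \<Otimes>\<^sub>M borel)"
proof -
  assume x: "x \<ge> 0"
  obtain F where F[measurable]: "F \<in> measurable (PiM {1..j} (\<lambda>_. path_space)) (borel \<Otimes>\<^sub>M borel)"
    and Fe: "\<And>w. w \<in> space M \<Longrightarrow> (disc_rv l x j w, Y_rv x j w) = F (restrict (\<lambda>i. rpath i w) {1..j})"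
    using state_functional[OF x, of j l] by blast
  have "(\<lambda>w. restrict (\<lambda>i. rpath i w) {1..j}) \<in> measurable M (PiM {1..j} (\<lambda>_. path_space))"
    by (rule measurable_restrict) auto
  hence "(\<lambda>w. F (restrict (\<lambda>i. rpath i w) {1..j})) \<in> measurable M (borel \<Otimes>\<^sub>M borel)" by measurable
  thus ?thesis by (subst measurable_cong[OF Fe]) auto
qed

lemma disc_rv_measurable: "x \<ge> 0 \<Longrightarrow> disc_rv l x j \<in> borel_measurable M"
  using measurable_compose[OF state_measurable measurable_fst] by simp

lemma Y_rv_measurable: "x \<ge> 0 \<Longrightarrow> Y_rv x j \<in> borel_measurable M"
  using measurable_compose[OF state_measurable[of x 1] measurable_snd] by simp

lemma tau_rv_measurable: "x \<ge> 0 \<Longrightarrow> tau_rv x j \<in> borel_measurable M"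
proof (induction j)
  case 0
  have "tau_rv x 0 = (\<lambda>_. 0)" by (simp add: tau_rv_0 fun_eq_iff)
  thus ?case by simp
next
  case (Suc j)
  note [measurable] = Suc.IH[OF Suc.prems] Y_rv_measurable[OF Suc.prems] rpath_measurable[of "Suc j"]
  have "(\<lambda>w. (\<lambda>(y, p). passQ p y) (Y_rv x j w, rpath (Suc j) w)) \<in> borel_measurable M" by measurable
  hence "(\<lambda>w. tau_rv x j w + passQ (rpath (Suc j) w) (Y_rv x j w)) \<in> borel_measurable M" by simp
  thus ?case by (subst measurable_cong[OF tau_rv_Suc]) auto
qed

text \<open>By the compensation formula this is the expectation of the discount at the first passage
  times \<psi> at the next level, the level 0 excluded.\<close>

definition K_res :: "real \<Rightarrow> (real \<Rightarrow> ennreal) \<Rightarrow> real \<Rightarrow> ennreal" where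
  "K_res l \<psi> = X1.U_op l (\<lambda>y. tail_nn y * \<psi> y)"

lemma K_res_measurable: "l \<ge> 0 \<Longrightarrow> \<psi> \<in> borel_measurable borel \<Longrightarrow> K_res l \<psi> \<in> borel_measurable borel"
  unfolding K_res_def by (rule X1.U_op_measurable) measurable

lemma K_res_zero: "y \<le> 0 \<Longrightarrow> K_res l \<psi> y = 0"
  unfolding K_res_def by (rule X1.U_op_zero) (auto simp: tail_nn_def)

text \<open>With the state after j resurrections frozen, what remains is one passage of an
  independent subordinator from the current level, evaluated by \<open>compensation\<close>.\<close>

lemma expect_step:
  assumes x: "x \<ge> 0" and l: "l > 0" and [measurable]: "\<psi> \<in> borel_measurable borel"
  shows "(\<integral>\<^sup>+w. ennreal (disc_rv l x (Suc j) w) * (\<psi> (Y_rv x (Suc j) w) * indicator {0<..} (Y_rv x (Suc j) w)) \<partial>M) =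
    (\<integral>\<^sup>+w. ennreal (disc_rv l x j w) * K_res l \<psi> (Y_rv x j w) \<partial>M)"
proof -
  interpret J: subordinated M f k \<mu> "S (Suc j)" by (rule sub_loc) simp
  define g where "g z = ennreal (fst (fst z)) * (ennreal (discount l (passQ (snd z) (snd (fst z)))) *
    (\<psi> (snd (fst z) - leftQ (snd z) (passQ (snd z) (snd (fst z)))) * indicator {0<..} (snd (fst z) - leftQ (snd z) (passQ (snd z) (snd (fst z))))))"
    for z :: "(real \<times> real) \<times> (real \<Rightarrow> real)"
  let ?N = "((borel \<Otimes>\<^sub>M borel) \<Otimes>\<^sub>M path_space) :: ((real \<times> real) \<times> (real \<Rightarrow> real)) measure"
  have [measurable]: "(\<lambda>z. passQ (snd z) (snd (fst z))) \<in> borel_measurable ?N"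
  proof -
    have "(\<lambda>z. (\<lambda>(y, p). passQ p y) (snd (fst z), snd z)) \<in> borel_measurable ?N" by measurable
    thus ?thesis by simp
  qed
  have [measurable]: "(\<lambda>z. leftQ (snd z) (passQ (snd z) (snd (fst z)))) \<in> borel_measurable ?N"
  proof -
    have "(\<lambda>z. (\<lambda>(s, p). leftQ p s) (passQ (snd z) (snd (fst z)), snd z)) \<in> borel_measurable ?N" by measurable
    thus ?thesis by simp
  qed
  have gm: "g \<in> borel_measurable ?N" unfolding g_def by measurable
  have "(\<integral>\<^sup>+w. ennreal (disc_rv l x (Suc j) w) * (\<psi> (Y_rv x (Suc j) w) * indicator {0<..} (Y_rv x (Suc j) w)) \<partial>M) =
    (\<integral>\<^sup>+w. g ((disc_rv l x j w, Y_rv x j w), rpath (Suc j) w) \<partial>M)"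
    by (intro nn_integral_cong) (simp add: g_def disc_rv_Suc[OF _ x] Y_rv_Suc[OF _ x] ennreal_mult disc_rv_nonneg discount_nonneg mult.assoc)
  also have "\<dots> = (\<integral>\<^sup>+w. (\<integral>\<^sup>+w'. g ((disc_rv l x j w, Y_rv x j w), rpath (Suc j) w') \<partial>M) \<partial>M)"
    by (rule state_indep[OF x gm])
  also have "\<dots> = (\<integral>\<^sup>+w. ennreal (disc_rv l x j w) * K_res l \<psi> (Y_rv x j w) \<partial>M)"
  proof (rule nn_integral_cong)
    fix w assume w: "w \<in> space M"
    define y where "y = Y_rv x j w"
    have y: "y \<ge> 0" unfolding y_def by (rule Y_rv_nonneg[OF w x])
    note [measurable] = J.pre_exit_measurable[OF y] J.exit_t_measurable
    have pp: "J.path_of = rpath (Suc j)" by (simp add: J.path_of_def rpath_def fun_eq_iff)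
    have "(\<integral>\<^sup>+w'. g ((disc_rv l x j w, y), rpath (Suc j) w') \<partial>M) =
      (\<integral>\<^sup>+w'. ennreal (disc_rv l x j w) * (ennreal (discount l (J.exit_t y w')) * (\<psi> (y - J.pre_exit y w') * indicator {0<..} (y - J.pre_exit y w'))) \<partial>M)"
      by (intro nn_integral_cong) (simp add: g_def J.exit_t_eq J.pre_exit_eq[OF _ y] pp)
    also have "\<dots> = ennreal (disc_rv l x j w) * (\<integral>\<^sup>+w'. ennreal (discount l (J.exit_t y w')) * (\<psi> (y - J.pre_exit y w') * indicator {0<..} (y - J.pre_exit y w')) \<partial>M)"
      by (rule nn_integral_cmult) measurable
    also have "(\<integral>\<^sup>+w'. ennreal (discount l (J.exit_t y w')) * (\<psi> (y - J.pre_exit y w') * indicator {0<..} (y - J.pre_exit y w')) \<partial>M) = J.U_op l (\<lambda>y. tail_nn y * \<psi> y) y"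
      by (rule J.compensation[OF y l]) measurable
    also have "\<dots> = K_res l \<psi> y"
      unfolding K_res_def J.U_op_def X1.U_op_def using umeas_unique[OF J.subordinated_axioms X1.subordinated_axioms, of l] l by simp
    finally show "(\<integral>\<^sup>+w'. g ((disc_rv l x j w, Y_rv x j w), rpath (Suc j) w') \<partial>M) = ennreal (disc_rv l x j w) * K_res l \<psi> (Y_rv x j w)"
      by (simp add: y_def)
  qed
  finally show ?thesis .
qed

lemma expect_iter:
  assumes x: "x \<ge> 0" and l: "l > 0" and "\<psi> \<in> borel_measurable borel" "\<And>y. y \<le> 0 \<Longrightarrow> \<psi> y = 0"
  shows "(\<integral>\<^sup>+w. ennreal (disc_rv l x j w) * \<psi> (Y_rv x j w) \<partial>M) = (K_res l ^^ j) \<psi> x"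
  using assms(3,4)
proof (induction j arbitrary: \<psi>)
  case 0 thus ?case by (simp add: disc_rv_0 Y_rv_0 emeasure_space_1)
next
  case (Suc j)
  have "(\<integral>\<^sup>+w. ennreal (disc_rv l x (Suc j) w) * \<psi> (Y_rv x (Suc j) w) \<partial>M) =
    (\<integral>\<^sup>+w. ennreal (disc_rv l x (Suc j) w) * (\<psi> (Y_rv x (Suc j) w) * indicator {0<..} (Y_rv x (Suc j) w)) \<partial>M)"
    by (intro nn_integral_cong) (auto simp: indicator_def Suc.prems(2))
  also have "\<dots> = (\<integral>\<^sup>+w. ennreal (disc_rv l x j w) * K_res l \<psi> (Y_rv x j w) \<partial>M)"
    by (rule expect_step[OF x l Suc.prems(1)])
  also have "\<dots> = (K_res l ^^ j) (K_res l \<psi>) x"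
    by (rule Suc.IH) (use l Suc.prems in \<open>auto intro: K_res_measurable K_res_zero\<close>)
  finally show ?case by (simp add: funpow_swap1)
qed

text \<open>Given its starting level, a life contributes the resolvent of a fresh subordinator. The
  inner integral runs over all s, beyond the passage as well, in accordance with the form of
  \<open>cterm\<close>.\<close>

lemma expect_occupation:
  assumes x: "x \<ge> 0" and l: "l > 0" and [measurable]: "g \<in> borel_measurable borel"
  shows "(\<integral>\<^sup>+w. ennreal (disc_rv l x j w) * (\<integral>\<^sup>+s. hexp l s * g (Y_rv x j w - S (Suc j) s w) \<partial>lborel) \<partial>M) =
    (\<integral>\<^sup>+w. ennreal (disc_rv l x j w) * X1.U_op l g (Y_rv x j w) \<partial>M)"
proof -
  interpret J: subordinated M f k \<mu> "S (Suc j)" by (rule sub_loc) simp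
  interpret P: pair_sigma_finite M "lborel :: real measure" ..
  note [measurable] = J.X_joint' J.X_joint disc_rv_measurable[OF x] Y_rv_measurable[OF x]
  have r: "(\<integral>\<^sup>+s. hexp l s * G (S (Suc j) s w) \<partial>lborel) = (\<integral>\<^sup>+s. hexp l s * G (S (Suc j) (max 0 s) w) \<partial>lborel)" for G :: "real \<Rightarrow> ennreal" and w
    by (intro nn_integral_cong) (auto simp: indicator_def max_absorb2)
  have "(\<integral>\<^sup>+w. ennreal (disc_rv l x j w) * (\<integral>\<^sup>+s. hexp l s * g (Y_rv x j w - S (Suc j) s w) \<partial>lborel) \<partial>M) =
    (\<integral>\<^sup>+w. (\<integral>\<^sup>+s. ennreal (disc_rv l x j w) * (hexp l s * g (Y_rv x j w - S (Suc j) (max 0 s) w)) \<partial>lborel) \<partial>M)"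
  proof (rule nn_integral_cong)
    fix w assume w: "w \<in> space M"
    have [measurable]: "(\<lambda>s. S (Suc j) (max 0 s) w) \<in> borel_measurable lborel"
      using nice_path_measurable[OF J.X_nice[OF w]] by simp
    show "ennreal (disc_rv l x j w) * (\<integral>\<^sup>+s. hexp l s * g (Y_rv x j w - S (Suc j) s w) \<partial>lborel) =
      (\<integral>\<^sup>+s. ennreal (disc_rv l x j w) * (hexp l s * g (Y_rv x j w - S (Suc j) (max 0 s) w)) \<partial>lborel)"
      unfolding r[of "\<lambda>v. g (Y_rv x j w - v)"] by (rule nn_integral_cmult[symmetric]) measurable
  qed
  also have "\<dots> = (\<integral>\<^sup>+s. (\<integral>\<^sup>+w. ennreal (disc_rv l x j w) * (hexp l s * g (Y_rv x j w - S (Suc j) (max 0 s) w)) \<partial>M) \<partial>lborel)"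
    by (rule P.Fubini'[symmetric]) measurable
  also have "\<dots> = (\<integral>\<^sup>+s. (\<integral>\<^sup>+w. ennreal (disc_rv l x j w) * (\<integral>\<^sup>+w'. hexp l s * g (Y_rv x j w - S (Suc j) (max 0 s) w') \<partial>M) \<partial>M) \<partial>lborel)"
  proof (rule nn_integral_cong)
    fix s :: real
    have s: "max 0 s \<ge> 0" by simp
    note [measurable] = J.X_meas[OF s]
    let ?N = "((borel \<Otimes>\<^sub>M borel) \<Otimes>\<^sub>M path_space) :: ((real \<times> real) \<times> (real \<Rightarrow> real)) measure"
    have cm: "(\<lambda>z. snd z (max 0 s)) \<in> borel_measurable ?N"
      by (rule measurable_compose[OF measurable_snd measurable_component_singleton]) simp
    define G where "G z = ennreal (fst (fst z)) * (hexp l s * g (snd (fst z) - snd z (max 0 s)))" for z :: "(real \<times> real) \<times> (real \<Rightarrow> real)"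
    have Gm: "G \<in> borel_measurable ?N" unfolding G_def using cm by measurable
    have e: "rpath (Suc j) w (max 0 s) = S (Suc j) (max 0 s) w" for w by (simp add: rpath_def)
    show "(\<integral>\<^sup>+w. ennreal (disc_rv l x j w) * (hexp l s * g (Y_rv x j w - S (Suc j) (max 0 s) w)) \<partial>M) =
      (\<integral>\<^sup>+w. ennreal (disc_rv l x j w) * (\<integral>\<^sup>+w'. hexp l s * g (Y_rv x j w - S (Suc j) (max 0 s) w') \<partial>M) \<partial>M)"
      using state_indep[OF x Gm, of l j] by (simp add: G_def e nn_integral_cmult)
  qed
  also have "\<dots> = (\<integral>\<^sup>+w. (\<integral>\<^sup>+s. ennreal (disc_rv l x j w) * (\<integral>\<^sup>+w'. hexp l s * g (Y_rv x j w - S (Suc j) (max 0 s) w') \<partial>M) \<partial>lborel) \<partial>M)"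
  proof (rule P.Fubini')
    have [measurable]: "(\<lambda>z. S (Suc j) (max 0 (snd (fst z))) (snd z)) \<in> borel_measurable ((M \<Otimes>\<^sub>M lborel) \<Otimes>\<^sub>M M)"
      by (rule right_cont_measurable[OF J.X_meas J.X_rc]) auto
    have "(\<lambda>z. \<integral>\<^sup>+w'. indicator {0..} (snd z) * ennreal (exp (-(l * (snd z)))) * g (Y_rv x j (fst z) - S (Suc j) (max 0 (snd z)) w') \<partial>M) \<in> borel_measurable (M \<Otimes>\<^sub>M lborel)"
      by (rule borel_measurable_nn_integral) (simp add: split_beta', measurable)
    thus "(\<lambda>(w, s). ennreal (disc_rv l x j w) * (\<integral>\<^sup>+w'. hexp l s * g (Y_rv x j w - S (Suc j) (max 0 s) w') \<partial>M)) \<in> borel_measurable (M \<Otimes>\<^sub>M lborel)"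
      unfolding split_beta' by measurable
  qed
  also have "\<dots> = (\<integral>\<^sup>+w. ennreal (disc_rv l x j w) * X1.U_op l g (Y_rv x j w) \<partial>M)"
  proof (rule nn_integral_cong)
    fix w
    define y where "y = Y_rv x j w"
    have [measurable]: "(\<lambda>s. \<integral>\<^sup>+w'. g (y - S (Suc j) (max 0 s) w') \<partial>M) \<in> borel_measurable lborel"
      by (rule borel_measurable_nn_integral) (simp add: split_beta', measurable)
    have inner: "(\<integral>\<^sup>+w'. hexp l s * g (y - S (Suc j) (max 0 s) w') \<partial>M) = hexp l s * (\<integral>\<^sup>+w'. g (y - S (Suc j) (max 0 s) w') \<partial>M)" for s
    proof -
      have s: "max 0 s \<ge> 0" by simp
      note [measurable] = J.X_meas[OF s]
      show ?thesis by (rule nn_integral_cmult) measurable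
    qed
    have "(\<integral>\<^sup>+s. ennreal (disc_rv l x j w) * (\<integral>\<^sup>+w'. hexp l s * g (y - S (Suc j) (max 0 s) w') \<partial>M) \<partial>lborel) =
      ennreal (disc_rv l x j w) * (\<integral>\<^sup>+s. hexp l s * (\<integral>\<^sup>+w'. g (y - S (Suc j) (max 0 s) w') \<partial>M) \<partial>lborel)"
      unfolding inner by (rule nn_integral_cmult) measurable
    also have "(\<integral>\<^sup>+s. hexp l s * (\<integral>\<^sup>+w'. g (y - S (Suc j) (max 0 s) w') \<partial>M) \<partial>lborel) =
      (\<integral>\<^sup>+s. hexp l s * (\<integral>\<^sup>+w'. g (y - S (Suc j) s w') \<partial>M) \<partial>lborel)"
      by (intro nn_integral_cong) (auto simp: indicator_def max_absorb2)
    also have "\<dots> = J.U_op l g y" unfolding J.U_op_def by (rule J.nn_umeas[symmetric]) measurable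
    also have "\<dots> = X1.U_op l g y"
      unfolding J.U_op_def X1.U_op_def using umeas_unique[OF J.subordinated_axioms X1.subordinated_axioms, of l] l by simp
    finally show "(\<integral>\<^sup>+s. ennreal (disc_rv l x j w) * (\<integral>\<^sup>+w'. hexp l s * g (Y_rv x j w - S (Suc j) (max 0 s) w') \<partial>M) \<partial>lborel) = ennreal (disc_rv l x j w) * X1.U_op l g (Y_rv x j w)"
      by (simp add: y_def)
  qed
  finally show ?thesis .
qed

end

section \<open>The resolvent of the censored process as a renewal series\<close>

context censored_process
begin

lemma Z_rv_bounds: "w \<in> space M \<Longrightarrow> x \<ge> 0 \<Longrightarrow> t \<ge> 0 \<Longrightarrow> 0 \<le> Z_rv x t w" "w \<in> space M \<Longrightarrow> x \<ge> 0 \<Longrightarrow> t \<ge> 0 \<Longrightarrow> Z_rv x t w \<le> x"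
  unfolding Z_rv_def by (rule Z_cens_bounds, use nice_S in auto)+

lemma Z_rv_right_cont: "w \<in> space M \<Longrightarrow> x \<ge> 0 \<Longrightarrow> t \<ge> 0 \<Longrightarrow> continuous (at_right t) (\<lambda>s. Z_rv x s w)"
  unfolding Z_rv_def by (rule Z_cens_right_cont) (use nice_S in auto)

lemma Z_rv_cterm:
  assumes "w \<in> space M" "x \<ge> 0" "t \<ge> 0" "\<And>z. z \<le> 0 \<Longrightarrow> g z = (0::ennreal)"
  shows "g (Z_rv x t w) = (\<Sum>j. if tau_rv x j w \<le> ereal t then g (Y_rv x j w - S (Suc j) (t - real_of_ereal (tau_rv x j w)) w) else 0)"
proof -
  have n: "\<And>j. 1 \<le> j \<Longrightarrow> nice_path (path_seq w j)" using nice_S[OF assms(1)] by blast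
  have e: "cterm (path_seq w) x g t = (\<lambda>j. if tau_cens (path_seq w) x j \<le> ereal t then g (Y_cens (path_seq w) x j - S (Suc j) (t - real_of_ereal (tau_cens (path_seq w) x j)) w) else 0)"
    by (rule ext) (simp add: cterm_def[OF n assms(2)] path_seq_def)
  show ?thesis
    using cens_cterm[of "path_seq w" x g t, OF n assms(2) assms(4) assms(3)]
    unfolding Z_rv_def tau_rv_def Y_rv_def e .
qed

lemma Z_rv_measurable:
  assumes x: "x \<ge> 0" and t: "t \<ge> 0" shows "Z_rv x t \<in> borel_measurable M"
proof -
  define c where "c j w = (if tau_rv x j w \<le> ereal t then ennreal (Y_rv x j w - S (Suc j) (max 0 (t - real_of_ereal (tau_rv x j w))) w) else 0)" for j w
  note [measurable] = tau_rv_measurable[OF x] Y_rv_measurable[OF x]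
  have cm[measurable]: "c j \<in> borel_measurable M" for j
  proof -
    interpret J: subordinated M f k \<mu> "S (Suc j)" by (rule sub_loc) simp
    have [measurable]: "(\<lambda>w. S (Suc j) (max 0 (t - real_of_ereal (tau_rv x j w))) w) \<in> borel_measurable M"
      by (rule right_cont_measurable[OF J.X_meas J.X_rc, where p="\<lambda>w. w"]) auto
    show ?thesis unfolding c_def by measurable
  qed
  have e: "Z_rv x t w = enn2real (\<Sum>j. c j w)" if w: "w \<in> space M" for w
  proof -
    \<comment> \<open>The map \<open>ennreal\<close> vanishes on nonpositive reals and is thus an
      admissible g, which exhibits the process itself as a series of measurable terms.\<close>
    have "ennreal (Z_rv x t w) = (\<Sum>j. if tau_rv x j w \<le> ereal t then ennreal (Y_rv x j w - S (Suc j) (t - real_of_ereal (tau_rv x j w)) w) else 0)"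
      using Z_rv_cterm[OF w x t, of ennreal] by (simp add: ennreal_neg)
    also have "\<dots> = (\<Sum>j. c j w)"
    proof (rule suminf_cong)
      fix j
      show "(if tau_rv x j w \<le> ereal t then ennreal (Y_rv x j w - S (Suc j) (t - real_of_ereal (tau_rv x j w)) w) else 0) = c j w"
        using tau_rv_nonneg[OF w x, of j] by (cases "tau_rv x j w") (auto simp: c_def max_absorb2)
    qed
    finally have "ennreal (Z_rv x t w) = (\<Sum>j. c j w)" .
    thus ?thesis using Z_rv_bounds(1)[OF w x t] by (metis enn2real_ennreal)
  qed
  have "(\<lambda>w. enn2real (\<Sum>j. c j w)) \<in> borel_measurable M" by measurable
  thus ?thesis by (subst measurable_cong[OF e]) auto
qed

lemma Z_rv_joint: "x \<ge> 0 \<Longrightarrow> (\<lambda>z. Z_rv x (max 0 (fst z)) (snd z)) \<in> borel_measurable (lborel \<Otimes>\<^sub>M M)"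
  by (rule right_cont_measurable[OF Z_rv_measurable Z_rv_right_cont]) auto

definition Rn :: "real \<Rightarrow> (real \<Rightarrow> ennreal) \<Rightarrow> real \<Rightarrow> ennreal" where
  "Rn l g x = (\<Sum>j. (K_res l ^^ j) (X1.U_op l g) x)"

lemma iter_measurable: "l \<ge> 0 \<Longrightarrow> g \<in> borel_measurable borel \<Longrightarrow> (K_res l ^^ j) (X1.U_op l g) \<in> borel_measurable borel"
  by (induction j) (auto intro: X1.U_op_measurable K_res_measurable)

lemma iter_zero: "(\<And>y. y \<le> 0 \<Longrightarrow> g y = 0) \<Longrightarrow> y \<le> 0 \<Longrightarrow> (K_res l ^^ j) (X1.U_op l g) y = 0"
  by (cases j) (auto intro: K_res_zero X1.U_op_zero)

lemma Rn_measurable: "l \<ge> 0 \<Longrightarrow> g \<in> borel_measurable borel \<Longrightarrow> Rn l g \<in> borel_measurable borel"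
proof -
  assume "l \<ge> 0" "g \<in> borel_measurable borel"
  note [measurable] = iter_measurable[OF this]
  show ?thesis unfolding Rn_def[abs_def] by measurable
qed

lemma Rn_zero: "(\<And>y. y \<le> 0 \<Longrightarrow> g y = 0) \<Longrightarrow> y \<le> 0 \<Longrightarrow> Rn l g y = 0"
  unfolding Rn_def by (simp add: iter_zero)

lemma cens_resolvent:
  assumes x: "x \<ge> 0" and l: "l > 0" and [measurable]: "g \<in> borel_measurable borel" and g0: "\<And>y. y \<le> 0 \<Longrightarrow> g y = 0"
  shows "(\<integral>\<^sup>+t. hexp l t * (\<integral>\<^sup>+w. g (Z_rv x t w) \<partial>M) \<partial>lborel) = Rn l g x"
proof -
  interpret P: pair_sigma_finite M "lborel :: real measure" ..
  note [measurable] = Z_rv_joint[OF x]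
  have zm: "(\<lambda>z. Z_rv x (max 0 (snd z)) (fst z)) \<in> borel_measurable (M \<Otimes>\<^sub>M lborel)"
    by (rule right_cont_measurable[OF Z_rv_measurable[OF x] Z_rv_right_cont[OF _ x]]) auto
  note [measurable] = zm disc_rv_measurable[OF x] Y_rv_measurable[OF x]
  have "(\<integral>\<^sup>+t. hexp l t * (\<integral>\<^sup>+w. g (Z_rv x t w) \<partial>M) \<partial>lborel) =
    (\<integral>\<^sup>+t. (\<integral>\<^sup>+w. hexp l t * g (Z_rv x (max 0 t) w) \<partial>M) \<partial>lborel)"
  proof (rule nn_integral_cong)
    fix t :: real
    show "hexp l t * (\<integral>\<^sup>+w. g (Z_rv x t w) \<partial>M) = (\<integral>\<^sup>+w. hexp l t * g (Z_rv x (max 0 t) w) \<partial>M)"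
    proof (cases "t \<ge> 0")
      case True
      note [measurable] = Z_rv_measurable[OF x True]
      show ?thesis using True by (simp add: nn_integral_cmult max_absorb2)
    qed simp
  qed
  also have "\<dots> = (\<integral>\<^sup>+w. (\<integral>\<^sup>+t. hexp l t * g (Z_rv x (max 0 t) w) \<partial>lborel) \<partial>M)"
    by (rule P.Fubini') measurable
  also have "\<dots> = (\<integral>\<^sup>+w. (\<Sum>j. ennreal (disc_rv l x j w) * (\<integral>\<^sup>+s. hexp l s * g (Y_rv x j w - S (Suc j) s w) \<partial>lborel)) \<partial>M)"
  proof (rule nn_integral_cong)
    fix w assume w: "w \<in> space M"
    have "(\<integral>\<^sup>+t. hexp l t * g (Z_rv x (max 0 t) w) \<partial>lborel) = (\<integral>\<^sup>+t. hexp l t * g (Z_cens (path_seq w) x t) \<partial>lborel)"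
      by (intro nn_integral_cong) (auto simp: Z_rv_def indicator_def max_absorb2)
    also have "\<dots> = (\<Sum>j. ennreal (discount l (tau_cens (path_seq w) x j)) * (\<integral>\<^sup>+s. hexp l s * g (Y_cens (path_seq w) x j - path_seq w (Suc j) s) \<partial>lborel))"
      by (rule cens_laplace[OF _ x g0]) (use nice_S[OF w] in auto)
    finally show "(\<integral>\<^sup>+t. hexp l t * g (Z_rv x (max 0 t) w) \<partial>lborel) =
      (\<Sum>j. ennreal (disc_rv l x j w) * (\<integral>\<^sup>+s. hexp l s * g (Y_rv x j w - S (Suc j) s w) \<partial>lborel))"
      by (simp add: disc_rv_def tau_rv_def Y_rv_def path_seq_def)
  qed
  also have "\<dots> = (\<Sum>j. \<integral>\<^sup>+w. ennreal (disc_rv l x j w) * (\<integral>\<^sup>+s. hexp l s * g (Y_rv x j w - S (Suc j) s w) \<partial>lborel) \<partial>M)"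
  proof (rule nn_integral_suminf)
    fix j
    interpret J: subordinated M f k \<mu> "S (Suc j)" by (rule sub_loc) simp
    note [measurable] = J.X_joint'
    have e: "(\<integral>\<^sup>+s. hexp l s * g (Y_rv x j w - S (Suc j) s w) \<partial>lborel) =
       (\<integral>\<^sup>+s. hexp l s * g (Y_rv x j w - S (Suc j) (max 0 s) w) \<partial>lborel)" for w
      by (intro nn_integral_cong) (auto simp: indicator_def max_absorb2)
    show "(\<lambda>w. ennreal (disc_rv l x j w) * (\<integral>\<^sup>+s. hexp l s * g (Y_rv x j w - S (Suc j) s w) \<partial>lborel)) \<in> borel_measurable M"
      unfolding e by measurable
  qed
  also have "\<dots> = Rn l g x"
    unfolding Rn_def
  proof (rule suminf_cong)
    fix j
    show "(\<integral>\<^sup>+w. ennreal (disc_rv l x j w) * (\<integral>\<^sup>+s. hexp l s * g (Y_rv x j w - S (Suc j) s w) \<partial>lborel) \<partial>M) = (K_res l ^^ j) (X1.U_op l g) x"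
      unfolding expect_occupation[OF x l assms(3)]
      by (rule expect_iter[OF x l]) (use l g0 in \<open>auto intro!: X1.U_op_measurable X1.U_op_zero\<close>)
  qed
  finally show ?thesis .
qed

lemma Rn_renewal:
  assumes l: "l > 0" and [measurable]: "g \<in> borel_measurable borel"
  shows "Rn l g x = X1.U_op l g x + K_res l (Rn l g) x"
proof -
  have l0: "l \<ge> 0" using l by simp
  note im[measurable] = iter_measurable[OF l0 assms(2)]
  have "Rn l g x = (K_res l ^^ 0) (X1.U_op l g) x + (\<Sum>j. (K_res l ^^ Suc j) (X1.U_op l g) x)"
    unfolding Rn_def by (rule suminf_offset[of _ 1, simplified, THEN trans]) auto
  also have "(\<Sum>j. (K_res l ^^ Suc j) (X1.U_op l g) x) = (\<Sum>j. \<integral>\<^sup>+z. tail_nn (x - z) * (K_res l ^^ j) (X1.U_op l g) (x - z) \<partial>X1.umeas l)"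
    by (simp add: K_res_def X1.U_op_def)
  also have "\<dots> = (\<integral>\<^sup>+z. (\<Sum>j. tail_nn (x - z) * (K_res l ^^ j) (X1.U_op l g) (x - z)) \<partial>X1.umeas l)"
    by (rule nn_integral_suminf[symmetric]) measurable
  also have "\<dots> = K_res l (Rn l g) x"
    unfolding K_res_def X1.U_op_def Rn_def by simp
  finally show ?thesis by simp
qed

text \<open>For z = g + tail R, the renewal equation says that R is \<open>U_op l z\<close>, so the
  resolvent equation of the subordinator between the rates 0 and l applies to z. Nothing is
  subtracted, because finiteness has not been established at this stage.\<close>

lemma Rn_resolvent:
  assumes l: "l > 0" and [measurable]: "g \<in> borel_measurable borel"
  shows "Rn l g x + ennreal l * X1.U_op 0 (Rn l g) x = X1.U_op 0 g x + X1.U_op 0 (\<lambda>y. tail_nn y * Rn l g y) x"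
proof -
  have [measurable]: "Rn l g \<in> borel_measurable borel" using l by (intro Rn_measurable) auto
  define z where "z y = g y + tail_nn y * Rn l g y" for y
  have zm[measurable]: "z \<in> borel_measurable borel" unfolding z_def by measurable
  have add: "X1.U_op a z y = X1.U_op a g y + X1.U_op a (\<lambda>y. tail_nn y * Rn l g y) y" for a y
    unfolding X1.U_op_def z_def by (subst nn_integral_add) auto
  have R: "X1.U_op l z = Rn l g"
  proof
    fix y show "X1.U_op l z y = Rn l g y" unfolding add using Rn_renewal[OF l assms(2), of y] by (simp add: K_res_def)
  qed
  have "X1.U_op 0 z x = X1.U_op l z x + ennreal l * X1.U_op 0 (X1.U_op l z) x" by (rule X1.U_op_resolvent[OF l zm])
  thus ?thesis unfolding R add by simp
qed

lemma Uo0_le: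
  assumes [measurable]: "\<psi> \<in> borel_measurable borel" and "\<And>y. y \<le> 0 \<Longrightarrow> \<psi> y = 0"
    and b: "\<And>y. 0 < y \<Longrightarrow> y \<le> T \<Longrightarrow> \<psi> y \<le> ennreal c" and x: "0 < x" "x \<le> T" and c: "c \<ge> 0"
  shows "X1.U_op 0 \<psi> x \<le> ennreal (c * kap x)"
proof -
  have "X1.U_op 0 \<psi> x = (\<integral>\<^sup>+z. k_nn z * \<psi> (x - z) \<partial>lborel)" by (rule X1.U_op_0) simp
  also have "\<dots> \<le> (\<integral>\<^sup>+z. ennreal c * (indicator {..<x} z * k_nn z) \<partial>lborel)"
  proof (rule nn_integral_mono)
    fix z
    consider "z \<le> 0" | "z \<ge> x" | "0 < z" "z < x" by linarith
    thus "k_nn z * \<psi> (x - z) \<le> ennreal c * (indicator {..<x} z * k_nn z)"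
    proof cases
      case 3
      hence "k_nn z * \<psi> (x - z) \<le> k_nn z * ennreal c" using x by (intro mult_left_mono b) auto
      thus ?thesis using 3 by (simp add: mult.commute)
    qed (use assms(2) in \<open>auto simp: k_nn_def\<close>)
  qed
  also have "\<dots> = ennreal c * ennreal (kap x)" by (subst nn_integral_cmult) (auto simp: kap_nn)
  also have "\<dots> = ennreal (c * kap x)" using c kap_nonneg by (simp add: ennreal_mult)
  finally show ?thesis .
qed

text \<open>\<open>U_op l\<close> is dominated by \<open>U_op 0\<close>, and against the weight
  \<open>kap\<close> each passage followed by a resurrection costs a factor \<open>rho\<close>. The
  bound is uniform in l and supplies the finiteness needed to pass to real-valued
  identities.\<close>

lemma Rn_bound:
  assumes l: "l > 0" and g[measurable]: "g \<in> borel_measurable borel" and g0: "\<And>y. y \<le> 0 \<Longrightarrow> g y = 0"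
    and b: "\<And>y. g y \<le> ennreal C" and C: "C \<ge> 0" and x: "0 < x" "x \<le> T"
  shows "Rn l g x \<le> ennreal (C / (1 - rho) * kap x)"
proof -
  have l0: "l \<ge> 0" using l by simp
  have it: "(K_res l ^^ j) (X1.U_op l g) y \<le> ennreal (C * rho ^ j * kap y)" if "0 < y" "y \<le> T" for j y
    using that
  proof (induction j arbitrary: y)
    case 0
    have "X1.U_op l g y \<le> X1.U_op 0 g y" by (rule X1.U_op_mono[OF g l0])
    also have "\<dots> \<le> ennreal (C * kap y)" by (rule Uo0_le[OF g g0 b 0 C])
    finally show ?case by simp
  next
    case (Suc j)
    define \<psi> where "\<psi> = (K_res l ^^ j) (X1.U_op l g)"
    have [measurable]: "\<psi> \<in> borel_measurable borel" unfolding \<psi>_def by (rule iter_measurable[OF l0 g])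
    have "(K_res l ^^ Suc j) (X1.U_op l g) y = X1.U_op l (\<lambda>y. tail_nn y * \<psi> y) y" by (simp add: K_res_def \<psi>_def)
    also have "\<dots> \<le> X1.U_op 0 (\<lambda>y. tail_nn y * \<psi> y) y" by (rule X1.U_op_mono[OF _ l0]) measurable
    also have "\<dots> \<le> ennreal ((C * rho ^ j * rho) * kap y)"
    proof (rule Uo0_le[OF _ _ _ Suc.prems])
      fix v assume v: "0 < v" "v \<le> T"
      have "tail_nn v * \<psi> v \<le> ennreal (tail \<mu> v) * ennreal (C * rho ^ j * kap v)"
        using Suc.IH[OF v] v by (auto simp: tail_nn_def \<psi>_def intro!: mult_left_mono)
      also have "\<dots> = ennreal (C * rho ^ j * (tail \<mu> v * kap v))"
        using tail_nonneg kap_nonneg C rho by (simp add: ennreal_mult[symmetric] mult_ac)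
      also have "\<dots> \<le> ennreal (C * rho ^ j * rho)"
        using rho(3)[OF v] C rho(1) by (intro ennreal_leI mult_left_mono) auto
      finally show "tail_nn v * \<psi> v \<le> ennreal (C * rho ^ j * rho)" .
    next
      show "(\<lambda>y. tail_nn y * \<psi> y) \<in> borel_measurable borel" by measurable
      show "tail_nn v * \<psi> v = 0" if "v \<le> 0" for v using that by (simp add: tail_nn_def)
      show "0 \<le> C * rho ^ j * rho" using C rho(1) by simp
    qed
    finally show ?case by (simp add: mult_ac)
  qed
  have s: "summable (\<lambda>j. C * rho ^ j * kap x)"
    using rho by (intro summable_mult2 summable_mult summable_geometric) simp
  have "Rn l g x \<le> (\<Sum>j. ennreal (C * rho ^ j * kap x))"
    unfolding Rn_def by (intro suminf_le it x) auto
  also have "\<dots> = ennreal (\<Sum>j. C * rho ^ j * kap x)"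
    using C rho kap_nonneg by (intro suminf_ennreal2 s) auto
  also have "(\<Sum>j. C * rho ^ j * kap x) = (\<Sum>j. rho ^ j * (C * kap x))" by (intro suminf_cong) simp
  also have "\<dots> = (\<Sum>j. rho ^ j) * (C * kap x)"
    using rho by (intro suminf_mult2[symmetric] summable_geometric) simp
  also have "\<dots> = C / (1 - rho) * kap x" using rho by (simp add: suminf_geometric)
  finally show ?thesis .
qed

lemma Uo0_conv:
  assumes h: "bmeas_le h C" "\<And>y. 0 < y \<Longrightarrow> y \<le> T \<Longrightarrow> 0 \<le> h y" and [measurable]: "\<psi> \<in> borel_measurable borel"
    and \<psi>: "\<And>y. y \<le> 0 \<Longrightarrow> \<psi> y = 0" "\<And>y. 0 < y \<Longrightarrow> y \<le> T \<Longrightarrow> \<psi> y = ennreal (h y)" and x: "0 < x" "x \<le> T"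
  shows "X1.U_op 0 \<psi> x = ennreal (conv k h x)" "0 \<le> conv k h x"
proof -
  have hm: "zext T h \<in> borel_measurable borel" using h by (simp add: bmeas_le_def bmeas_def)
  have nn: "0 \<le> zext T h s" "zext T h s \<le> C" if "0 < s" "s < x" for s
    using h(1) h(2)[of s] that x by (auto simp: zext_def bmeas_le_def)
  have "X1.U_op 0 \<psi> x = (\<integral>\<^sup>+z. k_nn z * \<psi> (x - z) \<partial>lborel)" by (rule X1.U_op_0) simp
  also have "\<dots> = (\<integral>\<^sup>+s. k_nn (x - s) * \<psi> s \<partial>lborel)"
    using nn_integral_real_affine[of "\<lambda>z. k_nn z * \<psi> (x - z)" "-1" x] by simp
  also have "\<dots> = (\<integral>\<^sup>+s. k_nn (x - s) * (indicator {0<..} s * ennreal (zext T h s)) \<partial>lborel)"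
  proof (rule nn_integral_cong)
    fix s
    show "k_nn (x - s) * \<psi> s = k_nn (x - s) * (indicator {0<..} s * ennreal (zext T h s))"
      using \<psi>(1)[of s] \<psi>(2)[of s] x by (cases "s \<le> 0"; cases "s \<ge> x") (auto simp: k_nn_def zext_def)
  qed
  also have "\<dots> = ennreal (conv k (zext T h) x)" by (rule conv_nn(1)[OF hm nn])
  finally show "X1.U_op 0 \<psi> x = ennreal (conv k h x)" by (simp only: conv_zext[OF x(2), symmetric])
  have "0 \<le> conv k (zext T h) x" by (rule conv_nn(2)[OF hm nn])
  thus "0 \<le> conv k h x" by (simp only: conv_zext[OF x(2), symmetric])
qed

section \<open>The resolvent identity\<close>

definition P_Z :: "real \<Rightarrow> (real \<Rightarrow> real) \<Rightarrow> real \<Rightarrow> real" where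
  "P_Z t \<phi> x = (\<integral>w. \<phi> (Z_rv x t w) \<partial>M)"

definition Res :: "real \<Rightarrow> (real \<Rightarrow> real) \<Rightarrow> real \<Rightarrow> real" where
  "Res l \<phi> x = (LBINT t:{0..}. exp (-(l * t)) * P_Z t \<phi> x)"

lemma P_cens_P_Z:
  assumes "\<phi> 0 = 0" shows "P_cens M S T t \<phi> = zext T (P_Z t \<phi>)"
proof -
  have e: "(case S_cens (\<lambda>j s. S j s w) x t of None \<Rightarrow> 0 | Some y \<Rightarrow> \<phi> y) = \<phi> (Z_rv x t w)" for x w
    using assms unfolding Z_rv_def Z_cens_def path_seq_def[abs_def] by (simp split: option.split)
  show ?thesis unfolding P_cens_def P_Z_def by (simp only: e)
qed

lemma P_Z_integrable:
  fixes \<phi> :: "real \<Rightarrow> real"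
  assumes [measurable]: "\<phi> \<in> borel_measurable borel" and "\<And>y. \<bar>\<phi> y\<bar> \<le> C" "x \<ge> 0" "t \<ge> 0"
  shows "integrable M (\<lambda>w. \<phi> (Z_rv x t w))"
proof (rule Bochner_Integration.integrable_bound[of M "\<lambda>_. C"])
  note [measurable] = Z_rv_measurable[OF assms(3,4)]
  show "(\<lambda>w. \<phi> (Z_rv x t w)) \<in> borel_measurable M" by measurable
  show "AE w in M. norm (\<phi> (Z_rv x t w)) \<le> norm C" by (intro AE_I2) (use order_trans[OF assms(2) abs_ge_self] in simp)
qed simp

lemma P_Z_bound:
  assumes "\<phi> \<in> borel_measurable borel" and b: "\<And>y. \<bar>\<phi> y\<bar> \<le> C" and "x \<ge> 0" "t \<ge> 0"
  shows "\<bar>P_Z t \<phi> x\<bar> \<le> C"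
proof -
  have "\<bar>P_Z t \<phi> x\<bar> \<le> (\<integral>w. \<bar>\<phi> (Z_rv x t w)\<bar> \<partial>M)" unfolding P_Z_def by (rule integral_abs_bound)
  also have "\<dots> \<le> (\<integral>w. C \<partial>M)"
    by (intro integral_mono integrable_abs P_Z_integrable[OF assms]) (use b in auto)
  finally show ?thesis by (simp add: prob_space)
qed

lemma P_Z_measurable:
  assumes [measurable]: "\<phi> \<in> borel_measurable borel" and x: "x \<ge> 0"
  shows "(\<lambda>t. P_Z (max 0 t) \<phi> x) \<in> borel_measurable borel"
proof -
  note [measurable] = Z_rv_joint[OF x]
  have "(\<lambda>t. \<integral>w. \<phi> (Z_rv x (max 0 t) w) \<partial>M) \<in> borel_measurable lborel"
    by (rule borel_measurable_lebesgue_integral) (simp add: split_beta', measurable)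
  thus ?thesis by (simp add: P_Z_def)
qed

lemma Res_integrable:
  assumes \<phi>: "\<phi> \<in> borel_measurable borel" and b: "\<And>y. \<bar>\<phi> y\<bar> \<le> C" and x: "x \<ge> 0" and l: "l > 0"
  shows "set_integrable lborel {0..} (\<lambda>t. exp (-(l * t)) * P_Z t \<phi> x)"
proof -
  have C: "C \<ge> 0" using b[of 0] by simp
  note [measurable] = P_Z_measurable[OF \<phi> x]
  have "integrable lborel (\<lambda>t. indicator {0..} t * (exp (-(l * t)) * P_Z (max 0 t) \<phi> x))"
  proof (rule Bochner_Integration.integrable_bound)
    show "integrable lborel (\<lambda>t. C * (indicator {0..} t * exp (-(l * t))))"
      using integrable_exp_half(1)[OF l] by (intro integrable_mult_right) (simp add: set_integrable_def)
    show "AE t in lborel. norm (indicator {0..} t * (exp (-(l * t)) * P_Z (max 0 t) \<phi> x)) \<le> norm (C * (indicator {0..} t * exp (-(l * t))))"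
    proof (rule AE_I2)
      fix t :: real
      show "norm (indicator {0..} t * (exp (-(l * t)) * P_Z (max 0 t) \<phi> x)) \<le> norm (C * (indicator {0..} t * exp (-(l * t))))"
      proof (cases "t \<ge> 0")
        case True
        have "exp (-(l * t)) * \<bar>P_Z (max 0 t) \<phi> x\<bar> \<le> exp (-(l * t)) * C"
          by (intro mult_left_mono P_Z_bound[OF \<phi> b x]) auto
        thus ?thesis using True C by (simp add: abs_mult mult.commute)
      qed simp
    qed
  qed measurable
  also have "(\<lambda>t. indicator {0..} t * (exp (-(l * t)) * P_Z (max 0 t) \<phi> x)) = (\<lambda>t. indicator {0..} t *\<^sub>R (exp (-(l * t)) * P_Z t \<phi> x))"
    by (auto simp: indicator_def max_absorb2)
  finally show ?thesis by (simp add: set_integrable_def)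
qed

lemma Res_lin:
  assumes "\<phi> \<in> borel_measurable borel" "\<And>y. \<bar>\<phi> y\<bar> \<le> C" "\<psi> \<in> borel_measurable borel" "\<And>y. \<bar>\<psi> y\<bar> \<le> D" "x \<ge> 0" "l > 0"
  shows "Res l (\<lambda>y. a * \<phi> y + b * \<psi> y) x = a * Res l \<phi> x + b * Res l \<psi> x"
proof -
  have "Res l (\<lambda>y. a * \<phi> y + b * \<psi> y) x = (LBINT t:{0..}. a * (exp (-(l * t)) * P_Z t \<phi> x) + b * (exp (-(l * t)) * P_Z t \<psi> x))"
    unfolding Res_def
  proof (rule set_lebesgue_integral_cong)
    show "\<forall>t. t \<in> {0..} \<longrightarrow> exp (-(l * t)) * P_Z t (\<lambda>y. a * \<phi> y + b * \<psi> y) x = a * (exp (-(l * t)) * P_Z t \<phi> x) + b * (exp (-(l * t)) * P_Z t \<psi> x)"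
    proof (intro allI impI)
      fix t :: real assume "t \<in> {0..}"
      hence "P_Z t (\<lambda>y. a * \<phi> y + b * \<psi> y) x = a * P_Z t \<phi> x + b * P_Z t \<psi> x"
        unfolding P_Z_def using P_Z_integrable[OF assms(1,2,5), of t] P_Z_integrable[OF assms(3,4,5), of t] by simp
      thus "exp (-(l * t)) * P_Z t (\<lambda>y. a * \<phi> y + b * \<psi> y) x = a * (exp (-(l * t)) * P_Z t \<phi> x) + b * (exp (-(l * t)) * P_Z t \<psi> x)"
        by (simp add: algebra_simps)
    qed
  qed simp
  also have "\<dots> = a * Res l \<phi> x + b * Res l \<psi> x"
    unfolding Res_def using Res_integrable[OF assms(1,2,5,6)] Res_integrable[OF assms(3,4,5,6)]
    by (simp add: set_integral_add set_integrable_mult_right)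
  finally show ?thesis .
qed

text \<open>For nonnegative g the renewal identity holds in the extended reals, all its terms are
  finite, and it can be rearranged to the fixed point equation of \<open>V\<close> with source g - l
  R. The bound by \<open>kap\<close> puts R in the class where this equation has one
  solution.\<close>

lemma Res_nonneg_eq:
  assumes g: "g \<in> C_infty T" "\<And>y. 0 \<le> g y" "\<And>y. g y \<le> C" and l: "l > 0"
  shows "bmeas (Res l g)" "\<And>x. 0 < x \<Longrightarrow> x \<le> T \<Longrightarrow> 0 \<le> Res l g x \<and> Res l g x \<le> C / (1 - rho) * kap x"
    "\<And>x. 0 < x \<Longrightarrow> x \<le> T \<Longrightarrow> Res l g x = V (\<lambda>r. g r - l * Res l g r) x"
proof -
  have gm[measurable]: "g \<in> borel_measurable borel" by (rule C_infty_measurable[OF T g(1)])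
  have gb: "\<bar>g y\<bar> \<le> C" for y using g(2,3)[of y] by simp
  have C: "C \<ge> 0" using gb[of 0] by simp
  have g0: "ennreal (g y) = 0" if "y \<le> 0" for y using g(1) that by (simp add: C_infty_def)
  define R where "R = Rn l (\<lambda>y. ennreal (g y))"
  have Rm[measurable]: "R \<in> borel_measurable borel" unfolding R_def using l by (intro Rn_measurable) auto
  have R0: "R y = 0" if "y \<le> 0" for y unfolding R_def by (rule Rn_zero[OF _ that]) (rule g0)
  have Rb: "R x \<le> ennreal (C / (1 - rho) * kap x)" if "0 < x" "x \<le> T" for x
    unfolding R_def by (rule Rn_bound[OF l _ g0 _ C that]) (use g(3) in \<open>auto intro: ennreal_leI\<close>)
  have RRe: "ennreal (Res l g x) = R x" "0 \<le> Res l g x" if x: "0 < x" "x \<le> T" for x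
  proof -
    have x0: "x \<ge> 0" using x by simp
    have P0: "P_Z t g x \<ge> 0" for t unfolding P_Z_def by (intro integral_nonneg_AE AE_I2 g(2))
    show "0 \<le> Res l g x" unfolding Res_def set_lebesgue_integral_def by (intro integral_nonneg_AE AE_I2) (simp add: P0)
    have "ennreal (Res l g x) = (\<integral>\<^sup>+t. ennreal (indicator {0..} t *\<^sub>R (exp (-(l * t)) * P_Z t g x)) \<partial>lborel)"
      unfolding Res_def set_lebesgue_integral_def
      by (rule nn_integral_eq_integral[symmetric]) (use Res_integrable[OF gm gb x0 l] P0 in \<open>auto simp: set_integrable_def\<close>)
    also have "\<dots> = (\<integral>\<^sup>+t. hexp l t * (\<integral>\<^sup>+w. ennreal (g (Z_rv x t w)) \<partial>M) \<partial>lborel)"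
    proof (rule nn_integral_cong)
      fix t :: real
      show "ennreal (indicator {0..} t *\<^sub>R (exp (-(l * t)) * P_Z t g x)) = hexp l t * (\<integral>\<^sup>+w. ennreal (g (Z_rv x t w)) \<partial>M)"
      proof (cases "t \<ge> 0")
        case True
        have "(\<integral>\<^sup>+w. ennreal (g (Z_rv x t w)) \<partial>M) = ennreal (P_Z t g x)"
          unfolding P_Z_def by (intro nn_integral_eq_integral P_Z_integrable[OF gm gb x0 True] AE_I2 g(2))
        thus ?thesis using True P0 by (simp add: ennreal_mult)
      qed simp
    qed
    also have "\<dots> = R x" unfolding R_def by (rule cens_resolvent[OF x0 l _ g0]) measurable
    finally show "ennreal (Res l g x) = R x" .
  qed
  have RRr: "Res l g x = enn2real (R x)" if "0 < x" "x \<le> T" for x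
    using RRe[OF that] by (metis enn2real_ennreal)
  show bm: "bmeas (Res l g)"
  proof (rule bmeas_cong[of "\<lambda>x. enn2real (R x)"])
    have "zext T (\<lambda>x. enn2real (R x)) = (\<lambda>x. indicator {0<..T} x * enn2real (R x))" by (auto simp: zext_def indicator_def)
    thus "bmeas (\<lambda>x. enn2real (R x))" unfolding bmeas_def by simp
  qed (use RRr in auto)
  show bd: "0 \<le> Res l g x \<and> Res l g x \<le> C / (1 - rho) * kap x" if x: "0 < x" "x \<le> T" for x
  proof -
    have "ennreal (Res l g x) \<le> ennreal (C / (1 - rho) * kap x)" using Rb[OF x] RRe[OF x] by simp
    moreover have "0 \<le> C / (1 - rho) * kap x" using C rho kap_nonneg by simp
    ultimately show ?thesis using RRe(2)[OF x] by (simp add: ennreal_le_iff)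
  qed
  define D where "D = C / (1 - rho)"
  have D: "D \<ge> 0" using C rho by (simp add: D_def)
  have RBd: "bmeas_le (Res l g) (D * kap T)"
    unfolding bmeas_le_def
  proof (intro conjI allI impI bm)
    fix y assume y: "0 < y" "y \<le> T"
    have "Res l g y \<le> D * kap y" using bd[OF y] by (simp add: D_def)
    also have "\<dots> \<le> D * kap T" using D kap_mono[OF y(2)] by (intro mult_left_mono) auto
    finally show "\<bar>Res l g y\<bar> \<le> D * kap T" using bd[OF y] by simp
  qed
  have tBd: "bmeas_le (\<lambda>r. tail \<mu> r * Res l g r) (D * rho)"
    unfolding bmeas_le_def
  proof (intro conjI allI impI bmeas_mult bmeas_tail bm)
    fix y assume y: "0 < y" "y \<le> T"
    show "\<bar>tail \<mu> y * Res l g y\<bar> \<le> D * rho" using bd[OF y] by (intro tail_mult_bound[OF y _ D]) (simp add: D_def)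
  qed
  have gBd: "bmeas_le g C" by (rule C_infty_bmeas_le[OF g(1) gb])
  have zBd: "bmeas_le (\<lambda>r. 1 * g r + (- l) * Res l g r) (\<bar>1\<bar> * C + \<bar>- l\<bar> * (D * kap T))" by (rule bmeas_le_comb[OF gBd RBd])
  show "Res l g x = V (\<lambda>r. g r - l * Res l g r) x" if x: "0 < x" "x \<le> T" for x
  proof -
    have eq: "Res l g y = conv k (\<lambda>r. 1 * g r + (- l) * Res l g r + tail \<mu> r * Res l g r) y" if y: "0 < y" "y \<le> T" for y
    proof -
      have gm': "(\<lambda>y. ennreal (g y)) \<in> borel_measurable borel" by measurable
      have c1: "X1.U_op 0 R y = ennreal (conv k (Res l g) y)" "0 \<le> conv k (Res l g) y"
        using Uo0_conv[OF RBd _ Rm R0 _ y] RRe by auto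
      have c2: "X1.U_op 0 (\<lambda>y. ennreal (g y)) y = ennreal (conv k g y)" "0 \<le> conv k g y"
        using Uo0_conv[OF gBd _ gm' g0 _ y] g(2) by auto
      have c3: "X1.U_op 0 (\<lambda>y. tail_nn y * R y) y = ennreal (conv k (\<lambda>r. tail \<mu> r * Res l g r) y)" "0 \<le> conv k (\<lambda>r. tail \<mu> r * Res l g r) y"
      proof -
        have m: "(\<lambda>y. tail_nn y * R y) \<in> borel_measurable borel" by measurable
        have n: "0 \<le> tail \<mu> v * Res l g v" if "0 < v" "v \<le> T" for v using RRe(2)[OF that] tail_nonneg by simp
        have z: "tail_nn v * R v = 0" if "v \<le> 0" for v using R0[OF that] by simp
        have e: "tail_nn v * R v = ennreal (tail \<mu> v * Res l g v)" if "0 < v" "v \<le> T" for v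
          using RRe[OF that] that tail_nonneg by (simp add: tail_nn_def ennreal_mult)
        show "X1.U_op 0 (\<lambda>y. tail_nn y * R y) y = ennreal (conv k (\<lambda>r. tail \<mu> r * Res l g r) y)" "0 \<le> conv k (\<lambda>r. tail \<mu> r * Res l g r) y"
          using Uo0_conv[OF tBd n m z e y] by auto
      qed
      have "ennreal (Res l g y + l * conv k (Res l g) y) = ennreal (Res l g y) + ennreal l * ennreal (conv k (Res l g) y)"
        using c1(2) RRe(2)[OF y] l by (simp add: ennreal_mult)
      also have "\<dots> = R y + ennreal l * X1.U_op 0 R y" by (simp only: c1(1) RRe(1)[OF y])
      also have "\<dots> = X1.U_op 0 (\<lambda>y. ennreal (g y)) y + X1.U_op 0 (\<lambda>y. tail_nn y * R y) y"
        unfolding R_def by (rule Rn_resolvent[OF l gm'])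
      also have "\<dots> = ennreal (conv k g y) + ennreal (conv k (\<lambda>r. tail \<mu> r * Res l g r) y)"
        by (simp only: c2(1) c3(1))
      also have "\<dots> = ennreal (conv k g y + conv k (\<lambda>r. tail \<mu> r * Res l g r) y)"
        using c2(2) c3(2) by simp
      finally have h: "ennreal (Res l g y + l * conv k (Res l g) y) = ennreal (conv k g y + conv k (\<lambda>r. tail \<mu> r * Res l g r) y)" .
      have "0 \<le> Res l g y + l * conv k (Res l g) y" "0 \<le> conv k g y + conv k (\<lambda>r. tail \<mu> r * Res l g r) y"
        using c1(2) c2(2) c3(2) RRe(2)[OF y] l by auto
      from ennreal_inj[THEN iffD1, OF this h]
      have "Res l g y + l * conv k (Res l g) y = conv k g y + conv k (\<lambda>r. tail \<mu> r * Res l g r) y" .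
      moreover have "conv k (\<lambda>r. 1 * (1 * g r + (- l) * Res l g r) + 1 * (tail \<mu> r * Res l g r)) y =
         1 * conv k (\<lambda>r. 1 * g r + (- l) * Res l g r) y + 1 * conv k (\<lambda>r. tail \<mu> r * Res l g r) y"
        by (rule conv_linT[OF zBd tBd y(2)])
      moreover have "conv k (\<lambda>r. 1 * g r + (- l) * Res l g r) y = 1 * conv k g y + (- l) * conv k (Res l g) y"
        by (rule conv_linT[OF gBd RBd y(2)])
      ultimately show ?thesis by simp
    qed
    have "Res l g x = V (\<lambda>r. 1 * g r + (- l) * Res l g r) x"
    proof (rule V_unique[OF zBd bm _ eq x])
      show "\<bar>Res l g y\<bar> \<le> D * kap y" if "0 < y" "y \<le> T" for y using bd[OF that] by (simp add: D_def)
    qed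
    thus ?thesis by simp
  qed
qed

end

section \<open>Closure properties of the function space and Laplace transforms in time\<close>

lemma C_infty_comb:
  assumes "u \<in> C_infty T" "v \<in> C_infty T" shows "(\<lambda>x. a * u x + b * v x) \<in> C_infty T"
proof -
  have "((\<lambda>x. a * u x + b * v x) \<longlongrightarrow> a * 0 + b * 0) (at_right 0)"
    using assms by (intro tendsto_intros) (auto simp: C_infty_def)
  thus ?thesis using assms by (auto simp: C_infty_def intro!: continuous_intros)
qed

lemma C_infty_max:
  assumes "u \<in> C_infty T" shows "(\<lambda>x. max 0 (u x)) \<in> C_infty T"
proof -
  have "((\<lambda>x. max 0 (u x)) \<longlongrightarrow> max 0 0) (at_right 0)"
    using assms by (intro tendsto_intros) (auto simp: C_infty_def)
  thus ?thesis using assms by (auto simp: C_infty_def intro!: continuous_intros)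
qed

lemma C_infty_sum:
  "finite I \<Longrightarrow> (\<And>i. i \<in> I \<Longrightarrow> u i \<in> C_infty T) \<Longrightarrow> (\<lambda>x. \<Sum>i\<in>I. c i * u i x) \<in> C_infty T"
proof (induction I rule: finite_induct)
  case empty
  show ?case by (simp add: C_infty_def)
next
  case (insert i I)
  have "(\<lambda>x. c i * u i x + 1 * (\<Sum>i\<in>I. c i * u i x)) \<in> C_infty T"
    using insert by (intro C_infty_comb) auto
  thus ?case using insert by simp
qed

lemma C_infty_uniform_limit:
  assumes T: "T > 0" and ap: "\<And>e. e > 0 \<Longrightarrow> \<exists>u\<in>C_infty T. \<forall>x. 0 < x \<longrightarrow> x \<le> T \<longrightarrow> \<bar>f x - u x\<bar> \<le> e"
  shows "zext T f \<in> C_infty T"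
  unfolding C_infty_iff[OF T]
proof (intro conjI allI impI)
  show "continuous_on {..T} (zext T f)"
    unfolding continuous_on_iff
  proof (intro ballI allI impI)
    fix x e assume x: "x \<in> {..T}" and e: "(0::real) < e"
    obtain u where u: "u \<in> C_infty T" "\<And>x. 0 < x \<Longrightarrow> x \<le> T \<Longrightarrow> \<bar>f x - u x\<bar> \<le> e/3" using ap[of "e/3"] e by auto
    have d: "\<bar>zext T f y - u y\<bar> \<le> e/3" for y using u e by (auto simp: zext_def C_infty_def)
    have "continuous_on {..T} u" using u(1) C_infty_iff[OF T] by blast
    then obtain dd where dd: "dd > 0" "\<And>x'. x' \<in> {..T} \<Longrightarrow> dist x' x < dd \<Longrightarrow> dist (u x') (u x) < e/3"
      unfolding continuous_on_iff using x e by (metis zero_less_divide_iff zero_less_numeral)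
    show "\<exists>d>0. \<forall>x'\<in>{..T}. dist x' x < d \<longrightarrow> dist (zext T f x') (zext T f x) < e"
    proof (intro exI[of _ dd] conjI ballI impI dd(1))
      fix x' assume "x' \<in> {..T}" "dist x' x < dd"
      hence "\<bar>u x' - u x\<bar> < e/3" using dd(2) by (simp add: dist_real_def)
      thus "dist (zext T f x') (zext T f x) < e" using d[of x] d[of x'] unfolding dist_real_def by linarith
    qed
  qed
qed (auto simp: zext_def)

lemma exp_integrable:
  assumes l: "l > (0::real)" and [measurable]: "u \<in> borel_measurable borel" and b: "\<And>s. s \<ge> 0 \<Longrightarrow> \<bar>u s\<bar> \<le> B"
  shows "set_integrable lborel {0..} (\<lambda>s. exp (-(l * s)) * u s)"
  unfolding set_integrable_def
proof (rule Bochner_Integration.integrable_bound)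
  show "integrable lborel (\<lambda>t. B * (indicator {0..} t * exp (-(l * t))))"
    using integrable_exp_half(1)[OF l] by (intro integrable_mult_right) (simp add: set_integrable_def)
  show "AE s in lborel. norm (indicator {0..} s *\<^sub>R (exp (-(l * s)) * u s)) \<le> norm (B * (indicator {0..} s * exp (-(l * s))))"
  proof (rule AE_I2)
    fix s :: real
    show "norm (indicator {0..} s *\<^sub>R (exp (-(l * s)) * u s)) \<le> norm (B * (indicator {0..} s * exp (-(l * s))))"
    proof (cases "s \<ge> 0")
      case True
      have "exp (-(l * s)) * \<bar>u s\<bar> \<le> exp (-(l * s)) * \<bar>B\<bar>" using b[OF True] by (intro mult_left_mono) auto
      thus ?thesis using True by (simp add: abs_mult mult.commute)
    qed simp
  qed
qed measurable

lemma exp_minus_mult_le_1: "exp (-s) * s \<le> (1::real)"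
proof -
  have "s \<le> exp s" using exp_ge_add_one_self[of s] by linarith
  hence "exp (-s) * s \<le> exp (-s) * exp s" by (intro mult_left_mono) auto
  moreover have "exp (-s) * exp s = 1" by (simp add: exp_minus)
  ultimately show ?thesis by linarith
qed

lemma laplace_primitive:
  assumes l: "l > (0::real)" and [measurable]: "u \<in> borel_measurable borel" and b: "\<And>s. s \<ge> 0 \<Longrightarrow> \<bar>u s\<bar> \<le> B"
  shows "(LBINT t:{0..}. exp (-(l * t)) * (LBINT s:{0..t}. u s)) = (LBINT s:{0..}. exp (-(l * s)) * u s) / l"
proof -
  have B: "B \<ge> 0" using b[of 0] by simp
  have tail: "(\<integral>\<^sup>+t. eexp l t * indicator {s..} t \<partial>lborel) = ennreal (exp (-(l * s)) / l)" for s
  proof -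
    have "(\<integral>\<^sup>+t. eexp l t * indicator {s..} t \<partial>lborel) = ennreal (0 - (- exp (-(l * s)) / l))"
    proof (rule nn_integral_FTC_atLeast)
      have "((\<lambda>x. exp (- (l * x))) \<longlongrightarrow> 0) at_top"
        by (rule filterlim_compose[OF exp_at_bot])
           (simp add: filterlim_uminus_at_bot filterlim_tendsto_pos_mult_at_top[OF tendsto_const l filterlim_ident])
      from tendsto_divide[OF tendsto_minus[OF this] tendsto_const, of l]
      show "((\<lambda>x. - exp (- (l * x)) / l) \<longlongrightarrow> 0) at_top" using l by simp
    qed (use l in \<open>auto intro!: derivative_eq_intros\<close>)
    thus ?thesis by simp
  qed
  have tail_int: "(\<integral>t. indicator {s..} t * exp (-(l * t)) \<partial>lborel) = exp (-(l * s)) / l" for s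
  proof -
    have "(\<integral>\<^sup>+t. ennreal (indicator {s..} t * exp (-(l * t))) \<partial>lborel) = ennreal (exp (-(l * s)) / l)"
      using tail[of s] by (simp add: ennreal_mult' ennreal_indicator mult.commute)
    thus ?thesis using l by (subst integral_eq_nn_integral) auto
  qed
  define K where "K s t = indicator {0..} s * u s * (indicator {s..} t * exp (-(l * t)))" for s t
  have Km: "case_prod K \<in> borel_measurable (lborel \<Otimes>\<^sub>M lborel)"
  proof -
    have "case_prod K = (\<lambda>z. indicator {0..} (fst z) * u (fst z) * ((if fst z \<le> snd z then 1 else 0) * exp (-(l * snd z))))"
      by (auto simp: K_def fun_eq_iff indicator_def)
    thus ?thesis by simp
  qed
  have int: "integrable (lborel \<Otimes>\<^sub>M lborel) (case_prod K)"
  proof (rule integrableI_bounded[OF Km])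
    have "(\<integral>\<^sup>+z. ennreal (norm (case_prod K z)) \<partial>(lborel \<Otimes>\<^sub>M lborel)) = (\<integral>\<^sup>+s. (\<integral>\<^sup>+t. ennreal (norm (K s t)) \<partial>lborel) \<partial>lborel)"
      using Km by (subst lborel.nn_integral_fst[symmetric]) auto
    also have "\<dots> \<le> (\<integral>\<^sup>+s. ennreal (B / l) * ennreal (indicator {0..} s * exp (-(l * s))) \<partial>lborel)"
    proof (rule nn_integral_mono)
      fix s :: real
      show "(\<integral>\<^sup>+t. ennreal (norm (K s t)) \<partial>lborel) \<le> ennreal (B / l) * ennreal (indicator {0..} s * exp (-(l * s)))"
      proof (cases "s \<ge> 0")
        case True
        have "(\<integral>\<^sup>+t. ennreal (norm (K s t)) \<partial>lborel) \<le> (\<integral>\<^sup>+t. ennreal B * (eexp l t * indicator {s..} t) \<partial>lborel)"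
          using b[OF True] B by (intro nn_integral_mono) (auto simp: K_def indicator_def abs_mult ennreal_mult[symmetric] intro!: ennreal_leI mult_right_mono)
        also have "\<dots> = ennreal B * ennreal (exp (-(l * s)) / l)" using tail[of s] by (subst nn_integral_cmult) auto
        also have "\<dots> = ennreal (B / l) * ennreal (indicator {0..} s * exp (-(l * s)))"
          using True B l by (simp add: ennreal_mult[symmetric])
        finally show ?thesis .
      qed (simp add: K_def)
    qed
    also have "\<dots> < \<infinity>"
      using integrable_exp_half(1)[OF l] by (subst nn_integral_cmult) (auto simp: set_integrable_def integrable_iff_bounded ennreal_mult_less_top)
    finally show "(\<integral>\<^sup>+z. ennreal (norm (case_prod K z)) \<partial>(lborel \<Otimes>\<^sub>M lborel)) < \<infinity>" .
  qed
  have "(LBINT t:{0..}. exp (-(l * t)) * (LBINT s:{0..t}. u s)) = (\<integral>t. (\<integral>s. K s t \<partial>lborel) \<partial>lborel)"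
    unfolding set_lebesgue_integral_def
  proof (rule Bochner_Integration.integral_cong)
    fix t :: real
    have "(\<integral>s. K s t \<partial>lborel) = (\<integral>s. exp (-(l * t)) * (indicator {0..t} s * u s) \<partial>lborel)"
      by (intro Bochner_Integration.integral_cong) (auto simp: K_def indicator_def)
    also have "\<dots> = exp (-(l * t)) * (\<integral>s. indicator {0..t} s * u s \<partial>lborel)" by simp
    also have "\<dots> = indicator {0..} t *\<^sub>R (exp (-(l * t)) * (\<integral>s. indicator {0..t} s *\<^sub>R u s \<partial>lborel))"
    proof (cases "t \<ge> 0")
      case False
      hence "(\<lambda>s. indicator {0..t} s * u s) = (\<lambda>_. 0)" by (auto simp: indicator_def)
      thus ?thesis using False by simp
    qed simp
    finally show "indicator {0..} t *\<^sub>R (exp (-(l * t)) * (\<integral>s. indicator {0..t} s *\<^sub>R u s \<partial>lborel)) = (\<integral>s. K s t \<partial>lborel)" by simp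
  qed simp
  also have "\<dots> = (\<integral>s. (\<integral>t. K s t \<partial>lborel) \<partial>lborel)"
    by (rule lborel_pair.Fubini_integral[OF int])
  also have "\<dots> = (\<integral>s. (indicator {0..} s * (exp (-(l * s)) * u s)) / l \<partial>lborel)"
    by (intro Bochner_Integration.integral_cong) (auto simp: K_def tail_int)
  also have "\<dots> = (LBINT s:{0..}. exp (-(l * s)) * u s) / l"
    by (simp add: set_lebesgue_integral_def)
  finally show ?thesis .
qed

section \<open>The resolvent as an operator on the function space\<close>

context censored_process
begin

lemma V_cong:
  assumes h: "bmeas_le h C" and g: "bmeas_le g D" and e: "\<And>y. 0 < y \<Longrightarrow> y \<le> T \<Longrightarrow> h y = g y" and x: "0 < x" "x \<le> T"
  shows "V h x = V g x"
proof (rule V_unique[OF g V_bmeas[OF h] _ _ x])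
  show "\<bar>V h y\<bar> \<le> C / (1 - rho) * kap y" if "0 < y" "y \<le> T" for y by (rule V_bound[OF h that])
  show "V h y = conv k (\<lambda>r. g r + tail \<mu> r * V h r) y" if y: "0 < y" "y \<le> T" for y
    unfolding V_eq[OF h y, symmetric, THEN sym] by (rule conv_cong) (use e y in auto)
qed

lemma bmeas_le_cong: "bmeas_le h C \<Longrightarrow> (\<And>y. 0 < y \<Longrightarrow> y \<le> T \<Longrightarrow> g y = h y) \<Longrightarrow> bmeas_le g C"
  unfolding bmeas_le_def using bmeas_cong[of h g] by auto

text \<open>The identity is linear in \<phi>, so it passes from the positive and negative parts,
  which are again in \<open>C_infty\<close>, to \<phi> itself.\<close>

lemma Res_eq:
  assumes \<phi>: "\<phi> \<in> C_infty T" and l: "l > 0"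
  shows "\<exists>D. bmeas_le (Res l \<phi>) D" "\<And>x. 0 < x \<Longrightarrow> x \<le> T \<Longrightarrow> Res l \<phi> x = V (\<lambda>r. \<phi> r - l * Res l \<phi> r) x"
proof -
  obtain C where C: "\<And>y. \<bar>\<phi> y\<bar> \<le> C" "C \<ge> 0" using C_infty_bounded[OF T \<phi>] by blast
  define p where "p y = max 0 (\<phi> y)" for y
  define n where "n y = max 0 (- \<phi> y)" for y
  have p: "p \<in> C_infty T" unfolding p_def[abs_def] by (rule C_infty_max[OF \<phi>])
  have n: "n \<in> C_infty T"
    using C_infty_max[OF C_infty_comb[OF \<phi> \<phi>, of "-1" 0]] by (simp add: n_def[abs_def])
  have pb: "0 \<le> p y" "p y \<le> C" "\<bar>p y\<bar> \<le> C" and nb: "0 \<le> n y" "n y \<le> C" "\<bar>n y\<bar> \<le> C" for y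
    using C(1)[of y] C(2) by (auto simp: p_def n_def)
  have pn: "\<phi> = (\<lambda>y. 1 * p y + (-1) * n y)" by (auto simp: p_def n_def max_def)
  note P = Res_nonneg_eq[OF p pb(1,2) l] and N = Res_nonneg_eq[OF n nb(1,2) l]
  define D where "D = C / (1 - rho) * kap T"
  have PBd: "bmeas_le (Res l p) D" and NBd: "bmeas_le (Res l n) D"
  proof -
    have k: "C / (1 - rho) * kap y \<le> D" if "y \<le> T" for y
      unfolding D_def using C(2) rho kap_mono[OF that] by (intro mult_left_mono) auto
    show "bmeas_le (Res l p) D" unfolding bmeas_le_def using P(1,2) k by (auto simp: abs_of_nonneg intro: order_trans)
    show "bmeas_le (Res l n) D" unfolding bmeas_le_def using N(1,2) k by (auto simp: abs_of_nonneg intro: order_trans)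
  qed
  have R: "Res l \<phi> x = 1 * Res l p x + (-1) * Res l n x" if "x \<ge> 0" for x
    using Res_lin[OF C_infty_measurable[OF T p] pb(3) C_infty_measurable[OF T n] nb(3) that l, of 1 "-1"]
    unfolding pn[symmetric] by simp
  have RBd: "bmeas_le (Res l \<phi>) (\<bar>1\<bar> * D + \<bar>-1\<bar> * D)" by (rule bmeas_le_cong[OF bmeas_le_comb[OF PBd NBd]]) (use R in auto)
  thus "\<exists>D. bmeas_le (Res l \<phi>) D" by blast
  fix x assume x: "0 < x" "x \<le> T"
  have zp: "bmeas_le (\<lambda>r. 1 * p r + (- l) * Res l p r) (\<bar>1\<bar> * C + \<bar>- l\<bar> * D)" by (rule bmeas_le_comb[OF C_infty_bmeas_le[OF p pb(3)] PBd])
  have zn: "bmeas_le (\<lambda>r. 1 * n r + (- l) * Res l n r) (\<bar>1\<bar> * C + \<bar>- l\<bar> * D)" by (rule bmeas_le_comb[OF C_infty_bmeas_le[OF n nb(3)] NBd])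
  have z: "bmeas_le (\<lambda>r. 1 * \<phi> r + (- l) * Res l \<phi> r) (\<bar>1\<bar> * C + \<bar>- l\<bar> * (\<bar>1\<bar> * D + \<bar>-1\<bar> * D))" by (rule bmeas_le_comb[OF C_infty_bmeas_le[OF \<phi> C(1)] RBd])
  have "Res l \<phi> x = 1 * V (\<lambda>r. 1 * p r + (- l) * Res l p r) x + (-1) * V (\<lambda>r. 1 * n r + (- l) * Res l n r) x"
    using R[of x] P(3)[OF x] N(3)[OF x] x by simp
  also have "\<dots> = V (\<lambda>r. 1 * (1 * p r + (- l) * Res l p r) + (-1) * (1 * n r + (- l) * Res l n r)) x"
    by (rule V_lin[OF zp zn x, symmetric])
  also have "\<dots> = V (\<lambda>r. 1 * \<phi> r + (- l) * Res l \<phi> r) x"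
  proof (rule V_cong[OF bmeas_le_comb[OF zp zn] z _ x])
    fix y assume y: "0 < y" "y \<le> T"
    have r: "Res l \<phi> y = Res l p y - Res l n y" using R[of y] y by simp
    have q: "\<phi> y = p y - n y" using fun_cong[OF pn, of y] by simp
    show "1 * (1 * p y + (- l) * Res l p y) + (-1) * (1 * n y + (- l) * Res l n y) = 1 * \<phi> y + (- l) * Res l \<phi> y"
      unfolding r q by (simp add: algebra_simps)
  qed
  finally show "Res l \<phi> x = V (\<lambda>r. \<phi> r - l * Res l \<phi> r) x" by simp
qed

definition Res_z :: "real \<Rightarrow> (real \<Rightarrow> real) \<Rightarrow> real \<Rightarrow> real" where "Res_z l \<phi> = zext T (Res l \<phi>)"
definition V_z :: "(real \<Rightarrow> real) \<Rightarrow> real \<Rightarrow> real" where "V_z h = zext T (V h)"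

lemma Res_z_in: "0 < x \<Longrightarrow> x \<le> T \<Longrightarrow> Res_z l \<phi> x = Res l \<phi> x" and V_z_in: "0 < x \<Longrightarrow> x \<le> T \<Longrightarrow> V_z h x = V h x"
  by (simp_all add: Res_z_def V_z_def zext_def)

lemma V_z_C_infty: "h \<in> C_infty T \<Longrightarrow> V_z h \<in> C_infty T"
  unfolding V_z_def using V_C_infty C_infty_ex_bmeas_le by metis

lemma Res_z_V_z:
  assumes \<phi>: "\<phi> \<in> C_infty T" and l: "l > 0"
  shows "Res_z l \<phi> \<in> C_infty T" "Res_z l \<phi> = V_z (\<lambda>r. \<phi> r - l * Res_z l \<phi> r)"
proof -
  obtain C where C: "bmeas_le \<phi> C" using C_infty_ex_bmeas_le[OF \<phi>] by blast
  obtain D where D: "bmeas_le (Res l \<phi>) D" using Res_eq(1)[OF \<phi> l] by blast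
  have z: "bmeas_le (\<lambda>r. 1 * \<phi> r + (- l) * Res l \<phi> r) (\<bar>1\<bar> * C + \<bar>- l\<bar> * D)" by (rule bmeas_le_comb[OF C D])
  have z': "bmeas_le (\<lambda>r. \<phi> r - l * Res_z l \<phi> r) (\<bar>1\<bar> * C + \<bar>- l\<bar> * D)" by (rule bmeas_le_cong[OF z]) (simp add: Res_z_in)
  show 1: "Res_z l \<phi> = V_z (\<lambda>r. \<phi> r - l * Res_z l \<phi> r)"
  proof
    fix x show "Res_z l \<phi> x = V_z (\<lambda>r. \<phi> r - l * Res_z l \<phi> r) x"
    proof (cases "0 < x \<and> x \<le> T")
      case True
      have "Res l \<phi> x = V (\<lambda>r. 1 * \<phi> r + (- l) * Res l \<phi> r) x" using Res_eq(2)[OF \<phi> l, of x] True by simp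
      also have "\<dots> = V (\<lambda>r. \<phi> r - l * Res_z l \<phi> r) x" by (rule V_cong[OF z z']) (use True Res_z_in in auto)
      finally show ?thesis using True by (simp add: Res_z_in V_z_in)
    qed (auto simp: Res_z_def V_z_def zext_def)
  qed
  have "V_z (\<lambda>r. \<phi> r - l * Res_z l \<phi> r) \<in> C_infty T" unfolding V_z_def by (rule V_C_infty[OF z'])
  thus "Res_z l \<phi> \<in> C_infty T" using 1 by simp
qed

lemma V_z_lin:
  assumes "g \<in> C_infty T" "h \<in> C_infty T"
  shows "V_z (\<lambda>r. a * g r + b * h r) = (\<lambda>x. a * V_z g x + b * V_z h x)"
proof -
  obtain C D where "bmeas_le g C" "bmeas_le h D" using C_infty_ex_bmeas_le assms by metis
  thus ?thesis using V_lin by (auto simp: V_z_def zext_def fun_eq_iff)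
qed

text \<open>Injectivity of 1 - cV for every real c. All algebraic identities between resolvents are
  derived from it, by checking that both sides solve the same equation.\<close>

lemma V_z_eigen:
  assumes w: "w \<in> C_infty T" "w = (\<lambda>x. c * V_z w x)" shows "w = (\<lambda>_. 0)"
proof
  fix x
  obtain C where C: "bmeas_le w C" using C_infty_ex_bmeas_le[OF w(1)] by blast
  show "w x = 0"
  proof (cases "0 < x \<and> x \<le> T")
    case True
    show ?thesis
    proof (rule V_quasinilpotent[OF C])
      fix y assume y: "0 < y" "y \<le> T"
      show "w y = c * V w y" using fun_cong[OF w(2), of y] y by (simp only: V_z_in)
    qed (use True in auto)
  next
    case False thus ?thesis using w(1) by (auto simp: C_infty_def)
  qed
qed

text \<open>Both sides solve a = V(V h) - l V a, so their difference w satisfies w = - l V w and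
  vanishes.\<close>

lemma Res_z_V_z_commute:
  assumes h: "h \<in> C_infty T" and l: "l > 0"
  shows "Res_z l (V_z h) = V_z (Res_z l h)"
proof -
  define a where "a = Res_z l (V_z h)"
  define b where "b = V_z (Res_z l h)"
  have Vh: "V_z h \<in> C_infty T" by (rule V_z_C_infty[OF h])
  have Rh: "Res_z l h \<in> C_infty T" by (rule Res_z_V_z(1)[OF h l])
  have aC: "a \<in> C_infty T" unfolding a_def by (rule Res_z_V_z(1)[OF Vh l])
  have bC: "b \<in> C_infty T" unfolding b_def by (rule V_z_C_infty[OF Rh])
  have a: "a = (\<lambda>x. 1 * V_z (V_z h) x + (- l) * V_z a x)"
    using Res_z_V_z(2)[OF Vh l] V_z_lin[OF Vh aC, of 1 "- l"] by (simp add: a_def)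
  have R: "Res_z l h = (\<lambda>x. 1 * V_z h x + (- l) * V_z (Res_z l h) x)"
    using Res_z_V_z(2)[OF h l] V_z_lin[OF h Rh, of 1 "- l"] by simp
  have b: "b = (\<lambda>x. 1 * V_z (V_z h) x + (- l) * V_z b x)"
  proof -
    have "b = V_z (\<lambda>x. 1 * V_z h x + (- l) * b x)" unfolding b_def by (rule arg_cong[OF R])
    thus ?thesis using V_z_lin[OF Vh bC, of 1 "- l"] by simp
  qed
  define w where "w x = 1 * a x + (-1) * b x" for x
  have wC: "w \<in> C_infty T" unfolding w_def[abs_def] by (rule C_infty_comb[OF aC bC])
  have Vw: "V_z w = (\<lambda>x. 1 * V_z a x + (-1) * V_z b x)" unfolding w_def[abs_def] by (rule V_z_lin[OF aC bC])
  have "w = (\<lambda>x. (- l) * V_z w x)"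
  proof
    fix x show "w x = (- l) * V_z w x"
      using fun_cong[OF a, of x] fun_cong[OF b, of x] unfolding Vw by (simp add: w_def algebra_simps)
  qed
  hence w0: "w = (\<lambda>_. 0)" by (rule V_z_eigen[OF wC])
  have "a = b"
  proof
    fix x show "a x = b x" using fun_cong[OF w0, of x] by (simp add: w_def)
  qed
  thus ?thesis unfolding a_def b_def .
qed

section \<open>Regularity in time and invariance of the function space\<close>

lemma P_Z_right_cont:
  assumes \<phi>: "\<phi> \<in> C_infty T" and x: "0 < x" "x \<le> T" and t: "t \<ge> 0"
  shows "continuous (at_right t) (\<lambda>s. P_Z s \<phi> x)"
proof -
  obtain C where C: "\<And>y. \<bar>\<phi> y\<bar> \<le> C" using C_infty_bounded[OF T \<phi>] by blast
  have x0: "x \<ge> 0" using x by simp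
  have [measurable]: "\<phi> \<in> borel_measurable borel" by (rule C_infty_measurable[OF T \<phi>])
  have cont: "continuous_on {..T} \<phi>" using \<phi> C_infty_iff[OF T] by blast
  have "((\<lambda>s. P_Z s \<phi> x) \<longlongrightarrow> P_Z t \<phi> x) (at_right t)"
  proof (rule tendsto_at_right_sequentially[of t "t + 1"])
    fix u assume u: "\<And>n::nat. t < u n" "\<And>n. u n < t + 1" "decseq u" "u \<longlonglongrightarrow> t"
    have u0: "u n \<ge> 0" for n using u(1)[of n] t by simp
    note [measurable] = Z_rv_measurable[OF x0 u0] Z_rv_measurable[OF x0 t]
    show "(\<lambda>n. P_Z (u n) \<phi> x) \<longlonglongrightarrow> P_Z t \<phi> x"
      unfolding P_Z_def
    proof (rule integral_dominated_convergence[where w="\<lambda>_. C"])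
      show "AE w in M. (\<lambda>n. \<phi> (Z_rv x (u n) w)) \<longlonglongrightarrow> \<phi> (Z_rv x t w)"
      proof (rule AE_I2)
        fix w assume w: "w \<in> space M"
        have "((\<lambda>s. Z_rv x s w) \<longlongrightarrow> Z_rv x t w) (at_right t)"
          using Z_rv_right_cont[OF w x0 t] by (simp add: continuous_within)
        moreover have "filterlim u (at_right t) sequentially"
          unfolding filterlim_at using u(4) u(1) by (auto intro!: always_eventually)
        ultimately have "(\<lambda>n. Z_rv x (u n) w) \<longlonglongrightarrow> Z_rv x t w" by (rule filterlim_compose)
        moreover have "\<forall>\<^sub>F n in sequentially. Z_rv x (u n) w \<in> {..T}"
          using Z_rv_bounds(2)[OF w x0 u0] x by (intro always_eventually) (auto intro: order_trans)
        moreover have "Z_rv x t w \<in> {..T}" using Z_rv_bounds(2)[OF w x0 t] x by auto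
        ultimately show "(\<lambda>n. \<phi> (Z_rv x (u n) w)) \<longlonglongrightarrow> \<phi> (Z_rv x t w)"
          by (intro continuous_on_tendsto_compose[OF cont])
      qed
    qed (use C in auto)
  qed simp
  thus ?thesis by (simp add: continuous_within)
qed

lemma P_Z_max_cont: "\<phi> \<in> C_infty T \<Longrightarrow> 0 < x \<Longrightarrow> x \<le> T \<Longrightarrow> t \<ge> 0 \<Longrightarrow> continuous (at_right t) (\<lambda>s. P_Z (max 0 s) \<phi> x)"
proof -
  assume a: "\<phi> \<in> C_infty T" "0 < x" "x \<le> T" and t: "t \<ge> 0"
  have "((\<lambda>s. P_Z s \<phi> x) \<longlongrightarrow> P_Z t \<phi> x) (at_right t)"
    using P_Z_right_cont[OF a t] by (simp add: continuous_within)
  moreover have "\<forall>\<^sub>F s in at_right t. P_Z s \<phi> x = P_Z (max 0 s) \<phi> x"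
    using eventually_at_right_less[of t] by eventually_elim (use t in \<open>simp add: max_absorb2\<close>)
  ultimately have "((\<lambda>s. P_Z (max 0 s) \<phi> x) \<longlongrightarrow> P_Z t \<phi> x) (at_right t)" by (rule Lim_transform_eventually)
  thus ?thesis using t by (simp add: continuous_within max_absorb2)
qed

lemma Res_max: "Res l \<phi> x = (LBINT t:{0..}. exp (-(l * t)) * P_Z (max 0 t) \<phi> x)"
  unfolding Res_def by (rule set_lebesgue_integral_cong) (auto simp: max_absorb2)

lemma indefinite_bound:
  assumes [measurable]: "u \<in> borel_measurable borel" and b: "\<And>s. \<bar>u s\<bar> \<le> C" and st: "0 \<le> s" "s \<le> (t::real)"
  shows "\<bar>(LBINT r:{0..t}. u r) - (LBINT r:{0..s}. u r)\<bar> \<le> C * (t - s)"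
proof -
  have C: "C \<ge> 0" using b[of 0] by simp
  have i: "integrable lborel (\<lambda>r. indicator {0..a} r * u r)" for a
  proof (rule Bochner_Integration.integrable_bound)
    show "integrable lborel (\<lambda>r. C * indicator {0..a} r :: real)"
      by (intro integrable_mult_right) (cases "a \<ge> 0", auto simp: integrable_indicator_iff)
    show "AE r in lborel. norm (indicator {0..a} r * u r) \<le> norm (C * indicator {0..a} r)"
      using b C by (intro AE_I2) (auto simp: indicator_def)
  qed measurable
  have "(LBINT r:{0..t}. u r) - (LBINT r:{0..s}. u r) = (\<integral>r. indicator {0..t} r * u r - indicator {0..s} r * u r \<partial>lborel)"
    using i by (simp add: set_lebesgue_integral_def)
  also have "\<bar>\<dots>\<bar> \<le> (\<integral>r. C * indicator {s..t} r \<partial>lborel)"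
  proof (rule integral_abs_bound[THEN order_trans], rule integral_mono)
    show "integrable lborel (\<lambda>r. \<bar>indicator {0..t} r * u r - indicator {0..s} r * u r\<bar>)"
      by (intro integrable_abs Bochner_Integration.integrable_diff i)
    show "integrable lborel (\<lambda>r. C * indicator {s..t} r :: real)"
      using st by (intro integrable_mult_right) (simp add: integrable_indicator_iff)
    show "\<bar>indicator {0..t} r * u r - indicator {0..s} r * u r\<bar> \<le> C * indicator {s..t} r" for r
      using b[of r] C st by (auto simp: indicator_def)
  qed
  also have "\<dots> = C * (t - s)" using st by simp
  finally show ?thesis .
qed

text \<open>At rate m the left side has the transform R_m V h = V R_m h = (V h - R_m h)/m, by
  commutation and R_m h = V(h - m R_m h). This is also the transform of the right side, and both
  sides are right continuous in t.\<close>

lemma P_Z_V_z: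
  assumes h: "h \<in> C_infty T" and x: "0 < x" "x \<le> T" and t: "t \<ge> 0"
  shows "P_Z t (V_z h) x = V_z h x - (LBINT s:{0..t}. P_Z (max 0 s) h x)"
proof -
  have Vh: "V_z h \<in> C_infty T" by (rule V_z_C_infty[OF h])
  have hm: "h \<in> borel_measurable borel" by (rule C_infty_measurable[OF T h])
  have Vm: "V_z h \<in> borel_measurable borel" by (rule C_infty_measurable[OF T Vh])
  obtain C where C: "\<And>y. \<bar>h y\<bar> \<le> C" "C \<ge> 0" using C_infty_bounded[OF T h] by blast
  obtain D where D: "\<And>y. \<bar>V_z h y\<bar> \<le> D" "D \<ge> 0" using C_infty_bounded[OF T Vh] by blast
  have x0: "x \<ge> 0" using x by simp
  define u where "u s = P_Z (max 0 s) h x" for s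
  have um[measurable]: "u \<in> borel_measurable borel" unfolding u_def[abs_def] by (rule P_Z_measurable[OF hm x0])
  have ub: "\<bar>u s\<bar> \<le> C" for s unfolding u_def by (rule P_Z_bound[OF hm C(1) x0]) simp
  define Q where "Q t = (LBINT s:{0..t}. u s)" for t
  have Qm[measurable]: "Q \<in> borel_measurable borel"
  proof -
    have "Q = (\<lambda>t. \<integral>s. (if 0 \<le> s \<and> s \<le> t then u s else 0) \<partial>lborel)"
      unfolding Q_def set_lebesgue_integral_def by (auto intro!: ext Bochner_Integration.integral_cong simp: indicator_def)
    also have "\<dots> \<in> borel_measurable borel"
      by (rule lborel.borel_measurable_lebesgue_integral) measurable
    finally show ?thesis .
  qed
  have Qlip: "\<bar>Q b - Q a\<bar> \<le> C * \<bar>b - a\<bar>" if "0 \<le> a" "0 \<le> b" for a b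
    using indefinite_bound[OF um ub, of a b] indefinite_bound[OF um ub, of b a] that unfolding Q_def
    by (cases "a \<le> b") (auto simp: abs_minus_commute)
  have Q0: "\<bar>Q a\<bar> \<le> C * a" if "0 \<le> a" for a
  proof -
    have "Q 0 = 0"
    proof -
      have "AE s in lborel. indicator {0..0} s *\<^sub>R u s = 0"
        using AE_lborel_singleton[of "0::real"] by eventually_elim auto
      thus ?thesis unfolding Q_def set_lebesgue_integral_def by (rule integral_eq_zero_AE)
    qed
    thus ?thesis using Qlip[of 0 a] that by simp
  qed
  \<comment> \<open>The integral over [0,s] may grow linearly, whereas uniqueness is available for
    bounded functions. Both sides are damped by exp(-s), which shifts the rate from l to m = l +
    1.\<close>
  define F where "F s = exp (-s) * P_Z (max 0 s) (V_z h) x" for s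
  define G where "G s = exp (-s) * (V_z h x - Q (max 0 s))" for s
  have "F t = G t"
  proof (rule laplace_unique_fun[where F=F and G=G and t=t and B="max D (D + C)"])
    have PVm[measurable]: "(\<lambda>s. P_Z (max 0 s) (V_z h) x) \<in> borel_measurable borel" by (rule P_Z_measurable[OF Vm x0])
    show "F \<in> borel_measurable borel" unfolding F_def by measurable
    show "G \<in> borel_measurable borel" unfolding G_def by measurable
    show "\<bar>F s\<bar> \<le> max D (D + C)" if "s \<ge> 0" for s
    proof -
      have "\<bar>F s\<bar> \<le> 1 * D" unfolding F_def abs_mult
        using that by (intro mult_mono P_Z_bound[OF Vm D(1) x0]) auto
      thus ?thesis by simp
    qed
    show "\<bar>G s\<bar> \<le> max D (D + C)" if "s \<ge> 0" for s
    proof -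
      have e1: "exp (-s) \<le> 1" using that by simp
      note e2 = exp_minus_mult_le_1[of s]
      have "\<bar>G s\<bar> = exp (-s) * \<bar>V_z h x - Q s\<bar>" using that by (simp add: G_def abs_mult max_absorb2)
      also have "\<dots> \<le> exp (-s) * (D + C * s)"
        using D(1)[of x] Q0[OF that] by (intro mult_left_mono) auto
      also have "\<dots> = exp (-s) * D + C * (exp (-s) * s)" by (simp add: algebra_simps)
      also have "\<dots> \<le> 1 * D + C * 1" using e1 e2 C D by (intro add_mono mult_mono mult_left_mono) auto
      finally show ?thesis by simp
    qed
    show "continuous (at_right t) F"
      unfolding F_def by (intro continuous_intros P_Z_max_cont[OF Vh x t])
    show "continuous (at_right t) G"
    proof -
      have "((\<lambda>s. Q (max 0 s)) \<longlongrightarrow> Q (max 0 t)) (at_right t)"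
      proof (rule LIM_zero_cancel, rule Lim_null_comparison)
        show "\<forall>\<^sub>F s in at_right t. norm (Q (max 0 s) - Q (max 0 t)) \<le> C * \<bar>s - t\<bar>"
          using eventually_at_right_less[of t] 
        proof eventually_elim
          case (elim s)
          thus ?case using Qlip[of t s] t by (simp add: max_absorb2)
        qed
        have "((\<lambda>s. C * \<bar>s - t\<bar>) \<longlongrightarrow> C * \<bar>t - t\<bar>) (at_right t)" by (intro tendsto_intros)
        thus "((\<lambda>s. C * \<bar>s - t\<bar>) \<longlongrightarrow> 0) (at_right t)" by simp
      qed
      hence "continuous (at_right t) (\<lambda>s. Q (max 0 s))" by (simp add: continuous_within)
      thus ?thesis unfolding G_def by (intro continuous_intros)
    qed
    fix l :: real assume l: "l > 0"
    define m where "m = l + 1"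
    have m: "m > 0" using l by (simp add: m_def)
    have mm: "exp (-(l * s)) * (exp (-s) * v) = exp (-(m * s)) * v" for s v
      by (simp add: m_def mult.assoc[symmetric] exp_add[symmetric] algebra_simps)
    have "(LBINT s:{0..}. exp (-(l * s)) * F s) = Res m (V_z h) x"
      unfolding F_def mm Res_max ..
    also have "\<dots> = V_z (Res_z m h) x" using fun_cong[OF Res_z_V_z_commute[OF h m], of x] x by (simp add: Res_z_in)
    also have "\<dots> = (V_z h x - Res m h x) / m"
    proof -
      have "Res_z m h = (\<lambda>x. 1 * V_z h x + (- m) * V_z (Res_z m h) x)"
        using Res_z_V_z(2)[OF h m] V_z_lin[OF h Res_z_V_z(1)[OF h m], of 1 "- m"] by simp
      from fun_cong[OF this, of x] have "Res m h x = V_z h x - m * V_z (Res_z m h) x" using x by (simp add: Res_z_in)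
      thus ?thesis using m by (simp add: field_simps)
    qed
    finally have L: "(LBINT s:{0..}. exp (-(l * s)) * F s) = (V_z h x - Res m h x) / m" .
    have iQ: "set_integrable lborel {0..} (\<lambda>s. exp (-(m * s)) * Q s)"
    proof -
      have "set_integrable lborel {0..} (\<lambda>s. exp (-(l * s)) * (exp (-s) * Q (max 0 s)))"
      proof (rule exp_integrable[OF l, where B=C])
        show "\<bar>exp (-s) * Q (max 0 s)\<bar> \<le> C" if "s \<ge> 0" for s
        proof -
          note e2 = exp_minus_mult_le_1[of s]
          have "\<bar>exp (-s) * Q (max 0 s)\<bar> \<le> exp (-s) * (C * s)" using Q0[OF that] that by (simp add: abs_mult max_absorb2)
          also have "\<dots> = C * (exp (-s) * s)" by simp
          also have "\<dots> \<le> C * 1" using e2 C by (intro mult_left_mono) auto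
          finally show ?thesis by simp
        qed
      qed measurable
      thus ?thesis unfolding mm
        by (rule set_integrable_cong[THEN iffD1, rotated 3]) (auto simp: max_absorb2)
    qed
    have "(LBINT s:{0..}. exp (-(l * s)) * G s) = (LBINT s:{0..}. V_z h x * exp (-(m * s)) - exp (-(m * s)) * Q s)"
      unfolding G_def mm by (rule set_lebesgue_integral_cong) (auto simp: max_absorb2 algebra_simps)
    also have "\<dots> = V_z h x * (1 / m) - (LBINT s:{0..}. exp (-(m * s)) * Q s)"
      using iQ integrable_exp_half[OF m] by (simp add: set_integral_diff set_integrable_mult_right)
    also have "(LBINT s:{0..}. exp (-(m * s)) * Q s) = (LBINT s:{0..}. exp (-(m * s)) * u s) / m"
      unfolding Q_def by (rule laplace_primitive[OF m um ub])
    also have "(LBINT s:{0..}. exp (-(m * s)) * u s) = Res m h x" unfolding Res_max u_def ..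
    finally show "(LBINT s:{0..}. exp (-(l * s)) * F s) = (LBINT s:{0..}. exp (-(l * s)) * G s)"
      unfolding L by (simp add: diff_divide_distrib)
  qed (rule t)
  thus ?thesis using t by (simp add: F_def G_def Q_def u_def max_absorb2)
qed

lemma P_Z_V_z_lipschitz:
  assumes h: "h \<in> C_infty T" "\<And>y. \<bar>h y\<bar> \<le> C" and x: "0 < x" "x \<le> T" and st: "0 \<le> s" "0 \<le> t"
  shows "\<bar>P_Z t (V_z h) x - P_Z s (V_z h) x\<bar> \<le> C * \<bar>t - s\<bar>"
proof -
  have x0: "x \<ge> 0" using x by simp
  have hm: "h \<in> borel_measurable borel" by (rule C_infty_measurable[OF T h(1)])
  have um: "(\<lambda>s. P_Z (max 0 s) h x) \<in> borel_measurable borel" by (rule P_Z_measurable[OF hm x0])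
  have ub: "\<bar>P_Z (max 0 s) h x\<bar> \<le> C" for s by (rule P_Z_bound[OF hm h(2) x0]) simp
  show ?thesis
    unfolding P_Z_V_z[OF h(1) x st(1)] P_Z_V_z[OF h(1) x st(2)]
    using indefinite_bound[OF um ub, of s t] indefinite_bound[OF um ub, of t s] st
    by (cases "s \<le> t") (auto simp: abs_minus_commute)
qed

lemma P_Z_lin:
  assumes "\<phi> \<in> C_infty T" "\<psi> \<in> C_infty T" "x \<ge> 0" "t \<ge> 0"
  shows "P_Z t (\<lambda>y. a * \<phi> y + b * \<psi> y) x = a * P_Z t \<phi> x + b * P_Z t \<psi> x"
proof -
  obtain C D where "\<And>y. \<bar>\<phi> y\<bar> \<le> C" "\<And>y. \<bar>\<psi> y\<bar> \<le> D" using C_infty_bounded[OF T] assms by metis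
  thus ?thesis
    using P_Z_integrable[OF C_infty_measurable[OF T assms(1)], of C x t] P_Z_integrable[OF C_infty_measurable[OF T assms(2)], of D x t] assms(3,4)
    unfolding P_Z_def by simp
qed

lemma P_Z_diff_bound:
  assumes "\<phi> \<in> C_infty T" "\<psi> \<in> C_infty T" "x \<ge> 0" "t \<ge> 0" "\<And>y. \<bar>\<phi> y - \<psi> y\<bar> \<le> e"
  shows "\<bar>P_Z t \<phi> x - P_Z t \<psi> x\<bar> \<le> e"
proof -
  have d: "(\<lambda>y. 1 * \<phi> y + (-1) * \<psi> y) \<in> C_infty T" by (rule C_infty_comb[OF assms(1,2)])
  have "\<bar>P_Z t (\<lambda>y. 1 * \<phi> y + (-1) * \<psi> y) x\<bar> \<le> e"
    by (rule P_Z_bound[OF C_infty_measurable[OF T d] _ assms(3,4)]) (use assms(5) in simp)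
  thus ?thesis using P_Z_lin[OF assms(1-4), of 1 "-1"] by simp
qed

text \<open>Up to an event of probability O(t), uniform in x, the first subordinator moves by at
  most d/2. Off this event either no passage has occurred and the process moved little, or x itself
  is small and \<phi> is small along the whole path. The error thus splits into e and K t.\<close>

lemma P_Z_near_identity:
  assumes \<phi>: "\<phi> \<in> C_infty T" and e: "e > 0"
  shows "\<exists>K\<ge>0. \<forall>t x. 0 \<le> t \<longrightarrow> 0 < x \<longrightarrow> x \<le> T \<longrightarrow> \<bar>P_Z t \<phi> x - \<phi> x\<bar> \<le> e + K * t"
proof -
  obtain C where C: "\<And>y. \<bar>\<phi> y\<bar> \<le> C" "C \<ge> 0" using C_infty_bounded[OF T \<phi>] by blast
  have \<phi>m[measurable]: "\<phi> \<in> borel_measurable borel" by (rule C_infty_measurable[OF T \<phi>])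
  have \<phi>0: "\<phi> 0 = 0" using \<phi> by (simp add: C_infty_def)
  have "continuous_on {0..T} \<phi>" using \<phi> C_infty_iff[OF T] continuous_on_subset[of "{..T}" \<phi> "{0..T}"] by auto
  hence "uniformly_continuous_on {0..T} \<phi>" by (rule compact_uniformly_continuous) simp
  then obtain d where d: "d > 0" "\<And>y z. y \<in> {0..T} \<Longrightarrow> z \<in> {0..T} \<Longrightarrow> dist z y < d \<Longrightarrow> dist (\<phi> z) (\<phi> y) < e / 2"
    unfolding uniformly_continuous_on_def using e by (metis half_gt_zero)
  \<comment> \<open>Twice the bound of \<phi> times the uniform estimate of \<open>itail\<close> at
    level d/2, which multiplied by t bounds the probability of a displacement beyond d/2.\<close>
  define K where "K = 2 * C * (f (1 / (d/2)) / (1 - exp (-1)))"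
  have K0: "K \<ge> 0" unfolding K_def using C f_nonneg[of "1 / (d/2)"] d by (intro mult_nonneg_nonneg divide_nonneg_nonneg) auto
  have main: "\<bar>P_Z t \<phi> x - \<phi> x\<bar> \<le> e + K * t" if t: "0 \<le> t" and x: "0 < x" "x \<le> T" for t x
  proof (cases "t = 0")
    case True
    have "\<phi> (Z_rv x 0 w) = \<phi> x" if w: "w \<in> space M" for w
    proof -
      have "path_seq w 1 0 = 0" using nice_S[OF w, of 1] by (simp add: nice_path_def)
      hence "Z_rv x 0 w = x" unfolding Z_rv_def using x
        by (subst Z_cens_start) (use nice_S[OF w] in auto)
      thus ?thesis by simp
    qed
    hence "P_Z 0 \<phi> x = (\<integral>w. \<phi> x \<partial>M)" unfolding P_Z_def by (intro Bochner_Integration.integral_cong) auto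
    thus ?thesis using True e by (simp add: prob_space)
  next
    case False
    hence t0: "t > 0" using t by simp
    have x0: "x \<ge> 0" using x by simp
    note [measurable] = X1.X_meas[OF t] Z_rv_measurable[OF x0 t]
    define B where "B = {w \<in> space M. d/2 < S (Suc 0) t w}"
    have Bm[measurable]: "B \<in> sets M" unfolding B_def by measurable
    have pw: "\<bar>\<phi> (Z_rv x t w) - \<phi> x\<bar> \<le> e + 2 * C * indicator B w" if w: "w \<in> space M" for w
    proof (cases "w \<in> B")
      case True
      thus ?thesis using C(1)[of "Z_rv x t w"] C(1)[of x] e by simp
    next
      case False
      hence s: "S (Suc 0) t w \<le> d/2" using w by (simp add: B_def)
      have s0: "0 \<le> S (Suc 0) t w" by (rule X1.X_nonneg[OF w t])
      have z: "0 \<le> Z_rv x t w" "Z_rv x t w \<le> x" using Z_rv_bounds[OF w x0 t] by auto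
      show ?thesis
      proof (cases "S (Suc 0) t w < x")
        case True
        have "Z_rv x t w = x - S (Suc 0) t w"
          unfolding Z_rv_def using Z_cens_start[of "path_seq w" x t] nice_S[OF w] x0 t True by (simp add: path_seq_def)
        hence "dist (Z_rv x t w) x < d" using s s0 d(1) by (simp add: dist_real_def)
        hence "dist (\<phi> (Z_rv x t w)) (\<phi> x) < e / 2" using z x by (intro d(2)) auto
        thus ?thesis using False e by (simp add: dist_real_def)
      next
        case False
        \<comment> \<open>Passage may have occurred, and the process can be anywhere in [0,x]; but
          this interval lies within d of 0, where \<phi> is within e/2 of \<phi>(0) = 0.\<close>
        hence xd: "x < d" using s d(1) by simp
        have "dist (\<phi> (Z_rv x t w)) (\<phi> 0) < e / 2" using z x xd by (intro d(2)) (auto simp: dist_real_def)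
        moreover have "dist (\<phi> x) (\<phi> 0) < e / 2" using x xd by (intro d(2)) (auto simp: dist_real_def)
        ultimately have "\<bar>\<phi> (Z_rv x t w) - \<phi> x\<bar> \<le> e" unfolding dist_real_def \<phi>0 by linarith
        thus ?thesis using C by (simp add: add_increasing2)
      qed
    qed
    have iB: "integrable M (indicator B :: _ \<Rightarrow> real)" by (rule integrable_real_indicator[OF Bm]) (simp add: emeasure_eq_measure)
    have i1: "integrable M (\<lambda>w. \<phi> (Z_rv x t w))" by (rule P_Z_integrable[OF \<phi>m C(1) x0 t])
    have "P_Z t \<phi> x - \<phi> x = (\<integral>w. \<phi> (Z_rv x t w) - \<phi> x \<partial>M)" unfolding P_Z_def using i1 by (simp add: prob_space)
    also have "\<bar>\<dots>\<bar> \<le> (\<integral>w. e + 2 * C * indicator B w \<partial>M)"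
    proof (rule integral_abs_bound[THEN order_trans], rule integral_mono)
      show "integrable M (\<lambda>w. \<bar>\<phi> (Z_rv x t w) - \<phi> x\<bar>)" using i1 by simp
      show "integrable M (\<lambda>w. e + 2 * C * indicator B w)" using iB by simp
    qed (rule pw)
    also have "\<dots> = e + 2 * C * measure M B" using iB by (simp add: prob_space)
    also have "measure M B = X1.itail t (d/2) * t" using t0 by (simp add: X1.itail_def B_def)
    also have "e + 2 * C * (X1.itail t (d/2) * t) \<le> e + 2 * C * (f (1 / (d/2)) / (1 - exp (-1)) * t)"
      using X1.itail_bound[OF t0, of "d/2"] d(1) C t by (intro add_left_mono mult_left_mono mult_right_mono) auto
    also have "\<dots> = e + K * t" by (simp add: K_def mult.assoc)
    finally show ?thesis .
  qed
  show ?thesis using K0 main by blast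
qed

text \<open>The approximant is $\lambda R_\lambda \phi = V(\lambda\phi - \lambda^2 R_\lambda\phi)$ for large $\lambda$.\<close>

lemma V_z_dense:
  assumes \<phi>: "\<phi> \<in> C_infty T" and e: "e > 0"
  shows "\<exists>h\<in>C_infty T. \<forall>x. \<bar>\<phi> x - V_z h x\<bar> \<le> e"
proof -
  obtain C where C: "\<And>y. \<bar>\<phi> y\<bar> \<le> C" "C \<ge> 0" using C_infty_bounded[OF T \<phi>] by blast
  have \<phi>m: "\<phi> \<in> borel_measurable borel" by (rule C_infty_measurable[OF T \<phi>])
  obtain K where K: "K \<ge> 0" "\<And>t x. 0 \<le> t \<Longrightarrow> 0 < x \<Longrightarrow> x \<le> T \<Longrightarrow> \<bar>P_Z t \<phi> x - \<phi> x\<bar> \<le> e/2 + K * t"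
    using P_Z_near_identity[OF \<phi>, of "e/2"] e by auto
  \<comment> \<open>Averaging e/2 + K t against the density l exp(-l t) gives e/2 + K/l, and this
    rate makes the second term at most e/2.\<close>
  define l where "l = 2 * (K + 1) / e"
  have l: "l > 0" using K e by (simp add: l_def)
  have K_res: "K / l \<le> e / 2"
  proof -
    have "K * 2 \<le> e * l" using e K unfolding l_def by simp
    thus ?thesis using l by (simp add: field_simps)
  qed
  define h where "h r = l * \<phi> r + (- l * l) * Res_z l \<phi> r" for r
  have Rc: "Res_z l \<phi> \<in> C_infty T" by (rule Res_z_V_z(1)[OF \<phi> l])
  have hC: "h \<in> C_infty T" unfolding h_def[abs_def] by (rule C_infty_comb[OF \<phi> Rc])
  have z: "(\<lambda>r. 1 * \<phi> r + (- l) * Res_z l \<phi> r) \<in> C_infty T" by (rule C_infty_comb[OF \<phi> Rc])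
  have Vh: "V_z h x = l * Res_z l \<phi> x" for x
  proof -
    have "h = (\<lambda>r. l * (1 * \<phi> r + (- l) * Res_z l \<phi> r) + 0 * (1 * \<phi> r + (- l) * Res_z l \<phi> r))"
      by (auto simp: h_def algebra_simps)
    hence "V_z h x = l * V_z (\<lambda>r. 1 * \<phi> r + (- l) * Res_z l \<phi> r) x" using fun_cong[OF V_z_lin[OF z z, of l 0], of x] by simp
    also have "V_z (\<lambda>r. 1 * \<phi> r + (- l) * Res_z l \<phi> r) x = Res_z l \<phi> x" using fun_cong[OF Res_z_V_z(2)[OF \<phi> l], of x] by simp
    finally show ?thesis .
  qed
  have i1: "set_integrable lborel {0..} (\<lambda>t. exp (-(l * t)))" "(LBINT t:{0..}. exp (-(l * t))) = 1 / l"
    using integrable_exp_half[OF l] by auto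
  have it: "set_integrable lborel {0..} (\<lambda>t. exp (-(l * t)) * t)" "(LBINT t:{0..}. exp (-(l * t)) * t) = 1 / l / l"
  proof -
    have e: "(LBINT s:{0..t}. 1) = t" if "t \<ge> 0" for t :: real using that by (simp add: set_lebesgue_integral_def)
    have "(LBINT t:{0..}. exp (-(l * t)) * t) = (LBINT t:{0..}. exp (-(l * t)) * (LBINT s:{0..t}. 1))"
      by (rule set_lebesgue_integral_cong) (use e in auto)
    also have "\<dots> = (LBINT s:{0..}. exp (-(l * s)) * 1) / l" by (rule laplace_primitive[OF l, where B=1]) auto
    finally show "(LBINT t:{0..}. exp (-(l * t)) * t) = 1 / l / l" using i1(2) by simp
    have l2: "l / 2 > 0" using l by simp
    have "set_integrable lborel {0..} (\<lambda>t. exp (-(l/2 * t)) * (exp (-(l/2 * t)) * t))"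
    proof (rule exp_integrable[OF l2, where B="2 / l"])
      fix s :: real assume s: "s \<ge> 0"
      have "exp (-(l/2 * s)) * (l/2 * s) \<le> 1" by (rule exp_minus_mult_le_1)
      hence "2 / l * (exp (-(l/2 * s)) * (l/2 * s)) \<le> 2 / l * 1" using l by (intro mult_left_mono) auto
      moreover have "2 / l * (exp (-(l/2 * s)) * (l/2 * s)) = exp (-(l/2 * s)) * s" using l by simp
      ultimately have "exp (-(l/2 * s)) * s \<le> 2 / l" by simp
      thus "\<bar>exp (-(l/2 * s)) * s\<bar> \<le> 2 / l" using s by simp
    qed measurable
    moreover have "exp (-(l/2 * t)) * (exp (-(l/2 * t)) * t) = exp (-(l * t)) * t" for t
    proof -
      have "exp (-(l/2 * t)) * exp (-(l/2 * t)) = exp (-(l * t))" by (simp add: exp_add[symmetric])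
      thus ?thesis by (simp only: mult.assoc[symmetric])
    qed
    ultimately show "set_integrable lborel {0..} (\<lambda>t. exp (-(l * t)) * t)" by (simp only:)
  qed
  have main: "\<bar>\<phi> x - V_z h x\<bar> \<le> e" if x: "0 < x" "x \<le> T" for x
  proof -
    have x0: "x \<ge> 0" using x by simp
    note ir = Res_integrable[OF \<phi>m C(1) x0 l]
    have eq: "Res l \<phi> x - \<phi> x / l = (LBINT t:{0..}. exp (-(l * t)) * P_Z t \<phi> x - \<phi> x * exp (-(l * t)))"
      unfolding Res_def using ir i1 by (simp add: set_integral_diff set_integrable_mult_right)
    have bd: "\<bar>Res l \<phi> x - \<phi> x / l\<bar> \<le> (LBINT t:{0..}. e / 2 * exp (-(l * t)) + K * (exp (-(l * t)) * t))"
      unfolding eq set_lebesgue_integral_def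
    proof (rule integral_abs_bound[THEN order_trans], rule integral_mono)
      show "integrable lborel (\<lambda>t. \<bar>indicator {0..} t *\<^sub>R (exp (-(l * t)) * P_Z t \<phi> x - \<phi> x * exp (-(l * t)))\<bar>)"
      proof (rule integrable_abs)
        have "set_integrable lborel {0..} (\<lambda>t. exp (-(l * t)) * P_Z t \<phi> x - \<phi> x * exp (-(l * t)))"
          by (rule set_integral_diff(1)[OF ir set_integrable_mult_right[OF i1(1)]])
        thus "integrable lborel (\<lambda>t. indicator {0..} t *\<^sub>R (exp (-(l * t)) * P_Z t \<phi> x - \<phi> x * exp (-(l * t))))"
          unfolding set_integrable_def .
      qed
      show "integrable lborel (\<lambda>t. indicator {0..} t *\<^sub>R (e / 2 * exp (-(l * t)) + K * (exp (-(l * t)) * t)))"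
        using set_integral_add(1)[OF set_integrable_mult_right[OF i1(1), of "e / 2"] set_integrable_mult_right[OF it(1), of K]]
        unfolding set_integrable_def .
      fix t :: real
      show "\<bar>indicator {0..} t *\<^sub>R (exp (-(l * t)) * P_Z t \<phi> x - \<phi> x * exp (-(l * t)))\<bar> \<le> indicator {0..} t *\<^sub>R (e / 2 * exp (-(l * t)) + K * (exp (-(l * t)) * t))"
      proof (cases "t \<ge> 0")
        case True
        have "exp (-(l * t)) * \<bar>P_Z t \<phi> x - \<phi> x\<bar> \<le> exp (-(l * t)) * (e / 2 + K * t)"
          using K(2)[OF True x] by (intro mult_left_mono) auto
        moreover have "\<bar>exp (-(l * t)) * P_Z t \<phi> x - \<phi> x * exp (-(l * t))\<bar> = exp (-(l * t)) * \<bar>P_Z t \<phi> x - \<phi> x\<bar>"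
        proof -
          have "exp (-(l * t)) * P_Z t \<phi> x - \<phi> x * exp (-(l * t)) = exp (-(l * t)) * (P_Z t \<phi> x - \<phi> x)" by (simp add: algebra_simps)
          thus ?thesis by (simp add: abs_mult)
        qed
        ultimately show ?thesis using True by (simp add: algebra_simps)
      qed simp
    qed
    have val: "(LBINT t:{0..}. e / 2 * exp (-(l * t)) + K * (exp (-(l * t)) * t)) = e / 2 * (1 / l) + K * (1 / l / l)"
      using set_integral_add(2)[OF set_integrable_mult_right[OF i1(1), of "e / 2"] set_integrable_mult_right[OF it(1), of K]]
      unfolding set_integral_mult_right i1(2) it(2) .
    have "l * \<bar>Res l \<phi> x - \<phi> x / l\<bar> \<le> l * (e / 2 * (1 / l) + K * (1 / l / l))"
      using l bd unfolding val by (intro mult_left_mono) auto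
    hence "\<bar>l * (Res l \<phi> x - \<phi> x / l)\<bar> \<le> e / 2 + K / l" using l by (simp add: abs_mult distrib_left)
    moreover have "l * (Res l \<phi> x - \<phi> x / l) = V_z h x - \<phi> x" using l x by (simp add: Vh Res_z_in right_diff_distrib)
    ultimately have "\<bar>V_z h x - \<phi> x\<bar> \<le> e / 2 + K / l" by (simp only:)
    thus ?thesis using K_res by linarith
  qed
  have "\<bar>\<phi> x - V_z h x\<bar> \<le> e" for x
  proof (cases "0 < x \<and> x \<le> T")
    case True thus ?thesis using main by blast
  next
    case False
    hence "\<phi> x = 0" "V_z h x = 0" using \<phi> by (auto simp: C_infty_def V_z_def zext_def)
    thus ?thesis using e by simp
  qed
  thus ?thesis using hC by blast
qed

text \<open>On the range of \<open>V\<close> the map t \<mapsto> P_t V h(x) is Lipschitz with a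
  constant independent of x. One choice of inversion coefficients therefore serves all x, and P_t V
  h is a uniform limit of combinations of resolvents.\<close>

lemma P_Z_Feller_range:
  assumes h: "h \<in> C_infty T" and t: "t \<ge> 0"
  shows "zext T (P_Z t (V_z h)) \<in> C_infty T"
proof (rule C_infty_uniform_limit[OF T])
  fix e :: real assume e: "e > 0"
  have Vh: "V_z h \<in> C_infty T" by (rule V_z_C_infty[OF h])
  have Vm: "V_z h \<in> borel_measurable borel" by (rule C_infty_measurable[OF T Vh])
  obtain C where C: "\<And>y. \<bar>h y\<bar> \<le> C" "C \<ge> 0" using C_infty_bounded[OF T h] by blast
  obtain D where D: "\<And>y. \<bar>V_z h y\<bar> \<le> D" "D \<ge> 0" using C_infty_bounded[OF T Vh] by blast
  define d where "d = e / 2 / (C + 1)"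
  have d: "d > 0" "C * d \<le> e / 2" using e C by (auto simp: d_def field_simps)
  have e2: "e / 2 > 0" using e by simp
  obtain c N where c: "\<And>F. F\<in>borel_measurable borel \<Longrightarrow> (\<forall>s\<ge>0. \<bar>F s\<bar> \<le> D) \<Longrightarrow> (\<forall>s\<in>{t..t+d}. \<bar>F s - F t\<bar> \<le> e / 2) \<Longrightarrow>
     \<bar>F t - (\<Sum>i\<le>(N::nat). c i * (LBINT s:{0..}. exp (-(real (Suc i) * s)) * F s))\<bar> \<le> 2 * (e / 2)"
    using laplace_inversion[OF t d(1) e2 D(2)] by blast
  define u where "u x = (\<Sum>i\<le>N. c i * Res_z (real (Suc i)) (V_z h) x)" for x
  have "u \<in> C_infty T" unfolding u_def[abs_def]
    by (rule C_infty_sum) (auto intro: Res_z_V_z(1)[OF Vh] simp del: of_nat_Suc)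
  moreover have "\<bar>P_Z t (V_z h) x - u x\<bar> \<le> e" if x: "0 < x" "x \<le> T" for x
  proof -
    have x0: "x \<ge> 0" using x by simp
    have "\<bar>P_Z (max 0 t) (V_z h) x - (\<Sum>i\<le>N. c i * (LBINT s:{0..}. exp (-(real (Suc i) * s)) * P_Z (max 0 s) (V_z h) x))\<bar> \<le> 2 * (e / 2)"
    proof (rule c)
      show "(\<lambda>s. P_Z (max 0 s) (V_z h) x) \<in> borel_measurable borel" by (rule P_Z_measurable[OF Vm x0])
      show "\<forall>s\<ge>0. \<bar>P_Z (max 0 s) (V_z h) x\<bar> \<le> D" using P_Z_bound[OF Vm D(1) x0] by simp
      show "\<forall>s\<in>{t..t + d}. \<bar>P_Z (max 0 s) (V_z h) x - P_Z (max 0 t) (V_z h) x\<bar> \<le> e / 2"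
      proof
        fix s assume s: "s \<in> {t..t+d}"
        have "\<bar>P_Z (max 0 s) (V_z h) x - P_Z (max 0 t) (V_z h) x\<bar> \<le> C * \<bar>max 0 s - max 0 t\<bar>"
          by (rule P_Z_V_z_lipschitz[OF h C(1) x]) auto
        also have "\<dots> \<le> C * d" using s t C by (intro mult_left_mono) (auto simp: max_absorb2)
        finally show "\<bar>P_Z (max 0 s) (V_z h) x - P_Z (max 0 t) (V_z h) x\<bar> \<le> e / 2" using d by simp
      qed
    qed
    thus ?thesis unfolding Res_max[symmetric] u_def using t x by (simp add: Res_z_in max_absorb2)
  qed
  ultimately show "\<exists>u\<in>C_infty T. \<forall>x. 0 < x \<longrightarrow> x \<le> T \<longrightarrow> \<bar>P_Z t (V_z h) x - u x\<bar> \<le> e" by blast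
qed

lemma P_Z_Feller:
  assumes \<phi>: "\<phi> \<in> C_infty T" and t: "t \<ge> 0"
  shows "zext T (P_Z t \<phi>) \<in> C_infty T"
proof (rule C_infty_uniform_limit[OF T])
  fix e :: real assume e: "e > 0"
  obtain h where h: "h \<in> C_infty T" "\<And>x. \<bar>\<phi> x - V_z h x\<bar> \<le> e" using V_z_dense[OF \<phi> e] by blast
  have "\<bar>P_Z t \<phi> x - zext T (P_Z t (V_z h)) x\<bar> \<le> e" if x: "0 < x" "x \<le> T" for x
    using P_Z_diff_bound[OF \<phi> V_z_C_infty[OF h(1)] _ t h(2), of x] x by (simp add: zext_def)
  thus "\<exists>u\<in>C_infty T. \<forall>x. 0 < x \<longrightarrow> x \<le> T \<longrightarrow> \<bar>P_Z t \<phi> x - u x\<bar> \<le> e"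
    using P_Z_Feller_range[OF h(1) t] by blast
qed

text \<open>Continuity in time uniform in x is what survives an application of P_s; pointwise right
  continuity in t would not pass through P_s in this form.\<close>

lemma P_Z_equicont:
  assumes \<phi>: "\<phi> \<in> C_infty T" and e: "e > 0"
  shows "\<exists>d>0. \<forall>s t x. 0 \<le> s \<longrightarrow> 0 \<le> t \<longrightarrow> \<bar>t - s\<bar> < d \<longrightarrow> 0 < x \<longrightarrow> x \<le> T \<longrightarrow> \<bar>P_Z t \<phi> x - P_Z s \<phi> x\<bar> \<le> e"
proof -
  have e3: "e / 3 > 0" using e by simp
  obtain h where h: "h \<in> C_infty T" "\<And>x. \<bar>\<phi> x - V_z h x\<bar> \<le> e/3" using V_z_dense[OF \<phi> e3] by blast
  obtain C where C: "\<And>y. \<bar>h y\<bar> \<le> C" "C \<ge> 0" using C_infty_bounded[OF T h(1)] by blast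
  define d where "d = e / 3 / (C + 1)"
  have d: "d > 0" "C * d \<le> e / 3" using e C by (auto simp: d_def field_simps)
  have "\<bar>P_Z t \<phi> x - P_Z s \<phi> x\<bar> \<le> e" if st: "0 \<le> s" "0 \<le> t" "\<bar>t - s\<bar> < d" and x: "0 < x" "x \<le> T" for s t x
  proof -
    have x0: "x \<ge> 0" using x by simp
    have "\<bar>P_Z t (V_z h) x - P_Z s (V_z h) x\<bar> \<le> C * \<bar>t - s\<bar>" by (rule P_Z_V_z_lipschitz[OF h(1) C(1) x st(1,2)])
    also have "\<dots> \<le> C * d" using C st by (intro mult_left_mono) auto
    finally show ?thesis
      using d P_Z_diff_bound[OF \<phi> V_z_C_infty[OF h(1)] x0 st(1) h(2)] P_Z_diff_bound[OF \<phi> V_z_C_infty[OF h(1)] x0 st(2) h(2)]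
      by linarith
  qed
  thus ?thesis using d(1) by blast
qed

end

section \<open>Semigroup and generator\<close>

lemma continuous_at_rightI:
  fixes H :: "real \<Rightarrow> real"
  assumes "\<And>e. e > 0 \<Longrightarrow> \<exists>d>0. \<forall>r. t < r \<longrightarrow> r < t + d \<longrightarrow> \<bar>H r - H t\<bar> \<le> e"
  shows "continuous (at_right t) H"
  unfolding continuous_within
proof (rule tendstoI)
  fix e :: real assume "e > 0"
  then obtain d where d: "d > 0" "\<And>r. t < r \<Longrightarrow> r < t + d \<Longrightarrow> \<bar>H r - H t\<bar> \<le> e / 2"
    using assms[of "e/2"] by auto
  have "\<forall>\<^sub>F r in at_right t. r \<in> {t<..<t + d}" by (rule eventually_at_right_real) (use d in simp)
  thus "\<forall>\<^sub>F r in at_right t. dist (H r) (H t) < e"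
  proof eventually_elim
    case (elim r)
    hence "\<bar>H r - H t\<bar> \<le> e / 2" using d(2) by simp
    thus ?case using \<open>e > 0\<close> by (simp add: dist_real_def)
  qed
qed

lemma sup_norm_abs_le:
  assumes T: "T > 0" and b: "\<And>x. 0 < x \<Longrightarrow> x \<le> T \<Longrightarrow> \<bar>u x\<bar> \<le> e"
  shows "\<bar>sup_norm T u\<bar> \<le> e"
proof -
  have bdd: "bdd_above ((\<lambda>x. \<bar>u x\<bar>) ` {0<..T})" using b by (auto intro!: bdd_aboveI2)
  have "\<bar>u T\<bar> \<le> sup_norm T u" unfolding sup_norm_def by (rule cSUP_upper[OF _ bdd]) (use T in auto)
  moreover have "sup_norm T u \<le> e" unfolding sup_norm_def by (rule cSUP_least) (use T b in auto)
  ultimately show ?thesis by linarith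
qed

lemma sup_norm_upper:
  assumes b: "\<And>x. 0 < x \<Longrightarrow> x \<le> T \<Longrightarrow> \<bar>u x\<bar> \<le> e" and x: "0 < x" "x \<le> T"
  shows "\<bar>u x\<bar> \<le> sup_norm T u"
proof -
  have bdd: "bdd_above ((\<lambda>x. \<bar>u x\<bar>) ` {0<..T})" using b by (auto intro!: bdd_aboveI2)
  show ?thesis unfolding sup_norm_def by (rule cSUP_upper[OF _ bdd]) (use x in auto)
qed

lemma sup_norm_tendsto_0I:
  fixes u :: "real \<Rightarrow> real \<Rightarrow> real"
  assumes T: "T > 0" and ev: "\<And>e. e > 0 \<Longrightarrow> \<exists>d>0. \<forall>t x. 0 < t \<longrightarrow> t < d \<longrightarrow> 0 < x \<longrightarrow> x \<le> T \<longrightarrow> \<bar>u t x\<bar> \<le> e"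
  shows "((\<lambda>t. sup_norm T (u t)) \<longlongrightarrow> 0) (at_right 0)"
proof (rule tendstoI)
  fix e :: real assume e: "e > 0"
  then obtain d where d: "d > 0" "\<And>t x. 0 < t \<Longrightarrow> t < d \<Longrightarrow> 0 < x \<Longrightarrow> x \<le> T \<Longrightarrow> \<bar>u t x\<bar> \<le> e / 2"
    using ev[of "e/2"] by auto
  have "\<forall>\<^sub>F t in at_right 0. t \<in> {0<..<d}" by (rule eventually_at_right_real[OF d(1)])
  thus "\<forall>\<^sub>F t in at_right 0. dist (sup_norm T (u t)) 0 < e"
  proof eventually_elim
    case (elim t)
    have "\<bar>sup_norm T (u t)\<bar> \<le> e / 2" by (rule sup_norm_abs_le[OF T]) (use d(2) elim in auto)
    thus ?case using e by (simp add: dist_real_def)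
  qed
qed

section \<open>The semigroup law from Hilbert's resolvent identity\<close>

context censored_process
begin

text \<open>Hilbert's identity. With m = l + b, both the iterated resolvent and the difference
  quotient of resolvents solve a = V R_b \<phi> - m V a, so \<open>V_z_eigen\<close> identifies
  them.\<close>

lemma Res_z_resolvent:
  assumes \<phi>: "\<phi> \<in> C_infty T" and b: "b > 0" and l: "l > 0"
  shows "l * Res_z (l + b) (Res_z b \<phi>) x = Res_z b \<phi> x - Res_z (l + b) \<phi> x"
proof -
  define m where "m = l + b"
  have m: "m > 0" using b l by (simp add: m_def)
  have Bc: "Res_z b \<phi> \<in> C_infty T" by (rule Res_z_V_z(1)[OF \<phi> b])
  have Mc: "Res_z m \<phi> \<in> C_infty T" by (rule Res_z_V_z(1)[OF \<phi> m])
  define a where "a = Res_z m (Res_z b \<phi>)"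
  have ac: "a \<in> C_infty T" unfolding a_def by (rule Res_z_V_z(1)[OF Bc m])
  define c where "c x = 1 / l * Res_z b \<phi> x + (- 1 / l) * Res_z m \<phi> x" for x
  have cc: "c \<in> C_infty T" unfolding c_def[abs_def] by (rule C_infty_comb[OF Bc Mc])
  have a: "a x = V_z (Res_z b \<phi>) x - m * V_z a x" for x
    using fun_cong[OF Res_z_V_z(2)[OF Bc m], of x] fun_cong[OF V_z_lin[OF Bc ac, of 1 "- m"], of x] by (simp add: a_def)
  have B: "Res_z b \<phi> x = V_z \<phi> x - b * V_z (Res_z b \<phi>) x" for x
    using fun_cong[OF Res_z_V_z(2)[OF \<phi> b], of x] fun_cong[OF V_z_lin[OF \<phi> Bc, of 1 "- b"], of x] by simp
  have Mm: "Res_z m \<phi> x = V_z \<phi> x - m * V_z (Res_z m \<phi>) x" for x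
    using fun_cong[OF Res_z_V_z(2)[OF \<phi> m], of x] fun_cong[OF V_z_lin[OF \<phi> Mc, of 1 "- m"], of x] by simp
  have Vc: "V_z c x = 1 / l * V_z (Res_z b \<phi>) x + (- 1 / l) * V_z (Res_z m \<phi>) x" for x
    using fun_cong[OF V_z_lin[OF Bc Mc, of "1 / l" "- 1 / l"], of x] unfolding c_def[abs_def] by simp
  have c: "c x = V_z (Res_z b \<phi>) x - m * V_z c x" for x
  proof -
    have "l * c x = Res_z b \<phi> x - Res_z m \<phi> x" using l by (simp add: c_def field_simps)
    also have "\<dots> = m * V_z (Res_z m \<phi>) x - b * V_z (Res_z b \<phi>) x" using B[of x] Mm[of x] by linarith
    also have "\<dots> = l * (V_z (Res_z b \<phi>) x - m * V_z c x)"
      using l by (simp add: Vc m_def field_simps)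
    finally show ?thesis using l by simp
  qed
  define w where "w x = 1 * a x + (-1) * c x" for x
  have wc: "w \<in> C_infty T" unfolding w_def[abs_def] by (rule C_infty_comb[OF ac cc])
  have "w = (\<lambda>x. (- m) * V_z w x)"
  proof
    fix x
    have Vw: "V_z w x = 1 * V_z a x + (-1) * V_z c x" using fun_cong[OF V_z_lin[OF ac cc, of 1 "-1"], of x] unfolding w_def[abs_def] by simp
    have wx: "w x = m * V_z c x - m * V_z a x" using a[of x] c[of x] by (simp add: w_def)
    show "w x = (- m) * V_z w x" unfolding wx Vw by (simp add: algebra_simps)
  qed
  hence "w = (\<lambda>_. 0)" by (rule V_z_eigen[OF wc])
  hence "w x = 0" by simp
  hence "a x = c x" by (simp add: w_def)
  thus ?thesis using l by (simp add: a_def c_def m_def field_simps)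
qed

lemma zext_P_Z_rc:
  assumes \<phi>: "\<phi> \<in> C_infty T" and t: "t \<ge> 0"
  shows "continuous (at_right t) (\<lambda>s. zext T (P_Z s \<phi>) z)"
proof (cases "0 < z \<and> z \<le> T")
  case True
  thus ?thesis using P_Z_right_cont[OF \<phi> _ _ t, of z] by (simp add: zext_def)
qed (auto simp: zext_def)

lemma zext_P_Z_bound: "\<phi> \<in> C_infty T \<Longrightarrow> (\<And>y. \<bar>\<phi> y\<bar> \<le> C) \<Longrightarrow> t \<ge> 0 \<Longrightarrow> \<bar>zext T (P_Z t \<phi>) y\<bar> \<le> C"
  using P_Z_bound[OF C_infty_measurable[OF T], of \<phi> C y t] by (auto simp: zext_def intro: order_trans[OF abs_ge_zero])

text \<open>The right side is the integral of exp(-b r) P_r \<phi> over r > s. Hilbert's identity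
  says that both sides have the same Laplace transform in s, and right continuity makes them equal.
  No Markov property of the process enters.\<close>

lemma P_Z_of_resolvent:
  assumes \<phi>: "\<phi> \<in> C_infty T" and b: "b > 0" and s: "s \<ge> 0" and x: "0 < x" "x \<le> T"
  shows "exp (-(b * s)) * P_Z s (Res_z b \<phi>) x = Res b \<phi> x - (LBINT r:{0..s}. exp (-(b * r)) * P_Z (max 0 r) \<phi> x)"
proof -
  have x0: "x \<ge> 0" using x by simp
  have Rc: "Res_z b \<phi> \<in> C_infty T" by (rule Res_z_V_z(1)[OF \<phi> b])
  have Rm: "Res_z b \<phi> \<in> borel_measurable borel" by (rule C_infty_measurable[OF T Rc])
  have \<phi>m: "\<phi> \<in> borel_measurable borel" by (rule C_infty_measurable[OF T \<phi>])
  obtain C where C: "\<And>y. \<bar>\<phi> y\<bar> \<le> C" "C \<ge> 0" using C_infty_bounded[OF T \<phi>] by blast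
  obtain D where D: "\<And>y. \<bar>Res_z b \<phi> y\<bar> \<le> D" "D \<ge> 0" using C_infty_bounded[OF T Rc] by blast
  define u where "u r = indicator {0..} r * (exp (-(b * r)) * P_Z (max 0 r) \<phi> x)" for r
  have um[measurable]: "u \<in> borel_measurable borel"
    unfolding u_def using P_Z_measurable[OF \<phi>m x0] by measurable
  have ub: "\<bar>u r\<bar> \<le> C" for r
  proof (cases "r \<ge> 0")
    case True
    have "\<bar>exp (-(b * r))\<bar> * \<bar>P_Z (max 0 r) \<phi> x\<bar> \<le> 1 * C"
      using True b by (intro mult_mono P_Z_bound[OF \<phi>m C(1) x0]) auto
    thus ?thesis using True by (simp add: u_def abs_mult)
  qed (use C in \<open>simp add: u_def\<close>)
  define Q where "Q t = (LBINT r:{0..t}. u r)" for t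
  have Qe: "Q t = (LBINT r:{0..t}. exp (-(b * r)) * P_Z (max 0 r) \<phi> x)" for t
    unfolding Q_def by (rule set_lebesgue_integral_cong) (auto simp: u_def)
  have Qm[measurable]: "Q \<in> borel_measurable borel"
  proof -
    have "Q = (\<lambda>t. \<integral>s. (if 0 \<le> s \<and> s \<le> t then u s else 0) \<partial>lborel)"
      unfolding Q_def set_lebesgue_integral_def by (auto intro!: ext Bochner_Integration.integral_cong simp: indicator_def)
    also have "\<dots> \<in> borel_measurable borel"
      by (rule lborel.borel_measurable_lebesgue_integral) measurable
    finally show ?thesis .
  qed
  have ui: "integrable lborel u"
  proof -
    have "set_integrable lborel {0..} (\<lambda>r. exp (-(b * r)) * P_Z (max 0 r) \<phi> x)"
      by (rule exp_integrable[OF b P_Z_measurable[OF \<phi>m x0] P_Z_bound[OF \<phi>m C(1) x0]]) simp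
    thus ?thesis by (simp add: set_integrable_def u_def[abs_def])
  qed
  define E where "E = (\<integral>r. \<bar>u r\<bar> \<partial>lborel)"
  have Qb: "\<bar>Q t\<bar> \<le> E" for t
  proof -
    have "\<bar>Q t\<bar> \<le> (\<integral>r. \<bar>indicator {0..t} r *\<^sub>R u r\<bar> \<partial>lborel)" unfolding Q_def set_lebesgue_integral_def by (rule integral_abs_bound)
    also have "\<dots> \<le> E" unfolding E_def
    proof (rule integral_mono)
      show "integrable lborel (\<lambda>r. \<bar>indicator {0..t} r *\<^sub>R u r\<bar>)"
        by (rule Bochner_Integration.integrable_bound[OF ui]) (auto simp: indicator_def)
    qed (use ui in \<open>auto simp: indicator_def\<close>)
    finally show ?thesis .
  qed
  define F where "F t = exp (-(b * t)) * P_Z (max 0 t) (Res_z b \<phi>) x" for t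
  define G where "G t = Res b \<phi> x - Q (max 0 t)" for t
  have "F s = G s"
  proof (rule laplace_unique_fun[where F=F and G=G and t=s and B="max D (D + E)"])
    have [measurable]: "(\<lambda>s. P_Z (max 0 s) (Res_z b \<phi>) x) \<in> borel_measurable borel" by (rule P_Z_measurable[OF Rm x0])
    show "F \<in> borel_measurable borel" unfolding F_def by measurable
    show "G \<in> borel_measurable borel" unfolding G_def by measurable
    show Fb: "\<bar>F t\<bar> \<le> max D (D + E)" if "t \<ge> 0" for t
    proof -
      have "\<bar>F t\<bar> \<le> 1 * D" unfolding F_def abs_mult
        using that b by (intro mult_mono P_Z_bound[OF Rm D(1) x0]) auto
      thus ?thesis by simp
    qed
    show Gb: "\<bar>G t\<bar> \<le> max D (D + E)" if "t \<ge> 0" for t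
    proof -
      have "\<bar>Res b \<phi> x\<bar> \<le> D" using D(1)[of x] x by (simp add: Res_z_in)
      thus ?thesis unfolding G_def using Qb[of "max 0 t"] by linarith
    qed
    show "continuous (at_right s) F"
      unfolding F_def by (intro continuous_intros P_Z_max_cont[OF Rc x s])
    show "continuous (at_right s) G"
    proof (rule continuous_at_rightI)
      fix e :: real assume e: "e > 0"
      show "\<exists>d>0. \<forall>r. s < r \<longrightarrow> r < s + d \<longrightarrow> \<bar>G r - G s\<bar> \<le> e"
      proof (intro exI[of _ "e / (C + 1)"] conjI allI impI)
        show "e / (C + 1) > 0" using e C by simp
        fix r assume r: "s < r" "r < s + e / (C + 1)"
        have "\<bar>Q r - Q s\<bar> \<le> C * (r - s)" unfolding Q_def by (rule indefinite_bound[OF um ub s]) (use r in simp)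
        also have "\<dots> \<le> (C + 1) * (e / (C + 1))" using r C by (intro mult_mono) auto
        also have "\<dots> = e" using C by simp
        finally show "\<bar>G r - G s\<bar> \<le> e" using r s by (simp add: G_def max_absorb2)
      qed
    qed
    fix l :: real assume l: "l > 0"
    have mm: "exp (-(l * t)) * (exp (-(b * t)) * v) = exp (-((l + b) * t)) * v" for t v
    proof -
      have "exp (-(l * t)) * exp (-(b * t)) = exp (-((l + b) * t))" by (simp add: exp_add[symmetric] algebra_simps)
      thus ?thesis by (simp only: mult.assoc[symmetric])
    qed
    have "(LBINT t:{0..}. exp (-(l * t)) * F t) = Res (l + b) (Res_z b \<phi>) x"
      unfolding F_def mm Res_max ..
    also have "\<dots> = (Res b \<phi> x - Res (l + b) \<phi> x) / l"
      using Res_z_resolvent[OF \<phi> b l, of x] l x by (simp add: Res_z_in field_simps)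
    finally have L: "(LBINT t:{0..}. exp (-(l * t)) * F t) = (Res b \<phi> x - Res (l + b) \<phi> x) / l" .
    have iQ: "set_integrable lborel {0..} (\<lambda>t. exp (-(l * t)) * Q t)"
      by (rule exp_integrable[OF l Qm Qb])
    have "(LBINT t:{0..}. exp (-(l * t)) * G t) = (LBINT t:{0..}. Res b \<phi> x * exp (-(l * t)) - exp (-(l * t)) * Q t)"
      unfolding G_def by (rule set_lebesgue_integral_cong) (auto simp: max_absorb2 algebra_simps)
    also have "\<dots> = Res b \<phi> x * (1 / l) - (LBINT t:{0..}. exp (-(l * t)) * Q t)"
      using iQ integrable_exp_half[OF l] by (simp add: set_integral_diff set_integrable_mult_right)
    also have "(LBINT t:{0..}. exp (-(l * t)) * Q t) = (LBINT t:{0..}. exp (-(l * t)) * u t) / l"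
      unfolding Q_def by (rule laplace_primitive[OF l um ub])
    also have "(LBINT t:{0..}. exp (-(l * t)) * u t) = (LBINT t:{0..}. exp (-((l + b) * t)) * P_Z (max 0 t) \<phi> x)"
      by (rule set_lebesgue_integral_cong) (auto simp: u_def mm)
    also have "\<dots> = Res (l + b) \<phi> x" by (simp only: Res_max)
    finally show "(LBINT t:{0..}. exp (-(l * t)) * F t) = (LBINT t:{0..}. exp (-(l * t)) * G t)"
      unfolding L by (simp add: diff_divide_distrib)
  qed (rule s)
  thus ?thesis using s by (simp add: F_def G_def Qe max_absorb2)
qed

lemma resolvent_shift:
  assumes \<phi>: "\<phi> \<in> C_infty T" and b: "b > 0" and s: "s \<ge> 0" and x: "0 < x" "x \<le> T"
  shows "P_Z s (Res_z b \<phi>) x = (LBINT r:{0..}. exp (-(b * r)) * P_Z (s + max 0 r) \<phi> x)"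
proof -
  have x0: "x \<ge> 0" using x by simp
  have \<phi>m: "\<phi> \<in> borel_measurable borel" by (rule C_infty_measurable[OF T \<phi>])
  obtain C where C: "\<And>y. \<bar>\<phi> y\<bar> \<le> C" "C \<ge> 0" using C_infty_bounded[OF T \<phi>] by blast
  define v where "v r = exp (-(b * r)) * P_Z (max 0 r) \<phi> x" for r
  have vi: "integrable lborel (\<lambda>r. indicator {0..} r * v r)"
    using exp_integrable[OF b P_Z_measurable[OF \<phi>m x0] P_Z_bound[OF \<phi>m C(1) x0]] by (simp add: set_integrable_def v_def)
  have vm[measurable]: "v \<in> borel_measurable borel" unfolding v_def using P_Z_measurable[OF \<phi>m x0] by measurable
  have vi2: "integrable lborel (\<lambda>r. indicator A r * v r)" if "A \<subseteq> {0..}" and [measurable]: "A \<in> sets borel" for A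
    by (rule Bochner_Integration.integrable_bound[OF vi]) (use that(1) in \<open>auto simp: indicator_def\<close>)
  have "exp (-(b * s)) * (LBINT r:{0..}. exp (-(b * r)) * P_Z (s + max 0 r) \<phi> x) = (\<integral>r. indicator {s..} (s + 1 * r) * v (s + 1 * r) \<partial>lborel)"
    unfolding set_lebesgue_integral_def integral_mult_right_zero[symmetric]
  proof (rule Bochner_Integration.integral_cong)
    fix r :: real
    show "exp (-(b * s)) * (indicator {0..} r *\<^sub>R (exp (-(b * r)) * P_Z (s + max 0 r) \<phi> x)) = indicator {s..} (s + 1 * r) * v (s + 1 * r)"
    proof (cases "r \<ge> 0")
      case True
      have "exp (-(b * s)) * exp (-(b * r)) = exp (-(b * (s + r)))" by (simp add: exp_add[symmetric] algebra_simps)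
      thus ?thesis using True s by (simp add: v_def max_absorb2 mult.assoc[symmetric])
    qed simp
  qed simp
  also have "\<dots> = (\<integral>r. indicator {s..} r * v r \<partial>lborel)"
    using lborel_integral_real_affine[of 1 "\<lambda>r. indicator {s..} r * v r" s] by simp
  also have "\<dots> = (\<integral>r. indicator {0..} r * v r - indicator {0..s} r * v r \<partial>lborel)"
  proof (rule integral_cong_AE)
    show "AE r in lborel. indicator {s..} r * v r = indicator {0..} r * v r - indicator {0..s} r * v r"
      using AE_lborel_singleton[of s] by eventually_elim (use s in \<open>auto simp: indicator_def\<close>)
  qed measurable
  also have "\<dots> = Res b \<phi> x - (LBINT r:{0..s}. v r)"
    using vi vi2[of "{0..s}"] by (simp add: Res_max set_lebesgue_integral_def v_def)
  also have "\<dots> = exp (-(b * s)) * P_Z s (Res_z b \<phi>) x"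
    unfolding v_def by (rule P_Z_of_resolvent[OF assms, symmetric])
  finally show ?thesis by simp
qed

text \<open>P_s is pulled inside the time integral of the resolvent. Joint measurability of (r,z)
  \<mapsto> P_r \<phi>(z) comes from invariance of \<open>C_infty\<close> in z together with right
  continuity in r.\<close>

lemma resolvent_Fubini:
  assumes \<phi>: "\<phi> \<in> C_infty T" and b: "b > 0" and s: "s \<ge> 0" and x: "0 < x" "x \<le> T"
  shows "(\<lambda>r. P_Z s (zext T (P_Z (max 0 r) \<phi>)) x) \<in> borel_measurable borel"
    and "P_Z s (Res_z b \<phi>) x = (LBINT r:{0..}. exp (-(b * r)) * P_Z s (zext T (P_Z (max 0 r) \<phi>)) x)"
proof -
  have x0: "x \<ge> 0" using x by simp
  obtain C where C: "\<And>y. \<bar>\<phi> y\<bar> \<le> C" "C \<ge> 0" using C_infty_bounded[OF T \<phi>] by blast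
  interpret P: pair_sigma_finite "lborel :: real measure" M ..
  note [measurable] = Z_rv_measurable[OF x0 s]
  define J where "J r w = zext T (P_Z (max 0 r) \<phi>) (Z_rv x s w)" for r w
  have Jm: "(\<lambda>z. J (fst z) (snd z)) \<in> borel_measurable (lborel \<Otimes>\<^sub>M M)"
    unfolding J_def
  proof (rule right_cont_measurable[where M=borel and X="\<lambda>r z. zext T (P_Z r \<phi>) z"])
    show "zext T (P_Z t \<phi>) \<in> borel_measurable borel" if "0 \<le> t" for t
      by (rule C_infty_measurable[OF T P_Z_Feller[OF \<phi> that]])
    show "continuous (at_right t) (\<lambda>s. zext T (P_Z s \<phi>) w)" if "0 \<le> t" for t w by (rule zext_P_Z_rc[OF \<phi> that])
  qed auto
  hence [measurable]: "case_prod J \<in> borel_measurable (lborel \<Otimes>\<^sub>M M)" by (simp add: split_beta')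
  have Jb: "\<bar>J r w\<bar> \<le> C" for r w unfolding J_def by (rule zext_P_Z_bound[OF \<phi> C(1)]) simp
  have "(\<lambda>r. \<integral>w. J r w \<partial>M) \<in> borel_measurable lborel"
    by (rule borel_measurable_lebesgue_integral) measurable
  thus "(\<lambda>r. P_Z s (zext T (P_Z (max 0 r) \<phi>)) x) \<in> borel_measurable borel" by (simp add: P_Z_def[of s] J_def)
  define I where "I r w = indicator {0..} r * exp (-(b * r)) * J r w" for r w
  have Im: "case_prod I \<in> borel_measurable (lborel \<Otimes>\<^sub>M M)" unfolding I_def split_beta' using Jm by measurable
  have int: "integrable (lborel \<Otimes>\<^sub>M M) (case_prod I)"
  proof (rule integrableI_bounded[OF Im])
    have "(\<integral>\<^sup>+z. ennreal (norm (case_prod I z)) \<partial>(lborel \<Otimes>\<^sub>M M)) = (\<integral>\<^sup>+r. (\<integral>\<^sup>+w. ennreal (norm (I r w)) \<partial>M) \<partial>lborel)"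
      using Im by (subst nn_integral_fst[symmetric]) auto
    also have "\<dots> \<le> (\<integral>\<^sup>+r. (\<integral>\<^sup>+w. ennreal C * ennreal (indicator {0..} r * exp (-(b * r))) \<partial>M) \<partial>lborel)"
    proof (intro nn_integral_mono)
      fix r w
      have "indicator {0..} r * exp (-(b * r)) * \<bar>J r w\<bar> \<le> indicator {0..} r * exp (-(b * r)) * C"
        using Jb by (intro mult_left_mono) auto
      thus "ennreal (norm (I r w)) \<le> ennreal C * ennreal (indicator {0..} r * exp (-(b * r)))"
        using C by (simp add: I_def abs_mult ennreal_mult[symmetric] mult.commute ennreal_leI)
    qed
    also have "\<dots> = (\<integral>\<^sup>+r. ennreal C * ennreal (indicator {0..} r * exp (-(b * r))) \<partial>lborel)"
      by (simp add: emeasure_space_1)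
    also have "\<dots> < \<infinity>"
      using integrable_exp_half(1)[OF b] by (subst nn_integral_cmult) (auto simp: set_integrable_def integrable_iff_bounded ennreal_mult_less_top)
    finally show "(\<integral>\<^sup>+z. ennreal (norm (case_prod I z)) \<partial>(lborel \<Otimes>\<^sub>M M)) < \<infinity>" .
  qed
  have "(LBINT r:{0..}. exp (-(b * r)) * P_Z s (zext T (P_Z (max 0 r) \<phi>)) x) = (\<integral>r. (\<integral>w. I r w \<partial>M) \<partial>lborel)"
    unfolding set_lebesgue_integral_def P_Z_def[of s] by (intro Bochner_Integration.integral_cong) (auto simp: I_def J_def)
  also have "\<dots> = (\<integral>w. (\<integral>r. I r w \<partial>lborel) \<partial>M)" by (rule P.Fubini_integral[OF int, symmetric])
  also have "\<dots> = (\<integral>w. Res_z b \<phi> (Z_rv x s w) \<partial>M)"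
  proof (rule Bochner_Integration.integral_cong)
    fix w
    define z where "z = Z_rv x s w"
    show "(\<integral>r. I r w \<partial>lborel) = Res_z b \<phi> (Z_rv x s w)"
    proof (cases "0 < z \<and> z \<le> T")
      case True
      thus ?thesis by (simp add: I_def J_def z_def[symmetric] Res_z_in Res_max set_lebesgue_integral_def zext_def mult.assoc)
    next
      case False
      hence "(\<lambda>r. I r w) = (\<lambda>_. 0)" by (auto simp: I_def J_def z_def[symmetric] zext_def)
      thus ?thesis using False by (auto simp: z_def[symmetric] Res_z_def zext_def)
    qed
  qed simp
  finally show "P_Z s (Res_z b \<phi>) x = (LBINT r:{0..}. exp (-(b * r)) * P_Z s (zext T (P_Z (max 0 r) \<phi>)) x)"
    by (simp add: P_Z_def[of s])
qed

text \<open>For fixed s, both sides are functions of t whose Laplace transforms at b equal P_s R_b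
  \<phi>(x): one by Fubini, the other by the shift formula. Uniqueness then applies at each
  t.\<close>

lemma P_Z_semigroup:
  assumes \<phi>: "\<phi> \<in> C_infty T" and s: "s \<ge> 0" and t: "t \<ge> 0" and x: "0 < x" "x \<le> T"
  shows "P_Z s (zext T (P_Z t \<phi>)) x = P_Z (s + t) \<phi> x"
proof -
  have x0: "x \<ge> 0" using x by simp
  have \<phi>m: "\<phi> \<in> borel_measurable borel" by (rule C_infty_measurable[OF T \<phi>])
  obtain C where C: "\<And>y. \<bar>\<phi> y\<bar> \<le> C" "C \<ge> 0" using C_infty_bounded[OF T \<phi>] by blast
  define F where "F r = P_Z s (zext T (P_Z (max 0 r) \<phi>)) x" for r
  define G where "G r = P_Z (s + max 0 r) \<phi> x" for r
  have mx: "max 0 r \<ge> 0" "s + max 0 r \<ge> 0" for r :: real using s by auto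
  have "F t = G t"
  proof (rule laplace_unique_fun[where F=F and G=G and t=t and B=C])
    show "F \<in> borel_measurable borel" unfolding F_def by (rule resolvent_Fubini(1)[OF \<phi> zero_less_one s x])
    show "G \<in> borel_measurable borel"
    proof -
      have "(\<lambda>r. (\<lambda>t. P_Z (max 0 t) \<phi> x) (s + max 0 r)) \<in> borel_measurable borel"
        by (rule measurable_compose[OF _ P_Z_measurable[OF \<phi>m x0]]) simp
      thus ?thesis using mx(2) by (simp add: G_def[abs_def] max_absorb2)
    qed
    show "\<bar>F r\<bar> \<le> C" for r unfolding F_def
      by (rule P_Z_bound[OF C_infty_measurable[OF T P_Z_Feller[OF \<phi> mx(1)]] zext_P_Z_bound[OF \<phi> C(1) mx(1)] x0 s])
    show "\<bar>G r\<bar> \<le> C" for r unfolding G_def by (rule P_Z_bound[OF \<phi>m C(1) x0 mx(2)])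
    show "continuous (at_right t) F"
    proof (rule continuous_at_rightI)
      fix e :: real assume e: "e > 0"
      obtain d where d: "d > 0" "\<And>s t x. 0 \<le> s \<Longrightarrow> 0 \<le> t \<Longrightarrow> \<bar>t - s\<bar> < d \<Longrightarrow> 0 < x \<Longrightarrow> x \<le> T \<Longrightarrow> \<bar>P_Z t \<phi> x - P_Z s \<phi> x\<bar> \<le> e"
        using P_Z_equicont[OF \<phi> e] by blast
      have "\<bar>F r - F t\<bar> \<le> e" if r: "t < r" "r < t + d" for r
        unfolding F_def
      proof (rule P_Z_diff_bound[OF P_Z_Feller[OF \<phi> mx(1)] P_Z_Feller[OF \<phi> mx(1)] x0 s])
        fix y
        show "\<bar>zext T (P_Z (max 0 r) \<phi>) y - zext T (P_Z (max 0 t) \<phi>) y\<bar> \<le> e"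
          using d(2)[of "max 0 t" "max 0 r" y] r t e by (auto simp: zext_def max_absorb2)
      qed
      thus "\<exists>d>0. \<forall>r. t < r \<longrightarrow> r < t + d \<longrightarrow> \<bar>F r - F t\<bar> \<le> e" using d(1) by blast
    qed
    show "continuous (at_right t) G"
    proof (rule continuous_at_rightI)
      fix e :: real assume e: "e > 0"
      obtain d where d: "d > 0" "\<And>s t x. 0 \<le> s \<Longrightarrow> 0 \<le> t \<Longrightarrow> \<bar>t - s\<bar> < d \<Longrightarrow> 0 < x \<Longrightarrow> x \<le> T \<Longrightarrow> \<bar>P_Z t \<phi> x - P_Z s \<phi> x\<bar> \<le> e"
        using P_Z_equicont[OF \<phi> e] by blast
      have "\<bar>G r - G t\<bar> \<le> e" if r: "t < r" "r < t + d" for r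
        unfolding G_def by (rule d(2)[OF mx(2) mx(2) _ x]) (use r t in \<open>simp add: max_absorb2\<close>)
      thus "\<exists>d>0. \<forall>r. t < r \<longrightarrow> r < t + d \<longrightarrow> \<bar>G r - G t\<bar> \<le> e" using d(1) by blast
    qed
    show "(LBINT r:{0..}. exp (-(l * r)) * F r) = (LBINT r:{0..}. exp (-(l * r)) * G r)" if l: "l > 0" for l
      unfolding F_def G_def resolvent_Fubini(2)[OF \<phi> l s x, symmetric] by (rule resolvent_shift[OF \<phi> l s x])
  qed (rule t)
  thus ?thesis using t by (simp add: F_def G_def max_absorb2)
qed

lemma P_Z_0: assumes "0 < x" shows "P_Z 0 \<phi> x = \<phi> x"
proof -
  have "\<phi> (Z_rv x 0 w) = \<phi> x" if w: "w \<in> space M" for w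
  proof -
    have "path_seq w 1 0 = 0" using nice_S[OF w, of 1] by (simp add: nice_path_def)
    hence "Z_rv x 0 w = x" unfolding Z_rv_def using assms
      by (subst Z_cens_start) (use nice_S[OF w] in auto)
    thus ?thesis by simp
  qed
  hence "P_Z 0 \<phi> x = (\<integral>w. \<phi> x \<partial>M)" unfolding P_Z_def by (intro Bochner_Integration.integral_cong) auto
  thus ?thesis by (simp add: prob_space)
qed

lemma P_cens_C: "\<phi> \<in> C_infty T \<Longrightarrow> P_cens M S T t \<phi> = zext T (P_Z t \<phi>)"
  by (rule P_cens_P_Z) (simp add: C_infty_def)

section \<open>The Feller property and the generator\<close>

lemma feller: "feller_semigroup T (P_cens M S T)"
  unfolding feller_semigroup_def
proof (intro conjI allI ballI impI)
  fix t :: real and u assume t: "0 \<le> t" and u: "u \<in> C_infty T"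
  show "P_cens M S T t u \<in> C_infty T" unfolding P_cens_C[OF u] by (rule P_Z_Feller[OF u t])
  obtain C where C: "\<And>y. \<bar>u y\<bar> \<le> C" "C \<ge> 0" using C_infty_bounded[OF T u] by blast
  have um: "u \<in> borel_measurable borel" by (rule C_infty_measurable[OF T u])
  {
    fix v a b assume v: "v \<in> C_infty T"
    have uv: "(\<lambda>x. a * u x + b * v x) \<in> C_infty T" by (rule C_infty_comb[OF u v])
    show "P_cens M S T t (\<lambda>x. a * u x + b * v x) = (\<lambda>x. a * P_cens M S T t u x + b * P_cens M S T t v x)"
      unfolding P_cens_C[OF u] P_cens_C[OF v] P_cens_C[OF uv]
      by (rule ext) (simp add: zext_def P_Z_lin[OF u v _ t])
  }
  {
    fix x assume pos: "\<forall>x. 0 \<le> u x"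
    show "0 \<le> P_cens M S T t u x"
      unfolding P_cens_C[OF u] by (simp add: zext_def P_Z_def pos)
  }
  show "sup_norm T (P_cens M S T t u) \<le> sup_norm T u"
  proof (rule abs_le_D1, rule sup_norm_abs_le[OF T])
    fix x assume x: "0 < x" "x \<le> T"
    have b: "\<bar>u y\<bar> \<le> sup_norm T u" for y
    proof (cases "0 < y \<and> y \<le> T")
      case True thus ?thesis using sup_norm_upper[of T u C y] C by blast
    next
      case False
      hence "u y = 0" using u by (auto simp: C_infty_def)
      moreover have "\<bar>u T\<bar> \<le> sup_norm T u" using sup_norm_upper[of T u C T] C T by blast
      ultimately show ?thesis by simp
    qed
    show "\<bar>P_cens M S T t u x\<bar> \<le> sup_norm T u"
      unfolding P_cens_C[OF u] using P_Z_bound[OF um b _ t, of x] x by (simp add: zext_def)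
  qed
next
  fix u assume u: "u \<in> C_infty T"
  show "P_cens M S T 0 u = u"
    unfolding P_cens_C[OF u] using u by (auto simp: zext_def P_Z_0 C_infty_def fun_eq_iff)
  show "((\<lambda>t. sup_norm T (\<lambda>x. P_cens M S T t u x - u x)) \<longlongrightarrow> 0) (at_right 0)"
  proof (rule sup_norm_tendsto_0I[OF T])
    fix e :: real assume e: "e > 0"
    obtain K where K: "K \<ge> 0" "\<And>t x. 0 \<le> t \<Longrightarrow> 0 < x \<Longrightarrow> x \<le> T \<Longrightarrow> \<bar>P_Z t u x - u x\<bar> \<le> e/2 + K * t"
      using P_Z_near_identity[OF u, of "e/2"] e by auto
    define d where "d = e / 2 / (K + 1)"
    have d: "d > 0" "K * d \<le> e / 2" using e K by (auto simp: d_def field_simps)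
    have "\<bar>P_cens M S T t u x - u x\<bar> \<le> e" if "0 < t" "t < d" "0 < x" "x \<le> T" for t x
    proof -
      have "K * t \<le> K * d" using K that by (intro mult_left_mono) auto
      thus ?thesis using K(2)[of t x] that d unfolding P_cens_C[OF u] by (simp add: zext_def)
    qed
    thus "\<exists>d>0. \<forall>t x. 0 < t \<longrightarrow> t < d \<longrightarrow> 0 < x \<longrightarrow> x \<le> T \<longrightarrow> \<bar>P_cens M S T t u x - u x\<bar> \<le> e"
      using d(1) by blast
  qed
next
  fix s t :: real and u assume s: "0 \<le> s" and t: "0 \<le> t" and u: "u \<in> C_infty T"
  show "P_cens M S T (s + t) u = P_cens M S T s (P_cens M S T t u)"
    unfolding P_cens_C[OF u] P_cens_C[OF P_Z_Feller[OF u t]]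
    by (rule ext) (simp add: zext_def[of T "P_Z (s + t) u"] zext_def[of T "P_Z s _"] P_Z_semigroup[OF u s t])
qed

text \<open>By the integrated equation the quotient plus g is minus the average of P_s g - g over s
  in [0,t], which tends to 0 uniformly in x by \<open>P_Z_near_identity\<close>.\<close>

lemma generator_V_z:
  assumes g: "g \<in> C_infty T"
  shows "(V_z g, \<lambda>x. - g x) \<in> generator T (P_cens M S T)"
proof -
  have Vg: "V_z g \<in> C_infty T" by (rule V_z_C_infty[OF g])
  have gm: "g \<in> borel_measurable borel" by (rule C_infty_measurable[OF T g])
  have ng: "(\<lambda>x. - g x) \<in> C_infty T" using C_infty_comb[OF g g, of "-1" 0] by simp
  have "((\<lambda>t. sup_norm T (\<lambda>x. (P_cens M S T t (V_z g) x - V_z g x) / t - (- g x))) \<longlongrightarrow> 0) (at_right 0)"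
  proof (rule sup_norm_tendsto_0I[OF T])
    fix e :: real assume e: "e > 0"
    obtain K where K: "K \<ge> 0" "\<And>t x. 0 \<le> t \<Longrightarrow> 0 < x \<Longrightarrow> x \<le> T \<Longrightarrow> \<bar>P_Z t g x - g x\<bar> \<le> e/2 + K * t"
      using P_Z_near_identity[OF g, of "e/2"] e by auto
    define d where "d = e / 2 / (K + 1)"
    have d: "d > 0" "K * d \<le> e / 2" using e K by (auto simp: d_def field_simps)
    have "\<bar>(P_cens M S T t (V_z g) x - V_z g x) / t - (- g x)\<bar> \<le> e" if t: "0 < t" "t < d" and x: "0 < x" "x \<le> T" for t x
    proof -
      have x0: "x \<ge> 0" using x by simp
      \<comment> \<open>Freezing the time at t beyond t makes the smallness of the integrand hold at
        every real s, as \<open>indefinite_bound\<close> asks; on [0,t] nothing changes.\<close>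
      define u where "u s = P_Z (max 0 (min s t)) g x - g x" for s
      have um: "u \<in> borel_measurable borel"
      proof -
        have "(\<lambda>s. (\<lambda>r. P_Z (max 0 r) g x) (min s t)) \<in> borel_measurable borel"
          by (rule measurable_compose[OF _ P_Z_measurable[OF gm x0]]) simp
        thus ?thesis unfolding u_def by measurable
      qed
      have ub: "\<bar>u s\<bar> \<le> e" for s
      proof -
        have "K * max 0 (min s t) \<le> K * d" using K t by (intro mult_left_mono) auto
        thus ?thesis using K(2)[of "max 0 (min s t)" x] x d by (simp add: u_def)
      qed
      have t0: "0 \<le> t" using t by simp
      have "\<bar>(LBINT s:{0..t}. u s) - (LBINT s:{0..0}. u s)\<bar> \<le> e * (t - 0)"
        by (rule indefinite_bound[OF um ub order_refl t0])
      moreover have "(LBINT s:{0..0}. u s) = 0"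
      proof -
        have "AE s in lborel. indicator {0..0} s *\<^sub>R u s = 0"
          using AE_lborel_singleton[of "0::real"] by eventually_elim auto
        thus ?thesis unfolding set_lebesgue_integral_def by (rule integral_eq_zero_AE)
      qed
      moreover have "(LBINT s:{0..t}. P_Z (max 0 s) g x) = (LBINT s:{0..t}. u s) + t * g x"
      proof -
        have "set_integrable lborel {0..t} u"
          unfolding set_integrable_def
        proof (rule Bochner_Integration.integrable_bound)
          show "integrable lborel (\<lambda>r. e * indicator {0..t} r :: real)"
            using t by (intro integrable_mult_right) (simp add: integrable_indicator_iff)
          show "AE r in lborel. norm (indicator {0..t} r *\<^sub>R u r) \<le> norm (e * indicator {0..t} r)"
            using ub e by (intro AE_I2) (auto simp: indicator_def)
          show "(\<lambda>r. indicator {0..t} r *\<^sub>R u r) \<in> borel_measurable lborel" using um by measurable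
        qed
        moreover have "set_integrable lborel {0..t} (\<lambda>_. g x)" using t by (simp add: set_integrable_def)
        ultimately have "(LBINT s:{0..t}. u s + g x) = (LBINT s:{0..t}. u s) + (LBINT s:{0..t}. g x)"
          by (rule set_integral_add(2))
        also have "(LBINT s:{0..t}. u s + g x) = (LBINT s:{0..t}. P_Z (max 0 s) g x)"
          by (rule set_lebesgue_integral_cong) (auto simp: u_def min_absorb1)
        also have "(LBINT s:{0..t}. g x) = t * g x" using t by (simp add: set_lebesgue_integral_def)
        finally show ?thesis .
      qed
      ultimately have "\<bar>P_cens M S T t (V_z g) x - V_z g x + t * g x\<bar> \<le> e * t"
        unfolding P_cens_C[OF Vg] using P_Z_V_z[OF g x, of t] t x by (simp add: zext_def)
      hence "\<bar>(P_cens M S T t (V_z g) x - V_z g x + t * g x) / t\<bar> \<le> e" using t by (simp add: abs_divide divide_le_eq)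
      moreover have "(P_cens M S T t (V_z g) x - V_z g x + t * g x) / t = (P_cens M S T t (V_z g) x - V_z g x) / t - (- g x)"
        using t by (simp add: add_divide_distrib)
      ultimately show ?thesis by simp
    qed
    thus "\<exists>d>0. \<forall>t x. 0 < t \<longrightarrow> t < d \<longrightarrow> 0 < x \<longrightarrow> x \<le> T \<longrightarrow> \<bar>(P_cens M S T t (V_z g) x - V_z g x) / t - (- g x)\<bar> \<le> e"
      using d(1) by blast
  qed
  thus ?thesis using Vg ng by (simp add: generator_def)
qed

text \<open>A real supremum over an unbounded set carries no information, so boundedness at each
  fixed t must be known before a small \<open>sup_norm\<close> bounds values.\<close>

lemma sup_norm_tendsto_0D:
  fixes u :: "real \<Rightarrow> real \<Rightarrow> real"
  assumes lim: "((\<lambda>t. sup_norm T (u t)) \<longlongrightarrow> 0) (at_right 0)" and e: "e > 0"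
    and b: "\<And>t. t > 0 \<Longrightarrow> \<exists>C. \<forall>x. 0 < x \<longrightarrow> x \<le> T \<longrightarrow> \<bar>u t x\<bar> \<le> C"
  shows "\<exists>d>0. \<forall>t x. 0 < t \<longrightarrow> t < d \<longrightarrow> 0 < x \<longrightarrow> x \<le> T \<longrightarrow> \<bar>u t x\<bar> \<le> e"
proof -
  have "\<forall>\<^sub>F t in at_right 0. sup_norm T (u t) < e" using lim e by (rule order_tendstoD)
  then obtain d where d: "d > 0" "\<forall>t>0. t < d \<longrightarrow> sup_norm T (u t) < e" unfolding eventually_at_right_field by blast
  have "\<bar>u t x\<bar> \<le> e" if "0 < t" "t < d" "0 < x" "x \<le> T" for t x
  proof -
    obtain C where "\<forall>x. 0 < x \<longrightarrow> x \<le> T \<longrightarrow> \<bar>u t x\<bar> \<le> C" using b \<open>0 < t\<close> by blast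
    hence "\<bar>u t x\<bar> \<le> sup_norm T (u t)" using sup_norm_upper[of T "u t" C x] that by blast
    thus ?thesis using d(2) that by (meson less_imp_le order_trans)
  qed
  thus ?thesis using d(1) by blast
qed

lemma quotient_bounded:
  assumes u: "u \<in> C_infty T" and v: "v \<in> C_infty T" and t: "t > 0"
  shows "\<exists>C. \<forall>x. 0 < x \<longrightarrow> x \<le> T \<longrightarrow> \<bar>(P_cens M S T t u x - u x) / t - v x\<bar> \<le> C"
proof -
  have t0: "t \<ge> 0" using t by simp
  have "(\<lambda>x. 1 / t * P_cens M S T t u x + (- 1 / t) * u x) \<in> C_infty T"
    unfolding P_cens_C[OF u] by (intro C_infty_comb P_Z_Feller[OF u t0] u)
  hence z: "(\<lambda>x. 1 * (1 / t * P_cens M S T t u x + (- 1 / t) * u x) + (-1) * v x) \<in> C_infty T" by (rule C_infty_comb[OF _ v])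
  obtain C where C: "\<And>x. \<bar>1 * (1 / t * P_cens M S T t u x + (- 1 / t) * u x) + (-1) * v x\<bar> \<le> C" using C_infty_bounded[OF T z] by blast
  have "(P_cens M S T t u x - u x) / t - v x = 1 * (1 / t * P_cens M S T t u x + (- 1 / t) * u x) + (-1) * v x" for x
    by (simp add: diff_divide_distrib)
  thus ?thesis using C by (intro exI[of _ C]) (simp only:, blast)
qed

text \<open>Given (u,v), the function u' = R_1(u - v) is in the range of \<open>V\<close>, with
  generator value u' - (u - v). The difference w = u - u' is thus mapped to itself by the generator,
  and contractivity of P_t forces it to be 0.\<close>

lemma generator_in_range:
  assumes uv: "(u, v) \<in> generator T (P_cens M S T)"
  shows "\<exists>g\<in>C_infty T. u = V_z g \<and> v = (\<lambda>x. - g x)"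
proof -
  have u: "u \<in> C_infty T" and v: "v \<in> C_infty T"
    and luv: "((\<lambda>t. sup_norm T (\<lambda>x. (P_cens M S T t u x - u x) / t - v x)) \<longlongrightarrow> 0) (at_right 0)"
    using uv by (auto simp: generator_def)
  define \<phi> where "\<phi> x = 1 * u x + (-1) * v x" for x
  have \<phi>: "\<phi> \<in> C_infty T" unfolding \<phi>_def[abs_def] by (rule C_infty_comb[OF u v])
  define u' where "u' = Res_z 1 \<phi>"
  have u': "u' \<in> C_infty T" unfolding u'_def by (rule Res_z_V_z(1)[OF \<phi>]) simp
  define g where "g x = 1 * \<phi> x + (-1) * u' x" for x
  have g: "g \<in> C_infty T" unfolding g_def[abs_def] by (rule C_infty_comb[OF \<phi> u'])
  have Vg: "u' = V_z g" using Res_z_V_z(2)[OF \<phi>, of 1] by (simp add: u'_def g_def[abs_def])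
  have ng: "(\<lambda>x. - g x) \<in> C_infty T" using C_infty_comb[OF g g, of "-1" 0] by simp
  have lu': "((\<lambda>t. sup_norm T (\<lambda>x. (P_cens M S T t u' x - u' x) / t - (- g x))) \<longlongrightarrow> 0) (at_right 0)"
    using generator_V_z[OF g] by (simp add: generator_def Vg)
  define w where "w x = 1 * u x + (-1) * u' x" for x
  have w: "w \<in> C_infty T" unfolding w_def[abs_def] by (rule C_infty_comb[OF u u'])
  obtain C where C: "\<And>y. \<bar>w y\<bar> \<le> C" using C_infty_bounded[OF T w] by blast
  define N where "N = sup_norm T w"
  have wN: "\<bar>w y\<bar> \<le> N" for y
  proof (cases "0 < y \<and> y \<le> T")
    case True thus ?thesis unfolding N_def using sup_norm_upper[of T w C y] C by blast
  next
    case False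
    hence "w y = 0" using w by (auto simp: C_infty_def)
    moreover have "\<bar>w T\<bar> \<le> N" unfolding N_def using sup_norm_upper[of T w C T] C T by blast
    ultimately show ?thesis by simp
  qed
  have Ne: "N \<le> e" if e: "e > 0" for e
  proof -
    have e2: "e / 2 > 0" using e by simp
    obtain d1 where d1: "d1 > 0" "\<And>t x. 0 < t \<Longrightarrow> t < d1 \<Longrightarrow> 0 < x \<Longrightarrow> x \<le> T \<Longrightarrow> \<bar>(P_cens M S T t u x - u x) / t - v x\<bar> \<le> e / 2"
      using sup_norm_tendsto_0D[OF luv e2 quotient_bounded[OF u v]] by blast
    obtain d2 where d2: "d2 > 0" "\<And>t x. 0 < t \<Longrightarrow> t < d2 \<Longrightarrow> 0 < x \<Longrightarrow> x \<le> T \<Longrightarrow> \<bar>(P_cens M S T t u' x - u' x) / t - (- g x)\<bar> \<le> e / 2"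
      using sup_norm_tendsto_0D[OF lu' e2 quotient_bounded[OF u' ng]] by blast
    define t where "t = min d1 d2 / 2"
    have t: "0 < t" "t < d1" "t < d2" using d1 d2 by (auto simp: t_def min_def)
    \<comment> \<open>Up to an error t e, the value P_t w(x) is (1 + t) w(x), while contractivity
      bounds it by the norm N of w. Taking the supremum over x leaves N \<le> e.\<close>
    have "\<bar>w x\<bar> * (1 + t) \<le> N + t * e" if x: "0 < x" "x \<le> T" for x
    proof -
      have lin: "P_cens M S T t w x = P_cens M S T t u x - P_cens M S T t u' x"
        unfolding P_cens_C[OF u] P_cens_C[OF u'] P_cens_C[OF w] unfolding w_def[abs_def]
        using P_Z_lin[OF u u', of x t 1 "-1"] t x by (simp add: zext_def)
      have vg: "v x - (- g x) = w x" by (simp add: g_def \<phi>_def w_def)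
      have "(P_cens M S T t w x - w x) / t = (P_cens M S T t u x - u x) / t - (P_cens M S T t u' x - u' x) / t"
        unfolding lin w_def by (simp add: diff_divide_distrib)
      hence "(P_cens M S T t w x - w x) / t - w x = ((P_cens M S T t u x - u x) / t - v x) - ((P_cens M S T t u' x - u' x) / t - (- g x))"
        using vg by linarith
      hence "\<bar>(P_cens M S T t w x - w x) / t - w x\<bar> \<le> e" using d1(2)[OF t(1,2) x] d2(2)[OF t(1,3) x] by linarith
      hence "t * \<bar>(P_cens M S T t w x - w x) / t - w x\<bar> \<le> t * e" using t by (intro mult_left_mono) auto
      moreover have "t * \<bar>(P_cens M S T t w x - w x) / t - w x\<bar> = \<bar>P_cens M S T t w x - w x * (1 + t)\<bar>"
      proof -
        have "t * ((P_cens M S T t w x - w x) / t - w x) = P_cens M S T t w x - w x * (1 + t)" using t by (simp add: field_simps)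
        thus ?thesis using abs_mult[of t "(P_cens M S T t w x - w x) / t - w x"] t by (simp only: abs_of_pos)
      qed
      ultimately have a: "\<bar>P_cens M S T t w x - w x * (1 + t)\<bar> \<le> t * e" by simp
      have "\<bar>P_cens M S T t w x\<bar> \<le> N"
        unfolding P_cens_C[OF w] using P_Z_bound[OF C_infty_measurable[OF T w] wN, of x t] t x by (simp add: zext_def)
      hence "\<bar>w x * (1 + t)\<bar> \<le> N + t * e" using a by linarith
      thus ?thesis using t by (simp add: abs_mult)
    qed
    hence "\<bar>w x\<bar> \<le> (N + t * e) / (1 + t)" if "0 < x" "x \<le> T" for x using that t by (simp add: pos_le_divide_eq)
    hence "\<bar>N\<bar> \<le> (N + t * e) / (1 + t)" unfolding N_def by (intro sup_norm_abs_le[OF T]) auto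
    hence "N \<le> (N + t * e) / (1 + t)" by linarith
    hence "N * (1 + t) \<le> N + t * e" using t by (simp add: pos_le_divide_eq)
    hence "t * N \<le> t * e" by (simp add: algebra_simps)
    thus "N \<le> e" using t by simp
  qed
  have "N \<le> 0"
  proof (rule ccontr)
    assume "\<not> N \<le> 0"
    thus False using Ne[of "N / 2"] by simp
  qed
  hence "w y = 0" for y using wN[of y] by simp
  hence uu: "u = u'" by (auto simp: w_def fun_eq_iff)
  have "v = (\<lambda>x. - g x)" unfolding g_def \<phi>_def by (simp add: uu)
  thus ?thesis using g Vg uu by blast
qed

lemma generator_eq:
  "generator T (P_cens M S T) = {(u, zext T (\<lambda>x. - D_Ce \<mu> T u x)) | u. u \<in> {zext T (I_Ce \<mu> k g) | g. g \<in> C_infty T}}"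
proof -
  have V: "zext T (I_Ce \<mu> k g) = V_z g" for g unfolding V_z_def by (simp add: V_def[abs_def])
  have D: "zext T (\<lambda>x. - D_Ce \<mu> T (V_z g) x) = (\<lambda>x. - g x)" if g: "g \<in> C_infty T" for g
  proof
    fix x
    show "zext T (\<lambda>x. - D_Ce \<mu> T (V_z g) x) x = - g x"
    proof (cases "0 < x \<and> x \<le> T")
      case True
      hence "D_Ce \<mu> T (V_z g) x = g x" using D_Ce_V[OF g, of x] by (simp add: V_z_def)
      thus ?thesis using True by (simp add: zext_def[of T "\<lambda>x. - D_Ce \<mu> T (V_z g) x"])
    next
      case False
      thus ?thesis using g by (auto simp: zext_def[of T "\<lambda>x. - D_Ce \<mu> T (V_z g) x"] C_infty_def)
    qed
  qed
  show ?thesis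
  proof (intro set_eqI iffI)
    fix z assume z: "z \<in> generator T (P_cens M S T)"
    obtain u v where uv: "z = (u, v)" by (cases z)
    obtain g where g: "g \<in> C_infty T" "u = V_z g" "v = (\<lambda>x. - g x)" using generator_in_range z uv by blast
    thus "z \<in> {(u, zext T (\<lambda>x. - D_Ce \<mu> T u x)) | u. u \<in> {zext T (I_Ce \<mu> k g) | g. g \<in> C_infty T}}"
      using uv D[OF g(1)] V[of g] g(1) by (auto intro!: exI[of _ g])
  next
    fix z assume "z \<in> {(u, zext T (\<lambda>x. - D_Ce \<mu> T u x)) | u. u \<in> {zext T (I_Ce \<mu> k g) | g. g \<in> C_infty T}}"
    then obtain g where g: "g \<in> C_infty T" "z = (V_z g, zext T (\<lambda>x. - D_Ce \<mu> T (V_z g) x))" using V by auto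
    thus "z \<in> generator T (P_cens M S T)" using D[OF g(1)] generator_V_z[OF g(1)] by simp
  qed
qed

lemma I_Ce_domain:
  assumes g: "g \<in> C_infty T"
  shows "\<forall>x\<in>{0<..T}. summable (\<lambda>j. (K_op \<mu> k ^^ j) (I_R k g) x)" "zext T (I_Ce \<mu> k g) \<in> C_tail \<mu> T"
proof -
  obtain C where C: "bmeas_le g C" using C_infty_ex_bmeas_le[OF g] by blast
  show "\<forall>x\<in>{0<..T}. summable (\<lambda>j. (K_op \<mu> k ^^ j) (I_R k g) x)"
    using V_summable[OF C] by (simp add: V_term_def)
  show "zext T (I_Ce \<mu> k g) \<in> C_tail \<mu> T" using V_C_tail[OF g] by (simp add: V_def[abs_def])
qed

end

theorem theorem6p3:
  fixes f k :: "real \<Rightarrow> real" and \<mu> :: "real measure" and q T :: real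
    and M :: "'w measure" and S :: "nat \<Rightarrow> real \<Rightarrow> 'w \<Rightarrow> real"
  assumes "complete_bernstein f \<mu>"
    and "filterlim (\<lambda>l. 1 / f l) at_top (at_right 0)"
    and "((\<lambda>l. 1 / f l) \<longlongrightarrow> 0) at_top"
    and "((\<lambda>l. l / f l) \<longlongrightarrow> 0) (at_right 0)"
    and "filterlim (\<lambda>l. l / f l) at_top at_top"
    and "potential_density f k"
    and "((\<lambda>x. tail \<mu> x * (LBINT s:{0<..<x}. k s)) \<longlongrightarrow> q) (at_right 0)"
    and "q < 1"
    and "prob_space M"
    and "\<And>j. j \<ge> 1 \<Longrightarrow> subordinator M (S j) f"
    and "iid_processes M {1..} S"
    and "T > 0"
  shows "feller_semigroup T (P_cens M S T)
    \<and> (\<forall>g\<in>C_infty T. (\<forall>x\<in>{0<..T}. summable (\<lambda>j. (K_op \<mu> k ^^ j) (I_R k g) x))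
          \<and> zext T (I_Ce \<mu> k g) \<in> C_tail \<mu> T)
    \<and> generator T (P_cens M S T) =
        {(u, zext T (\<lambda>x. - D_Ce \<mu> T u x)) | u. u \<in> {zext T (I_Ce \<mu> k g) | g. g \<in> C_infty T}}"
proof -
  interpret bernstein_pair f k \<mu>
    by (rule bernstein_pair.intro[OF assms(1-4) assms(6)])
  interpret censored_pair f k \<mu> q T
    by unfold_locales (rule assms(7), rule assms(8), rule assms(12))
  interpret prob_space M by (rule assms(9))
  interpret censored_process M f k \<mu> q T S
    by unfold_locales (rule assms(10), assumption, rule assms(11))
  show ?thesis
    by (intro conjI ballI feller generator_eq I_Ce_domain)
qed

end
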